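(* Let $\Omega\subset\mathbb{C}$ be a bounded simply connected domain with real-analytic boundary. For each $N\ge1$ let $\gamma_N$ be the Gaussian measure on the space $\mathcal{P}_N$ of polynomials of degree $\le N$ induced by either (for all $N$) the inner product $$\langle f,\bar g\rangle_{\partial\Omega,\rho}=\int_{\partial\Omega}f(z)\overline{g(z)}\,\rho(z)\,|dz|,$$ where $\rho$ is a positive real-analytic density on $\partial\Omega$, or (for all $N$) the inner product $$\langle f,\bar g\rangle_\Omega=\int_\Omega f(z)\overline{g(z)}\,dx\,dy\qquad(z=x+iy).$$ Let $\mu=\prod_{N=1}^\infty\gamma_N$ be the product probability measure on $\mathcal{S}=\prod_{N=1}^\infty\mathcal{P}_N$. Then for $\mu$-almost every sequence $\{f_N\}\in\mathcal{S}$, $\widetilde Z^N_{f_N}\to\nu_\Omega$ in the sense of measures, where $\nu_\Omega$ is the equilibrium measure of $\overline\Omega$; i.e., $\mu$-almost surely, $$\frac1N\sum_{\{z\in\mathbb{C}:\,f_N(z)=0\}}\varphi(z)\;\longrightarrow\;\int_{\partial\Omega}\varphi\,d\nu_\Omega\quad\text{as }N\to\infty,\qquad\text{for all }\varphi\in C(\widehat{\mathbb{C}}).$$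
   Context: $\widehat{\mathbb{C}}=\mathbb{C}\cup\{\infty\}$ is the Riemann sphere. $\mathcal{P}_N$ is the complex vector space of polynomials in one complex variable of degree $\le N$. An inner product on $\mathcal{P}_N$ induces a Gaussian probability measure: if $P_0,\dots,P_N$ is an orthonormal basis of $\mathcal{P}_N$ and $f=\sum_{j=0}^N a_jP_j$, then the $a_j$ are i.i.d. complex Gaussian random variables with $\mathbf{E}(a_j)=0$, $\mathbf{E}(a_j\bar a_k)=\delta_{jk}$, $\mathbf{E}(a_ja_k)=0$, i.e. the measure is $\pi^{-(N+1)}e^{-|a|^2}\,da$ in terms of $a\in\mathbb{C}^{N+1}$. For $f\in\mathcal{P}_N$, the normalized distribution of zeros is $\widetilde Z^N_f=\frac1N\sum_{f(z)=0}\delta_z$ (almost surely $f$ has degree exactly $N$ and only simple zeros). The equilibrium measure of a compact set $K\subset\mathbb{C}$ is the unique probability measure $\nu_K$ on $K$ minimizing the energy $E(\mu)=-\int_K\int_K\log|z-w|\,d\mu(z)\,d\mu(w)$; $\nu_\Omega$ denotes the equilibrium measure of $\overline\Omega$ (it is supported on $\partial\Omega$). *)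

theory Defs
  imports "HOL-Probability.Probability" "HOL-Computational_Algebra.Polynomial"
begin

definition real_analytic :: "(real \<Rightarrow> 'a::real_normed_vector) \<Rightarrow> bool" where
  "real_analytic f \<longleftrightarrow>
     (\<forall>t. \<exists>a. \<exists>r>0. \<forall>s. \<bar>s - t\<bar> < r \<longrightarrow> (\<lambda>n. (s - t) ^ n *\<^sub>R a n) sums f s)"

text \<open>A real-analytic closed curve is given by a 1-periodic regular parametrization of the
  whole real line, so that analyticity is also required at the base point.\<close>

definition analytic_jordan_curve :: "(real \<Rightarrow> complex) \<Rightarrow> bool" where
  "analytic_jordan_curve g \<longleftrightarrow>
     real_analytic g \<and> (\<forall>t. g (t + 1) = g t) \<and>
     (\<forall>t. vector_derivative g (at t) \<noteq> 0) \<and> inj_on g {0..<1}"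

text \<open>The measure \<open>|dz|\<close> on the curve.\<close>

definition arclength :: "(real \<Rightarrow> complex) \<Rightarrow> complex measure" where
  "arclength g =
     distr (density lborel
              (\<lambda>t. ennreal (norm (vector_derivative g (at t))) * indicator {0..<1} t))
       borel g"

text \<open>A function on the curve is real-analytic if it is so in the coordinate given by the
  parametrization; since the parametrization is regular, this does not depend on its choice.\<close>

definition positive_analytic_density :: "(real \<Rightarrow> complex) \<Rightarrow> (complex \<Rightarrow> real) \<Rightarrow> bool" where
  "positive_analytic_density g \<rho> \<longleftrightarrow>
     real_analytic (\<lambda>t. \<rho> (g t)) \<and> (\<forall>z\<in>range g. \<rho> z > 0)"

text \<open>Integrating over \<open>range g\<close> makes the values of \<open>\<rho>\<close> off the curve irrelevant, including for
  measurability.\<close>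

definition boundary_inner ::
    "(real \<Rightarrow> complex) \<Rightarrow> (complex \<Rightarrow> real) \<Rightarrow> complex poly \<Rightarrow> complex poly \<Rightarrow> complex" where
  "boundary_inner g \<rho> p q =
     (LINT z:range g|arclength g. poly p z * cnj (poly q z) * complex_of_real (\<rho> z))"

definition area_inner :: "complex set \<Rightarrow> complex poly \<Rightarrow> complex poly \<Rightarrow> complex" where
  "area_inner \<Omega> p q = (LINT z:\<Omega>|lborel. poly p z * cnj (poly q z))"

definition polys :: "nat \<Rightarrow> complex poly set" where
  "polys N = {p. degree p \<le> N}"

text \<open>The Borel sigma-algebra of the finite-dimensional space \<open>polys N\<close>, transported from the
  coefficient vectors. Only the measurable structure of this measure is used.\<close>

definition borel_polys :: "nat \<Rightarrow> complex poly measure" where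
  "borel_polys N =
     vimage_algebra (polys N) (\<lambda>p. restrict (coeff p) {..N}) (PiM {..N} (\<lambda>_. borel))"

definition orthonormal_basis ::
    "nat \<Rightarrow> (complex poly \<Rightarrow> complex poly \<Rightarrow> complex) \<Rightarrow> (nat \<Rightarrow> complex poly) \<Rightarrow> bool" where
  "orthonormal_basis N ip P \<longleftrightarrow>
     (\<forall>j\<le>N. P j \<in> polys N) \<and>
     (\<forall>j\<le>N. \<forall>k\<le>N. ip (P j) (P k) = (if j = k then 1 else 0)) \<and>
     (\<forall>f\<in>polys N. \<exists>a. f = (\<Sum>j\<le>N. smult (a j) (P j)))"

definition std_complex_gaussian :: "complex measure" where
  "std_complex_gaussian = density lborel (\<lambda>a. ennreal (exp (- (cmod a)\<^sup>2) / pi))"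

text \<open>The law of \<open>\<Sum>j\<le>N. a j P j\<close> with independent standard complex Gaussian coefficients. By
  unitary invariance of the Gaussian it is the same for every orthonormal basis, so the measure
  below is determined by \<open>N\<close> and \<open>ip\<close>.\<close>

definition induced_gaussian ::
    "nat \<Rightarrow> (complex poly \<Rightarrow> complex poly \<Rightarrow> complex) \<Rightarrow> complex poly measure \<Rightarrow> bool" where
  "induced_gaussian N ip M \<longleftrightarrow>
     (\<exists>P. orthonormal_basis N ip P \<and>
          M = distr (PiM {..N} (\<lambda>_. std_complex_gaussian)) (borel_polys N)
                (\<lambda>a. \<Sum>j\<le>N. smult (a j) (P j)))"

text \<open>The Lebesgue integral of an extended-real function, as positive part minus negative part
  (\<open>e2ennreal\<close> sends negative values to 0); it is meaningful if one of the two parts is finite,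
  as is the case for a kernel bounded below and a finite measure.\<close>

definition ereal_integral :: "'a measure \<Rightarrow> ('a \<Rightarrow> ereal) \<Rightarrow> ereal" where
  "ereal_integral M f =
     enn2ereal (\<integral>\<^sup>+x. e2ennreal (f x) \<partial>M) - enn2ereal (\<integral>\<^sup>+x. e2ennreal (- f x) \<partial>M)"

text \<open>\<open>- log |z - w|\<close>; the diagonal needs separate treatment because \<open>ln 0 = 0\<close> for reals.\<close>

definition log_kernel :: "complex \<Rightarrow> complex \<Rightarrow> ereal" where
  "log_kernel z w = (if z = w then \<infinity> else ereal (- ln (cmod (z - w))))"

definition log_energy :: "complex measure \<Rightarrow> ereal" where
  "log_energy \<mu> = ereal_integral \<mu> (\<lambda>w. ereal_integral \<mu> (\<lambda>z. log_kernel z w))"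

definition prob_measures_on :: "complex set \<Rightarrow> complex measure set" where
  "prob_measures_on K = {\<mu>. sets \<mu> = sets borel \<and> prob_space \<mu> \<and> emeasure \<mu> K = 1}"

definition equilibrium_measure :: "complex set \<Rightarrow> complex measure" where
  "equilibrium_measure K =
     (THE \<nu>. \<nu> \<in> prob_measures_on K \<and> (\<forall>\<mu>\<in>prob_measures_on K. log_energy \<nu> \<le> log_energy \<mu>))"

definition riemann_sphere :: "complex option topology" where
  "riemann_sphere = Alexandroff_compactification euclidean"

end

theory Submission
  imports Defs "HOL-Complex_Analysis.Complex_Analysis"
    "HOL-Computational_Algebra.Fundamental_Theorem_Algebra"
begin

text \<open>The zeros are tested against tents, the differences \<open>ln (max (2 s) |u|) - ln
  (max s |u|)\<close>. By Jensen's formula the mean of \<open>ln |f|\<close> over the circle of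
  radius \<open>s\<close> about \<open>z\<close> is a constant plus the sum of \<open>ln (max s |z
  - x|)\<close> over the zeros \<open>x\<close>, so a sum of tents over the zeros is the
  difference of two circle means of \<open>ln |f|\<close> (\<open>sum_tent_roots\<close>). The
  leading coefficient cancels, and the question becomes the behaviour of the circle means of
  \<open>ln |f\<^sub>N| / N\<close>.

  Write \<open>f\<^sub>N = \<Sum> a\<^sub>j P\<^sub>j\<close> in an orthonormal basis and let
  \<open>S\<^sub>N = \<Sum> |P\<^sub>j|\<^sup>2\<close> be the Christoffel function. At every
  point \<open>f\<^sub>N / sqrt S\<^sub>N\<close> is a linear form in the Gaussian coefficients
  with a coefficient vector of length one. The fourth moment of its logarithm is
  \<open>O(N)\<close> (\<open>ln_moment_linear_form\<close>), so the circle means of \<open>ln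
  (|f\<^sub>N| / sqrt S\<^sub>N) / N\<close> have fourth moments \<open>O(N^(-3))\<close>; these
  are summable, and the means tend to zero almost surely
  (\<open>AE_normalized_log_mean_limit\<close>).

  The deterministic part \<open>ln S\<^sub>N / (2 N)\<close> converges to the Green function of
  the exterior domain (\<open>christoffel_root_limit\<close>). For the upper bound, a polynomial
  of unit norm is bounded on the closed domain by \<open>C exp (\<epsilon> N)\<close>, the
  Bernstein-Markov property, and then off it by the Bernstein-Walsh inequality. For the lower
  bound, \<open>extremal_polynomials\<close> places zeros at equidistant points of a level curve
  of the Green function, parametrized by the exterior Riemann map. The Bernstein-Markov property
  for both inner products rests on one elementary inequality for connected sets
  (\<open>bernstein_walsh_connected\<close>), obtained by Lagrange interpolation.

  The harmonic measures of the level curves have explicit potentials. Helly's theorem yields a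
  limit measure \<open>\<nu>\<close> on the boundary with \<open>\<integral> ln |z - w|
  d\<nu>(w)\<close> equal to the logarithm of the capacity plus the Green function
  (\<open>limit_measure_exists\<close>); by the computation above its tent integrals are the
  limits of the sums over the zeros. It is the equilibrium measure because its potential is
  constant on the closed domain and the logarithmic energy is strictly positive definite:
  Frullani's integral writes it as a superposition of Gaussian energies
  (\<open>shifted_energy_strictly_positive\<close>, \<open>equilibrium_measure_eqI\<close>).

  Almost surely, then, the convergence holds for all tents of scale \<open>1 / k\<close> centred
  at a countable dense set, and these determine weak convergence against functions vanishing at
  infinity (\<open>weak_convergence_from_tents\<close>). A function on the sphere is such a
  function plus a constant, and the constants are matched because almost surely
  \<open>f\<^sub>N\<close> has exactly \<open>N\<close> distinct zeros
  (\<open>AE_simple_roots\<close>).\<close>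

section \<open>Circle means of logarithmic functions\<close>

text \<open>Circles are parametrized by the unit interval, so that all circle means are integrals
  against one probability measure on the line.\<close>

definition unif01 :: "real measure" where
  "unif01 = density lborel (\<lambda>t. ennreal (indicator {0..1} t))"

definition ucirc :: "real \<Rightarrow> complex" where
  "ucirc t = exp (2 * of_real pi * \<i> * of_real t)"

lemma norm_ucirc [simp]: "norm (ucirc t) = 1"
  by (simp add: ucirc_def)

lemma ucirc_nz [simp]: "ucirc t \<noteq> 0"
  by (simp add: ucirc_def)

lemma continuous_on_ucirc [continuous_intros]:
  "continuous_on S f \<Longrightarrow> continuous_on S (\<lambda>x. ucirc (f x))"
  unfolding ucirc_def by (intro continuous_intros)

lemma measurable_ucirc [measurable]: "ucirc \<in> borel_measurable borel"
  by (intro borel_measurable_continuous_onI continuous_intros)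

lemma sets_unif01 [simp, measurable_cong]: "sets unif01 = sets borel"
  by (simp add: unif01_def)

lemma space_unif01 [simp]: "space unif01 = UNIV"
  by (simp add: unif01_def)

lemma prob_space_unif01: "prob_space unif01"
proof
  have "emeasure unif01 (space unif01) = (\<integral>\<^sup>+x. indicator {0..1} x \<partial>(lborel::real measure))"
    unfolding unif01_def by (subst emeasure_density) (auto simp: ennreal_indicator simp del: nn_integral_indicator)
  also have "\<dots> = emeasure lborel {0..1::real}" by (rule nn_integral_indicator) auto
  also have "\<dots> = 1" by simp
  finally show "emeasure unif01 (space unif01) = 1" .
qed

lemma integral_unif01:
  fixes f :: "real \<Rightarrow> 'a::euclidean_space"
  assumes "continuous_on {0..1} f" "f \<in> borel_measurable borel"
  shows "integral\<^sup>L unif01 f = integral {0..1} f"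
proof -
  have "integral\<^sup>L unif01 f = (LINT x:{0..1}|lborel. f x)"
    unfolding unif01_def set_lebesgue_integral_def
    using assms(2) by (subst integral_density) auto
  also have "\<dots> = integral {0..1} f"
    unfolding set_lebesgue_integral_def[symmetric]
    by (rule set_borel_integral_eq_integral)
       (use borel_integrable_compact[OF compact_Icc assms(1)] in \<open>simp add: set_integrable_def\<close>)
  finally show ?thesis .
qed

lemma AE_unif01_countable:
  assumes "countable A" shows "AE t in unif01. t \<notin> A"
proof -
  have "AE t in lborel. t \<notin> A"
    using countable_imp_null_set_lborel[OF assms] AE_not_in by blast
  thus ?thesis unfolding unif01_def
    by (subst AE_density) auto
qed

lemma circle_mean_holomorphic:
  assumes "f holomorphic_on ball z R" "0 < r" "r < R"
  shows "integral\<^sup>L unif01 (\<lambda>t. f (z + of_real r * ucirc t)) = f z"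
proof -
  have hol: "f holomorphic_on cball z r"
    by (rule holomorphic_on_subset[OF assms(1)]) (use assms in auto)
  have "((\<lambda>u. f u / (u - z)) has_contour_integral (2 * of_real pi * \<i> * f z)) (circlepath z r)"
    by (rule Cauchy_integral_circlepath)
       (use hol assms in \<open>auto intro!: holomorphic_on_imp_continuous_on holomorphic_on_subset[OF hol]\<close>)
  hence "((\<lambda>t. 2 * of_real pi * \<i> * f (z + of_real r * ucirc t)) has_integral (2 * of_real pi * \<i> * f z)) {0..1}"
    unfolding has_contour_integral_def
  proof (rule has_integral_eq[rotated])
    fix x :: real assume "x \<in> {0..1}"
    hence "vector_derivative (circlepath z r) (at x within {0..1}) = 2 * of_real pi * \<i> * of_real r * ucirc x"
      by (simp add: vector_derivative_circlepath01 ucirc_def mult_ac)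
    moreover have "circlepath z r x = z + of_real r * ucirc x" by (simp add: circlepath ucirc_def)
    ultimately show "f (circlepath z r x) / (circlepath z r x - z) * vector_derivative (circlepath z r) (at x within {0..1})
        = 2 * of_real pi * \<i> * f (z + of_real r * ucirc x)" using assms by (simp add: field_simps)
  qed
  from has_integral_mult_right[OF this, of "1 / (2 * of_real pi * \<i>)"]
  have "((\<lambda>t. f (z + of_real r * ucirc t)) has_integral f z) {0..1}" by simp
  hence eq: "integral {0..1} (\<lambda>t. f (z + of_real r * ucirc t)) = f z" by (rule integral_unique)
  have cont: "continuous_on UNIV (\<lambda>t. f (z + of_real r * ucirc t))"
    by (rule continuous_on_compose2[OF holomorphic_on_imp_continuous_on[OF hol]])
       (use assms in \<open>auto intro!: continuous_intros simp: dist_norm norm_mult\<close>)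
  show ?thesis
    using eq cont by (subst integral_unif01)
      (auto intro: borel_measurable_continuous_onI continuous_on_subset)
qed

lemma integrable_unif01_continuous:
  fixes f :: "real \<Rightarrow> 'a::euclidean_space"
  assumes "continuous_on UNIV f"
  shows "integrable unif01 f"
proof -
  have [measurable]: "f \<in> borel_measurable borel" using assms by (rule borel_measurable_continuous_onI)
  have "integrable lborel (\<lambda>x. indicator {0..1} x *\<^sub>R f x)"
    by (rule borel_integrable_compact[OF compact_Icc continuous_on_subset[OF assms]]) auto
  thus ?thesis unfolding unif01_def
    by (subst integrable_density) auto
qed

text \<open>The logarithm of a holomorphic function without zeros is holomorphic, so the mean
  value property applies to its real part.\<close>

lemma circle_mean_ln_norm:
  assumes "F holomorphic_on ball 0 R" "0 < r" "r < R" "\<And>w. w \<in> ball 0 R \<Longrightarrow> F w \<noteq> 0"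
  shows "integrable unif01 (\<lambda>t. ln (norm (F (of_real r * ucirc t))))"
    and "integral\<^sup>L unif01 (\<lambda>t. ln (norm (F (of_real r * ucirc t)))) = ln (norm (F 0))"
proof -
  obtain L where L: "L holomorphic_on ball 0 R" "\<And>w. w \<in> ball 0 R \<Longrightarrow> F w = exp (L w)"
    using contractible_imp_holomorphic_log[OF assms(1) _ assms(4)]
      convex_imp_contractible[OF convex_ball] by metis
  have in_ball: "of_real r * ucirc t \<in> ball 0 R" for t
    using assms by (simp add: norm_mult)
  have cont: "continuous_on UNIV (\<lambda>t. L (of_real r * ucirc t))"
    by (rule continuous_on_compose2[OF holomorphic_on_imp_continuous_on[OF L(1)]])
       (use in_ball in \<open>auto intro!: continuous_intros\<close>)
  have eq: "ln (norm (F (of_real r * ucirc t))) = Re (L (of_real r * ucirc t))" for t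
    using L(2)[OF in_ball[of t]] by simp
  have int: "integrable unif01 (\<lambda>t. L (of_real r * ucirc t))"
    by (rule integrable_unif01_continuous[OF cont])
  show "integrable unif01 (\<lambda>t. ln (norm (F (of_real r * ucirc t))))"
    unfolding eq using int by (intro integrable_Re)
  have "integral\<^sup>L unif01 (\<lambda>t. ln (norm (F (of_real r * ucirc t)))) = Re (integral\<^sup>L unif01 (\<lambda>t. L (of_real r * ucirc t)))"
    unfolding eq using int by simp
  also have "\<dots> = Re (L 0)"
    using circle_mean_holomorphic[OF L(1) assms(2,3)] by simp
  also have "\<dots> = ln (norm (F 0))" using L(2)[of 0] assms by simp
  finally show "integral\<^sup>L unif01 (\<lambda>t. ln (norm (F (of_real r * ucirc t)))) = ln (norm (F 0))" .
qed

lemma countable_ucirc_vimage: "countable {t. of_real R * ucirc t = w}" if "R > 0"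
proof (cases "\<exists>t0. of_real R * ucirc t0 = w")
  case True
  then obtain t0 where t0: "of_real R * ucirc t0 = w" by blast
  have "{t. of_real R * ucirc t = w} \<subseteq> range (\<lambda>n::int. t0 + of_int n)"
  proof safe
    fix t assume "w = of_real R * ucirc t"
    hence "ucirc t = ucirc t0" using t0 that by simp
    then obtain n :: int where
      n: "2 * of_real pi * \<i> * of_real t = 2 * of_real pi * \<i> * of_real t0 + (of_int (2 * n) * pi) * \<i>"
      unfolding ucirc_def exp_eq by blast
    hence "(2 * of_real pi * \<i>) * (of_real t :: complex) = (2 * of_real pi * \<i>) * (of_real t0 + of_int n)"
      by (simp add: algebra_simps)
    hence "(of_real t :: complex) = of_real (t0 + of_int n)" by simp
    hence "t = t0 + of_int n" by (simp only: of_real_eq_iff)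
    thus "t \<in> range (\<lambda>n::int. t0 + of_int n)" by blast
  qed
  thus ?thesis by (rule countable_subset) simp
next
  case False thus ?thesis by (simp add: Collect_empty_eq[THEN iffD2])
qed

text \<open>Jensen's formula for a linear factor: \<open>max R\<close> appears because the
  logarithmic potential of a circle is constant inside and that of a point mass outside.\<close>

theorem circle_mean_ln_dist:
  assumes R: "R > 0"
  shows integrable_ln_dist_circle: "integrable unif01 (\<lambda>t. ln (norm (of_real R * ucirc t - w)))"
    and "integral\<^sup>L unif01 (\<lambda>t. ln (norm (of_real R * ucirc t - w))) = ln (max R (norm w))"
proof -
  have less: "integrable unif01 (\<lambda>t. ln (norm (of_real R * ucirc t - w))) \<and>
      integral\<^sup>L unif01 (\<lambda>t. ln (norm (of_real R * ucirc t - w))) = ln R" if w: "norm w < R" for w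
  proof -
    \<comment> \<open>Reflecting \<open>w\<close> in the circle leaves the distances on the circle
      unchanged up to a factor and gives a function without zeros on the closed disc.\<close>
    define F where "F = (\<lambda>\<zeta>. of_real R - cnj w * \<zeta>)"
    have eq: "norm (of_real R * ucirc t - w) = norm (F (of_real 1 * ucirc t))" for t
    proof -
      have "norm (of_real R * ucirc t - w) = norm (cnj (of_real R * ucirc t - w)) * norm (ucirc t)"
        by (simp only: complex_mod_cnj norm_ucirc mult_1_right)
      also have "\<dots> = norm (cnj (of_real R * ucirc t - w) * ucirc t)" by (simp only: norm_mult)
      also have "cnj (of_real R * ucirc t - w) * ucirc t = of_real R * (cnj (ucirc t) * ucirc t) - cnj w * ucirc t"
        by (simp add: algebra_simps)
      also have "cnj (ucirc t) * ucirc t = 1"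
        using complex_norm_square[of "ucirc t"] by (simp add: mult.commute)
      finally show ?thesis by (simp add: F_def)
    qed
    obtain \<rho> where rho: "1 < \<rho>" "norm w * \<rho> < R"
    proof (cases "w = 0")
      case True thus ?thesis using that[of 2] R by simp
    next
      case False
      have "1 < R / norm w" using False w by simp
      then obtain \<rho> where "1 < \<rho>" "\<rho> < R / norm w" using dense by blast
      thus ?thesis using that[of \<rho>] False by (simp add: field_simps)
    qed
    have F: "F \<zeta> \<noteq> 0" if "\<zeta> \<in> ball 0 \<rho>" for \<zeta>
    proof
      assume "F \<zeta> = 0"
      hence "R = norm (cnj w * \<zeta>)" using R by (metis F_def abs_of_pos eq_iff_diff_eq_0 norm_of_real)
      also have "\<dots> \<le> norm w * \<rho>" using that by (simp add: norm_mult mult_left_mono)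
      finally show False using rho by simp
    qed
    have hol: "F holomorphic_on ball 0 \<rho>" unfolding F_def by (intro holomorphic_intros)
    show ?thesis unfolding eq using circle_mean_ln_norm[OF hol _ rho(1) F] R
      by (auto simp: F_def)
  qed
  have "integrable unif01 (\<lambda>t. ln (norm (of_real R * ucirc t - w))) \<and>
      integral\<^sup>L unif01 (\<lambda>t. ln (norm (of_real R * ucirc t - w))) = ln (max R (norm w))"
  proof (cases "norm w" R rule: linorder_cases)
    case less thus ?thesis using \<open>\<And>w. norm w < R \<Longrightarrow> _\<close>[of w] by (simp add: max_def)
  next
    case greater
    define F where "F = (\<lambda>\<zeta>. of_real R * \<zeta> - w)"
    have F: "F \<zeta> \<noteq> 0" if "\<zeta> \<in> ball 0 (norm w / R)" for \<zeta>
    proof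
      assume "F \<zeta> = 0"
      hence "norm w = R * norm \<zeta>" using R by (auto simp: F_def norm_mult)
      thus False using that R by (simp add: field_simps)
    qed
    have hol: "F holomorphic_on ball 0 (norm w / R)" unfolding F_def by (intro holomorphic_intros)
    have "1 < norm w / R" using greater R by simp
    from circle_mean_ln_norm[OF hol _ this F] show ?thesis using greater by (auto simp: F_def max_def)
  next
    case equal
    \<comment> \<open>On the circle itself \<open>w\<close> is approached radially from inside;
      Fatou's lemma gives integrability, and the bounds \<open>f - ln 2 \<le> fn \<le> ln (2
      R)\<close> then allow dominated convergence.\<close>
    define \<rho> where "\<rho> = (\<lambda>n::nat. 1 - 1 / (real n + 2))"
    have rho: "0 < \<rho> n" "\<rho> n < 1" for n by (auto simp: \<rho>_def field_simps)
    have rho_lim: "\<rho> \<longlonglongrightarrow> 1" unfolding \<rho>_def by real_asymp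
    define f where "f = (\<lambda>t. ln (norm (of_real R * ucirc t - w)))"
    define fn where "fn = (\<lambda>n t. ln (norm (of_real R * ucirc t - of_real (\<rho> n) * w)))"
    have fn: "integrable unif01 (fn n)" "integral\<^sup>L unif01 (fn n) = ln R" for n
      using less[of "of_real (\<rho> n) * w"] rho[of n] equal R by (auto simp: fn_def norm_mult)
    have [measurable]: "f \<in> borel_measurable borel" "fn n \<in> borel_measurable borel" for n
      unfolding f_def fn_def by measurable
    have ae: "AE t in unif01. of_real R * ucirc t \<noteq> w"
      using AE_unif01_countable[OF countable_ucirc_vimage[OF R, of w]] by simp
    have ub: "fn n t \<le> ln (2 * R)" for n t
    proof -
      have "norm (of_real R * ucirc t - of_real (\<rho> n) * w) \<le> R + \<rho> n * R"
        using norm_triangle_ineq4[of "of_real R * ucirc t" "of_real (\<rho> n) * w"] R rho[of n] equal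
        by (simp add: norm_mult)
      also have "\<dots> \<le> 2 * R" using rho[of n] R by simp
      finally have le: "norm (of_real R * ucirc t - of_real (\<rho> n) * w) \<le> 2 * R" .
      have "R - \<rho> n * R \<le> norm (of_real R * ucirc t - of_real (\<rho> n) * w)"
        using norm_triangle_ineq2[of "of_real R * ucirc t" "of_real (\<rho> n) * w"] R rho[of n] equal
        by (simp add: norm_mult)
      moreover have "R - \<rho> n * R > 0" using rho[of n] R by simp
      ultimately show ?thesis unfolding fn_def using le R by (intro ln_mono) auto
    qed
    have lb: "f t - ln 2 \<le> fn n t" if "of_real R * ucirc t \<noteq> w" for n t
    proof -
      have a: "R - \<rho> n * R \<le> norm (of_real R * ucirc t - of_real (\<rho> n) * w)"
        using norm_triangle_ineq2[of "of_real R * ucirc t" "of_real (\<rho> n) * w"] R rho[of n] equal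
        by (simp add: norm_mult)
      have b: "norm (of_real R * ucirc t - w) \<le>
          norm (of_real R * ucirc t - of_real (\<rho> n) * w) + norm (of_real (\<rho> n) * w - w)"
        using norm_triangle_ineq[of "of_real R * ucirc t - of_real (\<rho> n) * w" "of_real (\<rho> n) * w - w"] by simp
      have "of_real (\<rho> n) * w - w = - (of_real (1 - \<rho> n) * w)" by (simp add: algebra_simps)
      hence "norm (of_real (\<rho> n) * w - w) = (1 - \<rho> n) * R"
        using rho[of n] equal by (simp only: norm_minus_cancel norm_mult norm_of_real)
      hence c: "norm (of_real R * ucirc t - w) \<le> 2 * norm (of_real R * ucirc t - of_real (\<rho> n) * w)"
        using a b by (simp add: algebra_simps)
      have p: "norm (of_real R * ucirc t - w) > 0" using that by simp
      have "f t \<le> ln (2 * norm (of_real R * ucirc t - of_real (\<rho> n) * w))"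
        unfolding f_def using c p by (intro ln_mono) auto
      also have "\<dots> = ln 2 + fn n t" unfolding fn_def using p c by (subst ln_mult) auto
      finally show ?thesis by simp
    qed
    have lim: "(\<lambda>n. fn n t) \<longlonglongrightarrow> f t" if "of_real R * ucirc t \<noteq> w" for t
    proof -
      have "(\<lambda>n. norm (of_real R * ucirc t - of_real (\<rho> n) * w)) \<longlonglongrightarrow> norm (of_real R * ucirc t - of_real 1 * w)"
        by (intro tendsto_intros rho_lim)
      thus ?thesis unfolding fn_def f_def using that by (intro tendsto_ln) auto
    qed
    interpret prob_space unif01 by (rule prob_space_unif01)
    have "(\<integral>\<^sup>+t. ennreal (ln (2 * R) - f t) \<partial>unif01) \<le> (\<integral>\<^sup>+t. liminf (\<lambda>n. ennreal (ln (2 * R) - fn n t)) \<partial>unif01)"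
    proof (rule nn_integral_mono_AE, use ae in eventually_elim)
      case (elim t)
      have "(\<lambda>n. ennreal (ln (2 * R) - fn n t)) \<longlonglongrightarrow> ennreal (ln (2 * R) - f t)"
        by (intro tendsto_ennrealI tendsto_intros lim elim)
      from lim_imp_Liminf[OF _ this] show ?case by simp
    qed
    also have "\<dots> \<le> liminf (\<lambda>n. \<integral>\<^sup>+t. ennreal (ln (2 * R) - fn n t) \<partial>unif01)"
      by (rule nn_integral_liminf) auto
    also have "(\<lambda>n. \<integral>\<^sup>+t. ennreal (ln (2 * R) - fn n t) \<partial>unif01) = (\<lambda>n. ennreal (ln (2 * R) - ln R))"
    proof
      fix n
      show "(\<integral>\<^sup>+t. ennreal (ln (2 * R) - fn n t) \<partial>unif01) = ennreal (ln (2 * R) - ln R)"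
        using fn[of n] ub prob_space by (subst nn_integral_eq_integral) auto
    qed
    also have "liminf \<dots> < \<infinity>" by (simp add: Liminf_const)
    finally have fin: "(\<integral>\<^sup>+t. ennreal (ln (2 * R) - f t) \<partial>unif01) < \<infinity>" .
    have ubf: "AE t in unif01. f t \<le> ln (2 * R)"
      using ae by eventually_elim (use LIMSEQ_le_const2[OF lim] ub in blast)
    have "integrable unif01 (\<lambda>t. ln (2 * R) - f t)"
      by (rule integrableI_nonneg) (use fin ubf in \<open>auto simp: less_top[symmetric]\<close>)
    from Bochner_Integration.integrable_diff[OF integrable_const[of "ln (2 * R)"] this]
    have intf: "integrable unif01 f" by simp
    have "(\<lambda>n. integral\<^sup>L unif01 (fn n)) \<longlonglongrightarrow> integral\<^sup>L unif01 f"
    proof (rule integral_dominated_convergence[where w = "\<lambda>t. \<bar>f t\<bar> + ln 2 + \<bar>ln (2 * R)\<bar>"])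
      show "AE t in unif01. (\<lambda>n. fn n t) \<longlonglongrightarrow> f t" using ae by eventually_elim (rule lim)
      show "AE t in unif01. norm (fn n t) \<le> \<bar>f t\<bar> + ln 2 + \<bar>ln (2 * R)\<bar>" for n
        using ae
      proof eventually_elim
        case (elim t)
        have "ln 2 \<ge> (0::real)" by simp
        thus ?case using ub[of n t] lb[OF elim, of n] unfolding real_norm_def by linarith
      qed
    qed (use intf in auto)
    hence "integral\<^sup>L unif01 f = ln R" using fn(2) by (simp add: LIMSEQ_const_iff)
    thus ?thesis using intf equal by (simp add: f_def)
  qed
  thus "integrable unif01 (\<lambda>t. ln (norm (of_real R * ucirc t - w)))"
    "integral\<^sup>L unif01 (\<lambda>t. ln (norm (of_real R * ucirc t - w))) = ln (max R (norm w))" by auto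
qed

section \<open>Polynomials on connected sets\<close>

text \<open>Chebyshev polynomials of the first kind.\<close>

fun cheb_poly :: "nat \<Rightarrow> real poly" where
  "cheb_poly 0 = 1"
| "cheb_poly (Suc 0) = [:0, 1:]"
| "cheb_poly (Suc (Suc n)) = [:0, 2:] * cheb_poly (Suc n) - cheb_poly n"

lemma degree_cheb_poly: "degree (cheb_poly n) \<le> n"
proof (induction n rule: cheb_poly.induct)
  case (3 n)
  have "degree ([:0, 2:] * cheb_poly (Suc n)) \<le> Suc (Suc n)"
    using degree_mult_le[of "[:0, 2::real:]" "cheb_poly (Suc n)"] 3 by simp
  thus ?case using 3 by (auto intro!: degree_diff_le)
qed auto

lemma cheb_poly_cos: "poly (cheb_poly n) (cos x) = cos (real n * x)"
proof (induction n rule: cheb_poly.induct)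
  case (3 n)
  have "cos (real (Suc (Suc n)) * x) + cos (real n * x) = 2 * cos x * cos (real (Suc n) * x)"
    using cos_plus_cos[of "real (Suc (Suc n)) * x" "real n * x"]
    by (simp add: algebra_simps add_divide_distrib)
  thus ?case using 3 by (simp add: algebra_simps)
qed auto

lemma cheb_poly_cosh: "poly (cheb_poly n) (cosh x) = cosh (real n * x)"
proof (induction n rule: cheb_poly.induct)
  case (3 n)
  have a: "real (Suc (Suc n)) * x = real (Suc n) * x + x" "real n * x = real (Suc n) * x - x"
    by (auto simp: algebra_simps)
  have "cosh (real (Suc (Suc n)) * x) + cosh (real n * x) = 2 * cosh x * cosh (real (Suc n) * x)"
    unfolding a cosh_add cosh_diff by simp
  thus ?case using 3 by (simp add: algebra_simps)
qed auto

lemma lagrange_interpolation: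
  fixes p :: "'a::field poly" and x :: "nat \<Rightarrow> 'a"
  assumes "degree p \<le> N" "inj_on x {..N}"
  shows "poly p z = (\<Sum>k\<le>N. poly p (x k) * (\<Prod>j\<in>{..N}-{k}. (z - x j) / (x k - x j)))"
proof -
  define q where "q = (\<Sum>k\<le>N. smult (poly p (x k)) (\<Prod>j\<in>{..N}-{k}. smult (1 / (x k - x j)) [:- x j, 1:]))"
  have poly_q: "poly q z = (\<Sum>k\<le>N. poly p (x k) * (\<Prod>j\<in>{..N}-{k}. (z - x j) / (x k - x j)))" for z
  proof -
    have "poly (smult (1 / (x k - x j)) [:- x j, 1:]) z = (z - x j) / (x k - x j)" for k j
      using diff_divide_distrib[of z "x j" "x k - x j"] by simp
    thus ?thesis unfolding q_def by (simp only: poly_sum poly_prod poly_smult)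
  qed
  have deg: "degree q \<le> N"
    unfolding q_def
  proof (rule degree_sum_le)
    fix k assume k: "k \<in> {..N}"
    have "degree (\<Prod>j\<in>{..N}-{k}. smult (1 / (x k - x j)) [:- x j, 1:]) \<le>
        (\<Sum>j\<in>{..N}-{k}. degree (smult (1 / (x k - x j)) [:- x j, 1:]))"
      using degree_prod_sum_le[of "{..N}-{k}" "\<lambda>j. smult (1 / (x k - x j)) [:- x j, 1:]"]
      by (simp only: comp_def finite_Diff finite_atMost)
    also have "\<dots> \<le> (\<Sum>j\<in>{..N}-{k}. 1)" by (intro sum_mono) auto
    also have "\<dots> = N" using k by simp
    finally have "degree (\<Prod>j\<in>{..N}-{k}. smult (1 / (x k - x j)) [:- x j, 1:]) \<le> N" .
    thus "degree (smult (poly p (x k)) (\<Prod>j\<in>{..N}-{k}. smult (1 / (x k - x j)) [:- x j, 1:])) \<le> N"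
      by (rule order_trans[OF degree_smult_le])
  qed auto
  have at: "poly q (x i) = poly p (x i)" if i: "i \<le> N" for i
  proof -
    have "poly q (x i) = (\<Sum>k\<le>N. poly p (x k) * (\<Prod>j\<in>{..N}-{k}. (x i - x j) / (x k - x j)))" by (rule poly_q)
    also have "\<dots> = (\<Sum>k\<le>N. if k = i then poly p (x i) else 0)"
    proof (rule sum.cong[OF refl])
      fix k assume k: "k \<in> {..N}"
      show "poly p (x k) * (\<Prod>j\<in>{..N}-{k}. (x i - x j) / (x k - x j)) = (if k = i then poly p (x i) else 0)"
      proof (cases "k = i")
        case True
        have "(x i - x j) / (x i - x j) = 1" if "j \<in> {..N} - {i}" for j
          using inj_onD[OF assms(2), of i j] that i by auto
        thus ?thesis using True by simp
      next
        case False
        have "(\<Prod>j\<in>{..N}-{k}. (x i - x j) / (x k - x j)) = 0"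
          by (rule prod_zero) (use False i in auto)
        thus ?thesis using False by simp
      qed
    qed
    also have "\<dots> = poly p (x i)" using i by simp
    finally show ?thesis .
  qed
  have "p = q"
  proof (rule ccontr)
    assume ne: "p \<noteq> q"
    have "finite {z. poly (p - q) z = 0}" using poly_roots_finite[of "p - q"] ne by simp
    moreover have "x ` {..N} \<subseteq> {z. poly (p - q) z = 0}" using at by auto
    ultimately have "card (x ` {..N}) \<le> card {z. poly (p - q) z = 0}" by (rule card_mono)
    also have "\<dots> \<le> degree (p - q)" by (rule card_poly_roots_bound) (use ne in simp)
    also have "\<dots> \<le> N" by (rule degree_diff_le) (use assms deg in auto)
    finally show False using card_image[OF assms(2)] by simp
  qed
  hence "poly p z = poly q z" by (rule arg_cong)
  thus ?thesis using poly_q by (rule trans)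
qed

text \<open>At the extremal nodes the Chebyshev polynomial is \<open>(-1)^k\<close>, which is also
  the sign of the \<open>k\<close>th Lagrange basis polynomial to the right of \<open>[-1,
  1]\<close>. Interpolating the Chebyshev polynomial therefore evaluates the sum of the absolute
  values of the basis polynomials.\<close>

lemma lagrange_sum_chebyshev:
  assumes N: "N \<ge> 1" and u: "u \<ge> 0"
  defines "y \<equiv> (\<lambda>k. cos (real k * pi / real N))"
  shows "(\<Sum>k\<le>N. \<Prod>j\<in>{..N}-{k}. (cosh u - y j) / \<bar>y k - y j\<bar>) = cosh (real N * u)"
    and "inj_on y {..N}"
proof -
  have less: "y j < y i" if "i < j" "j \<le> N" for i j
  proof -
    have "real i * pi / real N < real j * pi / real N" using that N by (simp add: divide_strict_right_mono)
    moreover have "real j * pi / real N \<le> pi" using that N by (simp add: field_simps)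
    ultimately show ?thesis unfolding y_def by (intro cos_monotone_0_pi) auto
  qed
  show inj: "inj_on y {..N}"
    by (rule inj_onI) (use less in \<open>metis atMost_iff less_irrefl linorder_neqE_nat\<close>)
  have one: "y j \<le> cosh u" for j
    using cosh_real_ge_1[of u] cos_le_one[of "real j * pi / real N"] unfolding y_def by linarith
  have val: "poly (cheb_poly N) (y k) = (-1) ^ k" for k
    unfolding y_def cheb_poly_cos using N by (simp add: cos_npi)
  have "cosh (real N * u) = poly (cheb_poly N) (cosh u)" by (simp add: cheb_poly_cosh)
  also have "\<dots> = (\<Sum>k\<le>N. poly (cheb_poly N) (y k) * (\<Prod>j\<in>{..N}-{k}. (cosh u - y j) / (y k - y j)))"
    by (rule lagrange_interpolation[OF degree_cheb_poly inj])
  also have "\<dots> = (\<Sum>k\<le>N. \<Prod>j\<in>{..N}-{k}. (cosh u - y j) / \<bar>y k - y j\<bar>)"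
  proof (rule sum.cong[OF refl])
    fix k assume k: "k \<in> {..N}"
    have split: "{..N}-{k} = {..<k} \<union> {k<..N}" using k by auto
    have disj: "{..<k} \<inter> {k<..N} = {}" by auto
    have neg: "(\<Prod>j<k. (cosh u - y j) / (y k - y j)) = (-1) ^ k * (\<Prod>j<k. (cosh u - y j) / \<bar>y k - y j\<bar>)"
    proof -
      have "(\<Prod>j<k. (cosh u - y j) / (y k - y j)) = (\<Prod>j<k. (-1) * ((cosh u - y j) / \<bar>y k - y j\<bar>))"
      proof (rule prod.cong[OF refl])
        fix j assume "j \<in> {..<k}"
        hence "y k < y j" using less[of j k] k by auto
        thus "(cosh u - y j) / (y k - y j) = (-1) * ((cosh u - y j) / \<bar>y k - y j\<bar>)"
          by (simp add: abs_if divide_simps) (simp add: algebra_simps)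
      qed
      thus ?thesis by (simp only: prod.distrib prod_constant card_lessThan)
    qed
    have pos: "(\<Prod>j\<in>{k<..N}. (cosh u - y j) / (y k - y j)) = (\<Prod>j\<in>{k<..N}. (cosh u - y j) / \<bar>y k - y j\<bar>)"
      by (rule prod.cong[OF refl]) (use less k in \<open>force simp: abs_if\<close>)
    show "poly (cheb_poly N) (y k) * (\<Prod>j\<in>{..N}-{k}. (cosh u - y j) / (y k - y j)) =
        (\<Prod>j\<in>{..N}-{k}. (cosh u - y j) / \<bar>y k - y j\<bar>)"
      unfolding val split
      by (simp add: prod.union_disjoint[OF _ _ disj] neg pos flip: power_mult_distrib power_add mult.assoc)
  qed
  finally show "(\<Sum>k\<le>N. \<Prod>j\<in>{..N}-{k}. (cosh u - y j) / \<bar>y k - y j\<bar>) = cosh (real N * u)" by simp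
qed

text \<open>Distances from \<open>e\<close> to points of the connected set \<open>L\<close> fill
  the interval \<open>[0, d]\<close>, so interpolation nodes can be chosen in \<open>L\<close>
  whose distances from \<open>e\<close> are the Chebyshev nodes of that interval. Mutual distances
  only increase in passing from the radii to the points, so the Lagrange basis is dominated by the
  one on the interval. The exponential rate is small when \<open>s\<close> is small compared with
  \<open>d\<close>, for all polynomials and all base points \<open>e\<close> at once.\<close>

theorem bernstein_walsh_connected:
  fixes L :: "complex set"
  assumes "connected L" "e \<in> L" "b \<in> L" "d > 0" "d \<le> norm (b - e)"
    and p: "degree p \<le> N" and M: "\<And>x. x \<in> L \<Longrightarrow> norm (poly p x) \<le> M"
    and z: "norm (z - e) \<le> s"
  shows "norm (poly p z) \<le> M * exp (real N * arcosh (1 + 2 * s / d))"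
proof (cases "N = 0")
  case True
  then obtain c where "p = [:c:]" using p degree_eq_zeroE by auto
  thus ?thesis using M[OF assms(2)] True by simp
next
  case False
  hence N: "N \<ge> 1" by simp
  have s: "s \<ge> 0" using z norm_ge_zero order_trans by blast
  have Mpos: "M \<ge> 0" using M[OF assms(2)] norm_ge_zero order_trans by blast
  define u where "u = arcosh (1 + 2 * s / d)"
  have cu: "cosh u = 1 + 2 * s / d" unfolding u_def
    using s assms(4) by (intro cosh_arcosh_real) auto
  have u: "u \<ge> 0" unfolding u_def using s assms(4) by (intro arcosh_nonneg_real) auto
  define y where "y = (\<lambda>k. cos (real k * pi / real N))"
  have yb: "-1 \<le> y k" "y k \<le> 1" for k by (auto simp: y_def)
  have ch: "(\<Sum>k\<le>N. \<Prod>j\<in>{..N}-{k}. (cosh u - y j) / \<bar>y k - y j\<bar>) = cosh (real N * u)" "inj_on y {..N}"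
    using lagrange_sum_chebyshev[OF N u] by (auto simp: y_def)
  have one: "y j \<le> cosh u" for j
    using cosh_real_ge_1[of u] yb[of j] by linarith
  \<comment> \<open>The Chebyshev nodes, carried from \<open>[-1, 1]\<close> to \<open>[0,
    d]\<close>; under this map \<open>- s\<close> corresponds to \<open>cosh u\<close>.\<close>
  define t where "t = (\<lambda>k. d * (1 - y k) / 2)"
  have ex: "\<exists>x\<in>L. norm (x - e) = t k" for k
  proof -
    have con: "connected ((\<lambda>x. norm (x - e)) ` L)"
      by (intro connected_continuous_image assms(1) continuous_intros)
    have "0 \<in> (\<lambda>x. norm (x - e)) ` L" "norm (b - e) \<in> (\<lambda>x. norm (x - e)) ` L" using assms(2,3) by force+
    moreover have "0 \<le> t k" using yb[of k] assms(4) by (simp add: t_def)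
    moreover have "d * (1 - y k) \<le> d * 2" using yb[of k] assms(4) by (intro mult_left_mono) auto
    hence "t k \<le> norm (b - e)" using assms(5) by (simp add: t_def)
    ultimately have "t k \<in> (\<lambda>x. norm (x - e)) ` L"
      using con unfolding connected_iff_interval by blast
    thus ?thesis by auto
  qed
  then obtain x where x: "\<And>k. x k \<in> L" "\<And>k. norm (x k - e) = t k" by metis
  have tdiff: "t k - t j = d / 2 * (y j - y k)" for j k by (simp add: t_def field_simps)
  have dist: "norm (x k - x j) \<ge> d / 2 * \<bar>y k - y j\<bar>" for j k
  proof -
    have "\<bar>norm (x k - e) - norm (x j - e)\<bar> \<le> norm ((x k - e) - (x j - e))" by (rule norm_triangle_ineq3)
    thus ?thesis using tdiff[of k j] assms(4) unfolding x by (simp add: abs_mult abs_minus_commute)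
  qed
  have inj: "inj_on x {..N}"
  proof (rule inj_onI)
    fix i j assume ij: "i \<in> {..N}" "j \<in> {..N}" "x i = x j"
    hence "\<bar>y i - y j\<bar> \<le> 0" using dist[of i j] assms(4) by (simp add: mult_le_0_iff)
    thus "i = j" using inj_onD[OF ch(2)] ij by auto
  qed
  have "norm (poly p z) \<le> (\<Sum>k\<le>N. norm (poly p (x k) * (\<Prod>j\<in>{..N}-{k}. (z - x j) / (x k - x j))))"
    unfolding lagrange_interpolation[OF p inj, of z] by (rule norm_sum)
  also have "\<dots> \<le> (\<Sum>k\<le>N. M * (\<Prod>j\<in>{..N}-{k}. (cosh u - y j) / \<bar>y k - y j\<bar>))"
  proof (rule sum_mono)
    fix k assume k: "k \<in> {..N}"
    have "(\<Prod>j\<in>{..N}-{k}. norm ((z - x j) / (x k - x j))) \<le> (\<Prod>j\<in>{..N}-{k}. (cosh u - y j) / \<bar>y k - y j\<bar>)"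
    proof (rule prod_mono, safe)
      fix j assume j: "j \<le> N" "j \<noteq> k"
      have ypos: "\<bar>y k - y j\<bar> > 0" using inj_onD[OF ch(2), of k j] j k by auto
      have "norm (z - x j) \<le> norm (z - e) + norm (x j - e)"
        using norm_triangle_ineq4[of "z - e" "x j - e"] by simp
      also have "\<dots> \<le> s + t j" using z x by simp
      also have "\<dots> = d / 2 * (cosh u - y j)" unfolding cu t_def using assms(4) by (simp add: field_simps)
      finally have "norm (z - x j) / norm (x k - x j) \<le> (d / 2 * (cosh u - y j)) / (d / 2 * \<bar>y k - y j\<bar>)"
        using dist[of k j] ypos assms(4) one[of j] by (intro frac_le) (auto intro!: mult_nonneg_nonneg)
      thus "norm ((z - x j) / (x k - x j)) \<le> (cosh u - y j) / \<bar>y k - y j\<bar>"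
        using assms(4) by (simp add: norm_divide)
    qed auto
    thus "norm (poly p (x k) * (\<Prod>j\<in>{..N}-{k}. (z - x j) / (x k - x j))) \<le>
        M * (\<Prod>j\<in>{..N}-{k}. (cosh u - y j) / \<bar>y k - y j\<bar>)"
      unfolding norm_mult prod_norm[symmetric] using M x Mpos
      by (intro mult_mono) (auto intro!: prod_nonneg)
  qed
  also have "\<dots> = M * cosh (real N * u)" unfolding sum_distrib_left[symmetric] ch(1) ..
  also have "\<dots> \<le> M * exp (real N * u)"
  proof (intro mult_left_mono Mpos)
    have "exp (- (real N * u)) \<le> exp (real N * u)" using u by simp
    thus "cosh (real N * u) \<le> exp (real N * u)" by (simp add: cosh_field_def)
  qed
  finally show ?thesis by (simp add: u_def)
qed

text \<open>A polynomial is not much smaller than its maximum near a point of \<open>L\<close> where the maximum is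
  attained: on a neighbourhood whose radius does not depend on the polynomial it is at most
  \<open>exp (\<epsilon> N)\<close> times the maximum, so by Cauchy's inequality it stays above half the maximum on a
  disc of radius comparable to \<open>exp (- \<epsilon> N)\<close>. Such a disc has mass at least a constant times
  \<open>exp (- 2 \<epsilon> N)\<close>, so that the \<open>L\<^sup>2\<close> norm controls the maximum up to a factor \<open>exp (\<epsilon> N)\<close>.\<close>

theorem bernstein_markov_connected:
  fixes L :: "complex set" and m :: "complex measure"
  assumes L: "compact L" "connected L" "a0 \<in> L" "b0 \<in> L" "a0 \<noteq> b0"
    and m: "finite_measure m" "sets m = sets borel" "\<And>p. integrable m (\<lambda>z. (norm (poly p z))\<^sup>2)"
    and c: "c > 0" "\<rho>0 > 0" "\<And>z \<rho>. z \<in> L \<Longrightarrow> 0 < \<rho> \<Longrightarrow> \<rho> \<le> \<rho>0 \<Longrightarrow> c * \<rho>\<^sup>2 \<le> measure m (ball z \<rho>)"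
    and eps: "\<epsilon> > 0"
  shows "\<exists>C>0. \<forall>N p z. degree p \<le> N \<longrightarrow> z \<in> L \<longrightarrow>
    norm (poly p z) \<le> C * exp (\<epsilon> * real N) * sqrt (\<integral>z. (norm (poly p z))\<^sup>2 \<partial>m)"
proof -
  interpret finite_measure m by fact
  define d where "d = norm (a0 - b0) / 2"
  have d: "d > 0" using L by (simp add: d_def)
  \<comment> \<open>The radius on which the inequality for connected sets costs exactly \<open>exp
    (\<epsilon> N)\<close>.\<close>
  define s where "s = d * (cosh \<epsilon> - 1) / 2"
  have ch: "cosh \<epsilon> > 1" using cosh_real_strict_mono[of 0 \<epsilon>] eps by simp
  have s: "s > 0" unfolding s_def using d ch by simp
  have arc: "arcosh (1 + 2 * s / d) = \<epsilon>"
    unfolding s_def using d eps by (simp add: arcosh_cosh_real)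
  define r where "r = min \<rho>0 (s / 4)"
  have r: "r > 0" using c s by (simp add: r_def)
  show ?thesis
  proof (intro exI[of _ "2 / (sqrt c * r)"] conjI allI impI)
    show "2 / (sqrt c * r) > 0" using c r by simp
    fix N and p :: "complex poly" and z assume p: "degree p \<le> N" and zL: "z \<in> L"
    have "continuous_on L (\<lambda>z. norm (poly p z))" by (intro continuous_intros)
    then obtain z0 where z0: "z0 \<in> L" and max: "\<And>x. x \<in> L \<Longrightarrow> norm (poly p x) \<le> norm (poly p z0)"
      using continuous_attains_sup[OF L(1)] L(3) by blast
    define M where "M = norm (poly p z0)"
    have M: "M \<ge> 0" by (simp add: M_def)
    obtain b where b: "b \<in> L" "d \<le> norm (b - z0)"
    proof -
      have "norm (a0 - b0) \<le> norm (a0 - z0) + norm (b0 - z0)"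
        using norm_triangle_ineq4[of "a0 - z0" "b0 - z0"] by simp
      hence "d \<le> norm (a0 - z0) \<or> d \<le> norm (b0 - z0)" unfolding d_def by linarith
      thus ?thesis using that L by blast
    qed
    have near: "norm (poly p x) \<le> M * exp (real N * \<epsilon>)" if "norm (x - z0) \<le> s" for x
      using bernstein_walsh_connected[OF L(2) z0 b(1) d b(2) p, of M x s] max that arc
      by (simp add: M_def)
    define \<rho> where "\<rho> = r * exp (- real N * \<epsilon>)"
    have rho: "\<rho> > 0" "\<rho> \<le> \<rho>0" "\<rho> \<le> s / 4"
    proof -
      show "\<rho> > 0" using r by (simp add: \<rho>_def)
      have "\<rho> \<le> r * 1" unfolding \<rho>_def using r eps by (intro mult_left_mono) auto
      thus "\<rho> \<le> \<rho>0" "\<rho> \<le> s / 4" by (auto simp: r_def)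
    qed
    have der: "norm (poly (pderiv p) x) \<le> 2 * M * exp (real N * \<epsilon>) / s" if x: "x \<in> ball z0 (s / 2)" for x
    proof -
      have "norm ((deriv ^^ 1) (poly p) x) \<le> fact 1 * (M * exp (real N * \<epsilon>)) / (s / 2) ^ 1"
      proof (rule Cauchy_inequality)
        fix y assume y: "norm (x - y) = s / 2"
        have "norm (y - z0) \<le> norm (x - y) + norm (x - z0)"
          using norm_triangle_ineq4[of "x - z0" "x - y"] by simp
        thus "norm (poly p y) \<le> M * exp (real N * \<epsilon>)"
          using x y by (intro near) (auto simp: dist_norm norm_minus_commute)
      qed (use s in \<open>auto intro!: holomorphic_intros continuous_intros\<close>)
      moreover have "deriv (poly p) x = poly (pderiv p) x" by (rule DERIV_imp_deriv) (rule poly_DERIV)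
      ultimately show ?thesis by (simp add: field_simps)
    qed
    have low: "norm (poly p x) \<ge> M / 2" if x: "x \<in> ball z0 \<rho>" for x
    proof -
      have "norm (poly p x - poly p z0) \<le> (2 * M * exp (real N * \<epsilon>) / s) * norm (x - z0)"
      proof (rule field_differentiable_bound[of "ball z0 (s/2)" "poly p" "poly (pderiv p)"])
        show "(poly p has_field_derivative poly (pderiv p) w) (at w within ball z0 (s/2))" for w
          using poly_DERIV by (rule has_field_derivative_at_within)
      qed (use der x rho s in auto)
      also have "\<dots> \<le> (2 * M * exp (real N * \<epsilon>) / s) * \<rho>"
        using x M s by (intro mult_left_mono) (auto simp: dist_norm norm_minus_commute)
      also have "\<dots> = 2 * M / s * r" unfolding \<rho>_def by (simp add: exp_minus)
      also have "\<dots> \<le> 2 * M / s * (s / 4)" using M s by (intro mult_left_mono) (auto simp: r_def)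
      also have "\<dots> = M / 2" using s by simp
      finally have "norm (poly p x - poly p z0) \<le> M / 2" .
      moreover have "M \<le> norm (poly p x) + norm (poly p x - poly p z0)"
        unfolding M_def using norm_triangle_ineq4[of "poly p x" "poly p x - poly p z0"] by simp
      ultimately show ?thesis by linarith
    qed
    have bs [simp]: "ball z0 \<rho> \<in> sets m" using m(2) by simp
    have "(M / 2)\<^sup>2 * (c * \<rho>\<^sup>2) \<le> (M / 2)\<^sup>2 * measure m (ball z0 \<rho>)"
      by (intro mult_left_mono c z0 rho) auto
    also have "\<dots> = (\<integral>x. (M / 2)\<^sup>2 * indicator (ball z0 \<rho>) x \<partial>m)" by simp
    also have "\<dots> \<le> (\<integral>z. (norm (poly p z))\<^sup>2 \<partial>m)"
    proof (rule integral_mono)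
      show "integrable m (\<lambda>x. (M / 2)\<^sup>2 * indicator (ball z0 \<rho>) x)"
        by (intro integrable_mult_right integrable_real_indicator) (auto simp: emeasure_eq_measure)
      fix x show "(M / 2)\<^sup>2 * indicator (ball z0 \<rho>) x \<le> (norm (poly p x))\<^sup>2"
        using low[of x] M by (auto intro!: power_mono split: split_indicator)
    qed (rule m(3))
    finally have "(M / 2)\<^sup>2 * (c * \<rho>\<^sup>2) \<le> (\<integral>z. (norm (poly p z))\<^sup>2 \<partial>m)" .
    moreover have "(M / 2 * (sqrt c * \<rho>))\<^sup>2 = (M / 2)\<^sup>2 * ((sqrt c)\<^sup>2 * \<rho>\<^sup>2)"
      by (simp only: power_mult_distrib)
    moreover have "(sqrt c)\<^sup>2 = c" using c(1) by simp
    ultimately have "(M / 2 * (sqrt c * \<rho>))\<^sup>2 \<le> (\<integral>z. (norm (poly p z))\<^sup>2 \<partial>m)" by presburger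
    hence "M / 2 * (sqrt c * \<rho>) \<le> sqrt (\<integral>z. (norm (poly p z))\<^sup>2 \<partial>m)" by (rule real_le_rsqrt)
    hence "M * (sqrt c * \<rho> / 2) \<le> sqrt (\<integral>z. (norm (poly p z))\<^sup>2 \<partial>m)" by (simp only: mult_ac times_divide_eq_left times_divide_eq_right)
    moreover have "sqrt c * \<rho> / 2 > 0" using c rho by simp
    ultimately have "M \<le> sqrt (\<integral>z. (norm (poly p z))\<^sup>2 \<partial>m) / (sqrt c * \<rho> / 2)"
      by (simp only: pos_le_divide_eq)
    also have "\<dots> = 2 / (sqrt c * r) * (1 / exp (- real N * \<epsilon>)) * sqrt (\<integral>z. (norm (poly p z))\<^sup>2 \<partial>m)"
      unfolding \<rho>_def by (simp add: mult_ac)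
    also have "1 / exp (- real N * \<epsilon>) = exp (\<epsilon> * real N)" by (simp add: exp_minus mult.commute inverse_eq_divide)
    finally show "norm (poly p z) \<le> 2 / (sqrt c * r) * exp (\<epsilon> * real N) * sqrt (\<integral>z. (norm (poly p z))\<^sup>2 \<partial>m)"
      using max[OF zL] by (simp add: M_def)
  qed
qed

section \<open>The exterior Riemann map and the Green function\<close>

lemma riemann_sum_bound:
  fixes f :: "real \<Rightarrow> real"
  assumes n: "n > 0" and cont: "continuous_on {0..1} f"
    and osc: "\<And>s t. s \<in> {0..1} \<Longrightarrow> t \<in> {0..1} \<Longrightarrow> \<bar>s - t\<bar> \<le> 1 / real n \<Longrightarrow> \<bar>f s - f t\<bar> \<le> \<epsilon>"
  shows "\<bar>(\<Sum>k<n. f (real k / real n)) / real n - integral {0..1} f\<bar> \<le> \<epsilon>"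
proof -
  have "\<bar>(\<Sum>k<m. f (real k / real n)) / real n - integral {0..real m / real n} f\<bar> \<le> real m * \<epsilon> / real n"
    if "m \<le> n" for m using that
  proof (induction m)
    case (Suc m)
    let ?a = "real m / real n" and ?b = "real (Suc m) / real n"
    have ab: "0 \<le> ?a" "?a \<le> ?b" "?b \<le> 1" "?b - ?a = 1 / real n" using Suc n by (auto simp: field_simps)
    have int: "f integrable_on {0..?b}" "f integrable_on {?a..?b}"
      using order_trans[OF ab(1)] order_trans[OF _ ab(3)]
      by (auto intro!: integrable_continuous_real continuous_on_subset[OF cont] simp del: of_nat_Suc)
    have split: "integral {0..?a} f + integral {?a..?b} f = integral {0..?b} f"
      by (rule Henstock_Kurzweil_Integration.integral_combine) (use ab int in auto)
    have "\<bar>integral {?a..?b} (\<lambda>t. f t - f ?a)\<bar> \<le> \<epsilon> * (?b - ?a)"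
    proof -
      have "norm (integral {?a..?b} (\<lambda>t. f t - f ?a)) \<le> \<epsilon> * (?b - ?a)"
      proof (rule integral_bound)
        show "continuous_on {?a..?b} (\<lambda>t. f t - f ?a)"
          using ab by (intro continuous_intros continuous_on_subset[OF cont]) auto
        fix t assume "t \<in> {?a..?b}"
        thus "norm (f t - f ?a) \<le> \<epsilon>" using osc[of t ?a] ab by auto
      qed (use ab in auto)
      thus ?thesis by simp
    qed
    moreover have "integral {?a..?b} (\<lambda>t. f t - f ?a) = integral {?a..?b} f - f ?a / real n"
      using ab int by (subst Henstock_Kurzweil_Integration.integral_diff) auto
    ultimately have "\<bar>f ?a / real n - integral {?a..?b} f\<bar> \<le> \<epsilon> / real n" using ab by simp
    moreover have "\<bar>(\<Sum>k<m. f (real k / real n)) / real n - integral {0..?a} f\<bar> \<le> real m * \<epsilon> / real n"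
      using Suc by simp
    moreover have "real (Suc m) * \<epsilon> / real n = real m * \<epsilon> / real n + \<epsilon> / real n" 
      using n by (simp add: field_simps)
    moreover have "(\<Sum>k<Suc m. f (real k / real n)) / real n = (\<Sum>k<m. f (real k / real n)) / real n + f ?a / real n"
      by (simp add: add_divide_distrib)
    ultimately show ?case using split by linarith
  qed auto
  from this[of n] n show ?thesis by simp
qed

text \<open>The exterior Riemann map of a compact set \<open>K\<close> in the chart at infinity
  \<open>u = 1 / (z - a)\<close>: \<open>D\<close> is the exterior domain with infinity as the
  point \<open>0\<close>, and \<open>H\<close>, \<open>h\<close> are inverse to each other between
  the unit disc and \<open>D\<close>.\<close>

locale exterior_map =
  fixes K :: "complex set" and a :: complex and H h :: "complex \<Rightarrow> complex" and D :: "complex set"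
  defines "D \<equiv> insert 0 ((\<lambda>z. 1 / (z - a)) ` (- K))"
  assumes compact_K: "compact K" and a_int: "a \<in> interior K"
    and holo_H: "H holomorphic_on ball 0 1" and H_0: "H 0 = 0"
    and cont_h: "continuous_on D h"
    and H_in: "\<And>w. w \<in> ball 0 1 \<Longrightarrow> H w \<in> D" and h_H: "\<And>w. w \<in> ball 0 1 \<Longrightarrow> h (H w) = w"
    and h_in: "\<And>u. u \<in> D \<Longrightarrow> h u \<in> ball 0 1" and H_h: "\<And>u. u \<in> D \<Longrightarrow> H (h u) = u"
begin

lemma a_in: "a \<in> K" using a_int interior_subset by blast

text \<open>The exterior map in the original coordinate, with its pole at \<open>0\<close>, and
  its inverse. In terms of \<open>|\<phi>|\<close> the unit circle corresponds to the boundary of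
  \<open>K\<close> and the origin to infinity, so \<open>- ln |\<phi>|\<close> is the Green
  function with pole at infinity.\<close>

definition \<psi> :: "complex \<Rightarrow> complex" where "\<psi> w = a + 1 / H w"
definition \<phi> :: "complex \<Rightarrow> complex" where "\<phi> z = h (1 / (z - a))"
definition green :: "complex \<Rightarrow> real" where "green z = (if z \<in> K then 0 else - ln (norm (\<phi> z)))"

text \<open>\<open>\<psi> w\<close> behaves like \<open>1 / (H'(0) w)\<close> at the origin, so
  \<open>1 / |H'(0)|\<close> is the capacity of \<open>K\<close>.\<close>

definition log_capacity :: real where "log_capacity = - ln (norm (deriv H 0))"

lemma inj_H: "inj_on H (ball 0 1)"
  by (rule inj_on_inverseI[of _ h]) (rule h_H)

lemma deriv_H_nz: "w \<in> ball 0 1 \<Longrightarrow> deriv H w \<noteq> 0"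
  using holomorphic_injective_imp_regular[OF holo_H open_ball inj_H] .

lemma H_nz: "w \<in> ball 0 1 \<Longrightarrow> w \<noteq> 0 \<Longrightarrow> H w \<noteq> 0"
  using inj_onD[OF inj_H, of w 0] H_0 by auto

lemma inv_in_D: "z \<notin> K \<Longrightarrow> 1 / (z - a) \<in> D"
  by (auto simp: D_def)

lemma \<phi>_less: "z \<notin> K \<Longrightarrow> norm (\<phi> z) < 1"
  using h_in[OF inv_in_D] by (simp add: \<phi>_def)

lemma \<phi>_nz: "z \<notin> K \<Longrightarrow> \<phi> z \<noteq> 0"
proof
  assume z: "z \<notin> K" "\<phi> z = 0"
  hence "H (\<phi> z) = 1 / (z - a)" unfolding \<phi>_def by (intro H_h inv_in_D)
  hence "z = a" using z H_0 by simp
  thus False using z a_in by simp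
qed

lemma \<psi>_\<phi>: "z \<notin> K \<Longrightarrow> \<psi> (\<phi> z) = z"
  using H_h[OF inv_in_D] by (simp add: \<phi>_def \<psi>_def)

lemma \<psi>_notin: assumes "w \<in> ball 0 1" "w \<noteq> 0" shows "\<psi> w \<notin> K" "\<phi> (\<psi> w) = w"
proof -
  have "H w \<in> D" "H w \<noteq> 0" using H_in H_nz assms by auto
  then obtain z where "z \<notin> K" "H w = 1 / (z - a)" by (auto simp: D_def)
  thus "\<psi> w \<notin> K" by (auto simp: \<psi>_def)
  show "\<phi> (\<psi> w) = w" using h_H[OF assms(1)] by (simp add: \<phi>_def \<psi>_def)
qed

lemma green_nonneg: "green z \<ge> 0"
  using \<phi>_less[of z] \<phi>_nz[of z] by (auto simp: green_def ln_le_zero_iff)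

lemma continuous_on_\<psi>: "continuous_on (ball 0 1 - {0}) \<psi>"
  unfolding \<psi>_def using H_nz
  by (auto intro!: continuous_intros continuous_on_subset[OF holomorphic_on_imp_continuous_on[OF holo_H]])

text \<open>The holomorphic extension of \<open>H w / w\<close>; multiplication by
  \<open>w\<close> removes the pole of \<open>\<psi>\<close>.\<close>

definition H1 :: "complex \<Rightarrow> complex" where
  "H1 w = (if w = 0 then deriv H 0 else (H w - H 0) / (w - 0))"

lemma H1: "H1 holomorphic_on ball 0 1" "\<And>w. w \<in> ball 0 1 \<Longrightarrow> H1 w \<noteq> 0"
   "H1 0 = deriv H 0" "\<And>w. w \<noteq> 0 \<Longrightarrow> H1 w = H w / w"
  unfolding H1_def using pole_lemma_open[OF holo_H open_ball, of 0] deriv_H_nz[of 0] H_nz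
  by (auto simp: H_0)

lemma circle_in: assumes "0 < r" "r < 1" shows "of_real r * ucirc t \<in> ball 0 1" "of_real r * ucirc t \<noteq> 0"
  using assms by (auto simp: norm_mult)

lemma continuous_\<psi>_circle:
  assumes "0 < r" "r < 1"
  shows "continuous_on S (\<lambda>t. \<psi> (of_real r * ucirc t))"
  by (rule continuous_on_compose2[OF continuous_on_\<psi>])
     (use circle_in[OF assms] in \<open>auto intro!: continuous_intros\<close>)

text \<open>The potential of the harmonic measure of a level curve of the Green function. The
  function \<open>w (z - \<psi> w)\<close> is holomorphic in the disc, has the value \<open>- 1 /
  H'(0)\<close> at the origin and can vanish only at \<open>\<phi> z\<close>; Jensen's formula
  takes account of that zero if it lies inside the circle.\<close>

lemma circle_mean_ln_\<psi>:
  assumes r: "0 < r" "r < 1"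
  shows "integrable unif01 (\<lambda>t. ln (norm (z - \<psi> (of_real r * ucirc t)))) \<and>
    integral\<^sup>L unif01 (\<lambda>t. ln (norm (z - \<psi> (of_real r * ucirc t)))) = log_capacity + max (green z) (- ln r)"
proof -
  interpret prob_space unif01 by (rule prob_space_unif01)
  define F where "F = (\<lambda>w. w * (z - a) - 1 / H1 w)"
  have hol_F: "F holomorphic_on ball 0 1" unfolding F_def by (intro holomorphic_intros H1)
  have F0: "F 0 = - 1 / deriv H 0" by (simp add: F_def H1)
  have F: "F w = w * (z - \<psi> w)" if "w \<noteq> 0" "w \<in> ball 0 1" for w
    using that H_nz by (simp add: F_def H1 \<psi>_def field_simps)
  have F_eq: "F w = 0 \<longleftrightarrow> z \<notin> K \<and> w = \<phi> z" if "w \<in> ball 0 1" for w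
    using that F[of w] F0 deriv_H_nz[of 0] \<psi>_notin[of w] \<psi>_\<phi>[of z] \<phi>_nz[of z]
    by (cases "w = 0") auto
  have lnF0: "ln (norm (F 0)) = log_capacity"
    using deriv_H_nz[of 0] by (simp add: F0 log_capacity_def norm_divide ln_div)
  let ?c = "\<lambda>t. of_real r * ucirc t"
  have lnF: "ln (norm (z - \<psi> (?c t))) = ln (norm (F (?c t))) - ln r" if "F (?c t) \<noteq> 0" for t
    using that r F[of "?c t"] circle_in[OF r, of t] by (simp add: norm_mult ln_mult)
  have meas: "(\<lambda>t. ln (norm (z - \<psi> (?c t)))) \<in> borel_measurable borel"
    using borel_measurable_continuous_onI[OF continuous_\<psi>_circle[OF r]] by measurable
  show ?thesis
  proof (cases "z \<in> K")
    case True
    have "integrable unif01 (\<lambda>t. ln (norm (F (?c t)))) \<and> integral\<^sup>L unif01 (\<lambda>t. ln (norm (F (?c t)))) = log_capacity"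
      using circle_mean_ln_norm[OF hol_F r] F_eq True lnF0 by auto
    moreover have "ln (norm (z - \<psi> (?c t))) = ln (norm (F (?c t))) - ln r" for t
      using lnF F_eq circle_in[OF r] True by auto
    moreover have "max (green z) (- ln r) = - ln r" using True r by (simp add: green_def)
    ultimately show ?thesis by (simp add: prob_space[simplified])
  next
    case False
    define w0 where "w0 = \<phi> z"
    have w0: "w0 \<in> ball 0 1" "w0 \<noteq> 0" "F w0 = 0"
      using \<phi>_less[OF False] \<phi>_nz[OF False] F_eq False by (auto simp: w0_def)
    define F1 where "F1 = (\<lambda>w. if w = w0 then deriv F w0 else (F w - F w0) / (w - w0))"
    have hol_F1: "F1 holomorphic_on ball 0 1" unfolding F1_def by (rule pole_lemma_open[OF hol_F open_ball])
    have dF: "deriv F w0 \<noteq> 0"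
    proof -
      have ev: "\<forall>\<^sub>F w in nhds w0. w \<in> ball 0 1 - {0}"
        by (rule eventually_nhds_in_open) (use w0 in auto)
      have "deriv F w0 = deriv (\<lambda>w. w * (z - a) - w / H w) w0"
        by (rule deriv_cong_ev) (use ev H_nz in \<open>auto elim!: eventually_mono simp: F_def H1\<close>)
      also have "\<dots> = (z - a) - (H w0 - w0 * deriv H w0) / (H w0)\<^sup>2"
      proof (rule DERIV_imp_deriv)
        have dH: "(H has_field_derivative deriv H w0) (at w0)"
          using holo_H w0 by (intro holomorphic_derivI[of _ "ball 0 1"]) auto
        show "((\<lambda>w. w * (z - a) - w / H w) has_field_derivative
            (z - a) - (H w0 - w0 * deriv H w0) / (H w0)\<^sup>2) (at w0)"
          using H_nz[OF w0(1,2)] by (auto intro!: derivative_eq_intros dH simp: power2_eq_square)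
      qed
      also have "z - a = 1 / H w0" using H_h[OF inv_in_D[OF False]] by (simp add: w0_def \<phi>_def)
      also have "1 / H w0 - (H w0 - w0 * deriv H w0) / (H w0)\<^sup>2 = w0 * deriv H w0 / (H w0)\<^sup>2"
        using H_nz[OF w0(1,2)] by (simp add: field_simps power2_eq_square)
      finally show ?thesis using H_nz[OF w0(1,2)] deriv_H_nz[OF w0(1)] w0 by simp
    qed
    have F1_nz: "F1 w \<noteq> 0" if "w \<in> ball 0 1" for w
      using that F_eq[of w] dF w0 by (auto simp: F1_def w0_def)
    have F1_0: "ln (norm (F1 0)) = log_capacity - ln (norm w0)"
      using w0 lnF0 deriv_H_nz[of 0] by (simp add: F1_def norm_divide ln_div F0 norm_mult ln_mult)
    have i1: "integrable unif01 (\<lambda>t. ln (norm (F1 (?c t))))"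
      "integral\<^sup>L unif01 (\<lambda>t. ln (norm (F1 (?c t)))) = log_capacity - ln (norm w0)"
      using circle_mean_ln_norm[OF hol_F1 r F1_nz] F1_0 by auto
    have i2: "integrable unif01 (\<lambda>t. ln (norm (?c t - w0)))"
      "integral\<^sup>L unif01 (\<lambda>t. ln (norm (?c t - w0))) = ln (max r (norm w0))"
      using circle_mean_ln_dist[OF r(1), of w0] by auto
    have ae: "AE t in unif01. ln (norm (z - \<psi> (?c t))) = ln (norm (?c t - w0)) + ln (norm (F1 (?c t))) - ln r"
      using AE_unif01_countable[OF countable_ucirc_vimage[OF r(1), of w0]]
    proof eventually_elim
      case (elim t)
      hence ne: "?c t \<noteq> w0" by simp
      hence "F (?c t) \<noteq> 0" using F_eq circle_in[OF r] by (auto simp: w0_def)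
      moreover have "F (?c t) = (?c t - w0) * F1 (?c t)" using ne w0 by (simp add: F1_def)
      ultimately show ?case using lnF[of t] by (simp add: norm_mult ln_mult)
    qed
    have "integrable unif01 (\<lambda>t. ln (norm (?c t - w0)) + ln (norm (F1 (?c t))) - ln r)"
      using i1 i2 by (intro Bochner_Integration.integrable_diff Bochner_Integration.integrable_add) auto
    moreover have "integral\<^sup>L unif01 (\<lambda>t. ln (norm (?c t - w0)) + ln (norm (F1 (?c t))) - ln r)
        = ln (max r (norm w0)) + (log_capacity - ln (norm w0)) - ln r"
      using i1 i2 by (simp add: prob_space[simplified])
    moreover have "ln (max r (norm w0)) + (log_capacity - ln (norm w0)) - ln r = log_capacity + max (green z) (- ln r)"
      using r w0 False by (auto simp: green_def w0_def max_def)
    moreover have "(\<lambda>t. ln (norm (?c t - w0)) + ln (norm (F1 (?c t))) - ln r) \<in> borel_measurable unif01"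
      using calculation(1) by (rule borel_measurable_integrable)
    ultimately show ?thesis
      using ae meas integrable_cong_AE[OF _ _ ae] integral_cong_AE[OF _ _ ae] by simp
  qed
qed

lemma green_eq_0_iff: "green z = 0 \<longleftrightarrow> z \<in> K"
proof (cases "z \<in> K")
  case False
  have "ln (norm (\<phi> z)) < 0" using \<phi>_less[OF False] \<phi>_nz[OF False] by simp
  thus ?thesis using False by (simp add: green_def)
qed (simp add: green_def)

lemma closed_green_ge:
  assumes "\<epsilon> > 0" shows "closed {z. green z \<ge> \<epsilon>}"
proof -
  define \<rho> where "\<rho> = exp (- \<epsilon>)"
  have rho: "0 < \<rho>" "\<rho> < 1" using assms by (auto simp: \<rho>_def)
  define C where "C = H ` cball 0 \<rho>"
  have sub: "cball 0 \<rho> \<subseteq> (ball 0 1 :: complex set)" using rho by auto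
  have cC: "compact C" unfolding C_def
    by (intro compact_continuous_image continuous_on_subset[OF holomorphic_on_imp_continuous_on[OF holo_H] sub]) auto
  have CD: "C \<subseteq> D" using H_in sub by (auto simp: C_def)
  obtain B where B: "B > 0" "\<And>u. u \<in> C \<Longrightarrow> norm u \<le> B"
    using compact_imp_bounded[OF cC] bounded_pos by metis
  have "{z. green z \<ge> \<epsilon>} = {z. norm (z - a) \<ge> 1 / B} \<inter> (\<lambda>z. 1 / (z - a)) -` C"
  proof (intro equalityI subsetI)
    fix z assume "z \<in> {z. green z \<ge> \<epsilon>}"
    hence g: "green z \<ge> \<epsilon>" by simp
    hence z: "z \<notin> K" using assms green_eq_0_iff[of z] by auto
    have "ln (norm (\<phi> z)) \<le> - \<epsilon>" using g z by (simp add: green_def)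
    hence "norm (\<phi> z) \<le> \<rho>" unfolding \<rho>_def using \<phi>_nz[OF z] ln_ge_iff
      by (metis exp_le_cancel_iff exp_ln zero_less_norm_iff)
    moreover have "1 / (z - a) = H (\<phi> z)" using H_h[OF inv_in_D[OF z]] by (simp add: \<phi>_def)
    ultimately have in_C: "1 / (z - a) \<in> C" unfolding C_def by auto
    have "z \<noteq> a" using z a_in by auto
    hence "norm (z - a) \<ge> 1 / B" using B(2)[OF in_C] B(1) by (simp add: norm_divide field_simps)
    thus "z \<in> {z. norm (z - a) \<ge> 1 / B} \<inter> (\<lambda>z. 1 / (z - a)) -` C" using in_C by simp
  next
    fix z assume z: "z \<in> {z. norm (z - a) \<ge> 1 / B} \<inter> (\<lambda>z. 1 / (z - a)) -` C"
    hence in_C: "1 / (z - a) \<in> C" and "norm (z - a) \<ge> 1 / B" by auto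
    hence za: "z \<noteq> a" using B(1) by auto
    have "1 / (z - a) \<in> D" using in_C CD by blast
    hence zK: "z \<notin> K" using za unfolding D_def by auto
    obtain w where w: "w \<in> cball 0 \<rho>" "1 / (z - a) = H w" using in_C by (auto simp: C_def)
    have "\<phi> z = w" unfolding \<phi>_def w using w sub by (intro h_H) auto
    hence "norm (\<phi> z) \<le> \<rho>" using w by simp
    hence "ln (norm (\<phi> z)) \<le> ln \<rho>" using \<phi>_nz[OF zK] rho by (intro ln_mono) auto
    thus "z \<in> {z. green z \<ge> \<epsilon>}" using zK by (simp add: green_def \<rho>_def)
  qed
  moreover have "closed ({z. norm (z - a) \<ge> 1 / B} \<inter> (\<lambda>z. 1 / (z - a)) -` C)"
  proof (rule continuous_closed_preimage)
    show "continuous_on {z. norm (z - a) \<ge> 1 / B} (\<lambda>z. 1 / (z - a))"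
      using B(1) by (intro continuous_intros) (auto simp: field_simps)
    show "closed {z. norm (z - a) \<ge> 1 / B}"
      by (intro closed_Collect_le continuous_intros)
  qed (rule compact_imp_closed[OF cC])
  ultimately show ?thesis by simp
qed

lemma continuous_green: "continuous_on UNIV green"
proof -
  have "isCont green z" for z
  proof (cases "z \<in> K")
    case True
    have "\<forall>\<^sub>F x in at z. dist (green x) (green z) < \<epsilon>" if "\<epsilon> > 0" for \<epsilon>
    proof -
      have "open {z. green z < \<epsilon>}"
        using closed_green_ge[OF that] by (simp add: closed_def Compl_eq not_le Collect_neg_eq[symmetric])
      moreover have "z \<in> {z. green z < \<epsilon>}" using True that by (simp add: green_def)
      ultimately have "\<forall>\<^sub>F x in nhds z. x \<in> {z. green z < \<epsilon>}" by (rule eventually_nhds_in_open)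
      hence "\<forall>\<^sub>F x in at z. x \<in> {z. green z < \<epsilon>}" unfolding eventually_at_filter by (rule eventually_mono) auto
      thus ?thesis
      proof eventually_elim
        case (elim x)
        thus ?case using True green_nonneg[of x] by (simp add: green_def[of z] dist_real_def)
      qed
    qed
    thus ?thesis unfolding isCont_def tendsto_iff by blast
  next
    case False
    have op: "open (- K)" using compact_imp_closed[OF compact_K] by (simp add: open_Compl)
    have "continuous_on (- K) (\<lambda>z. 1 / (z - a))" using a_in by (intro continuous_intros) auto
    hence "continuous_on (- K) \<phi>" unfolding \<phi>_def
      by (rule continuous_on_compose2[OF cont_h]) (use inv_in_D in auto)
    hence "continuous_on (- K) (\<lambda>z. - ln (norm (\<phi> z)))"
      using \<phi>_nz by (intro continuous_intros) auto
    hence "continuous_on (- K) green" by (rule continuous_on_eq) (auto simp: green_def)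
    thus ?thesis using continuous_on_interior[of "- K" green z] False op interior_open by auto
  qed
  thus ?thesis by (simp add: continuous_at_imp_continuous_on)
qed

text \<open>Compactness of the complement of \<open>V\<close> on the sphere: its image under the
  inverse map is a compact subset of the open disc.\<close>

lemma \<psi>_near_K:
  assumes V: "open V" "K \<subseteq> V"
  obtains \<rho>0 where "0 < \<rho>0" "\<rho>0 < 1" "\<And>w::complex. \<rho>0 < norm w \<Longrightarrow> norm w < 1 \<Longrightarrow> \<psi> w \<in> V"
proof -
  define E where "E = insert 0 ((\<lambda>z. 1 / (z - a)) ` (- V))"
  have ED: "E \<subseteq> D" using V by (auto simp: E_def D_def)
  have "a \<in> V" using V a_in by auto
  then obtain \<delta> where \<delta>: "\<delta> > 0" "ball a \<delta> \<subseteq> V" using V(1) openE by blast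
  have bE: "bounded E"
  proof (rule boundedI[of _ "1 / \<delta>"])
    fix u assume "u \<in> E"
    thus "norm u \<le> 1 / \<delta>" using \<delta> unfolding E_def
      by (auto simp: norm_divide dist_norm norm_minus_commute subset_iff intro!: frac_le) (meson not_le)
  qed
  have compl: "- E = (- {0}) \<inter> (\<lambda>u. a + 1 / u) -` V"
  proof (intro equalityI subsetI)
    fix u assume u: "u \<in> - E"
    hence "u \<noteq> 0" by (auto simp: E_def)
    moreover have "a + 1 / u \<in> V"
    proof (rule ccontr)
      assume "a + 1 / u \<notin> V"
      hence "1 / ((a + 1 / u) - a) \<in> E" unfolding E_def by blast
      thus False using u by simp
    qed
    ultimately show "u \<in> (- {0}) \<inter> (\<lambda>u. a + 1 / u) -` V" by simp
  qed (auto simp: E_def)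
  have "open (- E)" unfolding compl
    by (rule continuous_open_preimage) (auto intro!: continuous_intros V)
  hence "compact E" using bE by (simp add: compact_eq_bounded_closed closed_def)
  hence "compact (h ` E)" by (intro compact_continuous_image continuous_on_subset[OF cont_h ED])
  hence "compact ((\<lambda>u. norm (h u)) ` E)"
    using compact_continuous_image[of "h ` E" norm] by (simp add: image_image continuous_on_norm_id)
  moreover have "(\<lambda>u. norm (h u)) ` E \<noteq> {}" by (auto simp: E_def)
  ultimately obtain u0 where u0: "u0 \<in> E" "\<And>u. u \<in> E \<Longrightarrow> norm (h u) \<le> norm (h u0)"
    using compact_attains_sup[of "(\<lambda>u. norm (h u)) ` E"] by auto
  have lt: "norm (h u0) < 1" using h_in[of u0] u0 ED by auto
  show ?thesis
  proof (rule that[of "max (1/2) (norm (h u0))"])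
    fix w :: complex assume w: "max (1/2) (norm (h u0)) < norm w" "norm w < 1"
    hence wb: "w \<in> ball 0 1" "w \<noteq> 0" by auto
    show "\<psi> w \<in> V"
    proof (rule ccontr)
      assume "\<psi> w \<notin> V"
      hence "1 / (\<psi> w - a) \<in> E" by (auto simp: E_def)
      hence "H w \<in> E" by (simp add: \<psi>_def)
      hence "norm (h (H w)) \<le> norm (h u0)" by (rule u0)
      thus False using h_H[OF wb(1)] w by simp
    qed
  qed (use lt in auto)
qed

text \<open>The function \<open>w^N p(\<psi> w)\<close> is holomorphic in the disc because
  \<open>p \<circ> \<psi>\<close> has a pole of order at most \<open>N\<close> at the origin, and
  its modulus near the unit circle is at most \<open>M\<close> up to an arbitrarily small error.
  The maximum principle bounds it at \<open>\<phi> z\<close>.\<close>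

theorem bernstein_walsh:
  assumes p: "degree p \<le> N" and M: "\<And>x. x \<in> K \<Longrightarrow> norm (poly p x) \<le> M"
  shows "norm (poly p z) \<le> M * exp (real N * green z)"
proof (cases "z \<in> K")
  case True thus ?thesis using M by (simp add: green_def)
next
  case False
  define Q where "Q = (\<lambda>w. \<Sum>i\<le>N. coeff p i * (a * w + 1 / H1 w) ^ i * w ^ (N - i))"
  have hol_Q: "Q holomorphic_on ball 0 1" unfolding Q_def by (intro holomorphic_intros H1)
  have Q: "Q w = w ^ N * poly p (\<psi> w)" if w: "w \<in> ball 0 1" "w \<noteq> 0" for w
  proof -
    have "a * w + 1 / H1 w = w * \<psi> w" using w H_nz by (simp add: H1 \<psi>_def field_simps)
    note wpsi = this
    have "Q w = (\<Sum>i\<le>N. w ^ N * (coeff p i * \<psi> w ^ i))"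
      unfolding Q_def
    proof (intro sum.cong refl)
      fix i assume "i \<in> {..N}"
      hence "w ^ N = w ^ i * w ^ (N - i)" by (simp flip: power_add)
      thus "coeff p i * (a * w + 1 / H1 w) ^ i * w ^ (N - i) = w ^ N * (coeff p i * \<psi> w ^ i)"
        unfolding wpsi by (simp only: power_mult_distrib mult_ac)
    qed
    also have "\<dots> = w ^ N * poly p (\<psi> w)"
      unfolding poly_altdef sum_distrib_left using p
      by (intro sum.mono_neutral_right) (auto simp: coeff_eq_0)
    finally show ?thesis .
  qed
  define w0 where "w0 = \<phi> z"
  have w0: "w0 \<in> ball 0 1" "w0 \<noteq> 0" "\<psi> w0 = z"
    using \<phi>_less[OF False] \<phi>_nz[OF False] \<psi>_\<phi>[OF False] by (auto simp: w0_def)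
  have "norm (Q w0) \<le> M + \<eta>" if eta: "\<eta> > 0" for \<eta>
  proof -
    define V where "V = {x. norm (poly p x) < M + \<eta>}"
    have "open V" unfolding V_def by (intro open_Collect_less continuous_intros)
    moreover have "K \<subseteq> V" using M eta by (force simp: V_def)
    ultimately obtain \<rho>0 where r0: "0 < \<rho>0" "\<rho>0 < 1" "\<And>w. \<rho>0 < norm w \<Longrightarrow> norm w < 1 \<Longrightarrow> \<psi> w \<in> V"
      using \<psi>_near_K by metis
    obtain \<rho> where rho: "max \<rho>0 (norm w0) < \<rho>" "\<rho> < 1" using dense[of "max \<rho>0 (norm w0)" 1] r0 w0 by auto
    show ?thesis
    proof (rule maximum_modulus_frontier[of Q "cball 0 \<rho>"])
      show "Q holomorphic_on interior (cball 0 \<rho>)"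
        by (rule holomorphic_on_subset[OF hol_Q]) (use rho in auto)
      show "continuous_on (closure (cball 0 \<rho>)) Q"
        by (rule continuous_on_subset[OF holomorphic_on_imp_continuous_on[OF hol_Q]]) (use rho in auto)
      show "w0 \<in> cball 0 \<rho>" using rho by auto
      fix w :: complex assume "w \<in> frontier (cball 0 \<rho>)"
      hence nw: "norm w = \<rho>" by auto
      hence w: "w \<in> ball 0 1" "w \<noteq> 0" using rho r0 by auto
      have "norm (poly p (\<psi> w)) < M + \<eta>" using r0(3)[of w] nw rho by (simp add: V_def)
      moreover have "norm w ^ N \<le> 1" using nw rho r0 by (intro power_le_one) auto
      ultimately have "norm w ^ N * norm (poly p (\<psi> w)) \<le> 1 * (M + \<eta>)" by (intro mult_mono) auto
      thus "norm (Q w) \<le> M + \<eta>" using Q[OF w] by (simp add: norm_mult norm_power)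
    qed auto
  qed
  hence "norm (Q w0) \<le> M" by (rule field_le_epsilon)
  hence le: "norm w0 ^ N * norm (poly p z) \<le> M" using Q[OF w0(1,2)] w0(3) by (simp add: norm_mult norm_power)
  have "exp (real N * green z) = 1 / norm w0 ^ N"
    using False w0 by (simp add: green_def w0_def[symmetric] exp_minus exp_of_nat_mult inverse_eq_divide power_one_over)
  hence "norm (poly p z) = exp (real N * green z) * (norm w0 ^ N * norm (poly p z))" using w0 by simp
  also have "\<dots> \<le> exp (real N * green z) * M" using le by (intro mult_left_mono) auto
  finally show ?thesis by (simp add: mult.commute)
qed

text \<open>The zeros are the images of \<open>N\<close> equidistant points of a circle of radius
  \<open>r\<close> near \<open>1\<close>. Then \<open>ln |q| / N\<close> is a Riemann sum for the
  potential of the level curve, which is \<open>log_capacity - ln r\<close> on \<open>K\<close>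
  and \<open>log_capacity + green\<close> at a point outside the curve.\<close>

theorem extremal_polynomials:
  assumes z: "z \<notin> K" and eps: "\<epsilon> > 0"
  shows "\<exists>n0. \<forall>N\<ge>n0. \<exists>p. degree p \<le> N \<and> (\<forall>x\<in>K. norm (poly p x) \<le> 1) \<and>
    norm (poly p z) \<ge> exp (real N * (green z - \<epsilon>))"
proof -
  define r where "r = max (exp (- \<epsilon> / 3)) ((1 + norm (\<phi> z)) / 2)"
  have r: "0 < r" "r < 1" "norm (\<phi> z) < r" "- ln r \<le> \<epsilon> / 3"
  proof -
    show r0: "0 < r" by (simp add: r_def less_max_iff_disj)
    show "r < 1" "norm (\<phi> z) < r" using eps \<phi>_less[OF z] by (auto simp: r_def less_max_iff_disj)
    have "ln (exp (- \<epsilon> / 3)) \<le> ln r" by (intro ln_mono) (auto simp: r_def)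
    thus "- ln r \<le> \<epsilon> / 3" by simp
  qed
  let ?c = "\<lambda>t. of_real r * ucirc t"
  define f where "f = (\<lambda>x t. ln (norm (x - \<psi> (?c t))))"
  define X where "X = insert z K"
  have nz: "x \<noteq> \<psi> (?c t)" if "x \<in> X" for x t
  proof
    assume eq: "x = \<psi> (?c t)"
    hence "x = z" using that \<psi>_notin(1)[OF circle_in[OF r(1,2), of t]] by (auto simp: X_def)
    hence "\<phi> z = ?c t" using eq \<psi>_notin(2)[OF circle_in[OF r(1,2), of t]] by simp
    hence "norm (\<phi> z) = r" using r by (simp add: norm_mult)
    thus False using r by simp
  qed
  have contf: "continuous_on (X \<times> {0..1}) (\<lambda>(x, t). f x t)"
    unfolding f_def case_prod_unfold
  proof (intro continuous_intros)
    show "continuous_on (X \<times> {0..1}) (\<lambda>p. \<psi> (?c (snd p)))"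
      by (rule continuous_on_compose2[OF continuous_\<psi>_circle[OF r(1,2)]]) (auto intro: continuous_intros)
  qed (use nz in auto)
  have "uniformly_continuous_on (X \<times> {0..1}) (\<lambda>(x, t). f x t)"
    by (rule compact_uniformly_continuous[OF contf]) (auto simp: X_def compact_K intro!: compact_Times)
  then obtain \<delta> where \<delta>': "\<delta> > 0" "\<And>p q. p \<in> X \<times> {0..1} \<Longrightarrow> q \<in> X \<times> {0..1} \<Longrightarrow> dist q p < \<delta> \<Longrightarrow>
      dist (case q of (x, t) \<Rightarrow> f x t) (case p of (x, t) \<Rightarrow> f x t) < \<epsilon> / 3"
    unfolding uniformly_continuous_on_def using eps by (metis divide_pos_pos zero_less_numeral)
  have \<delta>: "\<delta> > 0" "\<And>x s t. x \<in> X \<Longrightarrow> s \<in> {0..1} \<Longrightarrow> t \<in> {0..1} \<Longrightarrow> \<bar>s - t\<bar> < \<delta> \<Longrightarrow> \<bar>f x s - f x t\<bar> < \<epsilon> / 3"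
  proof -
    fix x s t assume "x \<in> X" "s \<in> {0..1::real}" "t \<in> {0..1::real}" "\<bar>s - t\<bar> < \<delta>"
    thus "\<bar>f x s - f x t\<bar> < \<epsilon> / 3"
      using \<delta>'(2)[of "(x, t)" "(x, s)"] by (simp add: dist_Pair_Pair dist_real_def)
  qed (rule \<delta>'(1))
  obtain n0 :: nat where n0: "n0 > 0" "1 / real n0 < \<delta>" using nat_approx_posE[OF \<delta>(1)]
    by (metis of_nat_Suc zero_less_Suc)
  show ?thesis
  proof (intro exI[of _ n0] allI impI)
    fix N assume N: "N \<ge> n0"
    hence N0: "N > 0" using n0 by simp
    have "1 / real N \<le> 1 / real n0" using N n0 by (intro frac_le) auto
    hence N\<delta>: "1 / real N < \<delta>" using n0 by simp
    have sum: "\<bar>(\<Sum>k<N. f x (real k / real N)) / real N - (log_capacity + max (green x) (- ln r))\<bar> \<le> \<epsilon> / 3" if x: "x \<in> X" for x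
    proof -
      have cont: "continuous_on UNIV (f x)" unfolding f_def
        using continuous_\<psi>_circle[OF r(1,2)] nz[OF x] by (intro continuous_intros) auto
      have "integral {0..1} (f x) = integral\<^sup>L unif01 (f x)"
        by (rule integral_unif01[symmetric]) (use cont in \<open>auto intro: continuous_on_subset borel_measurable_continuous_onI\<close>)
      also have "\<dots> = log_capacity + max (green x) (- ln r)" unfolding f_def using circle_mean_ln_\<psi>[OF r(1,2)] by blast
      finally have "integral {0..1} (f x) = log_capacity + max (green x) (- ln r)" .
      moreover have "\<bar>(\<Sum>k<N. f x (real k / real N)) / real N - integral {0..1} (f x)\<bar> \<le> \<epsilon> / 3"
        by (rule riemann_sum_bound[OF N0]) (use cont \<delta>(2)[OF x] N\<delta> in \<open>force intro: continuous_on_subset\<close>)+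
      ultimately show ?thesis by simp
    qed
    define q where "q = (\<Prod>k<N. [:- \<psi> (?c (real k / real N)), 1:])"
    \<comment> \<open>Normalization: an upper bound for \<open>ln |q| / N\<close> on
      \<open>K\<close>.\<close>
    define b where "b = log_capacity - ln r + \<epsilon> / 3"
    define p where "p = smult (of_real (exp (- real N * b))) q"
    have qx: "norm (poly q x) = exp (\<Sum>k<N. f x (real k / real N))" if "x \<in> X" for x
      unfolding q_def f_def using nz[OF that]
      by (simp add: poly_prod prod_norm[symmetric] exp_sum)
    have px: "norm (poly p x) = exp ((\<Sum>k<N. f x (real k / real N)) - real N * b)" if "x \<in> X" for x
      using qx[OF that] by (simp add: p_def norm_mult norm_divide exp_diff exp_minus field_simps)
    show "\<exists>p. degree p \<le> N \<and> (\<forall>x\<in>K. norm (poly p x) \<le> 1) \<and> norm (poly p z) \<ge> exp (real N * (green z - \<epsilon>))"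
    proof (intro exI[of _ p] conjI ballI)
      have "degree q \<le> (\<Sum>k<N. degree [:- \<psi> (?c (real k / real N)), 1:])"
        unfolding q_def using degree_prod_sum_le[of "{..<N}" "\<lambda>k. [:- \<psi> (?c (real k / real N)), 1:]"]
        by (simp only: comp_def finite_lessThan)
      hence "degree q \<le> N" by simp
      thus "degree p \<le> N" unfolding p_def by (rule order_trans[OF degree_smult_le])
      fix x assume x: "x \<in> K"
      hence xX: "x \<in> X" by (simp add: X_def)
      have "max (green x) (- ln r) = - ln r" using x r by (simp add: green_def)
      hence "(\<Sum>k<N. f x (real k / real N)) / real N \<le> b" using sum[OF xX] unfolding b_def by linarith
      hence "(\<Sum>k<N. f x (real k / real N)) \<le> real N * b" using N0 by (simp add: field_simps)
      thus "norm (poly p x) \<le> 1" using px[OF xX] by simp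
    next
      have zX: "z \<in> X" by (simp add: X_def)
      have "max (green z) (- ln r) \<ge> green z" by simp
      hence "(\<Sum>k<N. f z (real k / real N)) / real N - b \<ge> green z - \<epsilon>"
        using sum[OF zX] r(4) unfolding b_def by linarith
      hence "real N * ((\<Sum>k<N. f z (real k / real N)) / real N - b) \<ge> real N * (green z - \<epsilon>)" by (intro mult_left_mono) auto
      moreover have "real N * ((\<Sum>k<N. f z (real k / real N)) / real N - b) = (\<Sum>k<N. f z (real k / real N)) - real N * b"
        using N0 by (simp add: field_simps)
      ultimately show "norm (poly p z) \<ge> exp (real N * (green z - \<epsilon>))" using px[OF zX] by simp
    qed
  qed
qed

end


text \<open>A connected set that misses the frontier of \<open>\<Omega>\<close> and meets
  \<open>\<Omega>\<close> lies in it, so \<open>\<Omega>\<close> is a union of components of the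
  complement of the curve; being bounded, it is the inside.\<close>

lemma jordan_domain_exterior:
  fixes \<Omega> :: "complex set" and c :: "real \<Rightarrow> complex"
  assumes \<Omega>: "open \<Omega>" "connected \<Omega>" "bounded \<Omega>" "\<Omega> \<noteq> {}"
    and c: "simple_path c" "pathfinish c = pathstart c" "frontier \<Omega> = path_image c"
  shows "connected (- closure \<Omega>)" "\<not> bounded (- closure \<Omega>)"
proof -
  let ?C = "path_image c"
  have dis: "\<Omega> \<inter> ?C = {}" using \<Omega>(1) c(3) by (metis frontier_disjoint_eq inf_commute)
  note J = Jordan_inside_outside[OF c(1,2)]
  have sub: "\<Omega> \<subseteq> inside ?C \<union> outside ?C" using dis inside_Un_outside[of ?C] by auto
  have absorb: "T \<subseteq> \<Omega>" if "connected T" "T \<inter> ?C = {}" "T \<inter> \<Omega> \<noteq> {}" for T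
    using connected_Int_frontier[OF that(1), of \<Omega>] that c(3) by blast
  have no_out: "outside ?C \<inter> \<Omega> = {}"
  proof (rule ccontr)
    assume "outside ?C \<inter> \<Omega> \<noteq> {}"
    hence "outside ?C \<subseteq> \<Omega>" using J outside_no_overlap[of ?C] by (intro absorb) auto
    hence "bounded (outside ?C)" using \<Omega>(3) bounded_subset by blast
    thus False using J by blast
  qed
  hence "\<Omega> \<subseteq> inside ?C" using sub by blast
  moreover have "inside ?C \<subseteq> \<Omega>"
    using J inside_no_overlap[of ?C] calculation \<Omega>(4) by (intro absorb) auto
  ultimately have "\<Omega> = inside ?C" by blast
  hence "closure \<Omega> = inside ?C \<union> ?C" using c(3) closure_Un_frontier by blast
  hence "- closure \<Omega> = outside ?C" using union_with_inside[of ?C] inside_Un_outside[of ?C]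
      inside_Int_outside[of ?C] outside_no_overlap[of ?C] by blast
  thus "connected (- closure \<Omega>)" "\<not> bounded (- closure \<Omega>)" using J by auto
qed

text \<open>Inversion at a point of \<open>\<Omega>\<close> turns the complement of its closure
  into a bounded domain, simply connected because its own complement is connected and unbounded;
  its Riemann map, normalized at the image of infinity, is the exterior map.\<close>

lemma exterior_map_exists:
  fixes \<Omega> :: "complex set"
  assumes \<Omega>: "open \<Omega>" "connected \<Omega>" "bounded \<Omega>" "a \<in> \<Omega>"
    and ext: "connected (- closure \<Omega>)" "\<not> bounded (- closure \<Omega>)"
  shows "\<exists>H h. exterior_map (closure \<Omega>) a H h"
proof -
  define K where "K = closure \<Omega>"
  define D where "D = insert 0 ((\<lambda>z. 1 / (z - a)) ` (- K))"
  have cK: "compact K" using \<Omega>(3) by (simp add: K_def)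
  have aK: "a \<in> K" using \<Omega>(4) closure_subset by (auto simp: K_def)
  obtain \<delta> where \<delta>: "\<delta> > 0" "ball a \<delta> \<subseteq> \<Omega>" using \<Omega>(1,4) openE by blast
  have a_int: "a \<in> interior K" using \<Omega>(1,4) closure_subset[of \<Omega>] interior_maximal[of \<Omega> K] by (auto simp: K_def)
  have mem_D: "u \<in> D \<longleftrightarrow> u = 0 \<or> a + 1 / u \<notin> K" for u
  proof
    assume "u \<in> D" thus "u = 0 \<or> a + 1 / u \<notin> K" by (auto simp: D_def)
  next
    assume u: "u = 0 \<or> a + 1 / u \<notin> K"
    show "u \<in> D"
    proof (cases "u = 0")
      case False
      hence "u = 1 / ((a + 1 / u) - a)" by simp
      moreover have "a + 1 / u \<in> - K" using u False by simp
      ultimately show ?thesis unfolding D_def by blast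
    qed (simp add: D_def)
  qed
  obtain B where B: "B > 0" "\<And>z. z \<in> K \<Longrightarrow> norm z \<le> B" using compact_imp_bounded[OF cK] bounded_pos by metis
  have open_D: "open D"
  proof -
    have "D = (- {0}) \<inter> (\<lambda>u. a + 1 / u) -` (- K) \<union> ball 0 (1 / (B + norm a + 1))"
    proof (intro equalityI subsetI)
      fix u assume u: "u \<in> (- {0}) \<inter> (\<lambda>u. a + 1 / u) -` (- K) \<union> ball 0 (1 / (B + norm a + 1))"
      show "u \<in> D"
      proof (cases "u = 0 \<or> a + 1 / u \<notin> K")
        case False
        hence u': "u \<in> ball 0 (1 / (B + norm a + 1))" and u0: "u \<noteq> 0" and "norm (a + 1 / u) \<le> B"
          using u B by auto
        hence "norm (1 / u) \<le> B + norm a" using norm_triangle_ineq4[of "a + 1 / u" a] by simp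
        hence "1 \<le> norm u * (B + norm a)" using u0 by (simp add: norm_divide field_simps)
        moreover have "norm u * (B + norm a + 1) < 1" using u' B(1) norm_ge_zero[of a]
          by (simp add: field_simps)
        ultimately show ?thesis using norm_ge_zero[of u] by (simp add: algebra_simps)
      qed (simp add: mem_D)
    next
      fix u assume "u \<in> D"
      moreover have "1 / (B + norm a + 1) > 0" using B(1) by (simp add: add_pos_nonneg)
      ultimately show "u \<in> (- {0}) \<inter> (\<lambda>u. a + 1 / u) -` (- K) \<union> ball 0 (1 / (B + norm a + 1))"
        unfolding mem_D by auto
    qed
    moreover have "open ((- {0}) \<inter> (\<lambda>u. a + 1 / u) -` (- K))"
      by (rule continuous_open_preimage)
         (auto intro!: continuous_intros simp: compact_imp_closed[OF cK] open_Compl)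
    ultimately show ?thesis by auto
  qed
  have conn_D: "connected D"
  proof -
    let ?E = "(\<lambda>z. 1 / (z - a)) ` (- K)"
    have "connected ?E"
      using ext(1) aK unfolding K_def[symmetric]
      by (intro connected_continuous_image continuous_intros) auto
    moreover have "0 \<in> closure ?E"
      unfolding closure_approachable
    proof (intro allI impI)
      fix e :: real assume e: "e > 0"
      have "\<not> (\<forall>z\<in>- K. norm z \<le> norm a + 1 / e)"
        using ext(2) unfolding K_def[symmetric] bounded_iff by blast
      then obtain z where z: "z \<notin> K" "norm z > norm a + 1 / e" by (auto simp: not_le)
      have "norm (z - a) \<ge> norm z - norm a" by (rule norm_triangle_ineq2)
      hence ge: "norm (z - a) > 1 / e" using z by linarith
      have "1 / e > 0" using e by simp
      with ge have "norm (z - a) > 0" by linarith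
      hence "norm (1 / (z - a)) < e" using e ge by (simp add: norm_divide field_simps)
      thus "\<exists>y\<in>?E. dist y 0 < e" using z by (auto simp: dist_norm)
    qed
    ultimately show ?thesis
      using connected_intermediate_closure[of ?E D] closure_subset[of ?E] unfolding D_def by blast
  qed
  have compl_D: "- D = (\<lambda>z. 1 / (z - a)) ` (K - {a})"
  proof (intro equalityI subsetI)
    fix u assume "u \<in> - D"
    hence u: "u \<noteq> 0" "a + 1 / u \<in> K" using mem_D by auto
    moreover have "u = 1 / ((a + 1 / u) - a)" using u by simp
    moreover have "a + 1 / u \<noteq> a" using u by simp
    ultimately show "u \<in> (\<lambda>z. 1 / (z - a)) ` (K - {a})" by blast
  next
    fix u assume "u \<in> (\<lambda>z. 1 / (z - a)) ` (K - {a})"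
    thus "u \<in> - D" using mem_D by auto
  qed
  have conn_compl: "connected (- D)"
  proof -
    have "connected (\<Omega> - {a})" by (rule connected_open_delete) (use \<Omega> in auto)
    moreover have "K - {a} \<subseteq> closure (\<Omega> - {a})"
    proof
      fix z assume z: "z \<in> K - {a}"
      have "closure \<Omega> \<subseteq> closure (\<Omega> - {a}) \<union> {a}"
        by (rule closure_minimal) (use closure_subset[of "\<Omega> - {a}"] in auto)
      thus "z \<in> closure (\<Omega> - {a})" using z by (auto simp: K_def)
    qed
    moreover have "\<Omega> - {a} \<subseteq> K - {a}" using closure_subset[of \<Omega>] by (auto simp: K_def)
    ultimately have "connected (K - {a})" using connected_intermediate_closure by blast
    thus ?thesis unfolding compl_D by (intro connected_continuous_image continuous_intros) auto
  qed
  have unb: "\<not> bounded (- D)"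
  proof
    assume "bounded (- D)"
    then obtain M where M: "M > 0" "\<And>u. u \<in> - D \<Longrightarrow> norm u \<le> M" using bounded_pos by metis
    define t where "t = min (\<delta> / 2) (1 / (2 * M))"
    have t: "t > 0" "t < \<delta>" "t \<le> 1 / (2 * M)" using \<delta>(1) M(1) by (auto simp: t_def)
    have "a + of_real t \<in> ball a \<delta>" using t by (simp add: dist_norm)
    hence "a + of_real t \<in> K" using \<delta>(2) closure_subset[of \<Omega>] unfolding K_def by blast
    hence "a + of_real t \<in> K - {a}" using t by simp
    hence "1 / ((a + of_real t) - a) \<in> - D" unfolding compl_D by blast
    from M(2)[OF this] have "1 / t \<le> M" using t by (simp add: norm_divide)
    moreover have "1 / t \<ge> 2 * M" using t M(1) by (simp add: field_simps)
    ultimately show False using M(1) by simp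
  qed
  have sc: "simply_connected D"
    unfolding simply_connected_eq_unbounded_complement_components[OF open_D]
  proof (intro conjI ballI conn_D)
    fix C assume C: "C \<in> components (- D)"
    have "- D \<in> components (- D)" using conn_compl unb by (metis bounded_empty components_eq_sing_iff insertI1)
    hence "C = - D" using C conn_compl by (metis components_eq_sing_iff empty_iff insert_iff components_empty)
    thus "\<not> bounded C" using unb by simp
  qed
  have "D \<noteq> {}" by (simp add: D_def)
  moreover have "D \<noteq> UNIV" using unb by auto
  ultimately obtain f g where fg: "f holomorphic_on D" "g holomorphic_on ball 0 1"
      "\<forall>z\<in>D. f z \<in> ball 0 1 \<and> g (f z) = z" "\<forall>z\<in>ball 0 1. g z \<in> D \<and> f (g z) = z"
    using Riemann_mapping_theorem[of D] open_D sc by metis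
  have D0: "0 \<in> D" by (simp add: D_def)
  have f0: "f 0 \<in> ball 0 1" using bspec[OF fg(3) D0] by blast
  obtain F G where FG: "F (f 0) = 0" "F holomorphic_on ball 0 1" "F ` ball 0 1 \<subseteq> ball 0 1"
      "G holomorphic_on ball 0 1" "G ` ball 0 1 \<subseteq> ball 0 1"
      "\<And>z. z \<in> ball 0 1 \<Longrightarrow> F (G z) = z" "\<And>z. z \<in> ball 0 1 \<Longrightarrow> G (F z) = z"
    using ball_biholomorphism_exists[OF f0] by metis
  have Gb: "G w \<in> ball 0 1" if "w \<in> ball 0 1" for w using FG(5) that by blast
  have Fb: "F w \<in> ball 0 1" if "w \<in> ball 0 1" for w using FG(3) that by blast
  have "exterior_map K a (g \<circ> G) (F \<circ> f)"
  proof (unfold_locales, fold D_def)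
    show "g \<circ> G holomorphic_on ball 0 1" by (rule holomorphic_on_compose_gen[OF FG(4) fg(2) FG(5)])
    have "G 0 = f 0" using FG(1,7) f0 by force
    thus "(g \<circ> G) 0 = 0" using bspec[OF fg(3) D0] by simp
    have "F \<circ> f holomorphic_on D" by (rule holomorphic_on_compose_gen[OF fg(1) FG(2)]) (use fg(3) in blast)
    thus "continuous_on D (F \<circ> f)" by (rule holomorphic_on_imp_continuous_on)
    fix w :: complex assume w: "w \<in> ball 0 1"
    show "(g \<circ> G) w \<in> D" "(F \<circ> f) ((g \<circ> G) w) = w" using bspec[OF fg(4) Gb[OF w]] FG(6)[OF w] by auto
  next
    fix u assume u: "u \<in> D"
    show "(F \<circ> f) u \<in> ball 0 1" "(g \<circ> G) ((F \<circ> f) u) = u"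
      using bspec[OF fg(3) u] Fb[of "f u"] FG(7)[of "f u"] by auto
  qed (rule cK, rule a_int)
  thus ?thesis unfolding K_def by blast
qed

section \<open>Convolution with planar Gaussians\<close>

text \<open>Identifies planar Lebesgue measure with the product of two linear ones, for Gaussian
  integrals in the plane.\<close>

lemma lborel_complex:
  "distr (lborel \<Otimes>\<^sub>M lborel) borel (\<lambda>(x, y). Complex x y) = (lborel :: complex measure)"
proof (rule lborel_eqI[symmetric])
  have [measurable]: "(\<lambda>(x, y). Complex x y) \<in> borel \<Otimes>\<^sub>M borel \<rightarrow>\<^sub>M borel"
    unfolding borel_prod
    by (intro borel_measurable_continuous_onI) (auto simp: case_prod_unfold Complex_eq intro!: continuous_intros)
  fix l u :: complex assume le: "\<And>b. b \<in> Basis \<Longrightarrow> l \<bullet> b \<le> u \<bullet> b"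
  have lu: "Re l \<le> Re u" "Im l \<le> Im u" using le[of 1] le[of \<i>] by (auto simp: Basis_complex_def)
  have "emeasure (distr (lborel \<Otimes>\<^sub>M lborel) borel (\<lambda>(x, y). Complex x y)) (box l u) =
      emeasure (lborel \<Otimes>\<^sub>M lborel) ((\<lambda>(x, y). Complex x y) -` box l u \<inter> space (lborel \<Otimes>\<^sub>M lborel))"
    by (rule emeasure_distr) auto
  also have "(\<lambda>(x, y). Complex x y) -` box l u \<inter> space (lborel \<Otimes>\<^sub>M lborel) = {Re l<..<Re u} \<times> {Im l<..<Im u}"
    by (auto simp: in_box_complex_iff space_pair_measure)
  also have "emeasure (lborel \<Otimes>\<^sub>M lborel) \<dots> = emeasure lborel {Re l<..<Re u} * emeasure lborel {Im l<..<Im u}"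
    by (rule lborel.emeasure_pair_measure_Times) auto
  also have "\<dots> = ennreal (\<Prod>b\<in>Basis. (u - l) \<bullet> b)"
    using lu by (simp add: Basis_complex_def ennreal_mult)
  finally show "emeasure (distr (lborel \<Otimes>\<^sub>M lborel) borel (\<lambda>(x, y). Complex x y)) (box l u) =
      ennreal (\<Prod>b\<in>Basis. (u - l) \<bullet> b)" .
qed simp

lemma nn_integral_gaussian_real:
  assumes "s > 0" shows "(\<integral>\<^sup>+x. ennreal (exp (- s * x\<^sup>2)) \<partial>lborel) = ennreal (sqrt (pi / s))"
proof -
  define \<sigma> where "\<sigma> = 1 / sqrt (2 * s)"
  have sg: "\<sigma> > 0" "\<sigma>\<^sup>2 = 1 / (2 * s)" using assms by (auto simp: \<sigma>_def power_divide)
  have nd: "ennreal (exp (- s * x\<^sup>2)) = ennreal (sqrt (pi / s)) * ennreal (normal_density 0 \<sigma> x)" for x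
    unfolding normal_density_def sg(2) using assms
    by (subst ennreal_mult[symmetric]) (auto simp: real_sqrt_divide field_simps)
  have "(\<integral>\<^sup>+x. ennreal (normal_density 0 \<sigma> x) \<partial>lborel) = 1"
    using prob_space.emeasure_space_1[OF prob_space_normal_density[OF sg(1)]]
    by (simp add: emeasure_density)
  thus ?thesis unfolding nd by (subst nn_integral_cmult) auto
qed

lemma nn_integral_gaussian:
  assumes "s > 0"
  shows "(\<integral>\<^sup>+z. ennreal (exp (- s * (norm z)\<^sup>2)) \<partial>(lborel :: complex measure)) = ennreal (pi / s)"
proof -
  have [measurable]: "(\<lambda>(x, y). Complex x y) \<in> borel \<Otimes>\<^sub>M borel \<rightarrow>\<^sub>M borel"
    unfolding borel_prod
    by (intro borel_measurable_continuous_onI) (auto simp: case_prod_unfold Complex_eq intro!: continuous_intros)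
  have "(\<integral>\<^sup>+z. ennreal (exp (- s * (norm z)\<^sup>2)) \<partial>(lborel :: complex measure)) =
      (\<integral>\<^sup>+p. ennreal (exp (- s * (norm (case p of (x, y) \<Rightarrow> Complex x y))\<^sup>2)) \<partial>(lborel \<Otimes>\<^sub>M lborel))"
    by (subst lborel_complex[symmetric]) (subst nn_integral_distr, auto)
  also have "\<dots> = (\<integral>\<^sup>+p. ennreal (exp (- s * (fst p)\<^sup>2)) * ennreal (exp (- s * (snd p)\<^sup>2)) \<partial>(lborel \<Otimes>\<^sub>M lborel))"
    by (intro nn_integral_cong)
       (auto simp: case_prod_unfold cmod_power2 ennreal_mult[symmetric] exp_add[symmetric] algebra_simps)
  also have "\<dots> = (\<integral>\<^sup>+x. \<integral>\<^sup>+y. ennreal (exp (- s * x\<^sup>2)) * ennreal (exp (- s * y\<^sup>2)) \<partial>lborel \<partial>lborel)"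
    by (subst lborel.nn_integral_fst[symmetric]) auto
  also have "\<dots> = ennreal (sqrt (pi / s)) * ennreal (sqrt (pi / s))"
    using assms by (simp add: nn_integral_cmult nn_integral_multc nn_integral_gaussian_real[OF assms, simplified])
  also have "\<dots> = ennreal (pi / s)" using assms by (subst ennreal_mult[symmetric]) auto
  finally show ?thesis .
qed

lemma nn_integral_lborel_shift:
  fixes f :: "'a::euclidean_space \<Rightarrow> ennreal"
  assumes [measurable]: "f \<in> borel_measurable borel"
  shows "(\<integral>\<^sup>+x. f (x - w) \<partial>lborel) = (\<integral>\<^sup>+x. f x \<partial>lborel)"
proof -
  have "(\<integral>\<^sup>+x. f x \<partial>lborel) = (\<integral>\<^sup>+x. f x \<partial>distr lborel borel ((+) (- w)))" by (simp only: lborel_distr_plus)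
  also have "\<dots> = (\<integral>\<^sup>+x. f (x - w) \<partial>lborel)" by (subst nn_integral_distr) auto
  finally show ?thesis by simp
qed

lemma integral_lborel_shift:
  fixes f :: "'a::euclidean_space \<Rightarrow> real"
  assumes [measurable]: "f \<in> borel_measurable borel"
  shows "(\<integral>x. f (x - w) \<partial>lborel) = (\<integral>x. f x \<partial>lborel)"
    and "integrable lborel (\<lambda>x. f (x - w)) \<longleftrightarrow> integrable lborel f"
proof -
  have d: "distr lborel borel ((+) (- w)) = lborel" by (rule lborel_distr_plus)
  have "(\<integral>x. f x \<partial>lborel) = (\<integral>x. f x \<partial>distr lborel borel ((+) (- w)))" by (simp only: d)
  also have "\<dots> = (\<integral>x. f (x - w) \<partial>lborel)" by (subst integral_distr) auto
  finally show "(\<integral>x. f (x - w) \<partial>lborel) = (\<integral>x. f x \<partial>lborel)" by simp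
  have "integrable lborel f \<longleftrightarrow> integrable (distr lborel borel ((+) (- w))) f" by (simp only: d)
  also have "\<dots> \<longleftrightarrow> integrable lborel (\<lambda>x. f (x - w))" by (subst integrable_distr_eq) auto
  finally show "integrable lborel (\<lambda>x. f (x - w)) \<longleftrightarrow> integrable lborel f" by simp
qed

text \<open>Averaging a function against a translated kernel almost returns a multiple of its value
  when most of the mass of the kernel is near the origin.\<close>

lemma kernel_average_bound:
  fixes \<phi> k :: "complex \<Rightarrow> real"
  assumes [measurable]: "\<phi> \<in> borel_measurable borel" "k \<in> borel_measurable borel"
    and k: "\<And>u. k u \<ge> 0" "integrable lborel k"
    and B: "\<And>u. \<bar>\<phi> u\<bar> \<le> B"
    and osc: "\<And>u. norm u \<le> \<delta> \<Longrightarrow> \<bar>\<phi> (u + w) - \<phi> w\<bar> \<le> \<epsilon>"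
    and tail: "(\<integral>u. k u * indicator (- cball 0 \<delta>) u \<partial>lborel) \<le> \<eta>" and pos: "\<epsilon> \<ge> 0" "B \<ge> 0"
  shows "\<bar>(\<integral>u. \<phi> u * k (u - w) \<partial>lborel) - \<phi> w * (\<integral>u. k u \<partial>lborel)\<bar>
    \<le> \<epsilon> * (\<integral>u. k u \<partial>lborel) + 2 * B * \<eta>"
proof -
  have bdd: "integrable lborel (\<lambda>u. f u * k u)" if "f \<in> borel_measurable borel" "\<And>u. \<bar>f u\<bar> \<le> c" for f :: "complex \<Rightarrow> real" and c
  proof (rule Bochner_Integration.integrable_bound[where f = "\<lambda>u. c * k u"])
    have "0 \<le> c" using that(2)[of 0] abs_ge_zero order_trans by blast
    thus "AE u in lborel. norm (f u * k u) \<le> norm (c * k u)"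
      using that k(1) by (auto simp: abs_mult intro!: mult_right_mono)
  qed (use k that in auto)
  have "(\<integral>u. \<phi> u * k (u - w) \<partial>lborel) = (\<integral>u. \<phi> ((u - w) + w) * k (u - w) \<partial>lborel)" by simp
  also have "\<dots> = (\<integral>u. \<phi> (u + w) * k u \<partial>lborel)"
    by (rule integral_lborel_shift(1)[of "\<lambda>u. \<phi> (u + w) * k u"]) auto
  finally have eq: "(\<integral>u. \<phi> u * k (u - w) \<partial>lborel) - \<phi> w * (\<integral>u. k u \<partial>lborel) = (\<integral>u. (\<phi> (u + w) - \<phi> w) * k u \<partial>lborel)"
    using bdd[of "\<lambda>u. \<phi> (u + w)" B] bdd[of "\<lambda>u. \<phi> w" B] B by (simp add: left_diff_distrib)
  have "norm (\<integral>u. (\<phi> (u + w) - \<phi> w) * k u \<partial>lborel) \<le> (\<integral>u. \<epsilon> * k u + 2 * B * (k u * indicator (- cball 0 \<delta>) u) \<partial>lborel)"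
  proof (rule Bochner_Integration.integral_norm_bound[THEN order_trans], rule integral_mono)
    have b2: "\<bar>\<phi> (u + w) - \<phi> w\<bar> \<le> 2 * B" for u using B[of "u + w"] B[of w] by linarith
    show "integrable lborel (\<lambda>u. norm ((\<phi> (u + w) - \<phi> w) * k u))"
      using bdd[OF _ b2] by auto
    show "integrable lborel (\<lambda>u. \<epsilon> * k u + 2 * B * (k u * indicator (- cball 0 \<delta>) u))"
      using k(2) by (intro Bochner_Integration.integrable_add integrable_mult_right integrable_real_mult_indicator) auto
    fix u :: complex
    show "norm ((\<phi> (u + w) - \<phi> w) * k u) \<le> \<epsilon> * k u + 2 * B * (k u * indicator (- cball 0 \<delta>) u)"
    proof (cases "u \<in> cball 0 \<delta>")
      case True thus ?thesis using osc[of u] k(1)[of u] by (auto simp: abs_mult intro!: mult_right_mono)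
    next
      case False
      have "\<bar>\<phi> (u + w) - \<phi> w\<bar> * k u \<le> 2 * B * k u" using b2 k(1) by (intro mult_right_mono) auto
      moreover have "\<epsilon> * k u \<ge> 0" using pos k(1) by simp
      ultimately show ?thesis using False k(1)[of u] by (simp add: abs_mult)
    qed
  qed
  also have "\<dots> = \<epsilon> * (\<integral>u. k u \<partial>lborel) + 2 * B * (\<integral>u. k u * indicator (- cball 0 \<delta>) u \<partial>lborel)"
    using k(2) integrable_real_mult_indicator[of "- cball 0 \<delta>" lborel k] by simp
  also have "\<dots> \<le> \<epsilon> * (\<integral>u. k u \<partial>lborel) + 2 * B * \<eta>"
    using tail pos by (intro add_left_mono mult_left_mono) auto
  finally show ?thesis using eq by simp
qed

text \<open>Indicators of closed sets are limits of decreasing sequences of Lipschitz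
  functions, and closed sets generate the Borel sets.\<close>

lemma measure_eqI_lipschitz:
  fixes \<mu> \<nu> :: "'a::euclidean_space measure"
  assumes \<mu>: "prob_space \<mu>" "sets \<mu> = sets borel" and \<nu>: "prob_space \<nu>" "sets \<nu> = sets borel"
    and eq: "\<And>f :: 'a \<Rightarrow> real. \<And>L. (\<And>x y. \<bar>f x - f y\<bar> \<le> L * dist x y) \<Longrightarrow> (\<And>x. \<bar>f x\<bar> \<le> 1) \<Longrightarrow>
      integral\<^sup>L \<mu> f = integral\<^sup>L \<nu> f"
  shows "\<mu> = \<nu>"
proof -
  interpret \<mu>: prob_space \<mu> by fact
  interpret \<nu>: prob_space \<nu> by fact
  have closed: "emeasure \<mu> C = emeasure \<nu> C" if C: "closed C" for C
  proof (cases "C = {}")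
    case False
    define f where "f = (\<lambda>n x. max 0 (1 - real n * infdist x C))"
    have lip: "\<bar>f n x - f n y\<bar> \<le> real n * dist x y" for n x y
    proof -
      have "\<bar>infdist x C - infdist y C\<bar> \<le> dist x y"
        using infdist_triangle[of x C y] infdist_triangle[of y C x] by (simp add: dist_commute)
      hence "real n * \<bar>infdist x C - infdist y C\<bar> \<le> real n * dist x y" by (intro mult_left_mono) auto
      moreover have "\<bar>f n x - f n y\<bar> \<le> \<bar>real n * infdist x C - real n * infdist y C\<bar>" unfolding f_def by linarith
      moreover have "\<bar>real n * infdist x C - real n * infdist y C\<bar> = real n * \<bar>infdist x C - infdist y C\<bar>"
        by (simp add: right_diff_distrib[symmetric] abs_mult)
      ultimately show ?thesis by linarith
    qed
    have bd: "\<bar>f n x\<bar> \<le> 1" for n x unfolding f_def using infdist_nonneg[of x C] by auto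
    have lim: "(\<lambda>n. f n x) \<longlonglongrightarrow> indicator C x" for x
    proof (cases "x \<in> C")
      case False
      hence p: "infdist x C > 0" using infdist_pos_not_in_closed[OF C \<open>C \<noteq> {}\<close>] by simp
      obtain N :: nat where N: "real N > 1 / infdist x C" using reals_Archimedean2 by blast
      have "f n x = 0" if "n \<ge> N" for n
      proof -
        have "real n > 1 / infdist x C" using that N by linarith
        thus ?thesis using p by (simp add: f_def field_simps)
      qed
      hence "\<forall>\<^sub>F n in sequentially. f n x = 0" using eventually_sequentially by blast
      thus ?thesis using False by (simp add: tendsto_eventually)
    qed (simp add: f_def)
    have m: "f n \<in> borel_measurable borel" for n
      unfolding f_def by (intro borel_measurable_continuous_onI continuous_intros)
    have conv: "(\<lambda>n. integral\<^sup>L M (f n)) \<longlonglongrightarrow> measure M C" if "prob_space M" "sets M = sets borel" for M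
    proof -
      interpret prob_space M by fact
      have "C \<in> sets M" using C that by simp
      have "(\<lambda>n. integral\<^sup>L M (f n)) \<longlonglongrightarrow> integral\<^sup>L M (indicator C)"
        by (rule integral_dominated_convergence[where w = "\<lambda>_. 1"])
           (use m lim bd C that in \<open>auto simp: measurable_cong_sets[OF that(2) refl]\<close>)
      thus ?thesis using \<open>C \<in> sets M\<close> by simp
    qed
    have "measure \<mu> C = measure \<nu> C"
      by (rule LIMSEQ_unique[OF conv[OF \<mu>]]) (use conv[OF \<nu>] eq[OF lip bd] in simp)
    thus ?thesis by (simp add: \<mu>.emeasure_eq_measure \<nu>.emeasure_eq_measure)
  qed simp
  show ?thesis
  proof (rule measure_eqI_generator_eq[where E = "Collect closed" and \<Omega> = UNIV and A = "\<lambda>_. UNIV"])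
    show "Int_stable (Collect (closed :: 'a set \<Rightarrow> bool))" by (auto simp: Int_stable_def)
    show "sets \<mu> = sigma_sets UNIV (Collect closed)" "sets \<nu> = sigma_sets UNIV (Collect closed)"
      using \<mu> \<nu> by (simp_all add: borel_eq_closed)
  qed (use closed \<mu>.emeasure_eq_measure in auto)
qed

section \<open>Gaussian energies of measures\<close>

text \<open>The factor \<open>2 t\<close> is chosen so that the integral of the product of two
  such averages is a multiple of the energy for the kernel \<open>exp (- t |z -
  w|\<^sup>2)\<close>.\<close>

definition gauss_conv :: "complex measure \<Rightarrow> real \<Rightarrow> complex \<Rightarrow> real" where
  "gauss_conv \<mu> t \<zeta> = (\<integral>z. exp (- (2 * t) * (norm (z - \<zeta>))\<^sup>2) \<partial>\<mu>)"

definition gauss_energy :: "complex measure \<Rightarrow> complex measure \<Rightarrow> real \<Rightarrow> real" where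
  "gauss_energy \<mu> \<nu> t = (\<integral>z. (\<integral>w. exp (- t * (norm (z - w))\<^sup>2) \<partial>\<nu>) \<partial>\<mu>)"

text \<open>By the parallelogram identity the product of two Gaussians centred at \<open>z\<close> and \<open>w\<close> is a
  Gaussian centred at their midpoint times a Gaussian in \<open>z - w\<close>.\<close>

lemma nn_integral_gaussian_product:
  assumes t: "t > 0"
  shows "(\<integral>\<^sup>+\<zeta>. ennreal (exp (- (2 * t) * (norm (z - \<zeta>))\<^sup>2)) * ennreal (exp (- (2 * t) * (norm (w - \<zeta>))\<^sup>2))
      \<partial>(lborel :: complex measure)) = ennreal (exp (- t * (norm (z - w))\<^sup>2)) * ennreal (pi / (4 * t))"
proof -
  have par: "2 * (norm (z - \<zeta>))\<^sup>2 + 2 * (norm (w - \<zeta>))\<^sup>2 = (norm (z - w))\<^sup>2 + 4 * (norm (\<zeta> - (z + w) / 2))\<^sup>2" for \<zeta>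
    unfolding cmod_power2 by (simp add: field_simps power2_eq_square)
  have "ennreal (exp (- (2 * t) * (norm (z - \<zeta>))\<^sup>2)) * ennreal (exp (- (2 * t) * (norm (w - \<zeta>))\<^sup>2)) =
      ennreal (exp (- t * (norm (z - w))\<^sup>2)) * ennreal (exp (- (4 * t) * (norm (\<zeta> - (z + w) / 2))\<^sup>2))" for \<zeta>
  proof -
    have "- (2 * t) * (norm (z - \<zeta>))\<^sup>2 + - (2 * t) * (norm (w - \<zeta>))\<^sup>2 =
      - t * (2 * (norm (z - \<zeta>))\<^sup>2 + 2 * (norm (w - \<zeta>))\<^sup>2)" by (simp add: algebra_simps)
    also have "\<dots> = - t * (norm (z - w))\<^sup>2 + - (4 * t) * (norm (\<zeta> - (z + w) / 2))\<^sup>2"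
      unfolding par by (simp add: algebra_simps)
    finally show ?thesis by (simp only: ennreal_mult[symmetric] exp_ge_zero exp_add[symmetric])
  qed
  hence "(\<integral>\<^sup>+\<zeta>. ennreal (exp (- (2 * t) * (norm (z - \<zeta>))\<^sup>2)) * ennreal (exp (- (2 * t) * (norm (w - \<zeta>))\<^sup>2))
      \<partial>(lborel :: complex measure)) = ennreal (exp (- t * (norm (z - w))\<^sup>2)) *
      (\<integral>\<^sup>+\<zeta>. ennreal (exp (- (4 * t) * (norm (\<zeta> - (z + w) / 2))\<^sup>2)) \<partial>lborel)"
    by (simp only: nn_integral_cmult measurable_lborel1)
       (subst nn_integral_cmult, auto)
  also have "(\<integral>\<^sup>+\<zeta>. ennreal (exp (- (4 * t) * (norm (\<zeta> - (z + w) / 2))\<^sup>2)) \<partial>(lborel :: complex measure)) = ennreal (pi / (4 * t))"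
    by (subst nn_integral_lborel_shift[of "\<lambda>\<zeta>. ennreal (exp (- (4 * t) * (norm \<zeta>)\<^sup>2))"])
       (use t nn_integral_gaussian[of "4 * t"] in auto)
  finally show ?thesis .
qed

locale two_prob_measures =
  fixes \<mu> \<nu> :: "complex measure"
  assumes prob_\<mu>: "prob_space \<mu>" and sets_\<mu> [measurable_cong]: "sets \<mu> = sets borel"
    and prob_\<nu>: "prob_space \<nu>" and sets_\<nu> [measurable_cong]: "sets \<nu> = sets borel"
begin

sublocale \<mu>: prob_space \<mu> by (rule prob_\<mu>)
sublocale \<nu>: prob_space \<nu> by (rule prob_\<nu>)

lemma gauss_conv_nn:
  assumes "t > 0"
  shows "ennreal (gauss_conv \<mu> t \<zeta>) = (\<integral>\<^sup>+z. ennreal (exp (- (2 * t) * (norm (z - \<zeta>))\<^sup>2)) \<partial>\<mu>)"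
    "ennreal (gauss_conv \<nu> t \<zeta>) = (\<integral>\<^sup>+z. ennreal (exp (- (2 * t) * (norm (z - \<zeta>))\<^sup>2)) \<partial>\<nu>)"
  unfolding gauss_conv_def
  by (rule nn_integral_eq_integral[symmetric],
      rule \<mu>.integrable_const_bound[of _ 1] \<nu>.integrable_const_bound[of _ 1]; use assms in simp)+

lemma gauss_energy_nn:
  assumes "t > 0"
  shows "ennreal (gauss_energy \<mu> \<nu> t) = (\<integral>\<^sup>+z. (\<integral>\<^sup>+w. ennreal (exp (- t * (norm (z - w))\<^sup>2)) \<partial>\<nu>) \<partial>\<mu>)"
    and "0 \<le> gauss_energy \<mu> \<nu> t"
proof -
  have i: "integrable \<nu> (\<lambda>w. exp (- t * (norm (z - w))\<^sup>2))" for z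
    by (rule \<nu>.integrable_const_bound[of _ 1]) (use assms in simp_all)
  have b: "0 \<le> (\<integral>w. exp (- t * (norm (z - w))\<^sup>2) \<partial>\<nu>)" "(\<integral>w. exp (- t * (norm (z - w))\<^sup>2) \<partial>\<nu>) \<le> 1" for z
    using \<nu>.integral_le_const[OF i[of z], of 1] assms by auto
  have "(\<integral>\<^sup>+z. (\<integral>\<^sup>+w. ennreal (exp (- t * (norm (z - w))\<^sup>2)) \<partial>\<nu>) \<partial>\<mu>) =
     (\<integral>\<^sup>+z. ennreal (\<integral>w. exp (- t * (norm (z - w))\<^sup>2) \<partial>\<nu>) \<partial>\<mu>)"
    by (intro nn_integral_cong nn_integral_eq_integral i) auto
  also have "\<dots> = ennreal (gauss_energy \<mu> \<nu> t)" unfolding gauss_energy_def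
    by (rule nn_integral_eq_integral, rule \<mu>.integrable_const_bound[of _ 1]) (use b in simp_all)
  finally show "ennreal (gauss_energy \<mu> \<nu> t) = (\<integral>\<^sup>+z. (\<integral>\<^sup>+w. ennreal (exp (- t * (norm (z - w))\<^sup>2)) \<partial>\<nu>) \<partial>\<mu>)" ..
  show "0 \<le> gauss_energy \<mu> \<nu> t" unfolding gauss_energy_def by simp
qed

lemma gauss_conv_nonneg: "0 \<le> gauss_conv \<mu> t \<zeta>" "0 \<le> gauss_conv \<nu> t \<zeta>"
  by (simp_all add: gauss_conv_def)

lemma measurable_gauss_conv [measurable]:
  "gauss_conv \<mu> t \<in> borel_measurable borel" "gauss_conv \<nu> t \<in> borel_measurable borel"
  unfolding gauss_conv_def by measurable

lemma gauss_conv_product: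
  assumes t: "t > 0"
  shows "integrable lborel (\<lambda>\<zeta>. gauss_conv \<mu> t \<zeta> * gauss_conv \<nu> t \<zeta>)"
    and "(\<integral>\<zeta>. gauss_conv \<mu> t \<zeta> * gauss_conv \<nu> t \<zeta> \<partial>lborel) = pi / (4 * t) * gauss_energy \<mu> \<nu> t"
proof -
  let ?e = "\<lambda>z \<zeta>. ennreal (exp (- (2 * t) * (norm (z - \<zeta>))\<^sup>2))"
  interpret A: pair_sigma_finite lborel \<mu> ..
  interpret B: pair_sigma_finite lborel \<nu> ..
  have "(\<integral>\<^sup>+\<zeta>. ennreal (gauss_conv \<mu> t \<zeta> * gauss_conv \<nu> t \<zeta>) \<partial>lborel) =
      (\<integral>\<^sup>+\<zeta>. (\<integral>\<^sup>+z. ?e z \<zeta> \<partial>\<mu>) * (\<integral>\<^sup>+w. ?e w \<zeta> \<partial>\<nu>) \<partial>lborel)"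
    by (simp only: ennreal_mult gauss_conv_nonneg gauss_conv_nn[OF t])
  also have "\<dots> = (\<integral>\<^sup>+\<zeta>. (\<integral>\<^sup>+z. (\<integral>\<^sup>+w. ?e z \<zeta> * ?e w \<zeta> \<partial>\<nu>) \<partial>\<mu>) \<partial>lborel)"
    by (intro nn_integral_cong, subst nn_integral_cmult, simp, subst nn_integral_multc, auto)
  also have "\<dots> = (\<integral>\<^sup>+z. (\<integral>\<^sup>+\<zeta>. (\<integral>\<^sup>+w. ?e z \<zeta> * ?e w \<zeta> \<partial>\<nu>) \<partial>lborel) \<partial>\<mu>)"
    by (rule A.Fubini'[symmetric]) measurable
  also have "\<dots> = (\<integral>\<^sup>+z. (\<integral>\<^sup>+w. (\<integral>\<^sup>+\<zeta>. ?e z \<zeta> * ?e w \<zeta> \<partial>lborel) \<partial>\<nu>) \<partial>\<mu>)"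
    by (intro nn_integral_cong B.Fubini'[symmetric]) measurable
  also have "\<dots> = (\<integral>\<^sup>+z. (\<integral>\<^sup>+w. ennreal (exp (- t * (norm (z - w))\<^sup>2)) * ennreal (pi / (4 * t)) \<partial>\<nu>) \<partial>\<mu>)"
    by (simp only: nn_integral_gaussian_product[OF t])
  also have "\<dots> = (\<integral>\<^sup>+z. (\<integral>\<^sup>+w. ennreal (exp (- t * (norm (z - w))\<^sup>2)) \<partial>\<nu>) \<partial>\<mu>) * ennreal (pi / (4 * t))"
    by (subst nn_integral_multc, simp, subst nn_integral_multc, auto)
  also have "\<dots> = ennreal (pi / (4 * t) * gauss_energy \<mu> \<nu> t)"
    using t gauss_energy_nn(2)[OF t] unfolding gauss_energy_nn(1)[OF t, symmetric]
    by (simp add: ennreal_mult[symmetric] mult.commute)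
  finally have eq: "(\<integral>\<^sup>+\<zeta>. ennreal (gauss_conv \<mu> t \<zeta> * gauss_conv \<nu> t \<zeta>) \<partial>lborel) =
      ennreal (pi / (4 * t) * gauss_energy \<mu> \<nu> t)" .
  show "integrable lborel (\<lambda>\<zeta>. gauss_conv \<mu> t \<zeta> * gauss_conv \<nu> t \<zeta>)"
    by (rule integrableI_nn_integral_finite[OF _ _ eq]) (auto simp: gauss_conv_nonneg)
  show "(\<integral>\<zeta>. gauss_conv \<mu> t \<zeta> * gauss_conv \<nu> t \<zeta> \<partial>lborel) = pi / (4 * t) * gauss_energy \<mu> \<nu> t"
    by (rule integral_eq_nn_integral[THEN trans])
       (use eq t gauss_energy_nn(2)[OF t] in \<open>auto simp: gauss_conv_nonneg\<close>)
qed

text \<open>The defect is, up to a positive factor, the square integral of \<open>gauss_conv \<mu>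
  - gauss_conv \<nu>\<close>.\<close>

lemma gauss_energy_positive_definite:
  assumes t: "t > 0"
  shows "2 * gauss_energy \<mu> \<nu> t \<le> gauss_energy \<mu> \<mu> t + gauss_energy \<nu> \<nu> t"
    and "2 * gauss_energy \<mu> \<nu> t = gauss_energy \<mu> \<mu> t + gauss_energy \<nu> \<nu> t \<Longrightarrow>
      AE \<zeta> in lborel. gauss_conv \<mu> t \<zeta> = gauss_conv \<nu> t \<zeta>"
proof -
  interpret M: two_prob_measures \<mu> \<mu> by unfold_locales (rule sets_\<mu>)+
  interpret N: two_prob_measures \<nu> \<nu> by unfold_locales (rule sets_\<nu>)+
  let ?d = "\<lambda>\<zeta>. (gauss_conv \<mu> t \<zeta> - gauss_conv \<nu> t \<zeta>)\<^sup>2"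
  have d: "?d = (\<lambda>\<zeta>. (gauss_conv \<mu> t \<zeta> * gauss_conv \<mu> t \<zeta> + gauss_conv \<nu> t \<zeta> * gauss_conv \<nu> t \<zeta>)
      - 2 * (gauss_conv \<mu> t \<zeta> * gauss_conv \<nu> t \<zeta>))"
    by (auto simp: power2_eq_square algebra_simps)
  note ints = gauss_conv_product(1)[OF t] M.gauss_conv_product(1)[OF t] N.gauss_conv_product(1)[OF t]
  have int: "integrable lborel ?d" unfolding d using ints by (intro Bochner_Integration.integrable_diff Bochner_Integration.integrable_add integrable_mult_right) auto
  have val: "(\<integral>\<zeta>. ?d \<zeta> \<partial>lborel) = pi / (4 * t) * (gauss_energy \<mu> \<mu> t + gauss_energy \<nu> \<nu> t - 2 * gauss_energy \<mu> \<nu> t)"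
    unfolding d using ints gauss_conv_product(2)[OF t] M.gauss_conv_product(2)[OF t] N.gauss_conv_product(2)[OF t]
    by (simp add: algebra_simps)
  have "0 \<le> (\<integral>\<zeta>. ?d \<zeta> \<partial>lborel)" by simp
  hence "0 \<le> pi / (4 * t) * (gauss_energy \<mu> \<mu> t + gauss_energy \<nu> \<nu> t - 2 * gauss_energy \<mu> \<nu> t)" using val by simp
  thus "2 * gauss_energy \<mu> \<nu> t \<le> gauss_energy \<mu> \<mu> t + gauss_energy \<nu> \<nu> t"
    using mult_pos_neg[of "pi / (4 * t)" "gauss_energy \<mu> \<mu> t + gauss_energy \<nu> \<nu> t - 2 * gauss_energy \<mu> \<nu> t"] t
    by (smt (verit) divide_pos_pos pi_gt_zero)
  assume "2 * gauss_energy \<mu> \<nu> t = gauss_energy \<mu> \<mu> t + gauss_energy \<nu> \<nu> t"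
  hence "(\<integral>\<zeta>. ?d \<zeta> \<partial>lborel) = 0" using val by simp
  hence "AE \<zeta> in lborel. ?d \<zeta> = 0" using integral_nonneg_eq_0_iff_AE[OF int] by simp
  thus "AE \<zeta> in lborel. gauss_conv \<mu> t \<zeta> = gauss_conv \<nu> t \<zeta>" by simp
qed

end

lemma integral_gauss_conv:
  fixes f :: "complex \<Rightarrow> real"
  assumes M: "prob_space M" "sets M = sets borel" and t: "t > 0"
    and [measurable]: "f \<in> borel_measurable borel" and bd: "\<And>x. \<bar>f x\<bar> \<le> 1"
  shows "(\<integral>w. (\<integral>u. f u * exp (- (2 * t) * (norm (u - w))\<^sup>2) \<partial>lborel) \<partial>M) = (\<integral>u. f u * gauss_conv M t u \<partial>lborel)"
    and "integrable M (\<lambda>w. \<integral>u. f u * exp (- (2 * t) * (norm (u - w))\<^sup>2) \<partial>lborel)"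
proof -
  interpret prob_space M by fact
  note [measurable_cong] = M(2)
  interpret P: pair_sigma_finite M lborel ..
  let ?F = "\<lambda>w u. f u * exp (- (2 * t) * (norm (u - w))\<^sup>2)"
  have nn: "(\<integral>\<^sup>+u. ennreal (exp (- (2 * t) * (norm (u - w))\<^sup>2)) \<partial>lborel) = ennreal (pi / (2 * t))" for w :: complex
    by (subst nn_integral_lborel_shift[of "\<lambda>\<zeta>. ennreal (exp (- (2 * t) * (norm \<zeta>)\<^sup>2))"])
       (use t nn_integral_gaussian[of "2 * t"] in auto)
  have int: "integrable lborel (\<lambda>u. exp (- (2 * t) * (norm (u - w))\<^sup>2))" for w :: complex
    by (rule integrableI_nn_integral_finite[OF _ _ nn]) (use t in auto)
  have int2: "integrable lborel (?F w)" for w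
    by (rule Bochner_Integration.integrable_bound[OF int[of w]])
       (use bd in \<open>auto simp: abs_mult mult_left_le_one_le\<close>)
  have val: "(\<integral>u. exp (- (2 * t) * (norm (u - w))\<^sup>2) \<partial>lborel) = pi / (2 * t)" for w :: complex
    by (rule integral_eq_nn_integral[THEN trans]) (use nn t in auto)
  have intP: "integrable (M \<Otimes>\<^sub>M lborel) (case_prod ?F)"
  proof (rule P.Fubini_integrable)
    show "integrable M (\<lambda>w. \<integral>u. norm (case (w, u) of (x, y) \<Rightarrow> ?F x y) \<partial>lborel)"
    proof (rule integrable_const_bound[of _ "pi / (2 * t)"])
      show "AE w in M. norm (\<integral>u. norm (case (w, u) of (x, y) \<Rightarrow> ?F x y) \<partial>lborel) \<le> pi / (2 * t)"
      proof (rule AE_I2)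
        fix w
        have "(\<integral>u. norm (?F w u) \<partial>lborel) \<le> (\<integral>u. exp (- (2 * t) * (norm (u - w))\<^sup>2) \<partial>lborel)"
        proof (rule integral_mono)
          show "integrable lborel (\<lambda>u. norm (?F w u))" using int2 by (rule integrable_norm)
          show "norm (?F w u) \<le> exp (- (2 * t) * (norm (u - w))\<^sup>2)" for u
            using bd[of u] by (simp add: abs_mult mult_left_le_one_le)
        qed (rule int)
        thus "norm (\<integral>u. norm (case (w, u) of (x, y) \<Rightarrow> ?F x y) \<partial>lborel) \<le> pi / (2 * t)"
          using val[of w] by simp
      qed
    qed measurable
  qed (use int2 in \<open>auto\<close>)
  have "(\<integral>u. (\<integral>w. ?F w u \<partial>M) \<partial>lborel) = (\<integral>w. (\<integral>u. ?F w u \<partial>lborel) \<partial>M)"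
    by (rule P.Fubini_integral[OF intP])
  moreover have "(\<integral>w. ?F w u \<partial>M) = f u * gauss_conv M t u" for u
    unfolding gauss_conv_def norm_minus_commute[of u] by simp
  ultimately show "(\<integral>w. (\<integral>u. ?F w u \<partial>lborel) \<partial>M) = (\<integral>u. f u * gauss_conv M t u \<partial>lborel)" by (simp only:)
  show "integrable M (\<lambda>w. \<integral>u. ?F w u \<partial>lborel)"
    using P.integrable_fst'[OF intP] by simp
qed

text \<open>The Gaussian averages of a measure determine it, because a Lipschitz function is uniformly
  approximated by its averages against narrow Gaussians.\<close>

lemma gauss_conv_determines:
  fixes \<mu> \<nu> :: "complex measure"
  assumes \<mu>: "prob_space \<mu>" "sets \<mu> = sets borel" and \<nu>: "prob_space \<nu>" "sets \<nu> = sets borel"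
    and eq: "\<And>T. \<exists>t\<ge>T. AE \<zeta> in lborel. gauss_conv \<mu> t \<zeta> = gauss_conv \<nu> t \<zeta>"
  shows "\<mu> = \<nu>"
proof (rule measure_eqI_lipschitz[OF \<mu> \<nu>])
  fix f :: "complex \<Rightarrow> real" and L
  assume lip: "\<And>x y. \<bar>f x - f y\<bar> \<le> L * dist x y" and bd: "\<And>x. \<bar>f x\<bar> \<le> 1"
  have cont: "continuous_on UNIV f"
  proof (rule lipschitz_on_continuous_on)
    show "\<bar>L\<bar>-lipschitz_on UNIV f"
    proof (rule lipschitz_onI)
      fix x y :: complex
      have "L * dist x y \<le> \<bar>L\<bar> * dist x y" by (intro mult_right_mono) auto
      thus "dist (f x) (f y) \<le> \<bar>L\<bar> * dist x y" using lip[of x y] by (simp add: dist_real_def)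
    qed simp
  qed
  hence [measurable]: "f \<in> borel_measurable borel" by (rule borel_measurable_continuous_onI)
  have "\<bar>integral\<^sup>L \<mu> f - integral\<^sup>L \<nu> f\<bar> \<le> \<epsilon>" if e: "\<epsilon> > 0" for \<epsilon>
  proof -
    define \<delta> where "\<delta> = \<epsilon> / (4 * (\<bar>L\<bar> + 1))"
    have d: "\<delta> > 0" "\<bar>L\<bar> * \<delta> \<le> \<epsilon> / 4" using e by (auto simp: \<delta>_def field_simps)
    have "((\<lambda>t. exp (- t * \<delta>\<^sup>2)) \<longlongrightarrow> 0) at_top" using d by real_asymp
    hence "\<forall>\<^sub>F t in at_top. exp (- t * \<delta>\<^sup>2) < \<epsilon> / 16" using e by (intro order_tendstoD) auto
    then obtain T where T: "\<And>t. t \<ge> T \<Longrightarrow> exp (- t * \<delta>\<^sup>2) < \<epsilon> / 16" by (auto simp: eventually_at_top_linorder)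
    obtain t where t: "t \<ge> max 1 T" "AE \<zeta> in lborel. gauss_conv \<mu> t \<zeta> = gauss_conv \<nu> t \<zeta>" using eq by blast
    have t0: "t > 0" using t by simp
    define k where "k = (\<lambda>u::complex. exp (- (2 * t) * (norm u)\<^sup>2))"
    have [measurable]: "k \<in> borel_measurable borel" unfolding k_def by measurable
    have gi: "integrable lborel (\<lambda>u::complex. exp (- s * (norm u)\<^sup>2))"
       "(\<integral>u. exp (- s * (norm (u::complex))\<^sup>2) \<partial>lborel) = pi / s" if "s > 0" for s
    proof -
      note nn = nn_integral_gaussian[OF that]
      show "integrable lborel (\<lambda>u::complex. exp (- s * (norm u)\<^sup>2))"
        by (rule integrableI_nn_integral_finite[OF _ _ nn]) (use that in auto)
      show "(\<integral>u. exp (- s * (norm (u::complex))\<^sup>2) \<partial>lborel) = pi / s"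
        by (rule integral_eq_nn_integral[THEN trans]) (use nn that in auto)
    qed
    define c where "c = pi / (2 * t)"
    have c: "c > 0" using t0 by (simp add: c_def)
    have ik: "integrable lborel k" "(\<integral>u. k u \<partial>lborel) = c" using gi[of "2 * t"] t0 by (auto simp: k_def c_def)
    have tail: "(\<integral>u. k u * indicator (- cball 0 \<delta>) u \<partial>lborel) \<le> exp (- t * \<delta>\<^sup>2) * (2 * c)"
    proof -
      have "(\<integral>u. k u * indicator (- cball 0 \<delta>) u \<partial>lborel) \<le> (\<integral>u. exp (- t * \<delta>\<^sup>2) * exp (- t * (norm (u::complex))\<^sup>2) \<partial>lborel)"
      proof (rule integral_mono)
        show "integrable lborel (\<lambda>u. k u * indicator (- cball 0 \<delta>) u)"
          using ik(1) by (intro integrable_real_mult_indicator) auto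
        show "integrable lborel (\<lambda>u::complex. exp (- t * \<delta>\<^sup>2) * exp (- t * (norm u)\<^sup>2))"
          using gi(1)[OF t0] by (intro integrable_mult_right)
        fix u :: complex
        show "k u * indicator (- cball 0 \<delta>) u \<le> exp (- t * \<delta>\<^sup>2) * exp (- t * (norm u)\<^sup>2)"
        proof (cases "norm u \<le> \<delta>")
          case False
          hence "\<delta>\<^sup>2 \<le> (norm u)\<^sup>2" using d by (intro power_mono) auto
          hence "t * \<delta>\<^sup>2 \<le> t * (norm u)\<^sup>2" using t0 by (intro mult_left_mono) auto
          thus ?thesis using False by (simp add: k_def exp_add[symmetric])
        qed simp
      qed
      also have "\<dots> = exp (- t * \<delta>\<^sup>2) * (2 * c)" using gi(2)[OF t0] t0 by (simp add: c_def)
      finally show ?thesis .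
    qed
    have near: "\<bar>(\<integral>u. f u * k (u - w) \<partial>lborel) - f w * c\<bar> \<le> \<epsilon> / 2 * c" for w
    proof -
      have "\<bar>(\<integral>u. f u * k (u - w) \<partial>lborel) - f w * (\<integral>u. k u \<partial>lborel)\<bar>
          \<le> \<epsilon> / 4 * (\<integral>u. k u \<partial>lborel) + 2 * 1 * (exp (- t * \<delta>\<^sup>2) * (2 * c))"
      proof (rule kernel_average_bound[OF _ _ _ ik(1) bd _ tail])
        fix u :: complex assume u: "norm u \<le> \<delta>"
        have "\<bar>f (u + w) - f w\<bar> \<le> L * norm u" using lip[of "u + w" w] by (simp add: dist_norm)
        also have "\<dots> \<le> \<bar>L\<bar> * \<delta>" using u d by (intro mult_mono) auto
        finally show "\<bar>f (u + w) - f w\<bar> \<le> \<epsilon> / 4" using d by linarith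
      qed (use e in \<open>auto simp: k_def\<close>)
      also have "\<dots> \<le> \<epsilon> / 4 * c + 2 * 1 * (\<epsilon> / 16 * (2 * c))"
        unfolding ik(2) using T[of t] t c by (intro add_left_mono mult_left_mono mult_right_mono) auto
      also have "\<dots> = \<epsilon> / 2 * c" by (simp add: field_simps)
      finally show ?thesis unfolding ik(2) .
    qed
    have est: "\<bar>(\<integral>u. f u * gauss_conv M t u \<partial>lborel) - integral\<^sup>L M f * c\<bar> \<le> \<epsilon> / 2 * c"
      if M: "prob_space M" "sets M = sets borel" for M
    proof -
      interpret prob_space M by fact
      have i1: "integrable M f"
        by (rule integrable_const_bound[of _ 1]) (use bd in \<open>auto simp: measurable_cong_sets[OF M(2) refl]\<close>)
      have i2: "integrable M (\<lambda>w. \<integral>u. f u * k (u - w) \<partial>lborel)"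
        "(\<integral>w. (\<integral>u. f u * k (u - w) \<partial>lborel) \<partial>M) = (\<integral>u. f u * gauss_conv M t u \<partial>lborel)"
        using integral_gauss_conv[OF M t0 _ bd] by (auto simp: k_def)
      have "norm ((\<integral>w. (\<integral>u. f u * k (u - w) \<partial>lborel) - f w * c \<partial>M)) \<le> (\<integral>w. \<epsilon> / 2 * c \<partial>M)"
        by (rule Bochner_Integration.integral_norm_bound[THEN order_trans], rule integral_mono)
           (use i1 i2 near in auto)
      moreover have "(\<integral>w. (\<integral>u. f u * k (u - w) \<partial>lborel) - f w * c \<partial>M) = (\<integral>u. f u * gauss_conv M t u \<partial>lborel) - integral\<^sup>L M f * c"
        using i1 i2 by simp
      ultimately show ?thesis by (simp add: prob_space)
    qed
    have "(\<integral>u. f u * gauss_conv \<mu> t u \<partial>lborel) = (\<integral>u. f u * gauss_conv \<nu> t u \<partial>lborel)"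
    proof (rule integral_cong_AE)
      interpret two_prob_measures \<mu> \<nu> using \<mu> \<nu> by (simp add: two_prob_measures_def)
      show "(\<lambda>u. f u * gauss_conv \<mu> t u) \<in> borel_measurable lborel" "(\<lambda>u. f u * gauss_conv \<nu> t u) \<in> borel_measurable lborel"
        by measurable
      show "AE u in lborel. f u * gauss_conv \<mu> t u = f u * gauss_conv \<nu> t u" using t(2) by eventually_elim simp
    qed
    hence "\<bar>integral\<^sup>L \<mu> f * c - integral\<^sup>L \<nu> f * c\<bar> \<le> \<epsilon> * c" using est[OF \<mu>] est[OF \<nu>] by linarith
    hence "\<bar>integral\<^sup>L \<mu> f - integral\<^sup>L \<nu> f\<bar> * c \<le> \<epsilon> * c" using c by (simp add: left_diff_distrib[symmetric] abs_mult)
    thus ?thesis using c by simp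
  qed
  thus "integral\<^sup>L \<mu> f = integral\<^sup>L \<nu> f" using field_le_epsilon[of "\<bar>integral\<^sup>L \<mu> f - integral\<^sup>L \<nu> f\<bar>" 0] by simp
qed

section \<open>Positive definiteness of the logarithmic energy\<close>

text \<open>The logarithm as a superposition of Gaussians, which follows by integrating \<open>exp
  (- t s) / 2\<close> over \<open>s\<close> in \<open>[x\<^sup>2, R\<^sup>2]\<close> and over
  \<open>t > 0\<close> in both orders. Subtracting the term with \<open>R\<close> makes the
  integrand positive and integrable near \<open>t = 0\<close>.\<close>

lemma frullani:
  fixes x R :: real
  assumes x: "0 \<le> x" "x \<le> R" and R: "R > 0"
  shows "(\<integral>\<^sup>+t. indicator {0<..} t * ennreal ((exp (- t * x\<^sup>2) - exp (- t * R\<^sup>2)) / (2 * t)) \<partial>lborel) =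
    (if x = 0 then \<infinity> else ennreal (ln R - ln x))"
proof -
  let ?\<alpha> = "x\<^sup>2" and ?\<beta> = "R\<^sup>2"
  have ab: "0 \<le> ?\<alpha>" "?\<alpha> \<le> ?\<beta>" "0 < ?\<beta>" using x R by (auto intro: power_mono)
  have inner: "indicator {0<..} t * ennreal ((exp (- t * ?\<alpha>) - exp (- t * ?\<beta>)) / (2 * t)) =
     (\<integral>\<^sup>+s. ennreal (exp (- t * s) / 2) * indicator {?\<alpha>..?\<beta>} s * indicator {0<..} t \<partial>lborel)" for t :: real
  proof (cases "t > 0")
    case True
    have "(\<integral>\<^sup>+s. ennreal (exp (- t * s) / 2) * indicator {?\<alpha>..?\<beta>} s \<partial>lborel) =
        - exp (- t * ?\<beta>) / (2 * t) - (- exp (- t * ?\<alpha>) / (2 * t))"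
      by (rule nn_integral_FTC_Icc) (use True ab in \<open>auto intro!: derivative_eq_intros\<close>)
    also have "- exp (- t * ?\<beta>) / (2 * t) - (- exp (- t * ?\<alpha>) / (2 * t)) = (exp (- t * ?\<alpha>) - exp (- t * ?\<beta>)) / (2 * t)"
      by (simp add: diff_divide_distrib)
    finally show ?thesis using True by simp
  qed simp
  have outer: "(\<integral>\<^sup>+t. ennreal (exp (- t * s) / 2) * indicator {?\<alpha>..?\<beta>} s * indicator {0<..} t \<partial>lborel) =
      ennreal (1 / (2 * s)) * indicator {?\<alpha>..?\<beta>} s" if s: "s > 0" for s :: real
  proof -
    have "(\<integral>\<^sup>+t. ennreal (exp (- t * s) / 2) * indicator {0..} t \<partial>lborel) = 0 - (- exp (- 0 * s) / (2 * s))"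
    proof (rule nn_integral_FTC_atLeast)
      show "((\<lambda>t. - exp (- t * s) / (2 * s)) \<longlongrightarrow> 0) at_top" using s by real_asymp
    qed (use s in \<open>auto intro!: derivative_eq_intros\<close>)
    moreover have "(\<integral>\<^sup>+t. ennreal (exp (- t * s) / 2) * indicator {0<..} t \<partial>lborel) =
        (\<integral>\<^sup>+t. ennreal (exp (- t * s) / 2) * indicator {0..} t \<partial>lborel)"
      by (rule nn_integral_cong_AE) (use AE_lborel_singleton[of 0] in \<open>auto split: split_indicator\<close>)
    ultimately have "(\<integral>\<^sup>+t. ennreal (exp (- t * s) / 2) * indicator {0<..} t \<partial>lborel) = ennreal (1 / (2 * s))"
      by simp
    thus ?thesis by (auto split: split_indicator)
  qed
  have "(\<integral>\<^sup>+t. indicator {0<..} t * ennreal ((exp (- t * ?\<alpha>) - exp (- t * ?\<beta>)) / (2 * t)) \<partial>lborel) =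
      (\<integral>\<^sup>+t. (\<integral>\<^sup>+s. ennreal (exp (- t * s) / 2) * indicator {?\<alpha>..?\<beta>} s * indicator {0<..} t \<partial>lborel) \<partial>lborel)"
    by (simp only: inner)
  also have "\<dots> = (\<integral>\<^sup>+s. (\<integral>\<^sup>+t. ennreal (exp (- t * s) / 2) * indicator {?\<alpha>..?\<beta>} s * indicator {0<..} t \<partial>lborel) \<partial>lborel)"
    by (rule lborel_pair.Fubini') measurable
  also have "\<dots> = (\<integral>\<^sup>+s. ennreal (1 / (2 * s)) * indicator {?\<alpha>..?\<beta>} s \<partial>lborel)"
  proof (rule nn_integral_cong_AE, use AE_lborel_singleton[of 0] in eventually_elim)
    fix s :: real assume "s \<noteq> 0"
    thus "(\<integral>\<^sup>+t. ennreal (exp (- t * s) / 2) * indicator {?\<alpha>..?\<beta>} s * indicator {0<..} t \<partial>lborel) =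
        ennreal (1 / (2 * s)) * indicator {?\<alpha>..?\<beta>} s"
    proof (cases "s > 0")
      case False
      hence "\<not> ?\<alpha> \<le> s" using ab(1) \<open>s \<noteq> 0\<close> by linarith
      thus ?thesis by simp
    qed (rule outer)
  qed
  finally have eq: "(\<integral>\<^sup>+t. indicator {0<..} t * ennreal ((exp (- t * ?\<alpha>) - exp (- t * ?\<beta>)) / (2 * t)) \<partial>lborel) =
     (\<integral>\<^sup>+s. ennreal (1 / (2 * s)) * indicator {?\<alpha>..?\<beta>} s \<partial>lborel)" .
  have pos: "(\<integral>\<^sup>+s. ennreal (1 / (2 * s)) * indicator {y\<^sup>2..?\<beta>} s \<partial>lborel) = ennreal (ln R - ln y)"
    if y: "0 < y" "y \<le> R" for y
  proof -
    have "(\<integral>\<^sup>+s. ennreal (1 / (2 * s)) * indicator {y\<^sup>2..?\<beta>} s \<partial>lborel) = ln ?\<beta> / 2 - ln (y\<^sup>2) / 2"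
    proof (rule nn_integral_FTC_Icc)
      fix s assume "s \<in> {y\<^sup>2..?\<beta>}"
      hence "s > 0" using y by (auto intro: less_le_trans[of 0 "y\<^sup>2"])
      thus "((\<lambda>s. ln s / 2) has_real_derivative 1 / (2 * s)) (at s)" "0 \<le> 1 / (2 * s)"
        by (auto intro!: derivative_eq_intros)
    qed (use y in \<open>auto intro: power_mono\<close>)
    thus ?thesis using y R by (simp add: ln_realpow)
  qed
  show ?thesis
  proof (cases "x = 0")
    case False thus ?thesis using eq pos[of x] x by simp
  next
    case True
    have "ennreal (real n) \<le> (\<integral>\<^sup>+s. ennreal (1 / (2 * s)) * indicator {?\<alpha>..?\<beta>} s \<partial>lborel)" for n
    proof -
      let ?y = "R * exp (- real n)"
      have y: "0 < ?y" "?y \<le> R" using R by (auto simp: mult_le_cancel_left1)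
      have "ennreal (real n) = ennreal (ln R - ln ?y)" using R by (simp add: ln_mult)
      also have "\<dots> = (\<integral>\<^sup>+s. ennreal (1 / (2 * s)) * indicator {?y\<^sup>2..?\<beta>} s \<partial>lborel)" by (rule pos[OF y, symmetric])
      also have "\<dots> \<le> (\<integral>\<^sup>+s. ennreal (1 / (2 * s)) * indicator {?\<alpha>..?\<beta>} s \<partial>lborel)"
        by (rule nn_integral_mono) (use True in \<open>auto split: split_indicator intro: order_trans[OF zero_le_power2]\<close>)
      finally show ?thesis .
    qed
    hence "(\<integral>\<^sup>+s. ennreal (1 / (2 * s)) * indicator {?\<alpha>..?\<beta>} s \<partial>lborel) = \<infinity>"
      using ennreal_Ex_less_of_nat by (metis ennreal_of_nat_eq_real_of_nat infinity_ennreal_def leD less_top)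
    thus ?thesis using eq True by simp
  qed
qed

text \<open>On a set of diameter at most \<open>R\<close> the kernel \<open>ln R - ln |z -
  w|\<close> is nonnegative, so energies become nonnegative integrals, to which Tonelli's theorem
  applies.\<close>

definition shifted_kernel :: "real \<Rightarrow> complex \<Rightarrow> complex \<Rightarrow> ennreal" where
  "shifted_kernel R z w = e2ennreal (log_kernel z w + ereal (ln R))"

definition shifted_energy :: "real \<Rightarrow> complex measure \<Rightarrow> complex measure \<Rightarrow> ennreal" where
  "shifted_energy R \<mu> \<nu> = (\<integral>\<^sup>+z. (\<integral>\<^sup>+w. shifted_kernel R z w \<partial>\<nu>) \<partial>\<mu>)"

lemma shifted_kernel_eq:
  "shifted_kernel R z w = (if z = w then \<infinity> else ennreal (ln R - ln (norm (z - w))))"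
  by (simp add: shifted_kernel_def log_kernel_def e2ennreal_infty flip: ennreal.abs_eq)

lemma measurable_shifted_kernel [measurable]:
  "(\<lambda>x. shifted_kernel R (f x) (g x)) \<in> borel_measurable M"
  if [measurable]: "f \<in> borel_measurable M" "g \<in> borel_measurable M"
  unfolding shifted_kernel_eq by measurable

lemma shifted_kernel_frullani:
  assumes "norm (z - w) \<le> R" "R > 0"
  shows "shifted_kernel R z w =
    (\<integral>\<^sup>+t. indicator {0<..} t * ennreal ((exp (- t * (norm (z - w))\<^sup>2) - exp (- t * R\<^sup>2)) / (2 * t)) \<partial>lborel)"
  using frullani[of "norm (z - w)" R] assms by (simp add: shifted_kernel_eq)

locale two_prob_measures_on = two_prob_measures +
  fixes K :: "complex set" and R :: real
  assumes \<mu>_K: "AE z in \<mu>. z \<in> K" and \<nu>_K: "AE z in \<nu>. z \<in> K"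
    and R: "R > 0" and diam: "\<And>z w. z \<in> K \<Longrightarrow> w \<in> K \<Longrightarrow> norm (z - w) \<le> R"
begin

lemma shifted_energy_gauss:
  "shifted_energy R \<mu> \<nu> =
    (\<integral>\<^sup>+t. indicator {0<..} t * ennreal ((gauss_energy \<mu> \<nu> t - exp (- t * R\<^sup>2)) / (2 * t)) \<partial>lborel)"
  and gauss_energy_ge: "t > 0 \<Longrightarrow> gauss_energy \<mu> \<nu> t \<ge> exp (- t * R\<^sup>2)"
proof -
  let ?h = "\<lambda>z w t. indicator {0<..} t * ennreal ((exp (- t * (norm (z - w))\<^sup>2) - exp (- t * R\<^sup>2)) / (2 * t))"
  interpret A: pair_sigma_finite lborel \<mu> ..
  interpret B: pair_sigma_finite lborel \<nu> ..
  have i1: "integrable \<nu> (\<lambda>w. exp (- t * (norm (z - w))\<^sup>2))" if "t > 0" for z t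
    by (rule \<nu>.integrable_const_bound[of _ 1]) (use that in simp_all)
  have b1: "0 \<le> (\<integral>w. exp (- t * (norm (z - w))\<^sup>2) \<partial>\<nu>)" "(\<integral>w. exp (- t * (norm (z - w))\<^sup>2) \<partial>\<nu>) \<le> 1" if "t > 0" for z t
    using \<nu>.integral_le_const[OF i1[OF that, of z], of 1] that by auto
  have i2: "integrable \<mu> (\<lambda>z. \<integral>w. exp (- t * (norm (z - w))\<^sup>2) \<partial>\<nu>)" if "t > 0" for t
    by (rule \<mu>.integrable_const_bound[of _ 1]) (use b1[OF that] in simp_all)
  have pt: "exp (- t * R\<^sup>2) \<le> exp (- t * (norm (z - w))\<^sup>2)" if "z \<in> K" "w \<in> K" "t > 0" for z w t
    using that diam by (auto intro!: mult_left_mono power_mono)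
  have ge1: "exp (- t * R\<^sup>2) \<le> (\<integral>w. exp (- t * (norm (z - w))\<^sup>2) \<partial>\<nu>)" if "z \<in> K" "t > 0" for z t
    by (rule \<nu>.integral_ge_const[OF i1[OF that(2)]]) (use \<nu>_K pt[OF that(1) _ that(2)] in \<open>auto elim!: eventually_mono\<close>)
  show ge2: "gauss_energy \<mu> \<nu> t \<ge> exp (- t * R\<^sup>2)" if "t > 0" for t
    unfolding gauss_energy_def
    by (rule \<mu>.integral_ge_const[OF i2[OF that]]) (use \<mu>_K ge1[OF _ that] in \<open>auto elim!: eventually_mono\<close>)
  have "shifted_energy R \<mu> \<nu> = (\<integral>\<^sup>+z. (\<integral>\<^sup>+w. (\<integral>\<^sup>+t. ?h z w t \<partial>lborel) \<partial>\<nu>) \<partial>\<mu>)"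
    unfolding shifted_energy_def
  proof (rule nn_integral_cong_AE, use \<mu>_K in eventually_elim, rule nn_integral_cong_AE, use \<nu>_K in eventually_elim)
    fix z w assume "z \<in> K" "w \<in> K"
    thus "shifted_kernel R z w = (\<integral>\<^sup>+t. ?h z w t \<partial>lborel)" by (intro shifted_kernel_frullani diam R)
  qed
  also have "\<dots> = (\<integral>\<^sup>+z. (\<integral>\<^sup>+t. (\<integral>\<^sup>+w. ?h z w t \<partial>\<nu>) \<partial>lborel) \<partial>\<mu>)"
    by (intro nn_integral_cong B.Fubini') measurable
  also have "\<dots> = (\<integral>\<^sup>+t. (\<integral>\<^sup>+z. (\<integral>\<^sup>+w. ?h z w t \<partial>\<nu>) \<partial>\<mu>) \<partial>lborel)"
    by (rule A.Fubini') measurable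
  also have "\<dots> = (\<integral>\<^sup>+t. indicator {0<..} t * ennreal ((gauss_energy \<mu> \<nu> t - exp (- t * R\<^sup>2)) / (2 * t)) \<partial>lborel)"
  proof (rule nn_integral_cong)
    fix t :: real
    show "(\<integral>\<^sup>+z. (\<integral>\<^sup>+w. ?h z w t \<partial>\<nu>) \<partial>\<mu>) = indicator {0<..} t * ennreal ((gauss_energy \<mu> \<nu> t - exp (- t * R\<^sup>2)) / (2 * t))"
    proof (cases "t > 0")
      case True
      have "(\<integral>\<^sup>+z. (\<integral>\<^sup>+w. ?h z w t \<partial>\<nu>) \<partial>\<mu>) = (\<integral>\<^sup>+z. ennreal (((\<integral>w. exp (- t * (norm (z - w))\<^sup>2) \<partial>\<nu>) - exp (- t * R\<^sup>2)) / (2 * t)) \<partial>\<mu>)"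
      proof (rule nn_integral_cong_AE, use \<mu>_K in eventually_elim)
        fix z assume z: "z \<in> K"
        have "(\<integral>\<^sup>+w. ?h z w t \<partial>\<nu>) = (\<integral>\<^sup>+w. ennreal ((exp (- t * (norm (z - w))\<^sup>2) - exp (- t * R\<^sup>2)) / (2 * t)) \<partial>\<nu>)"
          using True by simp
        also have "\<dots> = ennreal (\<integral>w. (exp (- t * (norm (z - w))\<^sup>2) - exp (- t * R\<^sup>2)) / (2 * t) \<partial>\<nu>)"
        proof (rule nn_integral_eq_integral)
          show "integrable \<nu> (\<lambda>w. (exp (- t * (norm (z - w))\<^sup>2) - exp (- t * R\<^sup>2)) / (2 * t))"
            using i1[OF True] by simp
          show "AE w in \<nu>. 0 \<le> (exp (- t * (norm (z - w))\<^sup>2) - exp (- t * R\<^sup>2)) / (2 * t)"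
            using \<nu>_K by eventually_elim (use pt[OF z _ True] True in simp)
        qed
        finally show "(\<integral>\<^sup>+w. ?h z w t \<partial>\<nu>) = ennreal (((\<integral>w. exp (- t * (norm (z - w))\<^sup>2) \<partial>\<nu>) - exp (- t * R\<^sup>2)) / (2 * t))"
          using i1[OF True] by (simp add: \<nu>.prob_space)
      qed
      also have "\<dots> = ennreal (\<integral>z. ((\<integral>w. exp (- t * (norm (z - w))\<^sup>2) \<partial>\<nu>) - exp (- t * R\<^sup>2)) / (2 * t) \<partial>\<mu>)"
      proof (rule nn_integral_eq_integral)
        show "AE z in \<mu>. 0 \<le> ((\<integral>w. exp (- t * (norm (z - w))\<^sup>2) \<partial>\<nu>) - exp (- t * R\<^sup>2)) / (2 * t)"
          using \<mu>_K by eventually_elim (use ge1[OF _ True] True in simp)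
      qed (use i2[OF True] in simp)
      finally show ?thesis using True i2[OF True] by (simp add: \<mu>.prob_space gauss_energy_def)
    qed simp
  qed
  finally show "shifted_energy R \<mu> \<nu> =
    (\<integral>\<^sup>+t. indicator {0<..} t * ennreal ((gauss_energy \<mu> \<nu> t - exp (- t * R\<^sup>2)) / (2 * t)) \<partial>lborel)" .
qed

lemma measurable_gauss_energy [measurable]: "gauss_energy \<mu> \<nu> \<in> borel_measurable borel"
  unfolding gauss_energy_def by measurable

end

text \<open>The logarithmic energy is strictly positive definite on differences of probability measures:
  it is a superposition of Gaussian energies, each of which is so.\<close>

theorem (in two_prob_measures_on) shifted_energy_strictly_positive:
  shows "2 * shifted_energy R \<mu> \<nu> \<le> shifted_energy R \<mu> \<mu> + shifted_energy R \<nu> \<nu>"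
    and "shifted_energy R \<mu> \<nu> < \<infinity> \<Longrightarrow> shifted_energy R \<mu> \<mu> + shifted_energy R \<nu> \<nu> = 2 * shifted_energy R \<mu> \<nu> \<Longrightarrow> \<mu> = \<nu>"
proof -
  interpret M: two_prob_measures_on \<mu> \<mu> K R by unfold_locales (use \<mu>_K R diam sets_\<mu> in auto)
  interpret N: two_prob_measures_on \<nu> \<nu> K R by unfold_locales (use \<nu>_K R diam sets_\<nu> in auto)
  let ?e = "\<lambda>M N t. (gauss_energy M N t - exp (- t * R\<^sup>2)) / (2 * t)"
  let ?d = "\<lambda>t. indicator {0<..} t * ennreal (?e \<mu> \<mu> t + ?e \<nu> \<nu> t - 2 * ?e \<mu> \<nu> t)"
  have nn: "0 \<le> ?e \<mu> \<nu> t" "0 \<le> ?e \<mu> \<mu> t" "0 \<le> ?e \<nu> \<nu> t" if "t > 0" for t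
    using gauss_energy_ge[OF that] M.gauss_energy_ge[OF that] N.gauss_energy_ge[OF that] that by auto
  have dn: "0 \<le> ?e \<mu> \<mu> t + ?e \<nu> \<nu> t - 2 * ?e \<mu> \<nu> t" if "t > 0" for t
  proof -
    have "?e \<mu> \<mu> t + ?e \<nu> \<nu> t - 2 * ?e \<mu> \<nu> t = (gauss_energy \<mu> \<mu> t + gauss_energy \<nu> \<nu> t - 2 * gauss_energy \<mu> \<nu> t) / (2 * t)"
      using that by (simp add: field_simps)
    thus ?thesis using gauss_energy_positive_definite(1)[OF that] that by simp
  qed
  have "shifted_energy R \<mu> \<mu> + shifted_energy R \<nu> \<nu> =
      (\<integral>\<^sup>+t. indicator {0<..} t * ennreal (?e \<mu> \<mu> t) + indicator {0<..} t * ennreal (?e \<nu> \<nu> t) \<partial>lborel)"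
    unfolding M.shifted_energy_gauss N.shifted_energy_gauss by (rule nn_integral_add[symmetric]) measurable
  also have "\<dots> = (\<integral>\<^sup>+t. 2 * (indicator {0<..} t * ennreal (?e \<mu> \<nu> t)) + ?d t \<partial>lborel)"
  proof (rule nn_integral_cong)
    fix t :: real
    show "indicator {0<..} t * ennreal (?e \<mu> \<mu> t) + indicator {0<..} t * ennreal (?e \<nu> \<nu> t) =
        2 * (indicator {0<..} t * ennreal (?e \<mu> \<nu> t)) + ?d t"
    proof (cases "t > 0")
      case True
      have "ennreal (?e \<mu> \<mu> t) + ennreal (?e \<nu> \<nu> t) = ennreal (2 * ?e \<mu> \<nu> t + (?e \<mu> \<mu> t + ?e \<nu> \<nu> t - 2 * ?e \<mu> \<nu> t))"
        using nn[OF True] by (simp add: ennreal_plus[symmetric] del: ennreal_plus)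
      also have "\<dots> = ennreal 2 * ennreal (?e \<mu> \<nu> t) + ennreal (?e \<mu> \<mu> t + ?e \<nu> \<nu> t - 2 * ?e \<mu> \<nu> t)"
        using nn[OF True] dn[OF True] by (simp only: ennreal_plus ennreal_mult zero_le_numeral mult_nonneg_nonneg)
      finally show ?thesis using True by simp
    qed simp
  qed
  also have "\<dots> = 2 * shifted_energy R \<mu> \<nu> + (\<integral>\<^sup>+t. ?d t \<partial>lborel)"
    unfolding shifted_energy_gauss
    by (subst nn_integral_add, measurable) (subst nn_integral_cmult, auto)
  finally have eq: "shifted_energy R \<mu> \<mu> + shifted_energy R \<nu> \<nu> = 2 * shifted_energy R \<mu> \<nu> + (\<integral>\<^sup>+t. ?d t \<partial>lborel)" .
  thus "2 * shifted_energy R \<mu> \<nu> \<le> shifted_energy R \<mu> \<mu> + shifted_energy R \<nu> \<nu>" by simp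
  assume fin: "shifted_energy R \<mu> \<nu> < \<infinity>" and "shifted_energy R \<mu> \<mu> + shifted_energy R \<nu> \<nu> = 2 * shifted_energy R \<mu> \<nu>"
  hence "2 * shifted_energy R \<mu> \<nu> + (\<integral>\<^sup>+t. ?d t \<partial>lborel) = 2 * shifted_energy R \<mu> \<nu> + 0" using eq by simp
  moreover have "2 * shifted_energy R \<mu> \<nu> \<noteq> \<infinity>" using fin by (simp add: ennreal_mult_eq_top_iff)
  ultimately have "(\<integral>\<^sup>+t. ?d t \<partial>lborel) = 0" by (simp add: ennreal_add_left_cancel)
  hence ae: "AE t in lborel. ?d t = 0" by (subst (asm) nn_integral_0_iff_AE) auto
  show "\<mu> = \<nu>"
  proof (rule gauss_conv_determines)
    fix T :: real
    \<comment> \<open>Narrow Gaussians are needed to separate measures; the equality holds for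
      almost every \<open>t\<close>, hence for arbitrarily large ones.\<close>
    have "\<exists>t\<in>{max 1 T..max 1 T + 1}. ?d t = 0"
    proof (rule ccontr)
      assume no: "\<not> (\<exists>t\<in>{max 1 T..max 1 T + 1}. ?d t = 0)"
      define a where "a = max 1 T"
      have "AE t in lborel. t \<notin> {a..a + 1}" using ae by eventually_elim (use no in \<open>unfold a_def, blast\<close>)
      moreover have "{t \<in> space lborel. \<not> t \<notin> {a..a + 1}} = {a..a + 1}" by auto
      ultimately have "emeasure lborel {a..a + 1} = 0" by (subst (asm) AE_iff_measurable[OF _ refl]) auto
      thus False by simp
    qed
    then obtain t where t: "t \<ge> max 1 T" "?d t = 0" by auto
    hence t0: "t > 0" by simp
    have "?e \<mu> \<mu> t + ?e \<nu> \<nu> t - 2 * ?e \<mu> \<nu> t = 0" using t(2) t0 dn[OF t0] by simp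
    moreover have "?e \<mu> \<mu> t + ?e \<nu> \<nu> t - 2 * ?e \<mu> \<nu> t = (gauss_energy \<mu> \<mu> t + gauss_energy \<nu> \<nu> t - 2 * gauss_energy \<mu> \<nu> t) / (2 * t)"
      using t0 by (simp add: field_simps)
    ultimately have "2 * gauss_energy \<mu> \<nu> t = gauss_energy \<mu> \<mu> t + gauss_energy \<nu> \<nu> t" using t0 by simp
    thus "\<exists>t\<ge>T. AE \<zeta> in lborel. gauss_conv \<mu> t \<zeta> = gauss_conv \<nu> t \<zeta>"
      using gauss_energy_positive_definite(2)[OF t0] t by (intro exI[of _ t]) auto
  qed (use \<mu>.prob_space_axioms \<nu>.prob_space_axioms sets_\<mu> sets_\<nu> in auto)
qed

section \<open>Characterization of the equilibrium measure\<close>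

text \<open>Adding a constant to an integrand bounded below replaces the difference of two
  nonnegative integrals by a single one.\<close>

lemma ereal_integral_shift:
  fixes f :: "'a \<Rightarrow> ereal"
  assumes M: "prob_space M" and [measurable]: "f \<in> borel_measurable M"
    and L: "L \<ge> 0" and ge: "AE x in M. f x \<ge> ereal (- L)"
  shows "ereal_integral M f = enn2ereal (\<integral>\<^sup>+x. e2ennreal (f x + ereal L) \<partial>M) - ereal L"
proof -
  interpret prob_space M by fact
  have pt: "e2ennreal (y + ereal L) + e2ennreal (- y) = e2ennreal y + ennreal L" if "y \<ge> ereal (- L)" for y
  proof (cases y)
    case (real r)
    thus ?thesis using that L
      by (cases "r \<ge> 0") (auto simp: e2ennreal_ereal ennreal_plus[symmetric] ennreal_neg simp del: ennreal_plus)
  qed (use that in \<open>auto simp: e2ennreal_infty e2ennreal_neg\<close>)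
  define P N S where "P = (\<integral>\<^sup>+x. e2ennreal (f x) \<partial>M)" and "N = (\<integral>\<^sup>+x. e2ennreal (- f x) \<partial>M)"
    and "S = (\<integral>\<^sup>+x. e2ennreal (f x + ereal L) \<partial>M)"
  have "S + N = (\<integral>\<^sup>+x. e2ennreal (f x + ereal L) + e2ennreal (- f x) \<partial>M)"
    unfolding S_def N_def by (rule nn_integral_add[symmetric]) measurable
  also have "\<dots> = (\<integral>\<^sup>+x. e2ennreal (f x) + ennreal L \<partial>M)"
    by (rule nn_integral_cong_AE, use ge in eventually_elim) (rule pt)
  also have "\<dots> = P + ennreal L"
    unfolding P_def by (subst nn_integral_add) (auto simp: emeasure_space_1)
  finally have eq: "S + N = P + ennreal L" .
  have "N \<le> (\<integral>\<^sup>+x. ennreal L \<partial>M)"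
    unfolding N_def
  proof (rule nn_integral_mono_AE, use ge in eventually_elim)
    fix x assume "f x \<ge> ereal (- L)"
    hence "- f x \<le> ereal L" by (simp add: ereal_uminus_le_reorder)
    hence "e2ennreal (- f x) \<le> e2ennreal (ereal L)" by (rule e2ennreal_mono)
    thus "e2ennreal (- f x) \<le> ennreal L" by (simp add: e2ennreal_ereal)
  qed
  also have "\<dots> = ennreal L" by (simp add: emeasure_space_1)
  finally have "N < \<infinity>" by (simp add: le_less_trans)
  then obtain n where n: "N = ennreal n" "n \<ge> 0" by (cases N) auto
  have "enn2ereal P - enn2ereal N = enn2ereal S - ereal L"
  proof (cases S)
    case (real s)
    hence "P < \<infinity>" using eq n by (metis ennreal_add_eq_top ennreal_neq_top infinity_ennreal_def top.not_eq_extremum)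
    then obtain p where p: "P = ennreal p" "p \<ge> 0" by (cases P) auto
    have "ennreal (s + n) = ennreal (p + L)" using eq real n p L by (simp add: ennreal_plus)
    moreover have "0 \<le> s + n" "0 \<le> p + L" using real n p L by auto
    ultimately have "s + n = p + L" by (simp only: ennreal_inj)
    thus ?thesis using real n p by (simp add: enn2ereal_ennreal)
  next
    case top
    hence "P + ennreal L = top" using eq by simp
    hence "P = top" by (simp add: ennreal_add_eq_top)
    thus ?thesis using top n by (simp add: enn2ereal_ennreal enn2ereal_top)
  qed
  thus ?thesis by (simp add: ereal_integral_def P_def N_def S_def)
qed

lemma ereal_integral_cong_AE:
  assumes "AE x in M. f x = g x" shows "ereal_integral M f = ereal_integral M g"
proof -
  have "(\<integral>\<^sup>+x. e2ennreal (f x) \<partial>M) = (\<integral>\<^sup>+x. e2ennreal (g x) \<partial>M)"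
    "(\<integral>\<^sup>+x. e2ennreal (- f x) \<partial>M) = (\<integral>\<^sup>+x. e2ennreal (- g x) \<partial>M)"
    by (rule nn_integral_cong_AE; use assms in eventually_elim; simp)+
  thus ?thesis by (simp add: ereal_integral_def)
qed

lemma measurable_log_kernel [measurable]:
  "(\<lambda>z. log_kernel (f z) (g z)) \<in> borel_measurable M"
  if [measurable]: "f \<in> borel_measurable M" "g \<in> borel_measurable M"
  unfolding log_kernel_def by measurable

lemma log_energy_eq_shifted:
  assumes \<mu>: "prob_space \<mu>" "sets \<mu> = sets borel" "AE z in \<mu>. z \<in> K"
    and R: "R \<ge> 1" "\<And>z w. z \<in> K \<Longrightarrow> w \<in> K \<Longrightarrow> norm (z - w) \<le> R"
  shows "log_energy \<mu> = enn2ereal (shifted_energy R \<mu> \<mu>) - ereal (ln R)"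
proof -
  interpret prob_space \<mu> by fact
  note [measurable_cong] = \<mu>(2)
  have L: "ln R \<ge> 0" using R by simp
  define S where "S = (\<lambda>w. \<integral>\<^sup>+z. shifted_kernel R z w \<partial>\<mu>)"
  have [measurable]: "S \<in> borel_measurable \<mu>" unfolding S_def by measurable
  have inner: "ereal_integral \<mu> (\<lambda>z. log_kernel z w) = enn2ereal (S w) - ereal (ln R)" if w: "w \<in> K" for w
    unfolding S_def shifted_kernel_def
  proof (rule ereal_integral_shift[OF \<mu>(1) _ L])
    show "AE z in \<mu>. log_kernel z w \<ge> ereal (- ln R)"
      using \<mu>(3)
    proof eventually_elim
      case (elim z)
      show ?case
      proof (cases "z = w")
        case False
        hence "ln (norm (z - w)) \<le> ln R" using R(2)[OF elim w] R(1) by (intro ln_mono) auto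
        thus ?thesis using False by (simp add: log_kernel_def)
      qed (simp add: log_kernel_def)
    qed
  qed measurable
  have "log_energy \<mu> = ereal_integral \<mu> (\<lambda>w. enn2ereal (S w) - ereal (ln R))"
    unfolding log_energy_def by (rule ereal_integral_cong_AE) (use \<mu>(3) inner in \<open>auto elim!: eventually_mono\<close>)
  also have "\<dots> = enn2ereal (\<integral>\<^sup>+w. e2ennreal (enn2ereal (S w) - ereal (ln R) + ereal (ln R)) \<partial>\<mu>) - ereal (ln R)"
  proof (rule ereal_integral_shift[OF \<mu>(1) _ L])
    show "(\<lambda>w. enn2ereal (S w) - ereal (ln R)) \<in> borel_measurable \<mu>" by measurable
    show "AE w in \<mu>. enn2ereal (S w) - ereal (ln R) \<ge> ereal (- ln R)"
    proof (rule AE_I2)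
      fix w
      have "0 - ereal (ln R) \<le> enn2ereal (S w) - ereal (ln R)" by (intro ereal_minus_mono) auto
      thus "ereal (- ln R) \<le> enn2ereal (S w) - ereal (ln R)" by (simp add: zero_ereal_def)
    qed
  qed
  also have "(\<integral>\<^sup>+w. e2ennreal (enn2ereal (S w) - ereal (ln R) + ereal (ln R)) \<partial>\<mu>) = shifted_energy R \<mu> \<mu>"
  proof -
    have "enn2ereal x - ereal (ln R) + ereal (ln R) = enn2ereal x" for x
      by (cases "enn2ereal x") auto
    moreover have "shifted_kernel R z w = shifted_kernel R w z" for z w
      by (auto simp: shifted_kernel_eq norm_minus_commute)
    ultimately show ?thesis by (simp add: S_def shifted_energy_def)
  qed
  finally show ?thesis .
qed

text \<open>A measure whose potential is constant on \<open>K\<close> has the same mutual energy with every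
  probability measure on \<open>K\<close>, so positive definiteness makes it the unique minimizer.\<close>

theorem equilibrium_measure_eqI:
  assumes K: "K \<in> sets borel" and R: "R \<ge> 1" "\<And>z w. z \<in> K \<Longrightarrow> w \<in> K \<Longrightarrow> norm (z - w) \<le> R"
    and \<nu>: "\<nu> \<in> prob_measures_on K"
    and const: "\<And>\<mu>. \<mu> \<in> prob_measures_on K \<Longrightarrow> shifted_energy R \<mu> \<nu> = ennreal E0"
  shows "equilibrium_measure K = \<nu>"
proof -
  have dest: "prob_space \<mu>" "sets \<mu> = sets borel" "AE z in \<mu>. z \<in> K" if "\<mu> \<in> prob_measures_on K" for \<mu>
  proof -
    show *: "prob_space \<mu>" "sets \<mu> = sets borel" using that by (auto simp: prob_measures_on_def)
    interpret prob_space \<mu> by fact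
    have "emeasure \<mu> K = 1" using that by (simp add: prob_measures_on_def)
    thus "AE z in \<mu>. z \<in> K" using K * AE_in_set_eq_1[of K] by (simp add: emeasure_eq_measure)
  qed
  have energy: "log_energy \<mu> = enn2ereal (shifted_energy R \<mu> \<mu>) - ereal (ln R)" if "\<mu> \<in> prob_measures_on K" for \<mu>
    by (rule log_energy_eq_shifted[OF dest[OF that] R])
  have loc: "two_prob_measures_on \<mu> \<nu> K R" if "\<mu> \<in> prob_measures_on K" for \<mu>
    unfolding two_prob_measures_on_def two_prob_measures_def two_prob_measures_on_axioms_def
    using dest[OF that] dest[OF \<nu>] R by auto
  have finite: "shifted_energy R \<nu> \<nu> = ennreal E0" by (rule const[OF \<nu>])
  have ge: "shifted_energy R \<nu> \<nu> \<le> shifted_energy R \<mu> \<mu>" if "\<mu> \<in> prob_measures_on K" for \<mu>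
  proof -
    have "2 * ennreal E0 \<le> shifted_energy R \<mu> \<mu> + ennreal E0"
      using two_prob_measures_on.shifted_energy_strictly_positive(1)[OF loc[OF that]] const[OF that] finite by simp
    hence "ennreal E0 + ennreal E0 \<le> ennreal E0 + shifted_energy R \<mu> \<mu>" by (simp add: mult_2 add.commute)
    thus ?thesis unfolding finite by (rule ennreal_add_left_cancel_le[THEN iffD1, THEN disjE]) auto
  qed
  show ?thesis
    unfolding equilibrium_measure_def
  proof (rule the_equality)
    show "\<nu> \<in> prob_measures_on K \<and> (\<forall>\<mu>\<in>prob_measures_on K. log_energy \<nu> \<le> log_energy \<mu>)"
      using \<nu> ge energy by (auto intro!: ereal_minus_mono simp: less_eq_ennreal.rep_eq)
    fix \<mu> assume \<mu>: "\<mu> \<in> prob_measures_on K \<and> (\<forall>\<mu>'\<in>prob_measures_on K. log_energy \<mu> \<le> log_energy \<mu>')"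
    hence "enn2ereal (shifted_energy R \<mu> \<mu>) - ereal (ln R) \<le> enn2ereal (shifted_energy R \<nu> \<nu>) - ereal (ln R)"
      using energy[of \<mu>] energy[OF \<nu>] \<nu> by auto
    hence "enn2ereal (shifted_energy R \<mu> \<mu>) \<le> enn2ereal (shifted_energy R \<nu> \<nu>)"
      by (cases "enn2ereal (shifted_energy R \<mu> \<mu>)"; cases "enn2ereal (shifted_energy R \<nu> \<nu>)") auto
    hence "shifted_energy R \<mu> \<mu> \<le> shifted_energy R \<nu> \<nu>" by (simp add: less_eq_ennreal.rep_eq)
    hence eq: "shifted_energy R \<mu> \<mu> = ennreal E0" using ge[of \<mu>] \<mu> finite by auto
    show "\<mu> = \<nu>"
      by (rule two_prob_measures_on.shifted_energy_strictly_positive(2)[OF loc])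
         (use \<mu> eq finite const[of \<mu>] in \<open>auto simp: mult_2\<close>)
  qed
qed

section \<open>Existence of the equilibrium measure\<close>

text \<open>Measures on a neighbourhood of a closed curve that shrinks to it are compared with measures
  on the parameter interval, where Helly's selection theorem gives a weakly convergent
  subsequence.\<close>

lemma weak_limit_on_curve:
  fixes g :: "real \<Rightarrow> complex" and c :: "nat \<Rightarrow> real \<Rightarrow> complex"
  assumes g: "continuous_on UNIV g" "range g = g ` {0..1}"
    and c: "\<And>n. continuous_on UNIV (c n)"
    and near: "\<And>\<eta>. \<eta> > 0 \<Longrightarrow> \<forall>\<^sub>F n in sequentially. \<forall>t. infdist (c n t) (range g) < \<eta>"
  shows "\<exists>m s. real_distribution m \<and> strict_mono (s :: nat \<Rightarrow> nat) \<and>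
    (\<forall>f :: complex \<Rightarrow> real. continuous_on UNIV f \<longrightarrow>
      (\<lambda>n. \<integral>t. f (c (s n) t) \<partial>unif01) \<longlonglongrightarrow> (\<integral>t. f (g t) \<partial>m))"
proof -
  have gc: "compact (range g)" unfolding g(2)
    by (intro compact_continuous_image continuous_on_subset[OF g(1)]) auto
  have "\<exists>N>0. \<forall>x\<in>{0..1}. \<forall>y\<in>{0..1}. \<bar>x - y\<bar> \<le> 1 / real N \<longrightarrow> norm (c n x - c n y) \<le> 1 / real (Suc n)" for n
  proof -
    have "uniformly_continuous_on {0..1} (c n)"
      by (intro compact_uniformly_continuous continuous_on_subset[OF c]) auto
    then obtain d where d: "d > 0" "\<And>x y. x \<in> {0..1} \<Longrightarrow> y \<in> {0..1} \<Longrightarrow> dist y x < d \<Longrightarrow> dist (c n y) (c n x) < 1 / real (Suc n)"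
      unfolding uniformly_continuous_on_def by (metis of_nat_0_less_iff zero_less_Suc zero_less_divide_1_iff)
    obtain N :: nat where N: "N > 0" "1 / real N < d" using nat_approx_posE[OF d(1)]
      by (metis of_nat_Suc zero_less_Suc)
    show ?thesis
      by (intro exI[of _ N] conjI ballI impI) (use N d(2) in \<open>force simp: dist_real_def dist_norm intro!: less_imp_le\<close>)+
  qed
  then obtain N where N: "\<And>n. N n > (0::nat)"
    "\<And>n x y. x \<in> {0..1} \<Longrightarrow> y \<in> {0..1} \<Longrightarrow> \<bar>x - y\<bar> \<le> 1 / real (N n) \<Longrightarrow> norm (c n x - c n y) \<le> 1 / real (Suc n)"
    by metis
  have "\<exists>t\<in>{0..1}. infdist z (range g) = dist z (g t)" for z
  proof -
    obtain x where "x \<in> range g" "infdist z (range g) = dist z x"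
      by (rule infdist_attains_inf[OF compact_imp_closed[OF gc], of z]) auto
    moreover from this(1) obtain t where "t \<in> {0..1}" "x = g t" unfolding g(2) by blast
    ultimately show ?thesis by (intro bexI[of _ t]) simp_all
  qed
  then obtain \<tau> where \<tau>: "\<And>z. \<tau> z \<in> {0..1::real}" "\<And>z. infdist z (range g) = dist z (g (\<tau> z))" by metis
  \<comment> \<open>A discrete approximation of the \<open>n\<close>th curve, projected to nearest
    points of the limit curve; the parameters of these points define a measure on the line.
    Discretizing makes measurability of the projection trivial.\<close>
  define T where "T = (\<lambda>n k. \<tau> (c n (real k / real (N n))))"
  define M where "M = (\<lambda>n. distr (uniform_count_measure {..<N n}) borel (T n))"
  have fin: "{..<N n} \<noteq> {}" for n using N(1)[of n] by auto
  have T_meas [measurable]: "T n \<in> uniform_count_measure {..<N n} \<rightarrow>\<^sub>M borel" for n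
    by (simp add: uniform_count_measure_def point_measure_def)
  have rd: "real_distribution (M n)" for n
  proof -
    interpret prob_space "uniform_count_measure {..<N n}"
      by (rule prob_space_uniform_count_measure) (use fin in auto)
    show ?thesis unfolding M_def real_distribution_def real_distribution_axioms_def
      by (auto intro!: prob_space_distr)
  qed
  have int_M: "integral\<^sup>L (M n) f = (\<Sum>k<N n. f (T n k)) / real (N n)" if "f \<in> borel_measurable borel" for f :: "real \<Rightarrow> real" and n
    unfolding M_def using that by (subst integral_distr) (auto simp: integral_uniform_count_measure)
  have "tight M"
    unfolding tight_def
  proof (intro conjI allI impI rd)
    fix \<epsilon> :: real assume e: "\<epsilon> > 0"
    \<comment> \<open>A half-open interval containing the parameter interval \<open>[0,
      1]\<close>.\<close>
    have "measure (M n) {-1<..1} = 1" for n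
    proof -
      interpret real_distribution "M n" by (rule rd)
      have "measure (M n) {-1<..1} = integral\<^sup>L (M n) (indicator {-1<..1})" by simp
      also have "\<dots> = (\<Sum>k<N n. indicator {-1<..1} (T n k)) / real (N n)" by (rule int_M) auto
      also have "(\<Sum>k<N n. indicator {-1<..1} (T n k)) = (\<Sum>k<N n. 1::real)"
      proof (rule sum.cong[OF refl])
        fix k
        have "T n k \<in> {-1<..1}" using \<tau>(1)[of "c n (real k / real (N n))"] by (simp add: T_def)
        thus "indicator {-1<..1} (T n k) = (1::real)" by (rule indicator_simps(1))
      qed
      finally show ?thesis using N(1)[of n] by simp
    qed
    thus "\<exists>a b. a < b \<and> (\<forall>n. 1 - \<epsilon> < measure (M n) {a<..b})" using e by (intro exI[of _ "-1"] exI[of _ 1]) auto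
  qed
  from tight_imp_convergent_subsubsequence[OF this strict_mono_id] obtain s m where
    s: "strict_mono (s :: nat \<Rightarrow> nat)" and m: "real_distribution m" and w: "weak_conv_m (M \<circ> s) m" by auto
  show ?thesis
  proof (intro exI[of _ m] exI[of _ s] conjI allI impI s m)
    fix f :: "complex \<Rightarrow> real" assume f: "continuous_on UNIV f"
    have fg: "continuous_on UNIV (\<lambda>t. f (g t))"
      by (rule continuous_on_compose2[OF f g(1)]) auto
    obtain B where B: "\<And>x. x \<in> range g \<Longrightarrow> norm (f x) \<le> B"
      using compact_imp_bounded[OF compact_continuous_image[OF continuous_on_subset[OF f] gc]]
      unfolding bounded_iff by auto
    have "(\<lambda>n. integral\<^sup>L ((M \<circ> s) n) (\<lambda>t. f (g t))) \<longlonglongrightarrow> integral\<^sup>L m (\<lambda>t. f (g t))"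
    proof (rule weak_conv_imp_integral_bdd_continuous_conv[OF _ m w])
      show "isCont (\<lambda>t. f (g t)) x" for x using fg by (simp add: continuous_on_eq_continuous_at)
    qed (use rd B in auto)
    moreover have "(\<lambda>n. (\<integral>t. f (c n t) \<partial>unif01) - integral\<^sup>L (M n) (\<lambda>t. f (g t))) \<longlonglongrightarrow> 0"
    proof (rule tendstoI)
      fix \<epsilon> :: real assume e: "\<epsilon> > 0"
      define X where "X = {x. infdist x (range g) \<le> 1}"
      have "compact X" unfolding X_def by (rule compact_infdist_le[OF _ gc]) auto
      hence "uniformly_continuous_on X f"
        by (intro compact_uniformly_continuous continuous_on_subset[OF f]) auto
      then obtain d where d: "d > 0" "\<And>x y. x \<in> X \<Longrightarrow> y \<in> X \<Longrightarrow> dist y x < d \<Longrightarrow> dist (f y) (f x) < \<epsilon> / 3"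
        using e unfolding uniformly_continuous_on_def by (metis divide_pos_pos zero_less_numeral)
      have "\<forall>\<^sub>F n in sequentially. \<forall>t. infdist (c n t) (range g) < min d 1" by (rule near) (use d in auto)
      moreover have "\<forall>\<^sub>F n in sequentially. 1 / real (Suc n) < d"
        using LIMSEQ_inverse_real_of_nat d(1) by (auto simp: inverse_eq_divide intro: order_tendstoD)
      ultimately show "\<forall>\<^sub>F n in sequentially. dist ((\<integral>t. f (c n t) \<partial>unif01) - integral\<^sup>L (M n) (\<lambda>t. f (g t))) 0 < \<epsilon>"
      proof eventually_elim
        case (elim n)
        have cX: "c n t \<in> X" for t using elim(1) by (auto simp: X_def intro: less_imp_le)
        have gX: "g t \<in> X" for t by (simp add: X_def)
        have fc: "continuous_on UNIV (\<lambda>t. f (c n t))"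
          by (rule continuous_on_compose2[OF f c]) auto
        have "\<bar>(\<Sum>k<N n. f (c n (real k / real (N n)))) / real (N n) - integral {0..1} (\<lambda>t. f (c n t))\<bar> \<le> \<epsilon> / 3"
        proof (rule riemann_sum_bound[OF N(1)])
          fix x y assume xy: "x \<in> {0..1::real}" "y \<in> {0..1::real}" "\<bar>x - y\<bar> \<le> 1 / real (N n)"
          have "dist (c n x) (c n y) < d" using N(2)[OF xy] elim(2) by (simp add: dist_norm)
          thus "\<bar>f (c n x) - f (c n y)\<bar> \<le> \<epsilon> / 3" using d(2)[OF cX cX] by (auto simp: dist_real_def intro: less_imp_le)
        qed (rule continuous_on_subset[OF fc], simp)
        moreover have "\<bar>(\<Sum>k<N n. f (g (T n k))) / real (N n) - (\<Sum>k<N n. f (c n (real k / real (N n)))) / real (N n)\<bar> \<le> \<epsilon> / 3"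
        proof -
          have "\<bar>f (g (T n k)) - f (c n (real k / real (N n)))\<bar> \<le> \<epsilon> / 3" for k
          proof -
            have "dist (g (T n k)) (c n (real k / real (N n))) < d"
              using elim(1) \<tau>(2) unfolding T_def by (metis dist_commute min_less_iff_conj)
            thus ?thesis using d(2)[OF cX gX] by (auto simp: dist_real_def intro: less_imp_le)
          qed
          hence "\<bar>\<Sum>k<N n. f (g (T n k)) - f (c n (real k / real (N n)))\<bar> \<le> (\<Sum>k<N n. \<epsilon> / 3)"
            by (intro order_trans[OF sum_abs] sum_mono) auto
          hence "\<bar>\<Sum>k<N n. f (g (T n k)) - f (c n (real k / real (N n)))\<bar> / real (N n) \<le> (real (N n) * (\<epsilon> / 3)) / real (N n)"
            by (intro divide_right_mono) auto
          moreover have "\<bar>(\<Sum>k<N n. f (g (T n k))) / real (N n) - (\<Sum>k<N n. f (c n (real k / real (N n)))) / real (N n)\<bar> =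
              \<bar>\<Sum>k<N n. f (g (T n k)) - f (c n (real k / real (N n)))\<bar> / real (N n)"
            by (simp add: sum_subtractf diff_divide_distrib[symmetric])
          ultimately show ?thesis using N(1)[of n] by simp
        qed
        moreover have "(\<integral>t. f (c n t) \<partial>unif01) = integral {0..1} (\<lambda>t. f (c n t))"
          by (rule integral_unif01) (use fc in \<open>auto intro: continuous_on_subset borel_measurable_continuous_onI\<close>)
        moreover have "integral\<^sup>L (M n) (\<lambda>t. f (g t)) = (\<Sum>k<N n. f (g (T n k))) / real (N n)"
          by (rule int_M) (rule borel_measurable_continuous_onI[OF fg])
        ultimately show ?case using e unfolding dist_real_def by linarith
      qed
    qed
    from LIMSEQ_subseq_LIMSEQ[OF this s]
    have "(\<lambda>n. (\<integral>t. f (c (s n) t) \<partial>unif01) - integral\<^sup>L (M (s n)) (\<lambda>t. f (g t))) \<longlonglongrightarrow> 0" by (simp add: o_def)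
    ultimately have "(\<lambda>n. ((\<integral>t. f (c (s n) t) \<partial>unif01) - integral\<^sup>L (M (s n)) (\<lambda>t. f (g t))) + integral\<^sup>L (M (s n)) (\<lambda>t. f (g t)))
        \<longlonglongrightarrow> 0 + integral\<^sup>L m (\<lambda>t. f (g t))"
      by (intro tendsto_add) (auto simp: o_def)
    thus "(\<lambda>n. \<integral>t. f (c (s n) t) \<partial>unif01) \<longlonglongrightarrow> (\<integral>t. f (g t) \<partial>m)" by simp
  qed
qed

text \<open>Tonelli's theorem for a real function bounded above whose partial integrals exist.\<close>

lemma iterated_integral_swap:
  fixes F :: "'a \<Rightarrow> 'b \<Rightarrow> real"
  assumes M: "prob_space M" "prob_space N"
    and [measurable]: "case_prod F \<in> borel_measurable (M \<Otimes>\<^sub>M N)"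
    and le: "\<And>x y. F x y \<le> L"
    and i1: "\<And>x. integrable N (F x)" and i2: "\<And>y. integrable M (\<lambda>x. F x y)"
    and I1: "integrable M (\<lambda>x. \<integral>y. F x y \<partial>N)" and I2: "integrable N (\<lambda>y. \<integral>x. F x y \<partial>M)"
  shows "(\<integral>x. (\<integral>y. F x y \<partial>N) \<partial>M) = (\<integral>y. (\<integral>x. F x y \<partial>M) \<partial>N)"
proof -
  interpret M: prob_space M by fact
  interpret N: prob_space N by fact
  interpret P: pair_sigma_finite M N ..
  have e1: "(\<integral>\<^sup>+y. ennreal (L - F x y) \<partial>N) = ennreal (L - (\<integral>y. F x y \<partial>N))" for x
    using i1[of x] le by (subst nn_integral_eq_integral) (auto simp: N.prob_space)
  have e2: "(\<integral>\<^sup>+x. ennreal (L - F x y) \<partial>M) = ennreal (L - (\<integral>x. F x y \<partial>M))" for y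
    using i2[of y] le by (subst nn_integral_eq_integral) (auto simp: M.prob_space)
  have l1: "(\<integral>y. F x y \<partial>N) \<le> L" for x by (rule N.integral_le_const[OF i1]) (use le in auto)
  have l2: "(\<integral>x. F x y \<partial>M) \<le> L" for y by (rule M.integral_le_const[OF i2]) (use le in auto)
  have L1: "(\<integral>x. (\<integral>y. F x y \<partial>N) \<partial>M) \<le> L" by (rule M.integral_le_const[OF I1]) (use l1 in auto)
  have L2: "(\<integral>y. (\<integral>x. F x y \<partial>M) \<partial>N) \<le> L" by (rule N.integral_le_const[OF I2]) (use l2 in auto)
  have "ennreal (L - (\<integral>x. (\<integral>y. F x y \<partial>N) \<partial>M)) = (\<integral>\<^sup>+x. ennreal (L - (\<integral>y. F x y \<partial>N)) \<partial>M)"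
    using I1 l1 by (subst nn_integral_eq_integral) (auto simp: M.prob_space)
  also have "\<dots> = (\<integral>\<^sup>+x. (\<integral>\<^sup>+y. ennreal (L - F x y) \<partial>N) \<partial>M)" by (simp only: e1)
  also have "\<dots> = (\<integral>\<^sup>+y. (\<integral>\<^sup>+x. ennreal (L - F x y) \<partial>M) \<partial>N)" by (rule P.Fubini'[symmetric]) measurable
  also have "\<dots> = (\<integral>\<^sup>+y. ennreal (L - (\<integral>x. F x y \<partial>M)) \<partial>N)" by (simp only: e2)
  also have "\<dots> = ennreal (L - (\<integral>y. (\<integral>x. F x y \<partial>M) \<partial>N))"
    using I2 l2 by (subst nn_integral_eq_integral) (auto simp: N.prob_space)
  finally have "L - (\<integral>x. (\<integral>y. F x y \<partial>N) \<partial>M) = L - (\<integral>y. (\<integral>x. F x y \<partial>M) \<partial>N)"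
    using L1 L2 by (subst (asm) ennreal_inj) auto
  thus ?thesis by simp
qed

definition circle_mean :: "(complex \<Rightarrow> real) \<Rightarrow> complex \<Rightarrow> real \<Rightarrow> real" where
  "circle_mean u z s = (\<integral>t. u (z + of_real s * ucirc t) \<partial>unif01)"

lemma integrable_circle:
  fixes u :: "complex \<Rightarrow> real"
  assumes "continuous_on UNIV u"
  shows "integrable unif01 (\<lambda>t. u (z + of_real s * ucirc t))"
  by (intro integrable_unif01_continuous continuous_on_compose2[OF assms]) (auto intro!: continuous_intros)

lemma circle_mean_tendsto:
  assumes u: "continuous_on UNIV u" and s: "s \<longlonglongrightarrow> 0"
  shows "(\<lambda>n. circle_mean u z (s n)) \<longlonglongrightarrow> u z"
proof (rule tendstoI)
  interpret prob_space unif01 by (rule prob_space_unif01)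
  fix \<epsilon> :: real assume e: "\<epsilon> > 0"
  have "isCont u z" using u by (simp add: continuous_on_eq_continuous_at)
  then obtain d where d: "d > 0" "\<And>x. dist x z < d \<Longrightarrow> dist (u x) (u z) < \<epsilon> / 2"
    unfolding continuous_at_eps_delta using e half_gt_zero by blast
  have "\<forall>\<^sub>F n in sequentially. dist (s n) 0 < d" using s d(1) by (rule tendstoD)
  thus "\<forall>\<^sub>F n in sequentially. dist (circle_mean u z (s n)) (u z) < \<epsilon>"
  proof eventually_elim
    case (elim n)
    have "norm (\<integral>t. u (z + of_real (s n) * ucirc t) - u z \<partial>unif01) \<le> (\<integral>t. \<epsilon> / 2 \<partial>unif01)"
    proof (rule Bochner_Integration.integral_norm_bound[THEN order_trans], rule integral_mono)
      fix t
      have "dist (z + of_real (s n) * ucirc t) z < d" using elim by (simp add: dist_norm norm_mult)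
      thus "norm (u (z + of_real (s n) * ucirc t) - u z) \<le> \<epsilon> / 2" using d(2) by (auto simp: dist_norm intro: less_imp_le)
    qed (use integrable_circle[OF u] in auto)
    moreover have "(\<integral>t. u (z + of_real (s n) * ucirc t) - u z \<partial>unif01) = circle_mean u z (s n) - u z"
      using integrable_circle[OF u] by (simp add: circle_mean_def prob_space[simplified])
    ultimately show ?case using e prob_space by (simp add: dist_real_def)
  qed
qed

context exterior_map
begin

lemma cont_green_max: "continuous_on UNIV (\<lambda>z. log_capacity + max (green z) c)"
  by (intro continuous_intros continuous_green)

lemma cont_log_capacity_green: "continuous_on UNIV (\<lambda>z. log_capacity + green z)"
  by (intro continuous_intros continuous_green)

text \<open>Exchanging the two circle averages of \<open>ln |z + s e(\<tau>) - \<psi> (r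
  e(t))|\<close>, where \<open>e\<close> parametrizes the unit circle: the inner average over
  \<open>\<tau>\<close> truncates the logarithm, the one over \<open>t\<close> is the potential of
  the level curve.\<close>

lemma circle_mean_log_capacity_green_r:
  assumes r: "0 < r" "r < 1" and s: "s > 0"
  shows "(\<integral>t. ln (max s (norm (z - \<psi> (of_real r * ucirc t)))) \<partial>unif01) =
    circle_mean (\<lambda>z. log_capacity + max (green z) (- ln r)) z s"
proof -
  let ?c = "\<lambda>t. \<psi> (of_real r * ucirc t)"
  have c: "continuous_on UNIV ?c" by (rule continuous_\<psi>_circle[OF r])
  hence [measurable]: "?c \<in> borel_measurable borel" by (rule borel_measurable_continuous_onI)
  have per: "?c ` UNIV \<subseteq> \<psi> ` sphere 0 r" using r by (auto simp: norm_mult)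
  have "compact (\<psi> ` sphere 0 r)"
    by (intro compact_continuous_image continuous_on_subset[OF continuous_on_\<psi>]) (use r in auto)
  then obtain B where B: "\<And>x. x \<in> \<psi> ` sphere 0 r \<Longrightarrow> norm x \<le> B"
    using compact_imp_bounded bounded_iff by metis
  have B: "norm (?c t) \<le> B" for t using B per by blast
  define F where "F = (\<lambda>\<tau> t. ln (norm ((z + of_real s * ucirc \<tau>) - ?c t)))"
  have Fa: "F \<tau> t = ln (norm (of_real s * ucirc \<tau> - (?c t - z)))" for \<tau> t unfolding F_def by (simp add: algebra_simps)
  note A = circle_mean_ln_dist[OF s]
  note Q = circle_mean_ln_\<psi>[OF r]
  have "(\<integral>\<tau>. (\<integral>t. F \<tau> t \<partial>unif01) \<partial>unif01) = (\<integral>t. (\<integral>\<tau>. F \<tau> t \<partial>unif01) \<partial>unif01)"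
  proof (rule iterated_integral_swap[OF prob_space_unif01 prob_space_unif01, where L = "norm z + s + B + 1"])
    show "case_prod F \<in> borel_measurable (unif01 \<Otimes>\<^sub>M unif01)" unfolding F_def by measurable
    fix \<tau> t
    show "F \<tau> t \<le> norm z + s + B + 1"
    proof (cases "(z + of_real s * ucirc \<tau>) - ?c t = 0")
      case False
      have "F \<tau> t \<le> norm ((z + of_real s * ucirc \<tau>) - ?c t)"
        unfolding F_def using False by (intro ln_bound) auto
      also have "\<dots> \<le> norm z + norm (of_real s * ucirc \<tau>) + norm (?c t)"
        by (intro order_trans[OF norm_triangle_ineq4] add_right_mono norm_triangle_ineq)
      also have "\<dots> \<le> norm z + s + B + 1" using B[of t] s by (simp add: norm_mult)
      finally show ?thesis .
    next
      case True
      have "0 \<le> B" using B[of t] norm_ge_zero order_trans by blast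
      thus ?thesis using True s by (simp add: F_def)
    qed
    show "integrable unif01 (F \<tau>)" unfolding F_def using Q by blast
    show "integrable unif01 (\<lambda>\<tau>. F \<tau> t)" unfolding Fa by (rule A(1))
    have "(\<lambda>\<tau>. \<integral>t. F \<tau> t \<partial>unif01) = (\<lambda>\<tau>. log_capacity + max (green (z + of_real s * ucirc \<tau>)) (- ln r))"
      unfolding F_def using Q by auto
    thus "integrable unif01 (\<lambda>\<tau>. \<integral>t. F \<tau> t \<partial>unif01)"
      using integrable_circle[OF cont_green_max] by simp
    have "(\<lambda>t. \<integral>\<tau>. F \<tau> t \<partial>unif01) = (\<lambda>t. ln (max s (norm (?c t - z))))" unfolding Fa A(2) ..
    thus "integrable unif01 (\<lambda>t. \<integral>\<tau>. F \<tau> t \<partial>unif01)"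
      using s c by (auto intro!: integrable_unif01_continuous continuous_intros)
  qed
  moreover have "(\<integral>\<tau>. F \<tau> t \<partial>unif01) = ln (max s (norm (z - ?c t)))" for t
    unfolding Fa A(2) by (simp add: norm_minus_commute)
  moreover have "(\<integral>t. F \<tau> t \<partial>unif01) = log_capacity + max (green (z + of_real s * ucirc \<tau>)) (- ln r)" for \<tau>
    unfolding F_def using Q by blast
  ultimately show ?thesis by (simp add: circle_mean_def)
qed

text \<open>A segment from a point outside \<open>K\<close> to a nearby point of \<open>K\<close>
  meets the frontier.\<close>

lemma \<psi>_near_frontier:
  assumes "\<eta> > 0" and sub: "frontier K \<subseteq> C"
  shows "\<exists>\<rho>0<1. 0 < \<rho>0 \<and> (\<forall>w. \<rho>0 < norm w \<longrightarrow> norm w < 1 \<longrightarrow> infdist (\<psi> w) C < \<eta>)"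
proof -
  define V where "V = (\<Union>x\<in>K. ball x \<eta>)"
  have "open V" "K \<subseteq> V" using assms by (auto simp: V_def)
  then obtain \<rho>0 where r: "0 < \<rho>0" "\<rho>0 < 1" "\<And>w. \<rho>0 < norm w \<Longrightarrow> norm w < 1 \<Longrightarrow> \<psi> w \<in> V"
    using \<psi>_near_K by metis
  show ?thesis
  proof (intro exI[of _ \<rho>0] conjI allI impI r)
    fix w :: complex assume w: "\<rho>0 < norm w" "norm w < 1"
    then obtain x where x: "x \<in> K" "dist x (\<psi> w) < \<eta>" using r(3)[OF w] by (auto simp: V_def)
    have "\<psi> w \<notin> K" using w r(1) by (intro \<psi>_notin) auto
    hence "closed_segment x (\<psi> w) \<inter> frontier K \<noteq> {}"
      using x by (intro connected_Int_frontier) auto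
    then obtain y where y: "y \<in> closed_segment x (\<psi> w)" "y \<in> frontier K" by blast
    have "infdist (\<psi> w) C \<le> dist (\<psi> w) y" by (rule infdist_le) (use y sub in auto)
    also have "\<dots> \<le> dist x (\<psi> w)" using dist_in_closed_segment[OF y(1)] by (auto simp: dist_commute)
    finally show "infdist (\<psi> w) C < \<eta>" using x by simp
  qed
qed

text \<open>The equilibrium measure arises as a weak limit of harmonic measures of level curves of the
  Green function. Averaging the logarithm over circles makes the potentials continuous, so they pass
  to the limit.\<close>

theorem limit_measure_exists:
  fixes g :: "real \<Rightarrow> complex"
  assumes g: "continuous_on UNIV g" "range g = g ` {0..1}" "frontier K \<subseteq> range g"
  shows "\<exists>\<nu>. prob_space \<nu> \<and> sets \<nu> = sets borel \<and> emeasure \<nu> (range g) = 1 \<and>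
    (\<forall>z s. s > 0 \<longrightarrow> (\<integral>w. ln (max s (norm (z - w))) \<partial>\<nu>) = circle_mean (\<lambda>z. log_capacity + green z) z s)"
proof -
  interpret U: prob_space unif01 by (rule prob_space_unif01)
  define r where "r = (\<lambda>n. 1 - 1 / (real n + 2))"
  have r: "0 < r n" "r n < 1" for n by (auto simp: r_def field_simps)
  have r_lim: "r \<longlonglongrightarrow> 1" unfolding r_def by real_asymp
  define c where "c = (\<lambda>n t. \<psi> (of_real (r n) * ucirc t))"
  have near: "\<forall>\<^sub>F n in sequentially. \<forall>t. infdist (c n t) (range g) < \<eta>" if pos: "\<eta> > 0" for \<eta>
  proof -
    obtain \<rho>0 where \<rho>0: "\<rho>0 < 1" "\<And>w. \<rho>0 < norm w \<Longrightarrow> norm w < 1 \<Longrightarrow> infdist (\<psi> w) (range g) < \<eta>"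
      using \<psi>_near_frontier[OF pos g(3)] by blast
    have "\<forall>\<^sub>F n in sequentially. \<rho>0 < r n" using order_tendstoD(1)[OF r_lim \<rho>0(1)] .
    thus ?thesis by eventually_elim (use r in \<open>auto simp: c_def norm_mult abs_of_pos intro!: \<rho>0(2)\<close>)
  qed
  have cc: "continuous_on UNIV (c n)" for n
    unfolding c_def by (rule continuous_\<psi>_circle[OF r])
  obtain m s where m: "real_distribution m" and s: "strict_mono (s :: nat \<Rightarrow> nat)" and
    lim: "\<And>f :: complex \<Rightarrow> real. continuous_on UNIV f \<Longrightarrow> (\<lambda>n. \<integral>t. f (c (s n) t) \<partial>unif01) \<longlonglongrightarrow> (\<integral>t. f (g t) \<partial>m)"
    using weak_limit_on_curve[OF g(1,2) cc near] by blast
  interpret m: real_distribution m by (rule m)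
  have [measurable]: "g \<in> borel_measurable borel" by (rule borel_measurable_continuous_onI[OF g(1)])
  have gm: "g \<in> m \<rightarrow>\<^sub>M borel" by measurable
  define \<nu> where "\<nu> = distr m borel g"
  have gC: "closed (range g)" unfolding g(2)
    by (intro compact_imp_closed compact_continuous_image continuous_on_subset[OF g(1)]) auto
  have "emeasure \<nu> (range g) = emeasure m (g -` range g \<inter> space m)"
    unfolding \<nu>_def by (rule emeasure_distr[OF gm]) (use gC in auto)
  also have "g -` range g \<inter> space m = space m" by auto
  finally have em: "emeasure \<nu> (range g) = 1" using m.emeasure_space_1 by simp
  show ?thesis
  proof (intro exI[of _ \<nu>] conjI allI impI em)
    show "prob_space \<nu>" unfolding \<nu>_def by (rule m.prob_space_distr[OF gm])
    show "sets \<nu> = sets borel" by (simp add: \<nu>_def)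
    fix z :: complex and \<sigma> :: real assume sg: "\<sigma> > 0"
    have cont: "continuous_on UNIV (\<lambda>w. ln (max \<sigma> (norm (z - w))))"
      using sg by (intro continuous_intros) auto
    hence "(\<integral>w. ln (max \<sigma> (norm (z - w))) \<partial>\<nu>) = (\<integral>t. ln (max \<sigma> (norm (z - g t))) \<partial>m)"
      unfolding \<nu>_def by (subst integral_distr[OF gm]) (auto intro: borel_measurable_continuous_onI)
    moreover have "(\<lambda>n. circle_mean (\<lambda>z. log_capacity + max (green z) (- ln (r (s n)))) z \<sigma>) \<longlonglongrightarrow> (\<integral>t. ln (max \<sigma> (norm (z - g t))) \<partial>m)"
      using lim[OF cont] circle_mean_log_capacity_green_r[OF r sg] by (simp add: c_def)
    moreover have "(\<lambda>n. circle_mean (\<lambda>z. log_capacity + max (green z) (- ln (r (s n)))) z \<sigma>) \<longlonglongrightarrow> circle_mean (\<lambda>z. log_capacity + green z) z \<sigma>"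
    proof (rule LIM_zero_cancel, rule Lim_null_comparison)
      have "(\<lambda>n. - ln (r (s n))) \<longlonglongrightarrow> - ln 1"
        by (intro tendsto_minus tendsto_ln LIMSEQ_subseq_LIMSEQ[OF r_lim s, unfolded o_def]) auto
      thus "(\<lambda>n. - ln (r (s n))) \<longlonglongrightarrow> 0" by simp
      show "\<forall>\<^sub>F n in sequentially. norm (circle_mean (\<lambda>z. log_capacity + max (green z) (- ln (r (s n)))) z \<sigma> - circle_mean (\<lambda>z. log_capacity + green z) z \<sigma>) \<le> - ln (r (s n))"
      proof (rule always_eventually, rule allI)
        fix n
        let ?L = "- ln (r (s n))"
        have L: "?L \<ge> 0" using r[of "s n"] by simp
        have i: "integrable unif01 (\<lambda>t. log_capacity + max (green (z + of_real \<sigma> * ucirc t)) ?L)"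
            "integrable unif01 (\<lambda>t. log_capacity + green (z + of_real \<sigma> * ucirc t))"
          using integrable_circle[OF cont_green_max] integrable_circle[OF cont_log_capacity_green] by simp_all
        have "circle_mean (\<lambda>z. log_capacity + max (green z) ?L) z \<sigma> - circle_mean (\<lambda>z. log_capacity + green z) z \<sigma> =
            (\<integral>t. (log_capacity + max (green (z + of_real \<sigma> * ucirc t)) ?L) - (log_capacity + green (z + of_real \<sigma> * ucirc t)) \<partial>unif01)"
          unfolding circle_mean_def using i by (intro Bochner_Integration.integral_diff[symmetric])
        also have "norm \<dots> \<le> (\<integral>t. ?L \<partial>unif01)"
        proof (rule Bochner_Integration.integral_norm_bound[THEN order_trans], rule integral_mono)
          show "integrable unif01 (\<lambda>t. norm ((log_capacity + max (green (z + of_real \<sigma> * ucirc t)) ?L) - (log_capacity + green (z + of_real \<sigma> * ucirc t))))"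
            by (intro integrable_norm Bochner_Integration.integrable_diff i)
          show "integrable unif01 (\<lambda>t. ?L)" by simp
          fix t show "norm ((log_capacity + max (green (z + of_real \<sigma> * ucirc t)) ?L) - (log_capacity + green (z + of_real \<sigma> * ucirc t))) \<le> ?L"
            using green_nonneg[of "z + of_real \<sigma> * ucirc t"] L by (auto simp: max_def)
        qed
        finally show "norm (circle_mean (\<lambda>z. log_capacity + max (green z) ?L) z \<sigma> - circle_mean (\<lambda>z. log_capacity + green z) z \<sigma>) \<le> ?L"
          using U.prob_space by simp
      qed
    qed
    ultimately show "(\<integral>w. ln (max \<sigma> (norm (z - w))) \<partial>\<nu>) = circle_mean (\<lambda>z. log_capacity + green z) z \<sigma>"
      using LIMSEQ_unique by metis
  qed
qed

text \<open>Letting the radius of the circles tend to zero recovers the potential itself, which is the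
  constant \<open>log_capacity\<close> on all of \<open>K\<close> since the Green function is continuous.\<close>

theorem equilibrium_measure_exterior:
  assumes C: "C \<subseteq> K" "C \<in> sets borel" and \<nu>: "prob_space \<nu>" "sets \<nu> = sets borel" "emeasure \<nu> C = 1"
    and pot: "\<And>z s. s > 0 \<Longrightarrow> (\<integral>w. ln (max s (norm (z - w))) \<partial>\<nu>) = circle_mean (\<lambda>z. log_capacity + green z) z s"
  shows "equilibrium_measure K = \<nu>"
proof -
  interpret \<nu>: prob_space \<nu> by fact
  note [measurable_cong] = \<nu>(2)
  have K_borel: "K \<in> sets borel" using compact_K by (simp add: compact_imp_closed)
  obtain B where B: "\<And>z. z \<in> K \<Longrightarrow> norm z \<le> B" "B > 0"
    using compact_imp_bounded[OF compact_K] unfolding bounded_pos by auto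
  define R where "R = max 1 (2 * B)"
  have R: "R \<ge> 1" "norm (z - w) \<le> R" if "z \<in> K" "w \<in> K" for z w
    unfolding R_def using B(1)[OF that(1)] B(1)[OF that(2)] norm_triangle_ineq4[of z w] by linarith+
  have R: "R \<ge> 1" "\<And>z w. z \<in> K \<Longrightarrow> w \<in> K \<Longrightarrow> norm (z - w) \<le> R"
    using R(2) by (auto simp: R_def)
  have \<nu>C: "AE w in \<nu>. w \<in> C" using \<nu>.AE_in_set_eq_1[of C] \<nu> C by (simp add: \<nu>.emeasure_eq_measure)
  hence \<nu>K: "AE w in \<nu>. w \<in> K" using C by (auto elim!: eventually_mono)
  have "emeasure \<nu> K = 1" using \<nu>.AE_in_set_eq_1[of K] \<nu>K \<nu>(2) K_borel by (simp add: \<nu>.emeasure_eq_measure)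
  hence \<nu>_in: "\<nu> \<in> prob_measures_on K" using \<nu> by (simp add: prob_measures_on_def)
  define s where "s = (\<lambda>n. 1 / (real n + 1))"
  have s: "s n > 0" "s n \<le> 1" "s \<longlonglongrightarrow> 0" for n
    unfolding s_def by (auto simp: field_simps) real_asymp
  have sdec: "s (Suc n) \<le> s n" for n by (simp add: s_def field_simps)
  have potential: "(\<integral>\<^sup>+w. shifted_kernel R z w \<partial>\<nu>) = ennreal (ln R - log_capacity)" if z: "z \<in> K" for z
  proof -
    let ?f = "\<lambda>n w. ennreal (ln R - ln (max (s n) (norm (z - w))))"
    have "(\<lambda>n. \<integral>\<^sup>+w. ?f n w \<partial>\<nu>) \<longlonglongrightarrow> (\<integral>\<^sup>+w. shifted_kernel R z w \<partial>\<nu>)"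
    proof (rule nn_integral_LIMSEQ)
      show "incseq ?f"
      proof (rule incseq_SucI, rule le_funI, rule ennreal_leI)
        fix n w
        have "ln (max (s (Suc n)) (norm (z - w))) \<le> ln (max (s n) (norm (z - w)))"
          using s(1)[of "Suc n"] sdec[of n] by (intro ln_mono) auto
        thus "ln R - ln (max (s n) (norm (z - w))) \<le> ln R - ln (max (s (Suc n)) (norm (z - w)))" by simp
      qed
      show "?f n \<in> borel_measurable \<nu>" for n by measurable
      fix w
      show "(\<lambda>n. ?f n w) \<longlonglongrightarrow> shifted_kernel R z w"
      proof (cases "z = w")
        case True
        have "filterlim (\<lambda>n. ln R - ln (s n)) at_top sequentially" unfolding s_def by real_asymp
        hence "(\<lambda>n. ennreal (ln R - ln (s n))) \<longlonglongrightarrow> \<infinity>" by (simp add: ennreal_tendsto_top_eq_at_top)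
        moreover have "max (s n) 0 = s n" for n using s(1)[of n] by simp
        ultimately show ?thesis using True by (simp add: shifted_kernel_eq)
      next
        case False
        have "(\<lambda>n. max (s n) (norm (z - w))) \<longlonglongrightarrow> max 0 (norm (z - w))" by (intro tendsto_intros s)
        hence "(\<lambda>n. ?f n w) \<longlonglongrightarrow> ennreal (ln R - ln (norm (z - w)))"
          using False by (intro tendsto_ennrealI tendsto_intros) auto
        thus ?thesis using False by (simp add: shifted_kernel_eq)
      qed
    qed
    moreover have "(\<integral>\<^sup>+w. ?f n w \<partial>\<nu>) = ennreal (ln R - circle_mean (\<lambda>z. log_capacity + green z) z (s n))" for n
    proof -
      have bound: "AE w in \<nu>. ln (max (s n) (norm (z - w))) \<le> ln R"
        using \<nu>K
      proof eventually_elim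
        case (elim w)
        have "max (s n) (norm (z - w)) \<le> R" using R(2)[OF z elim] R(1) s(2)[of n] by simp
        thus ?case using s(1)[of n] by (intro ln_mono) auto
      qed
      have low: "ln (s n) \<le> ln (max (s n) (norm (z - w)))" for w using s(1)[of n] by (intro ln_mono) auto
      have int: "integrable \<nu> (\<lambda>w. ln (max (s n) (norm (z - w))))"
      proof (rule \<nu>.integrable_const_bound[of _ "\<bar>ln (s n)\<bar> + \<bar>ln R\<bar>"])
        show "AE w in \<nu>. norm (ln (max (s n) (norm (z - w)))) \<le> \<bar>ln (s n)\<bar> + \<bar>ln R\<bar>"
          using bound
        proof eventually_elim
          case (elim w) thus ?case using low[of w] unfolding real_norm_def by linarith
        qed
      qed measurable
      have "(\<integral>\<^sup>+w. ?f n w \<partial>\<nu>) = ennreal (\<integral>w. ln R - ln (max (s n) (norm (z - w))) \<partial>\<nu>)"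
        by (rule nn_integral_eq_integral) (use int bound in auto)
      also have "(\<integral>w. ln R - ln (max (s n) (norm (z - w))) \<partial>\<nu>) = ln R - circle_mean (\<lambda>z. log_capacity + green z) z (s n)"
        using int pot[OF s(1)] by (simp add: \<nu>.prob_space)
      finally show ?thesis .
    qed
    moreover have "(\<lambda>n. ennreal (ln R - circle_mean (\<lambda>z. log_capacity + green z) z (s n))) \<longlonglongrightarrow> ennreal (ln R - (log_capacity + green z))"
      by (intro tendsto_ennrealI tendsto_diff tendsto_const circle_mean_tendsto s continuous_intros continuous_green)
    ultimately show ?thesis using LIMSEQ_unique z by (simp add: green_def)
  qed
  show ?thesis
  proof (rule equilibrium_measure_eqI[OF K_borel R \<nu>_in])
    fix \<mu> assume mu: "\<mu> \<in> prob_measures_on K"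
    interpret \<mu>: prob_space \<mu> using mu by (simp add: prob_measures_on_def)
    have "AE z in \<mu>. z \<in> K" using \<mu>.AE_in_set_eq_1[of K] mu K_borel
      by (simp add: prob_measures_on_def \<mu>.emeasure_eq_measure)
    hence "shifted_energy R \<mu> \<nu> = (\<integral>\<^sup>+z. ennreal (ln R - log_capacity) \<partial>\<mu>)"
      unfolding shifted_energy_def by (intro nn_integral_cong_AE) (use potential in \<open>auto elim!: eventually_mono\<close>)
    thus "shifted_energy R \<mu> \<nu> = ennreal (ln R - log_capacity)" by (simp add: \<mu>.emeasure_space_1)
  qed
qed

end

section \<open>Logarithmic moments of Gaussian linear forms\<close>

lemma prob_space_std_complex_gaussian: "prob_space std_complex_gaussian"
proof
  have "emeasure std_complex_gaussian (space std_complex_gaussian) =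
      (\<integral>\<^sup>+a. ennreal (1 / pi) * ennreal (exp (- 1 * (cmod a)\<^sup>2)) \<partial>lborel)"
    unfolding std_complex_gaussian_def
    by (subst emeasure_density) (auto simp: ennreal_mult[symmetric] intro!: nn_integral_cong)
  also have "\<dots> = ennreal (1 / pi) * ennreal (pi / 1)"
    by (subst nn_integral_cmult, simp, subst nn_integral_gaussian, auto)
  also have "\<dots> = 1" by (simp add: ennreal_mult[symmetric])
  finally show "emeasure std_complex_gaussian (space std_complex_gaussian) = 1" .
qed

lemma sets_std_complex_gaussian [simp, measurable_cong]: "sets std_complex_gaussian = sets borel"
  and space_std_complex_gaussian [simp]: "space std_complex_gaussian = UNIV"
  by (simp_all add: std_complex_gaussian_def)

lemma nn_integral_std_complex_gaussian:
  assumes [measurable]: "f \<in> borel_measurable borel"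
  shows "(\<integral>\<^sup>+a. f a \<partial>std_complex_gaussian) = (\<integral>\<^sup>+a. ennreal (exp (- (cmod a)\<^sup>2) / pi) * f a \<partial>lborel)"
  unfolding std_complex_gaussian_def by (subst nn_integral_density) auto

lemma finite_null_std_complex_gaussian:
  assumes "finite A" shows "emeasure std_complex_gaussian A = 0"
proof -
  have "A \<in> sets borel" using assms by (simp add: finite_imp_closed)
  moreover have "AE a in lborel. a \<notin> A"
    using countable_imp_null_set_lborel[OF countable_finite[OF assms]] by (rule AE_not_in)
  ultimately show ?thesis
    unfolding std_complex_gaussian_def
    by (subst emeasure_density) (auto simp: nn_integral_0_iff_AE elim!: eventually_mono)
qed

lemma second_moment_std_complex_gaussian:
  "(\<integral>\<^sup>+a. ennreal ((norm a)\<^sup>2) \<partial>std_complex_gaussian) \<le> 4"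
proof -
  have "(\<integral>\<^sup>+a. ennreal ((norm a)\<^sup>2) \<partial>std_complex_gaussian) =
      (\<integral>\<^sup>+a. ennreal (exp (- (cmod a)\<^sup>2) / pi) * ennreal ((norm a)\<^sup>2) \<partial>lborel)"
    by (rule nn_integral_std_complex_gaussian) measurable
  also have "\<dots> \<le> (\<integral>\<^sup>+a. ennreal (2 / pi) * ennreal (exp (- (1/2) * (cmod a)\<^sup>2)) \<partial>lborel)"
  proof (rule nn_integral_mono)
    fix a :: complex
    let ?t = "(cmod a)\<^sup>2"
    have "?t / 2 \<le> exp (?t / 2)" using exp_ge_add_one_self[of "?t / 2"] by linarith
    hence "exp (- ?t) * ?t \<le> exp (- ?t) * (2 * exp (?t / 2))" by (intro mult_left_mono) auto
    also have "\<dots> = 2 * exp (- (1/2) * ?t)" by (simp add: exp_add[symmetric] field_simps)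
    finally have "exp (- ?t) * ?t / pi \<le> 2 * exp (- (1/2) * ?t) / pi" by (intro divide_right_mono) auto
    thus "ennreal (exp (- ?t) / pi) * ennreal ?t \<le> ennreal (2 / pi) * ennreal (exp (- (1/2) * ?t))"
      by (simp add: ennreal_mult[symmetric])
  qed
  also have "\<dots> = ennreal (2 / pi) * ennreal (pi / (1/2))"
    by (subst nn_integral_cmult, simp, subst nn_integral_gaussian, auto)
  also have "\<dots> = 4" by (simp add: ennreal_mult[symmetric])
  finally show ?thesis .
qed

lemma ln_pow4_le: assumes "(x::real) \<ge> 1" shows "(ln x) ^ 4 \<le> 16 * x\<^sup>2"
proof -
  have "ln (sqrt x) \<le> sqrt x" using assms by (intro ln_bound) auto
  hence "ln x \<le> 2 * sqrt x" using assms by (simp add: ln_sqrt)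
  moreover have "0 \<le> ln x" using assms by simp
  ultimately have "(ln x) ^ 4 \<le> (2 * sqrt x) ^ 4" by (intro power_mono)
  also have "\<dots> = 16 * ((sqrt x)\<^sup>2)\<^sup>2" by (simp add: power_mult_distrib flip: power_mult)
  also have "\<dots> = 16 * x\<^sup>2" using assms by simp
  finally show ?thesis .
qed

text \<open>The singularity of the logarithm is integrable in the plane together with all its powers;
  a geometric sum of Gaussians of widths \<open>exp (- k)\<close> dominates the fourth power.\<close>

lemma ln_pow4_integrable:
  "(\<integral>\<^sup>+a. ennreal ((max 0 (- ln (norm a))) ^ 4) \<partial>(lborel :: complex measure)) < \<infinity>"
proof -
  define C :: real where "C = 256 * exp 2"
  have pt: "ennreal ((max 0 (- ln (norm a))) ^ 4) \<le> (\<Sum>k. ennreal (C * exp (real k)) * ennreal (exp (- exp (2 * real k) * (norm a)\<^sup>2)))"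
    for a :: complex
  proof (cases "0 < norm a \<and> norm a < 1")
    case True
    define x where "x = norm a"
    have x: "0 < x" "x < 1" using True by (auto simp: x_def)
    define k where "k = nat \<lfloor>- ln x\<rfloor>"
    have lnx: "- ln x > 0" using x by simp
    have k: "real k \<le> - ln x" "- ln x < real k + 1" unfolding k_def using lnx by linarith+
    have "x powr (- 1/4) > 0" using x by simp
    \<comment> \<open>The exponent \<open>1/4\<close> makes the fourth power of the logarithm at
      most a multiple of \<open>1 / x\<close>, which is integrable in the plane.\<close>
    have "ln (x powr (- 1/4)) \<le> x powr (- 1/4)" using x by (intro ln_bound) auto
    hence "- ln x \<le> 4 * x powr (- 1/4)" using x by (simp add: ln_powr)
    hence "(- ln x) ^ 4 \<le> (4 * x powr (- 1/4)) ^ 4" using lnx by (intro power_mono) auto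
    also have "\<dots> = 256 * (x powr (- 1/4)) ^ 4" by (simp add: power_mult_distrib)
    also have "(x powr (- 1/4)) ^ 4 = exp (- ln x)"
      using x by (simp add: powr_def flip: exp_of_nat_mult)
    also have "exp (- ln x) \<le> exp (real k + 1)" using k by simp
    finally have le1: "(- ln x) ^ 4 \<le> 256 * exp (real k + 1)" by simp
    have "exp (2 * real k) * x\<^sup>2 = (exp (real k) * x)\<^sup>2" by (simp add: power_mult_distrib exp_double)
    also have "exp (real k) * x \<le> 1"
    proof -
      have "exp (real k) \<le> exp (- ln x)" using k by simp
      thus ?thesis using x by (simp add: exp_minus field_simps)
    qed
    hence "(exp (real k) * x)\<^sup>2 \<le> 1" using x by (simp add: power_le_one)
    finally have "exp (- 1) \<le> exp (- exp (2 * real k) * x\<^sup>2)" by simp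
    hence "256 * exp (real k + 1) * (exp 1 * exp (- 1)) \<le> 256 * exp (real k + 1) * (exp 1 * exp (- exp (2 * real k) * x\<^sup>2))"
      by (intro mult_left_mono) auto
    hence "256 * exp (real k + 1) \<le> C * exp (real k) * exp (- exp (2 * real k) * x\<^sup>2)"
      by (simp add: C_def exp_add[symmetric] mult.assoc)
    hence "(max 0 (- ln x)) ^ 4 \<le> C * exp (real k) * exp (- exp (2 * real k) * x\<^sup>2)" using le1 lnx by simp
    hence "ennreal ((max 0 (- ln x)) ^ 4) \<le> ennreal (C * exp (real k)) * ennreal (exp (- exp (2 * real k) * x\<^sup>2))"
      by (subst ennreal_mult[symmetric]) (auto simp: C_def)
    also have "\<dots> \<le> (\<Sum>k. ennreal (C * exp (real k)) * ennreal (exp (- exp (2 * real k) * x\<^sup>2)))"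
      using sum_le_suminf[of "\<lambda>k. ennreal (C * exp (real k)) * ennreal (exp (- exp (2 * real k) * x\<^sup>2))" "{k}"] by simp
    finally show ?thesis by (simp add: x_def)
  next
    case False
    have "max 0 (- ln (norm a)) = 0" using False by (cases "a = 0") (auto simp: max_def)
    thus ?thesis by simp
  qed
  have "(\<integral>\<^sup>+a. ennreal ((max 0 (- ln (norm a))) ^ 4) \<partial>(lborel :: complex measure)) \<le>
      (\<integral>\<^sup>+a. (\<Sum>k. ennreal (C * exp (real k)) * ennreal (exp (- exp (2 * real k) * (norm a)\<^sup>2))) \<partial>(lborel :: complex measure))"
    by (rule nn_integral_mono) (rule pt)
  also have "\<dots> = (\<Sum>k. (\<integral>\<^sup>+a. ennreal (C * exp (real k)) * ennreal (exp (- exp (2 * real k) * (norm a)\<^sup>2)) \<partial>(lborel :: complex measure)))"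
    by (rule nn_integral_suminf) measurable
  also have "\<dots> = (\<Sum>k. ennreal (C * pi * exp (- 1) ^ k))"
  proof (rule suminf_cong)
    fix k :: nat
    have "(\<integral>\<^sup>+a. ennreal (C * exp (real k)) * ennreal (exp (- exp (2 * real k) * (norm a)\<^sup>2)) \<partial>(lborel :: complex measure)) =
        ennreal (C * exp (real k)) * ennreal (pi / exp (2 * real k))"
      by (subst nn_integral_cmult, simp, subst nn_integral_gaussian, auto)
    also have "\<dots> = ennreal (C * exp (real k) * (pi / exp (2 * real k)))" by (subst ennreal_mult) (auto simp: C_def)
    also have "C * exp (real k) * (pi / exp (2 * real k)) = C * pi * exp (- 1) ^ k"
    proof -
      have "exp (real k) / exp (2 * real k) = exp (- 1) ^ k"
        by (simp flip: exp_of_nat_mult exp_diff)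
      thus ?thesis by (simp add: field_simps)
    qed
    finally show "(\<integral>\<^sup>+a. ennreal (C * exp (real k)) * ennreal (exp (- exp (2 * real k) * (norm a)\<^sup>2)) \<partial>(lborel :: complex measure)) =
        ennreal (C * pi * exp (- 1) ^ k)" .
  qed
  also have "\<dots> < \<infinity>"
  proof -
    have "summable (\<lambda>k. C * pi * exp (- 1) ^ k)" by (intro summable_mult summable_geometric) auto
    thus ?thesis by (subst suminf_ennreal2) (auto simp: C_def)
  qed
  finally show ?thesis .
qed

lemma nn_integral_lborel_scale:
  fixes f :: "complex \<Rightarrow> ennreal"
  assumes [measurable]: "f \<in> borel_measurable borel" and c: "c > 0"
  shows "(\<integral>\<^sup>+x. f (c *\<^sub>R x) \<partial>lborel) = ennreal (1 / c\<^sup>2) * (\<integral>\<^sup>+x. f x \<partial>lborel)"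
proof -
  have "(\<integral>\<^sup>+x. f x \<partial>lborel) = (\<integral>\<^sup>+x. f x \<partial>density (distr lborel borel (\<lambda>x. 0 + c *\<^sub>R x)) (\<lambda>_. \<bar>c\<bar> ^ DIM(complex)))"
    using c by (subst lborel_affine[of c 0]) auto
  also have "\<dots> = (\<integral>\<^sup>+x. ennreal (c\<^sup>2) * f (c *\<^sub>R x) \<partial>lborel)"
    by (subst nn_integral_density, simp, simp, subst nn_integral_distr, auto)
  also have "\<dots> = ennreal (c\<^sup>2) * (\<integral>\<^sup>+x. f (c *\<^sub>R x) \<partial>lborel)" by (rule nn_integral_cmult) measurable
  finally have "ennreal (1 / c\<^sup>2) * (\<integral>\<^sup>+x. f x \<partial>lborel) = ennreal (1 / c\<^sup>2) * ennreal (c\<^sup>2) * (\<integral>\<^sup>+x. f (c *\<^sub>R x) \<partial>lborel)"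
    by (simp add: mult.assoc)
  also have "ennreal (1 / c\<^sup>2) * ennreal (c\<^sup>2) = 1" using c by (subst ennreal_mult[symmetric]) auto
  finally show ?thesis by simp
qed

text \<open>The Gaussian density is bounded, so the substitution \<open>y + a b\<close> reduces
  the claim to Lebesgue measure.\<close>

lemma ln_moment_one_coordinate:
  obtains C where "C \<ge> 0" "\<And>b y. b \<noteq> 0 \<Longrightarrow>
    (\<integral>\<^sup>+a. ennreal ((max 0 (- ln (norm (y + a * b)))) ^ 4) \<partial>std_complex_gaussian) \<le> ennreal (C / (norm b)\<^sup>2)"
proof -
  define I where "I = (\<integral>\<^sup>+a. ennreal ((max 0 (- ln (norm a))) ^ 4) \<partial>(lborel :: complex measure))"
  obtain i where i: "I = ennreal i" "i \<ge> 0" using ln_pow4_integrable unfolding I_def[symmetric] by (cases I) auto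
  show ?thesis
  proof (rule that[of i])
    fix b y :: complex assume b: "b \<noteq> 0"
    let ?F = "\<lambda>x. ennreal ((max 0 (- ln x)) ^ 4)"
    have "(\<integral>\<^sup>+a. ?F (norm (y + a * b)) \<partial>std_complex_gaussian) =
        (\<integral>\<^sup>+a. ennreal (exp (- (cmod a)\<^sup>2) / pi) * ?F (norm (y + a * b)) \<partial>lborel)"
      by (rule nn_integral_std_complex_gaussian) measurable
    also have "\<dots> \<le> (\<integral>\<^sup>+a. 1 * ?F (norm (y + a * b)) \<partial>lborel)"
    proof (rule nn_integral_mono, rule mult_right_mono)
      fix a :: complex
      have "exp (- (cmod a)\<^sup>2) \<le> 1" by simp
      also have "1 \<le> pi" using pi_gt3 by simp
      finally have "exp (- (cmod a)\<^sup>2) / pi \<le> 1" by (subst divide_le_eq_1_pos) auto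
      thus "ennreal (exp (- (cmod a)\<^sup>2) / pi) \<le> 1" by simp
    qed simp
    also have "\<dots> = (\<integral>\<^sup>+a. ?F (norm (norm b *\<^sub>R (a - (- y / b)))) \<partial>lborel)"
    proof (rule nn_integral_cong)
      fix a :: complex
      have "y + a * b = b * (a - (- y / b))" using b by (simp add: field_simps)
      hence "norm (y + a * b) = norm (norm b *\<^sub>R (a - (- y / b)))" by (simp add: norm_mult)
      thus "1 * ?F (norm (y + a * b)) = ?F (norm (norm b *\<^sub>R (a - (- y / b))))" by simp
    qed
    also have "\<dots> = (\<integral>\<^sup>+a. ?F (norm (norm b *\<^sub>R a)) \<partial>(lborel :: complex measure))"
      by (rule nn_integral_lborel_shift) measurable
    also have "\<dots> = ennreal (1 / (norm b)\<^sup>2) * I"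
      unfolding I_def using b by (intro nn_integral_lborel_scale) auto
    also have "\<dots> = ennreal (i / (norm b)\<^sup>2)" unfolding i(1) using i(2) by (subst ennreal_mult[symmetric]) auto
    finally show "(\<integral>\<^sup>+a. ?F (norm (y + a * b)) \<partial>std_complex_gaussian) \<le> ennreal (i / (norm b)\<^sup>2)" .
  qed (rule i)
qed

interpretation gauss: prob_space std_complex_gaussian by (rule prob_space_std_complex_gaussian)

interpretation gauss_product: product_prob_space "\<lambda>_::nat. std_complex_gaussian" UNIV ..

text \<open>Conditioning on all coordinates but one of modulus at least \<open>1 / sqrt (N + 1)\<close> bounds the
  contribution of small values; the growth in \<open>N\<close> is harmless for fourth moments.\<close>

lemma ln_moment_linear_form:
  obtains C where "C \<ge> 0" "\<And>(N::nat) u. (\<Sum>j\<le>N. (norm (u j))\<^sup>2) = 1 \<Longrightarrow>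
    (\<integral>\<^sup>+a. ennreal ((ln (norm (\<Sum>j\<le>N. a j * u j))) ^ 4) \<partial>PiM {..N} (\<lambda>_. std_complex_gaussian)) \<le> ennreal (C * (real N + 1))"
proof -
  obtain C where C: "C \<ge> 0" "\<And>b y. b \<noteq> 0 \<Longrightarrow>
    (\<integral>\<^sup>+a. ennreal ((max 0 (- ln (norm (y + a * b)))) ^ 4) \<partial>std_complex_gaussian) \<le> ennreal (C / (norm b)\<^sup>2)"
    using ln_moment_one_coordinate by metis
  show ?thesis
  proof (rule that[of "C + 64"])
    fix N :: nat and u :: "nat \<Rightarrow> complex" assume u: "(\<Sum>j\<le>N. (norm (u j))\<^sup>2) = 1"
    let ?M = "PiM {..N} (\<lambda>_. std_complex_gaussian)"
    let ?X = "\<lambda>a. \<Sum>j\<le>N. a j * u j"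
    interpret PM: prob_space ?M by (rule prob_space_PiM) (rule prob_space_std_complex_gaussian)
    have split: "(ln x) ^ 4 \<le> (max 0 (- ln x)) ^ 4 + 16 * x\<^sup>2" if "x \<ge> 0" for x :: real
    proof (cases "x \<ge> 1")
      case True thus ?thesis using ln_pow4_le[OF True] by simp
    next
      case False
      hence "ln x \<le> 0" using that by (cases "x = 0") auto
      hence "max 0 (- ln x) = - ln x" by simp
      thus ?thesis by simp
    qed
    have "\<exists>j\<le>N. (norm (u j))\<^sup>2 \<ge> 1 / (real N + 1)"
    proof (rule ccontr)
      assume "\<not> (\<exists>j\<le>N. (norm (u j))\<^sup>2 \<ge> 1 / (real N + 1))"
      hence "(\<Sum>j\<le>N. (norm (u j))\<^sup>2) < (\<Sum>j\<le>N. 1 / (real N + 1))" by (intro sum_strict_mono) auto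
      thus False using u by (simp add: add.commute)
    qed
    then obtain j where j: "j \<le> N" "(norm (u j))\<^sup>2 \<ge> 1 / (real N + 1)" by blast
    have uj: "u j \<noteq> 0" using j(2) by auto
    have low: "(\<integral>\<^sup>+a. ennreal ((max 0 (- ln (norm (?X a)))) ^ 4) \<partial>?M) \<le> ennreal (C * (real N + 1))"
    proof -
      define J where "J = {..N} - {j}"
      have J: "{..N} = insert j J" "finite J" "j \<notin> J" using j by (auto simp: J_def)
      interpret PJ: prob_space "PiM J (\<lambda>_. std_complex_gaussian)" by (rule prob_space_PiM) (rule prob_space_std_complex_gaussian)
      have "(\<integral>\<^sup>+a. ennreal ((max 0 (- ln (norm (?X a)))) ^ 4) \<partial>?M) =
          (\<integral>\<^sup>+a. ennreal ((max 0 (- ln (norm (\<Sum>j\<in>insert j J. a j * u j)))) ^ 4) \<partial>PiM (insert j J) (\<lambda>_. std_complex_gaussian))"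
        unfolding J(1) ..
      also have "\<dots> = (\<integral>\<^sup>+a. (\<integral>\<^sup>+y. ennreal ((max 0 (- ln (norm (\<Sum>i\<in>insert j J. (a(j := y)) i * u i)))) ^ 4) \<partial>std_complex_gaussian)
          \<partial>PiM J (\<lambda>_. std_complex_gaussian))"
        by (rule gauss_product.product_nn_integral_insert[OF J(2,3)]) measurable
      also have "\<dots> \<le> (\<integral>\<^sup>+a. ennreal (C * (real N + 1)) \<partial>PiM J (\<lambda>_. std_complex_gaussian))"
      proof (rule nn_integral_mono)
        fix a :: "nat \<Rightarrow> complex"
        have "(\<Sum>i\<in>insert j J. (a(j := y)) i * u i) = (\<Sum>i\<in>J. a i * u i) + y * u j" for y
        proof -
          have "(\<Sum>i\<in>J. (a(j := y)) i * u i) = (\<Sum>i\<in>J. a i * u i)" using J(3) by (intro sum.cong) auto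
          thus ?thesis using J by (simp add: add.commute)
        qed
        hence "(\<integral>\<^sup>+y. ennreal ((max 0 (- ln (norm (\<Sum>i\<in>insert j J. (a(j := y)) i * u i)))) ^ 4) \<partial>std_complex_gaussian)
            \<le> ennreal (C / (norm (u j))\<^sup>2)" using C(2)[OF uj, of "\<Sum>i\<in>J. a i * u i"] by simp
        also have "C / (norm (u j))\<^sup>2 \<le> C * (real N + 1)"
        proof -
          have "C * 1 \<le> C * ((real N + 1) * (norm (u j))\<^sup>2)"
            using j(2) C(1) by (intro mult_left_mono) (auto simp: field_simps)
          thus ?thesis using uj by (simp add: field_simps)
        qed
        finally show "(\<integral>\<^sup>+y. ennreal ((max 0 (- ln (norm (\<Sum>i\<in>insert j J. (a(j := y)) i * u i)))) ^ 4) \<partial>std_complex_gaussian)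
            \<le> ennreal (C * (real N + 1))" by (simp add: ennreal_leI)
      qed
      also have "\<dots> = ennreal (C * (real N + 1))" using PJ.emeasure_space_1 by simp
      finally show ?thesis .
    qed
    have up: "(\<integral>\<^sup>+a. ennreal ((norm (?X a))\<^sup>2) \<partial>?M) \<le> ennreal (4 * (real N + 1))"
    proof -
      have "(\<integral>\<^sup>+a. ennreal ((norm (?X a))\<^sup>2) \<partial>?M) \<le> (\<integral>\<^sup>+a. (\<Sum>i\<le>N. ennreal ((norm (a i))\<^sup>2)) \<partial>?M)"
      proof (rule nn_integral_mono)
        fix a :: "nat \<Rightarrow> complex"
        have "norm (?X a) \<le> (\<Sum>i\<le>N. norm (a i) * norm (u i))" by (rule order_trans[OF norm_sum]) (simp add: norm_mult)
        hence "(norm (?X a))\<^sup>2 \<le> (\<Sum>i\<le>N. norm (a i) * norm (u i))\<^sup>2" by (intro power_mono) auto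
        also have "\<dots> \<le> (\<Sum>i\<le>N. (norm (a i))\<^sup>2) * (\<Sum>i\<le>N. (norm (u i))\<^sup>2)" by (rule Cauchy_Schwarz_ineq_sum)
        finally have "(norm (?X a))\<^sup>2 \<le> (\<Sum>i\<le>N. (norm (a i))\<^sup>2)" using u by simp
        thus "ennreal ((norm (?X a))\<^sup>2) \<le> (\<Sum>i\<le>N. ennreal ((norm (a i))\<^sup>2))" by (subst sum_ennreal) (auto intro: ennreal_leI)
      qed
      also have "\<dots> = (\<Sum>i\<le>N. \<integral>\<^sup>+a. ennreal ((norm (a i))\<^sup>2) \<partial>?M)" by (rule nn_integral_sum) measurable
      also have "\<dots> \<le> (\<Sum>i\<le>N. 4)"
      proof (rule sum_mono)
        fix i assume i: "i \<in> {..N}"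
        have "(\<integral>\<^sup>+a. ennreal ((norm (a i))\<^sup>2) \<partial>?M) = (\<integral>\<^sup>+x. ennreal ((norm x)\<^sup>2) \<partial>distr ?M std_complex_gaussian (\<lambda>a. a i))"
          using i by (subst nn_integral_distr) auto
        also have "distr ?M std_complex_gaussian (\<lambda>a. a i) = std_complex_gaussian"
          by (rule distr_PiM_component) (use i prob_space_std_complex_gaussian in auto)
        finally show "(\<integral>\<^sup>+a. ennreal ((norm (a i))\<^sup>2) \<partial>?M) \<le> 4" using second_moment_std_complex_gaussian by simp
      qed
      also have "\<dots> = ennreal (4 * (real N + 1))"
      proof -
        have "(\<Sum>i\<le>N. 4 :: ennreal) = (\<Sum>i\<le>N. ennreal 4)" by simp
        also have "\<dots> = ennreal (\<Sum>i\<le>N. 4)" by (rule sum_ennreal) simp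
        also have "(\<Sum>i\<le>N. 4 :: real) = 4 * (real N + 1)" by simp
        finally show ?thesis .
      qed
      finally show ?thesis .
    qed
    have "(\<integral>\<^sup>+a. ennreal ((ln (norm (?X a))) ^ 4) \<partial>?M) \<le>
        (\<integral>\<^sup>+a. ennreal ((max 0 (- ln (norm (?X a)))) ^ 4) + 16 * ennreal ((norm (?X a))\<^sup>2) \<partial>?M)"
    proof (rule nn_integral_mono)
      fix a
      have "ennreal ((ln (norm (?X a))) ^ 4) \<le> ennreal ((max 0 (- ln (norm (?X a)))) ^ 4 + 16 * (norm (?X a))\<^sup>2)"
        by (intro ennreal_leI split) auto
      also have "\<dots> = ennreal ((max 0 (- ln (norm (?X a)))) ^ 4) + ennreal 16 * ennreal ((norm (?X a))\<^sup>2)"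
        by (subst ennreal_plus) (auto simp: ennreal_mult)
      finally show "ennreal ((ln (norm (?X a))) ^ 4) \<le> ennreal ((max 0 (- ln (norm (?X a)))) ^ 4) + 16 * ennreal ((norm (?X a))\<^sup>2)" by simp
    qed
    also have "\<dots> = (\<integral>\<^sup>+a. ennreal ((max 0 (- ln (norm (?X a)))) ^ 4) \<partial>?M) + 16 * (\<integral>\<^sup>+a. ennreal ((norm (?X a))\<^sup>2) \<partial>?M)"
      by (subst nn_integral_add, measurable, subst nn_integral_cmult, measurable)
    also have "\<dots> \<le> ennreal (C * (real N + 1)) + 16 * ennreal (4 * (real N + 1))"
      by (intro add_mono mult_left_mono low up) auto
    also have "\<dots> = ennreal (C * (real N + 1)) + ennreal 16 * ennreal (4 * (real N + 1))" by simp
    also have "\<dots> = ennreal ((C + 64) * (real N + 1))"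
      using C(1) by (subst ennreal_mult[symmetric]) (auto simp: ennreal_plus[symmetric] distrib_right simp del: ennreal_plus)
    finally show "(\<integral>\<^sup>+a. ennreal ((ln (norm (?X a))) ^ 4) \<partial>?M) \<le> ennreal ((C + 64) * (real N + 1))" .
  qed (use C in simp)
qed

section \<open>Random polynomials\<close>

lemma space_borel_polys [simp]: "space (borel_polys N) = polys N"
  by (simp add: borel_polys_def)

lemma measurable_coeff_borel_polys:
  assumes "i \<le> N" shows "(\<lambda>p. coeff p i) \<in> borel_measurable (borel_polys N)"
proof -
  have "(\<lambda>p. restrict (coeff p) {..N}) \<in> borel_polys N \<rightarrow>\<^sub>M PiM {..N} (\<lambda>_. borel)"
    unfolding borel_polys_def by (rule measurable_vimage_algebra1) (auto simp: space_PiM)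
  from measurable_compose[OF this measurable_component_singleton[of i]] assms
  show ?thesis by simp
qed

lemma measurable_borel_polysI:
  assumes "\<And>x. x \<in> space M \<Longrightarrow> F x \<in> polys N" "\<And>i. i \<le> N \<Longrightarrow> (\<lambda>x. coeff (F x) i) \<in> borel_measurable M"
  shows "F \<in> M \<rightarrow>\<^sub>M borel_polys N"
  unfolding borel_polys_def
  by (rule measurable_vimage_algebra2) (use assms in \<open>auto intro!: measurable_restrict\<close>)

lemma poly_sum_coeff: "p \<in> polys N \<Longrightarrow> poly p x = (\<Sum>i\<le>N. coeff p i * x ^ i)"
  unfolding poly_altdef by (rule sum.mono_neutral_left) (auto simp: polys_def coeff_eq_0)

lemma poly_pderiv_sum_coeff:
  assumes "p \<in> polys N"
  shows "poly (pderiv p) x = (\<Sum>i<N. of_nat (Suc i) * coeff p (Suc i) * x ^ i)"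
proof -
  have "poly (pderiv p) x = (\<Sum>i\<le>N. coeff (pderiv p) i * x ^ i)"
    by (rule poly_sum_coeff) (use assms degree_pderiv[of p] in \<open>auto simp: polys_def\<close>)
  also have "\<dots> = (\<Sum>i<N. coeff (pderiv p) i * x ^ i)"
    using assms by (intro sum.mono_neutral_right) (auto simp: polys_def coeff_pderiv coeff_eq_0 not_less)
  finally show ?thesis by (simp add: coeff_pderiv)
qed

lemma measurable_poly_eval:
  assumes F: "F \<in> M \<rightarrow>\<^sub>M borel_polys N" and [measurable]: "g \<in> borel_measurable M"
  shows "(\<lambda>x. poly (F x) (g x)) \<in> borel_measurable M"
proof -
  have [measurable]: "(\<lambda>x. coeff (F x) i) \<in> borel_measurable M" if "i \<le> N" for i
    using measurable_compose[OF F measurable_coeff_borel_polys[OF that]] .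
  have "(\<lambda>x. \<Sum>i\<le>N. coeff (F x) i * g x ^ i) \<in> borel_measurable M"
    by (rule borel_measurable_sum) (auto intro!: borel_measurable_times borel_measurable_power)
  thus ?thesis
    by (rule measurable_cong[THEN iffD1, rotated]) (use measurable_space[OF F] in \<open>auto simp: poly_sum_coeff[where N = N]\<close>)
qed

definition random_poly :: "nat \<Rightarrow> (nat \<Rightarrow> complex poly) \<Rightarrow> (nat \<Rightarrow> complex) \<Rightarrow> complex poly" where
  "random_poly N P a = (\<Sum>j\<le>N. smult (a j) (P j))"

text \<open>The Christoffel function, the Bergman kernel of the polynomial space on the diagonal.
  It is also the variance of the value of the random polynomial at \<open>z\<close>.\<close>

definition christoffel :: "nat \<Rightarrow> (nat \<Rightarrow> complex poly) \<Rightarrow> complex \<Rightarrow> real" where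
  "christoffel N P z = (\<Sum>j\<le>N. (norm (poly (P j) z))\<^sup>2)"

lemma random_poly_in_polys: "(\<And>j. j \<le> N \<Longrightarrow> P j \<in> polys N) \<Longrightarrow> random_poly N P a \<in> polys N"
  unfolding random_poly_def polys_def
  by (auto intro!: degree_sum_le intro: order_trans[OF degree_smult_le])

lemma measurable_random_poly:
  assumes "\<And>j. j \<le> N \<Longrightarrow> P j \<in> polys N"
  shows "random_poly N P \<in> PiM {..N} (\<lambda>_. std_complex_gaussian) \<rightarrow>\<^sub>M borel_polys N"
proof (rule measurable_borel_polysI)
  show "random_poly N P a \<in> polys N" for a by (rule random_poly_in_polys[OF assms])
  fix i
  have "(\<lambda>a. \<Sum>j\<le>N. a j * coeff (P j) i) \<in> borel_measurable (PiM {..N} (\<lambda>_. std_complex_gaussian))"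
    by measurable
  thus "(\<lambda>a. coeff (random_poly N P a) i) \<in> borel_measurable (PiM {..N} (\<lambda>_. std_complex_gaussian))"
    by (simp add: random_poly_def coeff_sum)
qed

lemma poly_random_poly: "poly (random_poly N P a) z = (\<Sum>j\<le>N. a j * poly (P j) z)"
  by (simp add: random_poly_def poly_sum)

lemma christoffel_pos:
  assumes "\<And>f. f \<in> polys N \<Longrightarrow> \<exists>a. f = random_poly N P a"
  shows "christoffel N P z > 0"
proof -
  obtain a where "1 = random_poly N P a" using assms[of 1] by (auto simp: polys_def)
  hence "(\<Sum>j\<le>N. a j * poly (P j) z) = 1" using poly_random_poly[of N P a z] by simp
  hence "\<exists>j\<le>N. poly (P j) z \<noteq> 0" by (metis (no_types, lifting) atMost_iff mult_zero_right sum.neutral zero_neq_one)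
  then obtain j where "j \<le> N" "poly (P j) z \<noteq> 0" by blast
  thus ?thesis unfolding christoffel_def by (intro sum_pos2[of _ j]) auto
qed

lemma continuous_christoffel: "continuous_on S (christoffel N P)"
  unfolding christoffel_def by (intro continuous_intros)

text \<open>Jensen's inequality for the fourth power in a form that covers integrals that do not
  converge: a nonintegrable function has the Bochner integral zero.\<close>

lemma fourth_power_integral_le:
  fixes h :: "'a \<Rightarrow> real"
  assumes "prob_space M" and [measurable]: "h \<in> borel_measurable M"
  shows "ennreal ((\<integral>x. h x \<partial>M) ^ 4) \<le> (\<integral>\<^sup>+x. ennreal (h x ^ 4) \<partial>M)"
proof (cases "integrable M h \<and> integrable M (\<lambda>x. h x ^ 4)")
  case True
  interpret prob_space M by fact
  define m where "m = (\<integral>x. h x \<partial>M)"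
  have tangent: "m ^ 4 + 4 * m ^ 3 * (h x - m) \<le> h x ^ 4" for x
  proof -
    have "h x ^ 4 - (m ^ 4 + 4 * m ^ 3 * (h x - m)) = (h x - m)\<^sup>2 * ((h x + m)\<^sup>2 + 2 * m\<^sup>2)"
      by (simp add: power2_eq_square power3_eq_cube power4_eq_xxxx algebra_simps)
    also have "\<dots> \<ge> 0" by (intro mult_nonneg_nonneg add_nonneg_nonneg) auto
    finally show ?thesis by simp
  qed
  have "(\<integral>x. m ^ 4 + 4 * m ^ 3 * (h x - m) \<partial>M) \<le> (\<integral>x. h x ^ 4 \<partial>M)"
    by (rule integral_mono) (use True tangent in auto)
  moreover have "(\<integral>x. m ^ 4 + 4 * m ^ 3 * (h x - m) \<partial>M) = m ^ 4"
    using True by (simp add: prob_space m_def[symmetric])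
  ultimately show ?thesis using True
    by (subst nn_integral_eq_integral) (auto simp: m_def intro: ennreal_leI)
next
  case False
  show ?thesis
  proof (cases "integrable M h")
    case True
    hence "\<not> integrable M (\<lambda>x. h x ^ 4)" using False by simp
    hence "(\<integral>\<^sup>+x. ennreal (h x ^ 4) \<partial>M) = \<infinity>"
    proof (rule contrapos_np)
      assume "(\<integral>\<^sup>+x. ennreal (h x ^ 4) \<partial>M) \<noteq> \<infinity>"
      hence "(\<integral>\<^sup>+x. ennreal (h x ^ 4) \<partial>M) < \<infinity>" by (simp only: infinity_ennreal_def less_top)
      thus "integrable M (\<lambda>x. h x ^ 4)" by (intro integrableI_nonneg) auto
    qed
    thus ?thesis by simp
  qed (simp add: not_integrable_integral_eq)
qed

text \<open>Dividing by the standard deviation makes the integrand the logarithm of the modulus of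
  a standard complex Gaussian at every point of the circle.\<close>

definition normalized_log_mean :: "nat \<Rightarrow> (nat \<Rightarrow> complex poly) \<Rightarrow> complex \<Rightarrow> real \<Rightarrow> complex poly \<Rightarrow> real" where
  "normalized_log_mean N P z r p =
    (\<integral>t. ln (norm (poly p (z + of_real r * ucirc t)) / sqrt (christoffel N P (z + of_real r * ucirc t))) \<partial>unif01)"

lemma measurable_normalized_log_mean [measurable]:
  "normalized_log_mean N P z r \<in> borel_measurable (borel_polys N)"
proof -
  interpret U: prob_space unif01 by (rule prob_space_unif01)
  have [measurable]: "christoffel N P \<in> borel_measurable borel"
    by (rule borel_measurable_continuous_onI[OF continuous_christoffel])
  have "(\<lambda>x. poly (fst x) (z + of_real r * ucirc (snd x))) \<in> borel_measurable (borel_polys N \<Otimes>\<^sub>M unif01)"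
    by (rule measurable_poly_eval[where N = N]) measurable
  hence "(\<lambda>(p, t). ln (norm (poly p (z + of_real r * ucirc t)) / sqrt (christoffel N P (z + of_real r * ucirc t))))
      \<in> borel_measurable (borel_polys N \<Otimes>\<^sub>M unif01)" unfolding case_prod_unfold by measurable
  thus ?thesis unfolding normalized_log_mean_def by (rule U.borel_measurable_lebesgue_integral)
qed

text \<open>The moment bound for a single point is uniform in the point, so it survives averaging
  over the circle.\<close>

theorem normalized_log_mean_moment:
  obtains C where "C \<ge> 0" "\<And>N P z r. (\<And>j. j \<le> N \<Longrightarrow> P j \<in> polys N) \<Longrightarrow>
     (\<And>f. f \<in> polys N \<Longrightarrow> \<exists>a. f = random_poly N P a) \<Longrightarrow>
    (\<integral>\<^sup>+p. ennreal ((normalized_log_mean N P z r p) ^ 4)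
       \<partial>distr (PiM {..N} (\<lambda>_. std_complex_gaussian)) (borel_polys N) (random_poly N P)) \<le> ennreal (C * (real N + 1))"
proof -
  obtain C where C: "C \<ge> 0" "\<And>(N::nat) u. (\<Sum>j\<le>N. (norm (u j))\<^sup>2) = 1 \<Longrightarrow>
    (\<integral>\<^sup>+a. ennreal ((ln (norm (\<Sum>j\<le>N. a j * u j))) ^ 4) \<partial>PiM {..N} (\<lambda>_. std_complex_gaussian)) \<le> ennreal (C * (real N + 1))"
    by (rule ln_moment_linear_form) blast
  show ?thesis
  proof (rule that[OF C(1)])
    fix N P z r assume P: "\<And>j. j \<le> N \<Longrightarrow> P j \<in> polys N" and span: "\<And>f. f \<in> polys N \<Longrightarrow> \<exists>a. f = random_poly N P a"
    let ?G = "PiM {..N} (\<lambda>_. std_complex_gaussian)"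
    let ?c = "\<lambda>t. z + of_real r * ucirc t"
    interpret U: prob_space unif01 by (rule prob_space_unif01)
    interpret G: prob_space ?G by (rule prob_space_PiM) (rule prob_space_std_complex_gaussian)
    interpret PS: pair_sigma_finite ?G unif01 ..
    have [measurable]: "christoffel N P \<in> borel_measurable borel"
      by (rule borel_measurable_continuous_onI[OF continuous_christoffel])
    note [measurable] = measurable_random_poly[OF P]
    define h where "h = (\<lambda>a t. ln (norm (poly (random_poly N P a) (?c t)) / sqrt (christoffel N P (?c t))))"
    have h_lin: "h a t = ln (norm (\<Sum>j\<le>N. a j * (poly (P j) (?c t) / of_real (sqrt (christoffel N P (?c t))))))" for a t
    proof -
      have "(\<Sum>j\<le>N. a j * (poly (P j) (?c t) / of_real (sqrt (christoffel N P (?c t))))) =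
          poly (random_poly N P a) (?c t) / of_real (sqrt (christoffel N P (?c t)))"
        by (simp add: poly_random_poly sum_divide_distrib)
      thus ?thesis using christoffel_pos[OF span, of "?c t"] by (simp add: h_def norm_divide)
    qed
    have unit: "(\<Sum>j\<le>N. (norm (poly (P j) w / of_real (sqrt (christoffel N P w))))\<^sup>2) = 1" for w
      using christoffel_pos[OF span, of w]
      by (simp add: norm_divide power_divide sum_divide_distrib[symmetric] christoffel_def[symmetric])
    have [measurable]: "case_prod h \<in> borel_measurable (?G \<Otimes>\<^sub>M unif01)"
    proof -
      have "(\<lambda>x. poly (random_poly N P (fst x)) (?c (snd x))) \<in> borel_measurable (?G \<Otimes>\<^sub>M unif01)"
        by (rule measurable_poly_eval[where N = N]) measurable
      thus ?thesis unfolding h_def case_prod_unfold by measurable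
    qed
    have hm: "h a \<in> borel_measurable unif01" if "a \<in> space ?G" for a
      using measurable_compose[OF measurable_Pair1'[OF that] \<open>case_prod h \<in> _\<close>] by simp
    have "(\<integral>\<^sup>+p. ennreal ((normalized_log_mean N P z r p) ^ 4) \<partial>distr ?G (borel_polys N) (random_poly N P)) =
        (\<integral>\<^sup>+a. ennreal ((normalized_log_mean N P z r (random_poly N P a)) ^ 4) \<partial>?G)"
      by (rule nn_integral_distr) measurable
    also have "\<dots> = (\<integral>\<^sup>+a. ennreal ((\<integral>t. h a t \<partial>unif01) ^ 4) \<partial>?G)"
      by (simp only: normalized_log_mean_def h_def)
    also have "\<dots> \<le> (\<integral>\<^sup>+a. (\<integral>\<^sup>+t. ennreal (h a t ^ 4) \<partial>unif01) \<partial>?G)"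
      by (intro nn_integral_mono fourth_power_integral_le prob_space_unif01 hm)
    also have "\<dots> = (\<integral>\<^sup>+t. (\<integral>\<^sup>+a. ennreal (h a t ^ 4) \<partial>?G) \<partial>unif01)"
      by (rule PS.Fubini'[symmetric]) measurable
    also have "\<dots> \<le> (\<integral>\<^sup>+t. ennreal (C * (real N + 1)) \<partial>unif01)"
      unfolding h_lin by (intro nn_integral_mono C(2) unit)
    also have "\<dots> = ennreal (C * (real N + 1))" using U.emeasure_space_1 by simp
    finally show "(\<integral>\<^sup>+p. ennreal ((normalized_log_mean N P z r p) ^ 4)
       \<partial>distr ?G (borel_polys N) (random_poly N P)) \<le> ennreal (C * (real N + 1))" .
  qed
qed

text \<open>A set that meets every line parallel to a coordinate axis in a finite set, unless it contains
  the whole line, is negligible as soon as it is not everything.\<close>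

lemma null_of_line_slices:
  fixes B :: "('i \<Rightarrow> complex) set"
  assumes "finite I" "B \<in> sets (PiM I (\<lambda>_. std_complex_gaussian))"
    and "\<And>a i. i \<in> I \<Longrightarrow> a \<in> space (PiM I (\<lambda>_. std_complex_gaussian)) \<Longrightarrow>
      finite {t. a(i := t) \<in> B} \<or> {t. a(i := t) \<in> B} = UNIV"
    and "a0 \<in> space (PiM I (\<lambda>_. std_complex_gaussian))" "a0 \<notin> B"
  shows "emeasure (PiM I (\<lambda>_. std_complex_gaussian)) B = 0"
  using assms
proof (induction I arbitrary: B a0 rule: finite_induct)
  case empty
  have "B = {}"
  proof (rule ccontr)
    assume "B \<noteq> {}"
    then obtain b where "b \<in> B" by blast
    moreover from this have "b \<in> space (PiM {} (\<lambda>_. std_complex_gaussian))" using empty.prems(1) sets.sets_into_space by blast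
    ultimately show False using empty.prems by (auto simp: space_PiM)
  qed
  thus ?case by simp
next
  case (insert i J)
  let ?M = "\<lambda>J. PiM J (\<lambda>_::'i. std_complex_gaussian)"
  interpret GP: product_prob_space "\<lambda>_::'i. std_complex_gaussian" UNIV ..
  note [measurable] = insert.prems(1)
  have upd: "a(i := t) \<in> space (?M (insert i J))" if "a \<in> space (?M J)" for a t
    using that by (auto simp: space_PiM PiE_iff extensional_def)
  define Bt where "Bt = (\<lambda>t. {b \<in> space (?M J). b(i := t) \<in> B})"
  have m: "(\<lambda>b. b(i := t)) \<in> ?M J \<rightarrow>\<^sub>M ?M (insert i J)" for t
    by (rule measurable_fun_upd[where J = J]) auto
  have Bt: "Bt t \<in> sets (?M J)" for t
    using measurable_sets[OF m[of t] insert.prems(1)] by (simp add: Bt_def vimage_def Int_def conj_commute)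
  define b0 where "b0 = a0(i := undefined)"
  have b0: "b0 \<in> space (?M J)" "b0(i := a0 i) = a0" "b0(i := t) = a0(i := t)" for t
    using insert.prems(3) insert.hyps by (auto simp: b0_def space_PiM PiE_iff extensional_def)
  have fin: "finite {t. a0(i := t) \<in> B}"
  proof -
    have "a0 i \<notin> {t. a0(i := t) \<in> B}" using insert.prems(4) by simp
    thus ?thesis using insert.prems(2)[of i a0] insert.prems(3) by blast
  qed
  have null: "emeasure (?M J) (Bt t) = 0" if t: "a0(i := t) \<notin> B" for t
  proof (rule insert.IH[OF Bt _ b0(1)])
    show "b0 \<notin> Bt t" using t b0(3) by (simp add: Bt_def)
    fix a k assume k: "k \<in> J" and a: "a \<in> space (?M J)"
    have ki: "k \<noteq> i" using k insert.hyps by auto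
    have "{s. a(k := s) \<in> Bt t} = {s. (a(i := t))(k := s) \<in> B}"
    proof -
      have "a(k := s) \<in> space (?M J)" for s using a k by (auto simp: space_PiM PiE_iff extensional_def)
      moreover have "(a(k := s))(i := t) = (a(i := t))(k := s)" for s using ki by (rule fun_upd_twist)
      ultimately show ?thesis by (simp add: Bt_def)
    qed
    moreover have "finite {s. (a(i := t))(k := s) \<in> B} \<or> {s. (a(i := t))(k := s) \<in> B} = UNIV"
      by (rule insert.prems(2)[OF _ upd[OF a]]) (use k in simp)
    ultimately show "finite {s. a(k := s) \<in> Bt t} \<or> {s. a(k := s) \<in> Bt t} = UNIV" by (simp only:)
  qed
  have "emeasure (?M (insert i J)) B = (\<integral>\<^sup>+x. indicator B x \<partial>?M (insert i J))" by simp
  also have "\<dots> = (\<integral>\<^sup>+t. (\<integral>\<^sup>+b. indicator B (b(i := t)) \<partial>?M J) \<partial>std_complex_gaussian)"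
    by (rule GP.product_nn_integral_insert_rev) (use insert.hyps in auto)
  also have "\<dots> = (\<integral>\<^sup>+t. emeasure (?M J) (Bt t) \<partial>std_complex_gaussian)"
  proof (rule nn_integral_cong)
    fix t
    have "(\<integral>\<^sup>+b. indicator B (b(i := t)) \<partial>?M J) = (\<integral>\<^sup>+b. indicator (Bt t) b \<partial>?M J)"
      by (rule nn_integral_cong) (auto simp: Bt_def split: split_indicator)
    thus "(\<integral>\<^sup>+b. indicator B (b(i := t)) \<partial>?M J) = emeasure (?M J) (Bt t)" using Bt by simp
  qed
  also have "\<dots> = (\<integral>\<^sup>+t. 0 \<partial>std_complex_gaussian)"
  proof (rule nn_integral_cong_AE)
    have "AE t in std_complex_gaussian. t \<notin> {t. a0(i := t) \<in> B}"
      using finite_null_std_complex_gaussian[OF fin] fin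
      by (intro AE_not_in null_setsI) (auto simp: finite_imp_closed)
    thus "AE t in std_complex_gaussian. emeasure (?M J) (Bt t) = 0"
      by eventually_elim (use null in auto)
  qed
  finally show ?case by simp
qed

lemma prod_linear_factors_dvd:
  fixes q :: "'a::field poly"
  assumes "finite A" "\<And>x. x \<in> A \<Longrightarrow> poly q x = 0"
  shows "(\<Prod>x\<in>A. [:- x, 1:]) dvd q"
  using assms
proof (induction A arbitrary: q rule: finite_induct)
  case (insert a A)
  obtain s where s: "q = [:- a, 1:] * s" using insert.prems[of a] poly_eq_0_iff_dvd[of q a] by (auto elim: dvdE)
  have "(\<Prod>x\<in>A. [:- x, 1:]) dvd s"
  proof (rule insert.IH)
    fix x assume x: "x \<in> A"
    hence "x \<noteq> a" using insert.hyps by auto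
    thus "poly s x = 0" using insert.prems[of x] x by (auto simp: s)
  qed
  thus ?case unfolding s prod.insert[OF insert.hyps] by (intro mult_dvd_mono dvd_refl)
qed simp

text \<open>A double zero of \<open>f + t q\<close> is a zero of the Wronskian \<open>f q' - f'
  q\<close>, and each zero of the Wronskian admits at most one \<open>t\<close>. If the Wronskian
  vanishes identically, then \<open>q\<close> is a constant multiple of \<open>f\<close>, whose
  zeros are simple.\<close>

lemma finite_double_zero_pencil:
  fixes f q :: "complex poly"
  assumes f: "\<And>x. \<not> (poly f x = 0 \<and> poly (pderiv f) x = 0)"
  shows "finite {t. \<exists>x. poly (f + smult t q) x = 0 \<and> poly (pderiv (f + smult t q)) x = 0}" (is "finite ?T")
proof -
  define W where "W = f * pderiv q - pderiv f * q"
  have f0: "f \<noteq> 0" using f[of 0] by auto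
  have ev: "poly f x + t * poly q x = 0" "poly (pderiv f) x + t * poly (pderiv q) x = 0"
    if "poly (f + smult t q) x = 0" "poly (pderiv (f + smult t q)) x = 0" for t x
    using that by (auto simp: pderiv_add pderiv_smult)
  show ?thesis
  proof (cases "W = 0")
    case False
    have "?T \<subseteq> (\<Union>x\<in>{x. poly W x = 0}. {t. poly f x + t * poly q x = 0 \<and> poly (pderiv f) x + t * poly (pderiv q) x = 0})"
    proof
      fix t assume "t \<in> ?T"
      then obtain x where x: "poly (f + smult t q) x = 0" "poly (pderiv (f + smult t q)) x = 0" by blast
      note e = ev[OF x]
      have "poly W x = (poly f x + t * poly q x) * poly (pderiv q) x - (poly (pderiv f) x + t * poly (pderiv q) x) * poly q x"
        by (simp add: W_def algebra_simps)
      hence "poly W x = 0" unfolding e by simp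
      thus "t \<in> (\<Union>x\<in>{x. poly W x = 0}. {t. poly f x + t * poly q x = 0 \<and> poly (pderiv f) x + t * poly (pderiv q) x = 0})"
        using e by blast
    qed
    moreover have "finite {t. poly f x + t * poly q x = 0 \<and> poly (pderiv f) x + t * poly (pderiv q) x = 0}" for x
    proof (cases "poly q x = 0")
      case False
      have "{t. poly f x + t * poly q x = 0 \<and> poly (pderiv f) x + t * poly (pderiv q) x = 0} \<subseteq> {- poly f x / poly q x}"
        using False by (auto simp: field_simps add_eq_0_iff2)
      thus ?thesis by (rule finite_subset) simp
    next
      case q: True
      show ?thesis
      proof (cases "poly (pderiv q) x = 0")
        case False
        have "{t. poly f x + t * poly q x = 0 \<and> poly (pderiv f) x + t * poly (pderiv q) x = 0} \<subseteq> {- poly (pderiv f) x / poly (pderiv q) x}"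
          using False by (auto simp: field_simps add_eq_0_iff2)
        thus ?thesis by (rule finite_subset) simp
      next
        case True
        hence "{t. poly f x + t * poly q x = 0 \<and> poly (pderiv f) x + t * poly (pderiv q) x = 0} = {}" using q f[of x] by auto
        thus ?thesis by (simp only: finite.emptyI)
      qed
    qed
    ultimately show ?thesis
      by (rule finite_subset[OF _ finite_UN_I[OF poly_roots_finite[OF False]]])
  next
    case True
    have sq: "rsquarefree f" using f by (simp add: rsquarefree_roots)
    have "(\<Prod>x | poly f x = 0. [:- x, 1:]) dvd q"
    proof (rule prod_linear_factors_dvd[OF poly_roots_finite[OF f0]])
      fix x assume x: "x \<in> {x. poly f x = 0}"
      have "poly W x = poly f x * poly (pderiv q) x - poly (pderiv f) x * poly q x" by (simp add: W_def)
      thus "poly q x = 0" using x f[of x] True by simp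
    qed
    hence "smult (lead_coeff f) (\<Prod>x | poly f x = 0. [:- x, 1:]) dvd q" using f0 by (intro smult_dvd) auto
    hence "f dvd q" using complex_poly_decompose_rsquarefree[OF sq] by simp
    then obtain s where s: "q = f * s" by blast
    have "f * f * pderiv s = W" unfolding W_def s pderiv_mult by (simp add: algebra_simps)
    hence "pderiv s = 0" using True f0 by simp
    then obtain c where c: "s = [:c:]" using pderiv_iszero by blast
    have "?T \<subseteq> {t. 1 + t * c = 0}"
    proof
      fix t assume "t \<in> ?T"
      then obtain x where x: "poly (f + smult t q) x = 0" "poly (pderiv (f + smult t q)) x = 0" by blast
      have "f + smult t q = smult (1 + t * c) f" by (simp add: s c smult_add_left)
      hence "(1 + t * c) * poly f x = 0" "(1 + t * c) * poly (pderiv f) x = 0" using x by (simp_all add: pderiv_smult)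
      thus "t \<in> {t. 1 + t * c = 0}" using f[of x] by auto
    qed
    moreover have "finite {t. 1 + t * c = 0}"
    proof (cases "c = 0")
      case False
      have "{t. 1 + t * c = 0} \<subseteq> {- 1 / c}"
      proof
        fix t assume "t \<in> {t. 1 + t * c = 0}"
        hence "t * c = - 1" by (simp add: add_eq_0_iff)
        hence "t = - 1 / c" by (rule nonzero_eq_divide_eq[OF False, THEN iffD2])
        thus "t \<in> {- 1 / c}" by simp
      qed
      thus ?thesis by (rule finite_subset) simp
    qed simp
    ultimately show ?thesis by (rule finite_subset)
  qed
qed

text \<open>A double zero in a closed disc exists if and only if \<open>|p| + |p'|\<close> takes
  arbitrarily small values there, which can be tested on a countable dense set.\<close>

lemma measurable_double_zero:
  "{p \<in> polys N. \<exists>x. poly p x = 0 \<and> poly (pderiv p) x = 0} \<in> sets (borel_polys N)"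
proof -
  obtain D :: "complex set" where D: "countable D" "\<And>X. open X \<Longrightarrow> X \<noteq> {} \<Longrightarrow> \<exists>d\<in>D. d \<in> X"
    using countable_dense_setE by blast
  let ?F = "\<lambda>p x. norm (poly p x) + norm (poly (pderiv p) x)"
  have meas: "(\<lambda>p. ?F p x) \<in> borel_measurable (borel_polys N)" for x
  proof -
    have 1: "(\<lambda>p. poly p x) \<in> borel_measurable (borel_polys N)" by (rule measurable_poly_eval[where N = N]) auto
    have "(\<lambda>p. \<Sum>i<N. of_nat (Suc i) * coeff p (Suc i) * x ^ i) \<in> borel_measurable (borel_polys N)"
      by (intro borel_measurable_sum borel_measurable_times borel_measurable_const measurable_coeff_borel_polys) auto
    hence 2: "(\<lambda>p. poly (pderiv p) x) \<in> borel_measurable (borel_polys N)"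
      by (rule measurable_cong[THEN iffD1, rotated]) (auto simp: poly_pderiv_sum_coeff[where N = N] simp del: of_nat_Suc)
    show ?thesis using 1 2 by measurable
  qed
  have "{p \<in> polys N. \<exists>x. poly p x = 0 \<and> poly (pderiv p) x = 0} =
     (\<Union>R::nat. \<Inter>n::nat. \<Union>x\<in>D \<inter> ball 0 (real R). {p \<in> space (borel_polys N). ?F p x < 1 / (real n + 1)})"
    (is "?L = ?R")
  proof (intro equalityI subsetI)
    fix p assume p: "p \<in> ?L"
    then obtain x where x: "poly p x = 0" "poly (pderiv p) x = 0" by blast
    obtain R :: nat where R: "norm x < real R" using reals_Archimedean2 by blast
    have "\<exists>d\<in>D \<inter> ball 0 (real R). ?F p d < 1 / (real n + 1)" for n :: nat
    proof -
      let ?X = "ball 0 (real R) \<inter> {y. ?F p y < 1 / (real n + 1)}"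
      have "open ?X" by (intro open_Int open_ball open_Collect_less continuous_intros)
      moreover have "x \<in> ?X" using x R by simp
      ultimately show ?thesis using D(2)[of ?X] by blast
    qed
    thus "p \<in> ?R" using p by auto
  next
    fix p assume p: "p \<in> ?R"
    then obtain R :: nat where R: "\<And>n. \<exists>x\<in>D \<inter> ball 0 (real R). ?F p x < 1 / (real n + 1)" and pN: "p \<in> polys N" by auto
    have ne: "cball (0::complex) (real R) \<noteq> {}" using R[of 0] by auto
    have "continuous_on (cball 0 (real R)) (?F p)" by (intro continuous_intros)
    then obtain y where y: "y \<in> cball 0 (real R)" "\<And>x. x \<in> cball 0 (real R) \<Longrightarrow> ?F p y \<le> ?F p x"
      using continuous_attains_inf[OF compact_cball ne] by blast
    have "?F p y \<le> 0"
    proof (rule ccontr)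
      assume "\<not> ?F p y \<le> 0"
      hence "?F p y > 0" by simp
      then obtain n :: nat where n: "1 / (real n + 1) < ?F p y" using nat_approx_posE by (metis of_nat_Suc add.commute)
      obtain x where "x \<in> ball 0 (real R)" "?F p x < 1 / (real n + 1)" using R[of n] by blast
      thus False using y(2)[of x] n by auto
    qed
    hence "poly p y = 0 \<and> poly (pderiv p) y = 0" using norm_ge_zero[of "poly p y"] norm_ge_zero[of "poly (pderiv p) y"]
      by (metis add_nonneg_eq_0_iff antisym add_nonneg_nonneg norm_eq_zero)
    thus "p \<in> ?L" using pN by blast
  qed
  also have "\<dots> \<in> sets (borel_polys N)"
  proof -
    have s1: "{p \<in> space (borel_polys N). ?F p x < c} \<in> sets (borel_polys N)" for x c
      by (rule borel_measurable_less[OF meas]) simp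
    have s2: "(\<Union>x\<in>D \<inter> ball 0 (real R). {p \<in> space (borel_polys N). ?F p x < c}) \<in> sets (borel_polys N)" for R :: nat and c
      by (rule sets.countable_UN') (use D(1) s1 in \<open>auto simp del: space_borel_polys\<close>)
    have s3: "(\<Inter>n::nat. \<Union>x\<in>D \<inter> ball 0 (real R). {p \<in> space (borel_polys N). ?F p x < 1 / (real n + 1)}) \<in> sets (borel_polys N)" for R :: nat
      by (rule sets.countable_INT) (use s2 in blast)+
    show ?thesis by (rule sets.countable_UN) (use s3 in blast)
  qed
  finally show ?thesis .
qed

text \<open>Changing one coefficient moves the polynomial along a line in the direction of a basis
  element. Both exceptional sets, multiple zeros and degree less than \<open>N\<close>, meet such
  a line in a finite set unless they contain it, and \<open>x^N - 1\<close> belongs to neither.\<close>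

theorem AE_simple_roots:
  assumes N: "N \<ge> 1" and P: "\<And>j. j \<le> N \<Longrightarrow> P j \<in> polys N" and span: "\<And>f. f \<in> polys N \<Longrightarrow> \<exists>a. f = random_poly N P a"
  shows "AE p in distr (PiM {..N} (\<lambda>_. std_complex_gaussian)) (borel_polys N) (random_poly N P).
    degree p = N \<and> rsquarefree p"
proof -
  let ?G = "PiM {..N} (\<lambda>_. std_complex_gaussian)"
  have mF: "random_poly N P \<in> ?G \<rightarrow>\<^sub>M borel_polys N" by (rule measurable_random_poly) (rule P)
  have preim: "{a \<in> space ?G. random_poly N P a \<in> B} \<in> sets ?G" if "B \<in> sets (borel_polys N)" for B
  proof -
    have "{a \<in> space ?G. random_poly N P a \<in> B} = random_poly N P -` B \<inter> space ?G" by auto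
    thus ?thesis using measurable_sets[OF mF that] by simp
  qed
  have upd: "random_poly N P (a(i := t)) = random_poly N P (a(i := 0)) + smult t (P i)" if "i \<le> N" for a i t
  proof -
    have "(\<Sum>j\<in>{..N} - {i}. smult ((a(i := t)) j) (P j)) = (\<Sum>j\<in>{..N} - {i}. smult ((a(i := 0)) j) (P j))"
      by (rule sum.cong) auto
    moreover have "(\<Sum>j\<le>N. smult ((a(i := s)) j) (P j)) = smult s (P i) + (\<Sum>j\<in>{..N} - {i}. smult ((a(i := s)) j) (P j))" for s
      using sum.remove[of "{..N}" i "\<lambda>j. smult ((a(i := s)) j) (P j)"] that by simp
    ultimately show ?thesis unfolding random_poly_def by (simp add: add.commute)
  qed
  define Z where "Z = {p \<in> polys N. \<exists>x. poly p x = 0 \<and> poly (pderiv p) x = 0}"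
  define L where "L = {p \<in> polys N. coeff p N = 0}"
  have Z: "Z \<in> sets (borel_polys N)" unfolding Z_def by (rule measurable_double_zero)
  have "{p \<in> space (borel_polys N). coeff p N = 0} \<in> sets (borel_polys N)"
    using measurable_sets[OF measurable_coeff_borel_polys[of N N], of "{0}"]
    by (simp add: vimage_def Int_def conj_commute)
  hence L: "L \<in> sets (borel_polys N)" by (simp add: L_def)
  have inN: "random_poly N P a \<in> polys N" for a by (rule random_poly_in_polys[OF P])
  define p0 :: "complex poly" where "p0 = monom 1 N - 1"
  have d0: "degree p0 \<le> N" unfolding p0_def by (rule degree_diff_le) (auto simp: degree_monom_le)
  have c0: "coeff p0 N = 1" using N by (simp add: p0_def)
  obtain b where b: "p0 = random_poly N P b" using span[of p0] d0 by (auto simp: polys_def)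
  define a0 where "a0 = restrict b {..N}"
  have a0: "a0 \<in> space ?G" "random_poly N P a0 = p0"
    unfolding b by (auto simp: a0_def space_PiM random_poly_def intro!: sum.cong)
  have p0_Z: "p0 \<notin> Z"
  proof
    assume "p0 \<in> Z"
    then obtain x :: complex where x: "x ^ N = 1" "of_nat N * x ^ (N - 1) = 0"
      using N by (auto simp: Z_def p0_def poly_monom pderiv_monom pderiv_diff power_0_left)
    hence "x = 0" using N by (auto split: if_splits)
    thus False using x N by (simp add: power_0_left)
  qed
  have p0_L: "p0 \<notin> L" using c0 by (simp add: L_def)
  have null: "emeasure ?G {a \<in> space ?G. random_poly N P a \<in> B} = 0"
    if B: "B \<in> sets (borel_polys N)" and p0: "p0 \<notin> B"
      and fin: "\<And>f q. f \<in> polys N \<Longrightarrow> q \<in> polys N \<Longrightarrow> f \<notin> B \<Longrightarrow> finite {t. f + smult t q \<in> B}" for B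
  proof (rule null_of_line_slices[where ?a0.0 = a0])
    show "{a \<in> space ?G. random_poly N P a \<in> B} \<in> sets ?G"
      by (rule preim[OF B])
    fix a i assume i: "i \<in> {..N}" and a: "a \<in> space ?G"
    have sp: "a(i := t) \<in> space ?G" for t using a i by (auto simp: space_PiM PiE_iff extensional_def)
    define f0 where "f0 = random_poly N P (a(i := 0))"
    have updf: "random_poly N P (a(i := t)) = f0 + smult t (P i)" for t
      unfolding f0_def by (rule upd) (use i in simp)
    have eq: "{t. a(i := t) \<in> {a \<in> space ?G. random_poly N P a \<in> B}} = {t. f0 + smult t (P i) \<in> B}"
      using sp updf by auto
    show "finite {t. a(i := t) \<in> {a \<in> space ?G. random_poly N P a \<in> B}} \<or>
        {t. a(i := t) \<in> {a \<in> space ?G. random_poly N P a \<in> B}} = UNIV"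
    proof (cases "\<exists>t0. f0 + smult t0 (P i) \<notin> B")
      case True
      then obtain t0 where t0: "random_poly N P (a(i := t0)) \<notin> B" using updf by auto
      have "finite {t. random_poly N P (a(i := t0)) + smult t (P i) \<in> B}"
        by (rule fin) (use inN P i t0 in auto)
      hence "finite ((\<lambda>t. t + t0) ` {t. random_poly N P (a(i := t0)) + smult t (P i) \<in> B})" by (rule finite_imageI)
      moreover have "{t. f0 + smult t (P i) \<in> B} \<subseteq>
          (\<lambda>t. t + t0) ` {t. random_poly N P (a(i := t0)) + smult t (P i) \<in> B}"
      proof
        fix t assume t: "t \<in> {t. f0 + smult t (P i) \<in> B}"
        have "random_poly N P (a(i := t0)) + smult (t - t0) (P i) =
            f0 + (smult t0 (P i) + smult (t - t0) (P i))"
          by (simp only: updf add.assoc)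
        also have "smult t0 (P i) + smult (t - t0) (P i) = smult t (P i)" by (simp flip: smult_add_left)
        finally have "random_poly N P (a(i := t0)) + smult (t - t0) (P i) = f0 + smult t (P i)" .
        hence "t - t0 \<in> {t. random_poly N P (a(i := t0)) + smult t (P i) \<in> B}" using t by simp
        moreover have "t = (t - t0) + t0" by simp
        ultimately show "t \<in> (\<lambda>t. t + t0) ` {t. random_poly N P (a(i := t0)) + smult t (P i) \<in> B}"
          by (rule image_eqI[rotated])
      qed
      ultimately show ?thesis unfolding eq by (blast intro: finite_subset)
    next
      case False
      thus ?thesis unfolding eq by auto
    qed
  qed (use a0 p0 in auto)
  have nZ: "emeasure ?G {a \<in> space ?G. random_poly N P a \<in> Z} = 0"
  proof (rule null[OF Z p0_Z])
    fix f q assume f: "f \<in> polys N" "q \<in> polys N" "f \<notin> Z"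
    have "finite {t. \<exists>x. poly (f + smult t q) x = 0 \<and> poly (pderiv (f + smult t q)) x = 0}"
      by (rule finite_double_zero_pencil) (use f in \<open>auto simp: Z_def\<close>)
    thus "finite {t. f + smult t q \<in> Z}" by (rule rev_finite_subset) (auto simp: Z_def)
  qed
  have nL: "emeasure ?G {a \<in> space ?G. random_poly N P a \<in> L} = 0"
  proof (rule null[OF L p0_L])
    fix f q assume f: "f \<in> polys N" "q \<in> polys N" "f \<notin> L"
    hence fN: "coeff f N \<noteq> 0" by (simp add: L_def)
    have "{t. f + smult t q \<in> L} \<subseteq> {- coeff f N / coeff q N}"
      using fN by (auto simp: L_def field_simps add_eq_0_iff2)
    thus "finite {t. f + smult t q \<in> L}" by (rule finite_subset) simp
  qed
  have ae: "AE a in ?G. random_poly N P a \<notin> Z \<and> random_poly N P a \<notin> L"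
  proof -
    have "AE a in ?G. \<not> random_poly N P a \<in> B" if "B \<in> sets (borel_polys N)" "emeasure ?G {a \<in> space ?G. random_poly N P a \<in> B} = 0" for B
      using that preim[OF that(1)]
      by (intro AE_I'[of "{a \<in> space ?G. random_poly N P a \<in> B}"]) (auto simp: null_sets_def)
    from this[OF Z nZ] this[OF L nL] show ?thesis by auto
  qed
  have good: "degree p = N \<and> rsquarefree p \<longleftrightarrow> p \<notin> Z \<and> p \<notin> L" if p: "p \<in> polys N" for p
  proof -
    have "degree p = N \<longleftrightarrow> coeff p N \<noteq> 0"
      using p N by (auto simp: polys_def intro: le_degree antisym)
    thus ?thesis using p by (auto simp: rsquarefree_roots Z_def L_def)
  qed
  show ?thesis
  proof (subst AE_distr_iff[OF mF])
    have "{p \<in> space (borel_polys N). degree p = N \<and> rsquarefree p} = space (borel_polys N) - (Z \<union> L)"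
      using good by auto
    thus "{p \<in> space (borel_polys N). degree p = N \<and> rsquarefree p} \<in> sets (borel_polys N)" using Z L
      by (simp only: sets.Diff sets.Un sets.top)
    show "AE a in ?G. degree (random_poly N P a) = N \<and> rsquarefree (random_poly N P a)"
      using ae by eventually_elim (use good inN in auto)
  qed
qed

section \<open>Circular means of polynomials\<close>

text \<open>Jensen's formula for polynomials, summed over the linear factors.\<close>

lemma circle_mean_ln_poly:
  fixes p :: "complex poly"
  assumes p: "rsquarefree p" and r: "r > 0"
  shows "integrable unif01 (\<lambda>t. ln (norm (poly p (z + of_real r * ucirc t))))"
    and "circle_mean (\<lambda>x. ln (norm (poly p x))) z r =
      ln (norm (lead_coeff p)) + (\<Sum>x | poly p x = 0. ln (max r (norm (z - x))))"
    and "AE t in unif01. poly p (z + of_real r * ucirc t) \<noteq> 0"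
proof -
  interpret prob_space unif01 by (rule prob_space_unif01)
  let ?c = "\<lambda>t. z + of_real r * ucirc t"
  let ?Z = "{x. poly p x = 0}"
  have p0: "p \<noteq> 0" using p by (auto simp: rsquarefree_def)
  have fin: "finite ?Z" using poly_roots_finite[OF p0] .
  have ae: "AE t in unif01. \<forall>x\<in>?Z. of_real r * ucirc t \<noteq> x - z"
    using AE_unif01_countable[OF countable_ucirc_vimage[OF r]] fin
    by (subst AE_finite_all[OF fin]) auto
  show nz: "AE t in unif01. poly p (?c t) \<noteq> 0"
    using ae by eventually_elim (force simp: algebra_simps)
  have dec: "poly p y = lead_coeff p * (\<Prod>x\<in>?Z. (y - x))" for y
  proof -
    have "poly p y = poly (smult (lead_coeff p) (\<Prod>x\<in>?Z. [:- x, 1:])) y"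
      using complex_poly_decompose_rsquarefree[OF p] by simp
    thus ?thesis by (simp add: poly_prod)
  qed
  let ?s = "\<lambda>t. ln (norm (lead_coeff p)) + (\<Sum>x\<in>?Z. ln (norm (of_real r * ucirc t - (x - z))))"
  have eq: "AE t in unif01. ln (norm (poly p (?c t))) = ?s t"
    using ae
  proof eventually_elim
    case (elim t)
    have "ln (norm (poly p (?c t))) = ln (norm (lead_coeff p) * (\<Prod>x\<in>?Z. norm (?c t - x)))"
      unfolding dec[of "?c t"] by (simp only: norm_mult prod_norm)
    also have "\<dots> = ln (norm (lead_coeff p)) + ln (\<Prod>x\<in>?Z. norm (?c t - x))"
      using elim p0 fin by (subst ln_mult) (auto simp: prod_zero_iff algebra_simps)
    also have "ln (\<Prod>x\<in>?Z. norm (?c t - x)) = (\<Sum>x\<in>?Z. ln (norm (?c t - x)))"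
      using elim fin by (subst ln_prod) (auto simp: algebra_simps)
    finally show ?case by (simp add: algebra_simps)
  qed
  have int: "integrable unif01 ?s"
    by (intro Bochner_Integration.integrable_add Bochner_Integration.integrable_sum integrable_ln_dist_circle r) simp
  have m: "(\<lambda>t. ln (norm (poly p (?c t)))) \<in> borel_measurable unif01"
  proof -
    have "(\<lambda>t. poly p (?c t)) \<in> borel_measurable borel"
      by (intro borel_measurable_continuous_onI continuous_intros)
    thus ?thesis by measurable
  qed
  show "integrable unif01 (\<lambda>t. ln (norm (poly p (?c t))))"
    using integrable_cong_AE[OF m borel_measurable_integrable[OF int] eq] int by simp
  have "circle_mean (\<lambda>x. ln (norm (poly p x))) z r = integral\<^sup>L unif01 ?s"
    unfolding circle_mean_def by (rule integral_cong_AE[OF m borel_measurable_integrable[OF int] eq])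
  also have "\<dots> = ln (norm (lead_coeff p)) + (\<Sum>x\<in>?Z. \<integral>t. ln (norm (of_real r * ucirc t - (x - z))) \<partial>unif01)"
    using integrable_ln_dist_circle[OF r] prob_space by simp
  also have "\<dots> = ln (norm (lead_coeff p)) + (\<Sum>x\<in>?Z. ln (max r (norm (z - x))))"
    unfolding circle_mean_ln_dist(2)[OF r] by (simp add: norm_minus_commute)
  finally show "circle_mean (\<lambda>x. ln (norm (poly p x))) z r =
      ln (norm (lead_coeff p)) + (\<Sum>x\<in>?Z. ln (max r (norm (z - x))))" .
qed

text \<open>A Lipschitz bump of height \<open>ln 2\<close> supported in the disc of radius
  \<open>2 s\<close>.\<close>

definition tent :: "real \<Rightarrow> complex \<Rightarrow> real" where
  "tent s u = ln (max (2 * s) (norm u)) - ln (max s (norm u))"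

text \<open>An arbitrary positive weight \<open>S\<close> may be split off. For the Christoffel
  function the first difference is random and negligible, the second deterministic and of order
  \<open>N\<close>.\<close>

lemma sum_tent_roots:
  fixes p :: "complex poly"
  assumes p: "rsquarefree p" and s: "s > 0"
    and S: "continuous_on UNIV S" "\<And>x. S x > 0"
  shows "(\<Sum>x | poly p x = 0. tent s (z - x)) =
    ((\<integral>t. ln (norm (poly p (z + of_real (2 * s) * ucirc t)) / sqrt (S (z + of_real (2 * s) * ucirc t))) \<partial>unif01)
      - (\<integral>t. ln (norm (poly p (z + of_real s * ucirc t)) / sqrt (S (z + of_real s * ucirc t))) \<partial>unif01))
    + (circle_mean (\<lambda>x. ln (S x) / 2) z (2 * s) - circle_mean (\<lambda>x. ln (S x) / 2) z s)"
proof -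
  have cS: "continuous_on UNIV (\<lambda>x. ln (S x) / 2)" using S(2) by (intro continuous_intros S(1)) (auto simp: less_imp_neq[symmetric])
  have [measurable]: "S \<in> borel_measurable borel" using S(1) by (rule borel_measurable_continuous_onI)
  have eq: "(\<integral>t. ln (norm (poly p (z + of_real r * ucirc t)) / sqrt (S (z + of_real r * ucirc t))) \<partial>unif01) =
      circle_mean (\<lambda>x. ln (norm (poly p x))) z r - circle_mean (\<lambda>x. ln (S x) / 2) z r" if r: "r > 0" for r
  proof -
    note P = circle_mean_ln_poly[OF p r, of z]
    note I = integrable_circle[OF cS, of z r]
    have "(\<integral>t. ln (norm (poly p (z + of_real r * ucirc t)) / sqrt (S (z + of_real r * ucirc t))) \<partial>unif01) =
        (\<integral>t. ln (norm (poly p (z + of_real r * ucirc t))) - ln (S (z + of_real r * ucirc t)) / 2 \<partial>unif01)"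
    proof (rule integral_cong_AE)
      have "(\<lambda>t. poly p (z + of_real r * ucirc t)) \<in> borel_measurable borel"
        by (intro borel_measurable_continuous_onI continuous_intros)
      thus "(\<lambda>t. ln (norm (poly p (z + of_real r * ucirc t)) / sqrt (S (z + of_real r * ucirc t)))) \<in> borel_measurable unif01"
        "(\<lambda>t. ln (norm (poly p (z + of_real r * ucirc t))) - ln (S (z + of_real r * ucirc t)) / 2) \<in> borel_measurable unif01"
        by measurable
      show "AE t in unif01. ln (norm (poly p (z + of_real r * ucirc t)) / sqrt (S (z + of_real r * ucirc t))) =
          ln (norm (poly p (z + of_real r * ucirc t))) - ln (S (z + of_real r * ucirc t)) / 2"
        using P(3)
      proof eventually_elim
        case (elim t) thus ?case using S(2)[of "z + of_real r * ucirc t"] by (simp add: ln_div ln_sqrt)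
      qed
    qed
    also have "\<dots> = circle_mean (\<lambda>x. ln (norm (poly p x))) z r - circle_mean (\<lambda>x. ln (S x) / 2) z r"
      unfolding circle_mean_def by (rule Bochner_Integration.integral_diff[OF P(1) I])
    finally show ?thesis .
  qed
  show ?thesis
    using s unfolding eq[of "2 * s", simplified] eq[OF s] circle_mean_ln_poly(2)[OF p s] tent_def
    by (subst eq) (simp_all add: circle_mean_ln_poly(2)[OF p] sum_subtractf)
qed

section \<open>The Christoffel function\<close>

text \<open>Both inner products are \<open>L\<^sup>2\<close> products for a finite measure on
  \<open>K\<close>.\<close>

locale orthonormal_setting = exterior_map +
  fixes m :: "complex measure"
  assumes finite_m: "finite_measure m" and sets_m [measurable_cong]: "sets m = sets borel"
    and m_K: "AE z in m. z \<in> K"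
begin

sublocale m: finite_measure m by (rule finite_m)

definition ip :: "complex poly \<Rightarrow> complex poly \<Rightarrow> complex" where
  "ip p q = (\<integral>z. poly p z * cnj (poly q z) \<partial>m)"

text \<open>The square of the norm.\<close>

definition L2 :: "complex poly \<Rightarrow> real" where
  "L2 p = (\<integral>z. (norm (poly p z))\<^sup>2 \<partial>m)"

lemma integrable_continuous_m:
  fixes f :: "complex \<Rightarrow> 'a::{banach, second_countable_topology}"
  assumes "continuous_on UNIV f" shows "integrable m f"
proof -
  obtain B where "\<And>z. z \<in> K \<Longrightarrow> norm (f z) \<le> B"
    using compact_imp_bounded[OF compact_continuous_image[OF continuous_on_subset[OF assms] compact_K]]
    unfolding bounded_iff by auto
  thus ?thesis using m_K borel_measurable_continuous_onI[OF assms]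
    by (intro m.integrable_const_bound[of _ B]) (auto elim!: eventually_mono simp: measurable_cong_sets[OF sets_m refl])
qed

lemma ip_self: "ip p p = of_real (L2 p)"
proof -
  have "ip p p = (\<integral>z. complex_of_real ((norm (poly p z))\<^sup>2) \<partial>m)"
    unfolding ip_def by (simp only: complex_norm_square)
  also have "\<dots> = of_real (L2 p)" unfolding L2_def by (rule integral_complex_of_real)
  finally show ?thesis .
qed

lemma ip_expand:
  assumes on: "\<And>j k. j \<le> N \<Longrightarrow> k \<le> N \<Longrightarrow> ip (P j) (P k) = (if j = k then 1 else 0)"
  shows "L2 (random_poly N P b) = (\<Sum>j\<le>N. (norm (b j))\<^sup>2)"
proof -
  have "of_real (L2 (random_poly N P b)) =
      (\<integral>z. (\<Sum>j\<le>N. \<Sum>k\<le>N. (b j * cnj (b k)) * (poly (P j) z * cnj (poly (P k) z))) \<partial>m)"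
  proof -
    have "(\<Sum>j\<le>N. b j * poly (P j) z) * cnj (\<Sum>k\<le>N. b k * poly (P k) z) =
        (\<Sum>j\<le>N. \<Sum>k\<le>N. (b j * cnj (b k)) * (poly (P j) z * cnj (poly (P k) z)))" for z
      unfolding cnj_sum sum_product by (intro sum.cong refl) (simp add: mult_ac)
    thus ?thesis unfolding ip_self[symmetric] ip_def poly_random_poly by (simp only:)
  qed
  also have "\<dots> = (\<Sum>j\<le>N. \<Sum>k\<le>N. (b j * cnj (b k)) * ip (P j) (P k))"
  proof -
    have i: "integrable m (\<lambda>z. c * (poly p z * cnj (poly q z)))" for c p q
      by (intro integrable_continuous_m continuous_intros)
    have "(\<integral>z. (\<Sum>j\<le>N. \<Sum>k\<le>N. (b j * cnj (b k)) * (poly (P j) z * cnj (poly (P k) z))) \<partial>m) =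
        (\<Sum>j\<le>N. \<integral>z. (\<Sum>k\<le>N. (b j * cnj (b k)) * (poly (P j) z * cnj (poly (P k) z))) \<partial>m)"
      by (rule Bochner_Integration.integral_sum) (intro Bochner_Integration.integrable_sum i)
    also have "\<dots> = (\<Sum>j\<le>N. \<Sum>k\<le>N. \<integral>z. (b j * cnj (b k)) * (poly (P j) z * cnj (poly (P k) z)) \<partial>m)"
      by (intro sum.cong refl Bochner_Integration.integral_sum i)
    finally show ?thesis by (simp add: ip_def)
  qed
  also have "\<dots> = (\<Sum>j\<le>N. \<Sum>k\<le>N. if k = j then b j * cnj (b j) else 0)"
    by (intro sum.cong refl) (auto simp: on)
  also have "\<dots> = (\<Sum>j\<le>N. b j * cnj (b j))" by (intro sum.cong refl) (simp add: sum.delta)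
  also have "\<dots> = of_real (\<Sum>j\<le>N. (norm (b j))\<^sup>2)"
    by (simp only: complex_norm_square[symmetric] of_real_sum)
  finally show ?thesis by (simp only: of_real_eq_iff)
qed

lemma poly_le_christoffel:
  assumes on: "\<And>j k. j \<le> N \<Longrightarrow> k \<le> N \<Longrightarrow> ip (P j) (P k) = (if j = k then 1 else 0)"
  shows "(norm (poly (random_poly N P b) z))\<^sup>2 \<le> L2 (random_poly N P b) * christoffel N P z"
proof -
  have "norm (poly (random_poly N P b) z) \<le> (\<Sum>j\<le>N. norm (b j) * norm (poly (P j) z))"
    unfolding poly_random_poly by (rule order_trans[OF norm_sum]) (simp add: norm_mult)
  hence "(norm (poly (random_poly N P b) z))\<^sup>2 \<le> (\<Sum>j\<le>N. norm (b j) * norm (poly (P j) z))\<^sup>2"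
    by (intro power_mono) auto
  also have "\<dots> \<le> (\<Sum>j\<le>N. (norm (b j))\<^sup>2) * (\<Sum>j\<le>N. (norm (poly (P j) z))\<^sup>2)" by (rule Cauchy_Schwarz_ineq_sum)
  finally show ?thesis by (simp add: ip_expand[OF on] christoffel_def)
qed

text \<open>The bound is applied to the reproducing kernel \<open>\<Sum> P\<^sub>j conj (P\<^sub>j
  z)\<close>, whose value at \<open>z\<close> and whose squared norm are both the Christoffel
  function.\<close>

lemma christoffel_le:
  assumes on: "\<And>j k. j \<le> N \<Longrightarrow> k \<le> N \<Longrightarrow> ip (P j) (P k) = (if j = k then 1 else 0)"
    and P: "\<And>j. j \<le> N \<Longrightarrow> P j \<in> polys N" and A: "A \<ge> 0"
    and bound: "\<And>p. p \<in> polys N \<Longrightarrow> norm (poly p z) \<le> A * sqrt (L2 p)"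
  shows "christoffel N P z \<le> A\<^sup>2"
proof -
  define S where "S = christoffel N P z"
  have S: "S \<ge> 0" by (simp add: S_def christoffel_def sum_nonneg)
  define q where "q = random_poly N P (\<lambda>j. cnj (poly (P j) z))"
  have "poly q z = (\<Sum>j\<le>N. of_real ((norm (poly (P j) z))\<^sup>2))"
    unfolding q_def poly_random_poly by (simp only: complex_norm_square mult.commute)
  hence "poly q z = of_real S" unfolding S_def christoffel_def by (simp only: of_real_sum)
  moreover have "L2 q = S" using ip_expand[of N P, OF on] by (simp add: q_def S_def christoffel_def)
  moreover have "q \<in> polys N" unfolding q_def by (rule random_poly_in_polys[OF P])
  ultimately have "S \<le> A * sqrt S" using bound[of q] S by simp
  hence "sqrt S * sqrt S \<le> A * sqrt S" using S by simp
  hence "sqrt S \<le> A" using A S by (cases "S = 0") (auto intro: mult_right_le_imp_le simp del: real_sqrt_mult_self)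
  hence "(sqrt S)\<^sup>2 \<le> A\<^sup>2" using S by (intro power_mono) auto
  thus ?thesis using S by (simp add: S_def)
qed

definition bernstein_markov :: bool where
  "bernstein_markov \<longleftrightarrow> (\<forall>\<epsilon>>0. \<exists>C>0. \<forall>N p z. degree p \<le> N \<longrightarrow> z \<in> K \<longrightarrow>
    norm (poly p z) \<le> C * exp (\<epsilon> * real N) * sqrt (L2 p))"

text \<open>Upper bound by the Bernstein-Markov property and the Bernstein-Walsh inequality, lower
  bound by testing with the extremal polynomials, or with the constant \<open>1\<close> for points
  of \<open>K\<close>, where the Green function vanishes. The second claim is the domination
  needed to integrate the limit over circles.\<close>

theorem christoffel_root_limit:
  fixes P :: "nat \<Rightarrow> nat \<Rightarrow> complex poly"
  assumes bm: "bernstein_markov"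
    and P: "\<And>N j. N \<ge> 1 \<Longrightarrow> j \<le> N \<Longrightarrow> P N j \<in> polys N"
    and on: "\<And>N j k. N \<ge> 1 \<Longrightarrow> j \<le> N \<Longrightarrow> k \<le> N \<Longrightarrow> ip (P N j) (P N k) = (if j = k then 1 else 0)"
    and span: "\<And>N f. N \<ge> 1 \<Longrightarrow> f \<in> polys N \<Longrightarrow> \<exists>a. f = random_poly N (P N) a"
  shows "(\<lambda>N. ln (christoffel N (P N) z) / (2 * real N)) \<longlonglongrightarrow> green z"
    and "\<exists>B. \<forall>N\<ge>1. \<forall>z. \<bar>ln (christoffel N (P N) z) / (2 * real N)\<bar> \<le> B + green z"
proof -
  let ?S = "\<lambda>N. christoffel N (P N)"
  have Spos: "?S N z > 0" if "N \<ge> 1" for N z by (rule christoffel_pos[OF span[OF that]])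
  have upper: "\<exists>C>0. \<forall>N\<ge>1. \<forall>z. ln (?S N z) / (2 * real N) \<le> ln C / real N + \<epsilon> + green z" if eps: "\<epsilon> > 0" for \<epsilon>
  proof -
    obtain C where C: "C > 0" "\<And>N p z. degree p \<le> N \<Longrightarrow> z \<in> K \<Longrightarrow> norm (poly p z) \<le> C * exp (\<epsilon> * real N) * sqrt (L2 p)"
      using bm eps unfolding bernstein_markov_def by blast
    show ?thesis
    proof (intro exI[of _ C] conjI allI impI C(1))
      fix N :: nat and z assume N: "N \<ge> 1"
      let ?A = "C * exp (\<epsilon> * real N) * exp (real N * green z)"
      have A: "?A > 0" using C(1) by simp
      have "?S N z \<le> ?A\<^sup>2"
      proof (rule christoffel_le[OF on P])
        fix p assume "p \<in> polys N"
        hence d: "degree p \<le> N" by (simp add: polys_def)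
        have "norm (poly p z) \<le> (C * exp (\<epsilon> * real N) * sqrt (L2 p)) * exp (real N * green z)"
          by (rule bernstein_walsh[OF d]) (rule C(2)[OF d])
        thus "norm (poly p z) \<le> ?A * sqrt (L2 p)" by (simp add: mult_ac)
      qed (use N A in auto)
      hence "ln (?S N z) \<le> ln (?A\<^sup>2)" using Spos[OF N] by (intro ln_mono) auto
      also have "\<dots> = 2 * ln ?A" using A by (simp add: ln_realpow)
      also have "ln ?A = ln C + \<epsilon> * real N + real N * green z" using C(1) by (simp add: ln_mult)
      finally have "ln (?S N z) / (2 * real N) \<le> (2 * (ln C + \<epsilon> * real N + real N * green z)) / (2 * real N)"
        using N by (intro divide_right_mono) auto
      also have "\<dots> = ln C / real N + \<epsilon> + green z" using N by (simp add: field_simps)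
      finally show "ln (?S N z) / (2 * real N) \<le> ln C / real N + \<epsilon> + green z" .
    qed
  qed
  define m1 where "m1 = L2 1 + 1"
  have L21: "L2 1 \<ge> 0" unfolding L2_def by simp
  have m1: "m1 \<ge> 1" using L21 by (simp add: m1_def)
  have L2_le: "L2 p \<le> m1" if "\<And>x. x \<in> K \<Longrightarrow> norm (poly p x) \<le> 1" for p
  proof -
    have "L2 p \<le> L2 1" unfolding L2_def
    proof (rule integral_mono_AE)
      show "AE x in m. (norm (poly p x))\<^sup>2 \<le> (norm (poly 1 x))\<^sup>2"
        using m_K by eventually_elim (use that in \<open>auto intro: power_le_one\<close>)
    qed (auto intro!: integrable_continuous_m continuous_intros)
    thus ?thesis by (simp add: m1_def)
  qed
  have low: "ln (?S N z) / (2 * real N) \<ge> x - ln m1 / (2 * real N)"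
    if N: "N \<ge> 1" and p: "p \<in> polys N" "\<And>x. x \<in> K \<Longrightarrow> norm (poly p x) \<le> 1" and px: "norm (poly p z) \<ge> exp (real N * x)"
    for N p z x
  proof -
    obtain a where a: "p = random_poly N (P N) a" using span[OF N p(1)] by blast
    have "(exp (real N * x))\<^sup>2 \<le> (norm (poly p z))\<^sup>2" using px by (intro power_mono) auto
    also have "\<dots> \<le> L2 p * ?S N z" unfolding a by (rule poly_le_christoffel[OF on[OF N]])
    also have "\<dots> \<le> m1 * ?S N z" using L2_le[OF p(2)] Spos[OF N] by (intro mult_right_mono) (auto intro: less_imp_le)
    finally have "ln ((exp (real N * x))\<^sup>2) \<le> ln (m1 * ?S N z)" by (intro ln_mono) auto
    hence "2 * (real N * x) \<le> ln m1 + ln (?S N z)" using m1 Spos[OF N, of z] by (simp add: ln_mult ln_realpow)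
    hence "(2 * (real N * x) - ln m1) / (2 * real N) \<le> ln (?S N z) / (2 * real N)" using N by (intro divide_right_mono) auto
    moreover have "(2 * (real N * x) - ln m1) / (2 * real N) = x - ln m1 / (2 * real N)"
      using N by (simp add: diff_divide_distrib)
    ultimately show ?thesis by simp
  qed
  have low0: "ln (?S N z) / (2 * real N) \<ge> - (ln m1 / (2 * real N))" if "N \<ge> 1" for N z
    using low[OF that, of 1 0 z] by (simp add: polys_def)
  show "(\<lambda>N. ln (?S N z) / (2 * real N)) \<longlonglongrightarrow> green z"
  proof (rule tendstoI)
    fix \<epsilon> :: real assume e: "\<epsilon> > 0"
    obtain C where C: "C > 0" "\<And>N z. N \<ge> 1 \<Longrightarrow> ln (?S N z) / (2 * real N) \<le> ln C / real N + \<epsilon> / 3 + green z"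
      using upper[of "\<epsilon> / 3"] e by auto
    have l1: "(\<lambda>N. ln C / real N) \<longlonglongrightarrow> 0" and l2: "(\<lambda>N. ln m1 / (2 * real N)) \<longlonglongrightarrow> 0" by real_asymp+
    have e3: "0 < \<epsilon> / 3" using e by simp
    have 1: "\<forall>\<^sub>F N in sequentially. ln C / real N < \<epsilon> / 3" by (rule order_tendstoD(2)[OF l1 e3])
    have 2: "\<forall>\<^sub>F N in sequentially. ln m1 / (2 * real N) < \<epsilon> / 3" by (rule order_tendstoD(2)[OF l2 e3])
    have 3: "\<forall>\<^sub>F N in sequentially. ln (?S N z) / (2 * real N) \<ge> (green z - \<epsilon> / 3) - ln m1 / (2 * real N)"
    proof (cases "z \<in> K")
      case True
      show ?thesis using eventually_ge_at_top[of 1]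
      proof eventually_elim
        case (elim N)
        thus ?case using low0[of N z] True e by (simp add: green_def)
      qed
    next
      case False
      then obtain n0 where n0: "\<And>N. N \<ge> n0 \<Longrightarrow> \<exists>p. degree p \<le> N \<and> (\<forall>x\<in>K. norm (poly p x) \<le> 1) \<and>
          norm (poly p z) \<ge> exp (real N * (green z - \<epsilon> / 3))"
        using extremal_polynomials[OF False, of "\<epsilon> / 3"] e by auto
      show ?thesis using eventually_ge_at_top[of "max 1 n0"]
      proof eventually_elim
        case (elim N)
        then obtain p where "degree p \<le> N" "\<forall>x\<in>K. norm (poly p x) \<le> 1" "norm (poly p z) \<ge> exp (real N * (green z - \<epsilon> / 3))"
          using n0[of N] by auto
        thus ?case using elim by (intro low[of N p]) (auto simp: polys_def)
      qed
    qed
    show "\<forall>\<^sub>F N in sequentially. dist (ln (?S N z) / (2 * real N)) (green z) < \<epsilon>"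
      using 1 2 3 eventually_ge_at_top[of 1]
    proof eventually_elim
      case (elim N)
      thus ?case using C(2)[of N z] unfolding dist_real_def by linarith
    qed
  qed
  obtain C where C: "C > 0" "\<And>N z. N \<ge> 1 \<Longrightarrow> ln (?S N z) / (2 * real N) \<le> ln C / real N + 1 + green z"
    using upper[of 1] by auto
  show "\<exists>B. \<forall>N\<ge>1. \<forall>z. \<bar>ln (?S N z) / (2 * real N)\<bar> \<le> B + green z"
  proof (intro exI[of _ "\<bar>ln C\<bar> + 1 + ln m1"] allI impI)
    fix N :: nat and z assume N: "N \<ge> 1"
    have "ln C / real N \<le> \<bar>ln C\<bar> / real N" using N by (intro divide_right_mono) auto
    also have "\<dots> \<le> \<bar>ln C\<bar> / 1" using N by (intro divide_left_mono) auto
    finally have 1: "ln C / real N \<le> \<bar>ln C\<bar>" by simp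
    have l: "ln m1 \<ge> 0" using m1 by simp
    hence "ln m1 / (2 * real N) \<le> ln m1 / 1" using N by (intro divide_left_mono) auto
    thus "\<bar>ln (?S N z) / (2 * real N)\<bar> \<le> \<bar>ln C\<bar> + 1 + ln m1 + green z"
      using low0[OF N, of z] C(2)[OF N, of z] 1 l green_nonneg[of z] by linarith
  qed
qed

theorem circle_mean_christoffel_limit:
  fixes P :: "nat \<Rightarrow> nat \<Rightarrow> complex poly"
  assumes bm: "bernstein_markov"
    and P: "\<And>N j. N \<ge> 1 \<Longrightarrow> j \<le> N \<Longrightarrow> P N j \<in> polys N"
    and on: "\<And>N j k. N \<ge> 1 \<Longrightarrow> j \<le> N \<Longrightarrow> k \<le> N \<Longrightarrow> ip (P N j) (P N k) = (if j = k then 1 else 0)"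
    and span: "\<And>N f. N \<ge> 1 \<Longrightarrow> f \<in> polys N \<Longrightarrow> \<exists>a. f = random_poly N (P N) a"
  shows "(\<lambda>N. circle_mean (\<lambda>x. ln (christoffel N (P N) x) / 2) z r / real N) \<longlonglongrightarrow> circle_mean green z r"
proof -
  interpret U: prob_space unif01 by (rule prob_space_unif01)
  let ?c = "\<lambda>t. z + of_real r * ucirc t"
  obtain B where B: "\<And>N z. N \<ge> 1 \<Longrightarrow> \<bar>ln (christoffel N (P N) z) / (2 * real N)\<bar> \<le> B + green z"
    using christoffel_root_limit(2)[OF bm P on span] by blast
  have "(\<lambda>N. \<integral>t. ln (christoffel (Suc N) (P (Suc N)) (?c t)) / (2 * real (Suc N)) \<partial>unif01) \<longlonglongrightarrow> (\<integral>t. green (?c t) \<partial>unif01)"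
  proof (rule integral_dominated_convergence[where w = "\<lambda>t. B + green (?c t)"])
    show "integrable unif01 (\<lambda>t. B + green (?c t))" using integrable_circle[OF continuous_green] by simp
    thus "(\<lambda>t. green (?c t)) \<in> borel_measurable unif01" using integrable_circle[OF continuous_green] by blast
    fix N
    have [measurable]: "christoffel (Suc N) (P (Suc N)) \<in> borel_measurable borel"
      by (rule borel_measurable_continuous_onI[OF continuous_christoffel])
    show "(\<lambda>t. ln (christoffel (Suc N) (P (Suc N)) (?c t)) / (2 * real (Suc N))) \<in> borel_measurable unif01" by measurable
    show "AE t in unif01. norm (ln (christoffel (Suc N) (P (Suc N)) (?c t)) / (2 * real (Suc N))) \<le> B + green (?c t)"
      unfolding real_norm_def by (intro AE_I2 B) simp
  next
    show "AE t in unif01. (\<lambda>N. ln (christoffel (Suc N) (P (Suc N)) (?c t)) / (2 * real (Suc N))) \<longlonglongrightarrow> green (?c t)"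
      using LIMSEQ_Suc[OF christoffel_root_limit(1)[OF bm P on span]] by (intro AE_I2) simp
  qed
  moreover have "(\<integral>t. ln (christoffel (Suc N) (P (Suc N)) (?c t)) / (2 * real (Suc N)) \<partial>unif01) =
      circle_mean (\<lambda>x. ln (christoffel (Suc N) (P (Suc N)) x) / 2) z r / real (Suc N)" for N
    unfolding circle_mean_def by (subst integral_divide_zero[symmetric]) (simp del: of_nat_Suc)
  ultimately have "(\<lambda>N. circle_mean (\<lambda>x. ln (christoffel (Suc N) (P (Suc N)) x) / 2) z r / real (Suc N)) \<longlonglongrightarrow> circle_mean green z r"
    by (simp only: circle_mean_def[of green])
  thus ?thesis by (rule LIMSEQ_imp_Suc)
qed

end

section \<open>Testing against tents\<close>

lemma abs_ln_max_diff_le: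
  assumes "s > 0" shows "\<bar>ln (max s x) - ln (max s y)\<bar> \<le> \<bar>x - y\<bar> / (s::real)"
proof -
  have le: "ln (max s x) - ln (max s y) \<le> \<bar>x - y\<bar> / s" for x y
  proof -
    have m: "max s y > 0" "max s x > 0" using assms by auto
    have "ln (max s x) - ln (max s y) = ln (max s x / max s y)" using m by (simp add: ln_div)
    also have "\<dots> \<le> max s x / max s y - 1" using m by (intro ln_le_minus_one) auto
    also have "\<dots> = (max s x - max s y) / max s y" using m by (simp add: diff_divide_distrib)
    also have "\<dots> \<le> \<bar>x - y\<bar> / max s y" using m by (intro divide_right_mono) auto
    also have "\<dots> \<le> \<bar>x - y\<bar> / s" using assms by (intro divide_left_mono) auto
    finally show ?thesis .
  qed
  show ?thesis using le[of x y] le[of y x] by (simp add: abs_le_iff abs_minus_commute)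
qed

lemma tent_lipschitz:
  assumes "s > 0" shows "\<bar>tent s u - tent s v\<bar> \<le> 2 / s * norm (u - v)"
proof -
  have "\<bar>norm u - norm v\<bar> \<le> norm (u - v)" by (rule norm_triangle_ineq3)
  hence d: "\<bar>norm u - norm v\<bar> / s \<le> norm (u - v) / s" "\<bar>norm u - norm v\<bar> / (2 * s) \<le> norm (u - v) / s"
    using assms by (auto intro!: frac_le)
  show ?thesis
    unfolding tent_def
    using abs_ln_max_diff_le[of "2 * s" "norm u" "norm v"] abs_ln_max_diff_le[of s "norm u" "norm v"] assms d
    by (simp add: abs_le_iff)
qed

lemma tent_bounds:
  assumes "s > 0"
  shows "0 \<le> tent s u" "tent s u \<le> ln 2" "norm u \<ge> 2 * s \<Longrightarrow> tent s u = 0" "norm u \<le> s \<Longrightarrow> tent s u = ln 2"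
proof -
  have "ln (max s (norm u)) \<le> ln (max (2 * s) (norm u))" using assms by (intro ln_mono) auto
  thus "0 \<le> tent s u" by (simp add: tent_def)
  have "ln (max (2 * s) (norm u)) \<le> ln (2 * max s (norm u))" using assms by (intro ln_mono) (auto simp: max_def)
  also have "\<dots> = ln 2 + ln (max s (norm u))" using assms by (subst ln_mult) auto
  finally show "tent s u \<le> ln 2" by (simp add: tent_def)
  show "norm u \<ge> 2 * s \<Longrightarrow> tent s u = 0" using assms by (simp add: tent_def max_def)
  show "norm u \<le> s \<Longrightarrow> tent s u = ln 2"
    using assms by (auto simp: tent_def max_def ln_mult not_le)
qed

lemma continuous_tent [continuous_intros]: "s > 0 \<Longrightarrow> continuous_on S f \<Longrightarrow> continuous_on S (\<lambda>x. tent s (f x))"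
  unfolding tent_def by (intro continuous_intros) auto

lemma integral_tent_pos:
  assumes s: "s > 0"
  shows "integrable lborel (tent s)" "(\<integral>u. tent s u \<partial>lborel) > 0"
proof -
  have ct: "continuous_on UNIV (tent s)" using continuous_tent[OF s continuous_on_id] by simp
  have [measurable]: "tent s \<in> borel_measurable borel" by (rule borel_measurable_continuous_onI[OF ct])
  have "integrable lborel (\<lambda>u. indicator (cball 0 (2 * s)) u *\<^sub>R tent s u)"
    by (rule borel_integrable_compact[OF compact_cball continuous_on_subset[OF ct]]) auto
  moreover have "(\<lambda>u. indicator (cball 0 (2 * s)) u *\<^sub>R tent s u) = tent s"
    using tent_bounds(3)[OF s] by (auto simp: fun_eq_iff indicator_def not_le)
  ultimately show int: "integrable lborel (tent s)" by simp
  have "0 < ln 2 * measure lborel (ball (0::complex) s)"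
    by (intro mult_pos_pos content_ball_pos s) simp
  also have "\<dots> = (\<integral>u. ln 2 * indicator (ball (0::complex) s) u \<partial>lborel)" by simp
  also have "\<dots> \<le> (\<integral>u. tent s u \<partial>lborel)"
  proof (rule integral_mono[OF _ int])
    show "integrable lborel (\<lambda>u::complex. ln 2 * indicator (ball 0 s) u :: real)"
      by (intro integrable_mult_right integrable_real_indicator) (use emeasure_bounded_finite[OF bounded_ball[of "0::complex" s]] in auto)
    fix u show "ln 2 * indicator (ball 0 s) u \<le> tent s u"
      using tent_bounds[OF s, of u] by (auto split: split_indicator)
  qed
  finally show "(\<integral>u. tent s u \<partial>lborel) > 0" .
qed

text \<open>Convergence against all small tents centred at a dense set implies weak convergence: a
  continuous function of compact support is close to its convolution with a narrow tent, and the
  integral of a convolution is an average of integrals of tents.\<close>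

theorem weak_convergence_from_tents:
  fixes Z :: "nat \<Rightarrow> complex set" and D :: "complex set" and \<psi> :: "complex \<Rightarrow> real"
  assumes Z: "\<And>N. N \<ge> 1 \<Longrightarrow> finite (Z N)" "\<And>N. N \<ge> 1 \<Longrightarrow> card (Z N) = N"
    and \<nu>: "prob_space \<nu>" "sets \<nu> = sets borel"
    and D: "\<And>X. open X \<Longrightarrow> X \<noteq> {} \<Longrightarrow> \<exists>d\<in>D. d \<in> X"
    and tents: "\<And>a k. a \<in> D \<Longrightarrow> (\<lambda>N. (\<Sum>x\<in>Z N. tent (1 / real (Suc k)) (a - x)) / real N)
        \<longlonglongrightarrow> (\<integral>w. tent (1 / real (Suc k)) (a - w) \<partial>\<nu>)"
    and \<psi>: "continuous_on UNIV \<psi>" "(\<psi> \<longlongrightarrow> 0) at_infinity"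
  shows "(\<lambda>N. (\<Sum>x\<in>Z N. \<psi> x) / real N) \<longlonglongrightarrow> (\<integral>w. \<psi> w \<partial>\<nu>)" and "integrable \<nu> \<psi>"
proof -
  interpret \<nu>: prob_space \<nu> by fact
  note [measurable_cong] = \<nu>(2)
  have [measurable]: "\<psi> \<in> borel_measurable borel" by (rule borel_measurable_continuous_onI[OF \<psi>(1)])
  define E where "E = (\<lambda>N (f :: complex \<Rightarrow> real). (\<Sum>x\<in>Z N. f x) / real N)"
  have E_le: "\<bar>E N f - E N h\<bar> \<le> c" if "\<And>x. \<bar>f x - h x\<bar> \<le> c" "N \<ge> 1" for N f h c
  proof -
    have "\<bar>(\<Sum>x\<in>Z N. f x - h x)\<bar> \<le> (\<Sum>x\<in>Z N. c)" by (rule order_trans[OF sum_abs sum_mono]) (rule that(1))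
    hence "\<bar>(\<Sum>x\<in>Z N. f x - h x)\<bar> \<le> real N * c" using Z[OF that(2)] by simp
    hence "\<bar>(\<Sum>x\<in>Z N. f x - h x)\<bar> / real N \<le> c" using that(2) by (simp add: field_simps)
    moreover have "E N f - E N h = (\<Sum>x\<in>Z N. f x - h x) / real N"
      by (simp add: E_def sum_subtractf diff_divide_distrib)
    ultimately show ?thesis by simp
  qed
  have tents_all: "(\<lambda>N. E N (\<lambda>x. tent s (z - x))) \<longlonglongrightarrow> (\<integral>w. tent s (z - w) \<partial>\<nu>)" if s: "s = 1 / real (Suc k)" for s k z
  proof (rule tendstoI)
    have s0: "s > 0" using s by simp
    fix \<epsilon> :: real assume e: "\<epsilon> > 0"
    have "s * \<epsilon> / 6 > 0" using s0 e by simp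
    then obtain a where a: "a \<in> D" "norm (z - a) < s * \<epsilon> / 6"
      using D[of "ball z (s * \<epsilon> / 6)"] by (auto simp: dist_norm)
    have close: "\<bar>tent s (z - x) - tent s (a - x)\<bar> \<le> \<epsilon> / 3" for x
    proof -
      have "\<bar>tent s (z - x) - tent s (a - x)\<bar> \<le> 2 / s * norm ((z - x) - (a - x))" by (rule tent_lipschitz[OF s0])
      also have "\<dots> \<le> 2 / s * (s * \<epsilon> / 6)" using a s0 by (intro mult_left_mono) auto
      also have "\<dots> = \<epsilon> / 3" using s0 by simp
      finally show ?thesis .
    qed
    have int: "integrable \<nu> (\<lambda>w. tent s (y - w))" for y
    proof (rule \<nu>.integrable_const_bound[of _ "ln 2"])
      have "continuous_on UNIV (\<lambda>w. tent s (y - w))" by (intro continuous_intros s0)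
      thus "(\<lambda>w. tent s (y - w)) \<in> borel_measurable \<nu>"
        unfolding measurable_cong_sets[OF \<nu>(2) refl] by (rule borel_measurable_continuous_onI)
    qed (use tent_bounds[OF s0] in auto)
    have "norm (\<integral>w. tent s (z - w) - tent s (a - w) \<partial>\<nu>) \<le> (\<integral>w. \<epsilon> / 3 \<partial>\<nu>)"
    proof (rule Bochner_Integration.integral_norm_bound[THEN order_trans], rule integral_mono)
      show "integrable \<nu> (\<lambda>w. norm (tent s (z - w) - tent s (a - w)))"
        by (intro integrable_norm Bochner_Integration.integrable_diff int)
    qed (use close in auto)
    hence c2: "\<bar>(\<integral>w. tent s (z - w) \<partial>\<nu>) - (\<integral>w. tent s (a - w) \<partial>\<nu>)\<bar> \<le> \<epsilon> / 3"
      using int \<nu>.prob_space by simp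
    have "\<epsilon> / 3 > 0" using e by simp
    hence "\<forall>\<^sub>F N in sequentially. dist (E N (\<lambda>x. tent s (a - x))) (\<integral>w. tent s (a - w) \<partial>\<nu>) < \<epsilon> / 3"
      using tents[OF a(1), of k] unfolding E_def s by (rule tendstoD[rotated])
    thus "\<forall>\<^sub>F N in sequentially. dist (E N (\<lambda>x. tent s (z - x))) (\<integral>w. tent s (z - w) \<partial>\<nu>) < \<epsilon>"
      using eventually_ge_at_top[of 1]
    proof eventually_elim
      case (elim N)
      have "\<bar>E N (\<lambda>x. tent s (z - x)) - E N (\<lambda>x. tent s (a - x))\<bar> \<le> \<epsilon> / 3" by (rule E_le[OF close elim(2)])
      thus ?case using elim(1) c2 unfolding dist_real_def by linarith
    qed
  qed
  have bdd: "\<exists>B. \<forall>x. \<bar>\<psi> x\<bar> \<le> B"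
  proof -
    have "\<forall>\<^sub>F x in at_infinity. dist (\<psi> x) 0 < 1" using \<psi>(2) by (rule tendstoD) simp
    then obtain b where b: "\<And>x. norm x \<ge> b \<Longrightarrow> \<bar>\<psi> x\<bar> < 1" by (auto simp: eventually_at_infinity)
    obtain B where B: "\<forall>x\<in>cball 0 b. norm (\<psi> x) \<le> B"
      using compact_imp_bounded[OF compact_continuous_image[OF continuous_on_subset[OF \<psi>(1)] compact_cball[of 0 b]]]
      unfolding bounded_iff by auto
    have "\<bar>\<psi> x\<bar> \<le> max 1 B" for x :: complex
      using b[of x] bspec[OF B, of x] by (cases "norm x \<ge> b") (auto simp: le_max_iff_disj)
    thus ?thesis by blast
  qed
  then obtain B where B: "\<And>x. \<bar>\<psi> x\<bar> \<le> B" by blast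
  show int\<psi>: "integrable \<nu> \<psi>"
    by (rule \<nu>.integrable_const_bound[of _ B]) (use B in auto)
  show "(\<lambda>N. (\<Sum>x\<in>Z N. \<psi> x) / real N) \<longlonglongrightarrow> (\<integral>w. \<psi> w \<partial>\<nu>)"
  proof (rule tendstoI)
    fix \<epsilon>0 :: real assume e0: "\<epsilon>0 > 0"
    define \<epsilon> where "\<epsilon> = \<epsilon>0 / 6"
    have e: "\<epsilon> > 0" using e0 by (simp add: \<epsilon>_def)
    \<comment> \<open>Soft thresholding makes the support compact at the price of an error \<open>\<epsilon>\<close>.\<close>
    define f where "f = (\<lambda>x. \<psi> x - max (- \<epsilon>) (min \<epsilon> (\<psi> x)))"
    have f\<psi>: "\<bar>\<psi> x - f x\<bar> \<le> \<epsilon>" for x using e by (simp add: f_def)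
    have contf: "continuous_on UNIV f" unfolding f_def by (intro continuous_intros \<psi>(1))
    hence [measurable]: "f \<in> borel_measurable borel" by (rule borel_measurable_continuous_onI)
    have "\<forall>\<^sub>F x in at_infinity. dist (\<psi> x) 0 < \<epsilon>" using \<psi>(2) e by (rule tendstoD)
    then obtain b where b: "\<And>x. norm x \<ge> b \<Longrightarrow> \<bar>\<psi> x\<bar> < \<epsilon>" by (auto simp: eventually_at_infinity)
    have supp: "f x = 0" if "norm x \<ge> b" for x using b[OF that] by (simp add: f_def max_def min_def abs_less_iff)
    have Bf: "\<bar>f x\<bar> \<le> B + \<epsilon>" for x using B[of x] f\<psi>[of x] by linarith
    have B0: "B + \<epsilon> \<ge> 0" using Bf[of 0] abs_ge_zero order_trans by blast
    have "uniformly_continuous_on (cball 0 (b + 2)) f"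
      by (intro compact_uniformly_continuous continuous_on_subset[OF contf]) auto
    then obtain d where d: "d > 0" "\<And>x y. x \<in> cball 0 (b + 2) \<Longrightarrow> y \<in> cball 0 (b + 2) \<Longrightarrow> dist y x < d \<Longrightarrow> dist (f y) (f x) < \<epsilon>"
      using e unfolding uniformly_continuous_on_def by metis
    obtain k where k: "1 / real (Suc k) < min (d / 2) (1 / 2)" using nat_approx_posE[of "min (d / 2) (1 / 2)"] d by auto
    define s where "s = 1 / real (Suc k)"
    have s: "s > 0" "2 * s < d" "2 * s < 1" using k by (auto simp: s_def)
    have osc: "\<bar>f (u + w) - f w\<bar> \<le> \<epsilon>" if u: "norm u \<le> 2 * s" for u w
    proof (cases "norm w \<le> b + 1")
      case True
      hence "norm (u + w) \<le> b + 2" using norm_triangle_ineq[of u w] u s by linarith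
      hence "u + w \<in> cball 0 (b + 2)" "w \<in> cball 0 (b + 2)" using True by auto
      moreover have "dist (u + w) w < d" using u s by (simp add: dist_norm)
      ultimately have "dist (f (u + w)) (f w) < \<epsilon>" by (intro d(2))
      thus ?thesis by (simp add: dist_real_def)
    next
      case False
      hence "norm (u + w) \<ge> b" using norm_diff_ineq[of w u] u s by (simp add: add.commute)
      thus ?thesis using False supp[of w] supp[of "u + w"] e by simp
    qed
    define c where "c = (\<integral>u. tent s u \<partial>lborel)"
    have c: "c > 0" "integrable lborel (tent s)" using integral_tent_pos[OF s(1)] by (auto simp: c_def)
    have ct: "continuous_on UNIV (tent s)" using continuous_tent[OF s(1) continuous_on_id] by simp
    have tm [measurable]: "tent s \<in> borel_measurable borel" by (rule borel_measurable_continuous_onI[OF ct])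
    define F where "F = (\<lambda>w. \<integral>u. f u * tent s (u - w) \<partial>lborel)"
    have near: "\<bar>f w - F w / c\<bar> \<le> \<epsilon>" for w
    proof -
      have "\<bar>F w - f w * c\<bar> \<le> \<epsilon> * c + 2 * (B + \<epsilon>) * 0"
        unfolding F_def c_def
      proof (rule kernel_average_bound[where \<delta> = "2 * s"])
        have "(\<lambda>u. tent s u * indicator (- cball 0 (2 * s)) u) = (\<lambda>u. 0)"
          using tent_bounds(3)[OF s(1)] by (auto simp: fun_eq_iff split: split_indicator)
        thus "(\<integral>u. tent s u * indicator (- cball 0 (2 * s)) u \<partial>lborel) \<le> 0" by (simp only: integral_zero order_refl)
      qed (use tent_bounds[OF s(1)] c Bf B0 osc e in auto)
      hence "\<bar>F w - f w * c\<bar> / c \<le> \<epsilon>" using c by (simp add: pos_divide_le_eq)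
      moreover have "\<bar>f w - F w / c\<bar> = \<bar>F w - f w * c\<bar> / c"
      proof -
        have "f w - F w / c = - ((F w - f w * c) / c)" using c by (simp add: field_simps)
        thus ?thesis using c by (simp only: abs_minus_cancel abs_divide abs_of_pos)
      qed
      ultimately show ?thesis by simp
    qed
    define T where "T = (\<lambda>u. \<integral>w. tent s (u - w) \<partial>\<nu>)"
    have intu: "integrable lborel (\<lambda>u. f u * tent s (u - w))" for w
    proof (rule Bochner_Integration.integrable_bound[where f = "\<lambda>u. (B + \<epsilon>) * tent s (u - w)"])
      show "integrable lborel (\<lambda>u. (B + \<epsilon>) * tent s (u - w))"
        using integral_lborel_shift(2)[OF tm, of w] c(2) by (intro integrable_mult_right) simp
      show "AE u in lborel. norm (f u * tent s (u - w)) \<le> norm ((B + \<epsilon>) * tent s (u - w))"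
        using Bf B0 tent_bounds(1)[OF s(1)] by (auto simp: abs_mult intro!: mult_right_mono)
    qed measurable
    have fI: "integrable lborel (\<lambda>u. ln 2 * \<bar>f u\<bar>)"
    proof -
      have "integrable lborel (\<lambda>u. indicator (cball 0 b) u *\<^sub>R \<bar>f u\<bar>)"
        by (rule borel_integrable_compact) (auto intro!: continuous_intros continuous_on_subset[OF contf])
      moreover have "(\<lambda>u. indicator (cball 0 b) u *\<^sub>R \<bar>f u\<bar>) = (\<lambda>u. \<bar>f u\<bar>)"
        using supp by (auto simp: fun_eq_iff indicator_def)
      ultimately show ?thesis by (intro integrable_mult_right) simp
    qed
    have "(\<lambda>N. \<integral>u. f u * E N (\<lambda>x. tent s (u - x)) \<partial>lborel) \<longlonglongrightarrow> (\<integral>u. f u * T u \<partial>lborel)"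
    proof (rule LIMSEQ_imp_Suc, rule integral_dominated_convergence[OF _ _ fI])
      show "(\<lambda>u. f u * T u) \<in> borel_measurable lborel" unfolding T_def by measurable
      show "(\<lambda>u. f u * E (Suc N) (\<lambda>x. tent s (u - x))) \<in> borel_measurable lborel" for N unfolding E_def by measurable
      show "AE u in lborel. (\<lambda>N. f u * E (Suc N) (\<lambda>x. tent s (u - x))) \<longlonglongrightarrow> f u * T u"
        unfolding T_def by (intro AE_I2 tendsto_mult tendsto_const LIMSEQ_Suc[OF tents_all[OF s_def]])
      fix N
      have "\<bar>E (Suc N) (\<lambda>x. tent s (u - x)) - E (Suc N) (\<lambda>x. 0)\<bar> \<le> ln 2" for u
        by (rule E_le) (use tent_bounds[OF s(1)] in auto)
      hence "\<bar>E (Suc N) (\<lambda>x. tent s (u - x))\<bar> \<le> ln 2" for u by (simp add: E_def)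
      hence "\<bar>f u\<bar> * \<bar>E (Suc N) (\<lambda>x. tent s (u - x))\<bar> \<le> \<bar>f u\<bar> * ln 2" for u by (intro mult_left_mono) auto
      thus "AE u in lborel. norm (f u * E (Suc N) (\<lambda>x. tent s (u - x))) \<le> ln 2 * \<bar>f u\<bar>"
        by (intro AE_I2) (simp add: abs_mult mult.commute)
    qed
    moreover have "(\<integral>u. f u * E N (\<lambda>x. tent s (u - x)) \<partial>lborel) = E N F" for N
    proof -
      have "(\<integral>u. f u * E N (\<lambda>x. tent s (u - x)) \<partial>lborel) = (\<integral>u. (\<Sum>x\<in>Z N. f u * tent s (u - x)) / real N \<partial>lborel)"
        by (simp add: E_def sum_distrib_left)
      also have "\<dots> = (\<integral>u. (\<Sum>x\<in>Z N. f u * tent s (u - x)) \<partial>lborel) / real N" by (rule integral_divide_zero)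
      also have "(\<integral>u. (\<Sum>x\<in>Z N. f u * tent s (u - x)) \<partial>lborel) = (\<Sum>x\<in>Z N. F x)"
        unfolding F_def by (rule Bochner_Integration.integral_sum) (rule intu)
      finally show ?thesis by (simp add: E_def)
    qed
    moreover have FI: "(\<integral>u. f u * T u \<partial>lborel) = (\<integral>w. F w \<partial>\<nu>)" "integrable \<nu> F"
    proof -
      interpret P: pair_sigma_finite \<nu> lborel ..
      have FB: "(\<integral>u. norm (f u * tent s (u - w)) \<partial>lborel) \<le> (B + \<epsilon>) * c" for w
      proof -
        have "(\<integral>u. norm (f u * tent s (u - w)) \<partial>lborel) \<le> (\<integral>u. (B + \<epsilon>) * tent s (u - w) \<partial>lborel)"
        proof (rule integral_mono)
          show "integrable lborel (\<lambda>u. (B + \<epsilon>) * tent s (u - w))"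
            using integral_lborel_shift(2)[OF tm, of w] c(2) by (intro integrable_mult_right) simp
          show "norm (f u * tent s (u - w)) \<le> (B + \<epsilon>) * tent s (u - w)" for u
            using Bf tent_bounds(1)[OF s(1)] by (auto simp: abs_mult intro!: mult_right_mono)
        qed (rule integrable_norm[OF intu])
        also have "\<dots> = (B + \<epsilon>) * c" using integral_lborel_shift(1)[OF tm, of w] by (simp add: c_def)
        finally show ?thesis .
      qed
      have iP: "integrable (\<nu> \<Otimes>\<^sub>M lborel) (\<lambda>(w, u). f u * tent s (u - w))"
      proof (rule P.Fubini_integrable)
        show "integrable \<nu> (\<lambda>w. \<integral>u. norm (case (w, u) of (w, u) \<Rightarrow> f u * tent s (u - w)) \<partial>lborel)"
          by (rule \<nu>.integrable_const_bound[of _ "(B + \<epsilon>) * c"]) (use FB in auto)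
      qed (use intu in auto)
      show "integrable \<nu> F" using P.integrable_fst'[OF iP] by (simp add: F_def)
      have "(\<integral>u. (\<integral>w. f u * tent s (u - w) \<partial>\<nu>) \<partial>lborel) = (\<integral>w. (\<integral>u. f u * tent s (u - w) \<partial>lborel) \<partial>\<nu>)"
        by (rule P.Fubini_integral[OF iP])
      thus "(\<integral>u. f u * T u \<partial>lborel) = (\<integral>w. F w \<partial>\<nu>)" by (simp add: F_def T_def)
    qed
    ultimately have "(\<lambda>N. E N F) \<longlonglongrightarrow> (\<integral>w. F w \<partial>\<nu>)" by simp
    hence limc: "(\<lambda>N. E N (\<lambda>w. F w / c)) \<longlonglongrightarrow> (\<integral>w. F w / c \<partial>\<nu>)"
    proof -
      assume "(\<lambda>N. E N F) \<longlonglongrightarrow> (\<integral>w. F w \<partial>\<nu>)"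
      hence "(\<lambda>N. E N F / c) \<longlonglongrightarrow> (\<integral>w. F w \<partial>\<nu>) / c" using c by (intro tendsto_divide tendsto_const) auto
      moreover have "E N (\<lambda>w. F w / c) = E N F / c" for N by (simp add: E_def sum_divide_distrib field_simps)
      ultimately show ?thesis by simp
    qed
    have app: "\<bar>\<psi> w - F w / c\<bar> \<le> 2 * \<epsilon>" for w using near[of w] f\<psi>[of w] by linarith
    have "norm (\<integral>w. \<psi> w - F w / c \<partial>\<nu>) \<le> (\<integral>w. 2 * \<epsilon> \<partial>\<nu>)"
    proof (rule Bochner_Integration.integral_norm_bound[THEN order_trans], rule integral_mono)
      show "integrable \<nu> (\<lambda>w. norm (\<psi> w - F w / c))"
        using FI(2) by (intro integrable_norm Bochner_Integration.integrable_diff int\<psi>) simp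
    qed (use app in auto)
    hence app\<nu>: "\<bar>(\<integral>w. \<psi> w \<partial>\<nu>) - (\<integral>w. F w / c \<partial>\<nu>)\<bar> \<le> 2 * \<epsilon>"
      using int\<psi> FI(2) \<nu>.prob_space by simp
    have "\<forall>\<^sub>F N in sequentially. dist (E N (\<lambda>w. F w / c)) (\<integral>w. F w / c \<partial>\<nu>) < \<epsilon>" using limc e by (rule tendstoD)
    thus "\<forall>\<^sub>F N in sequentially. dist ((\<Sum>x\<in>Z N. \<psi> x) / real N) (\<integral>w. \<psi> w \<partial>\<nu>) < \<epsilon>0"
      using eventually_ge_at_top[of 1]
    proof eventually_elim
      case (elim N)
      have "\<bar>E N \<psi> - E N (\<lambda>w. F w / c)\<bar> \<le> 2 * \<epsilon>" by (rule E_le[OF app elim(2)])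
      moreover have "6 * \<epsilon> = \<epsilon>0" by (simp add: \<epsilon>_def)
      ultimately have "\<bar>E N \<psi> - (\<integral>w. \<psi> w \<partial>\<nu>)\<bar> < \<epsilon>0"
        using elim(1) app\<nu> e unfolding dist_real_def by linarith
      thus ?case unfolding dist_real_def E_def .
    qed
  qed
qed

section \<open>Real-analytic curves\<close>

text \<open>The power series that represents the function near a point extends it to a holomorphic
  function on a disc.\<close>

lemma real_analytic_C1:
  fixes f :: "real \<Rightarrow> complex"
  assumes "real_analytic f"
  shows "(f has_vector_derivative vector_derivative f (at t)) (at t)"
    and "continuous_on UNIV (\<lambda>t. vector_derivative f (at t))"
proof -
  have loc: "\<exists>F r. r > 0 \<and> F holomorphic_on ball 0 r \<and> (\<forall>s. \<bar>s - t\<bar> < r \<longrightarrow> f s = F (of_real (s - t)))" for t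
  proof -
    obtain c r where r: "r > 0" "\<And>s. \<bar>s - t\<bar> < r \<Longrightarrow> (\<lambda>n. (s - t) ^ n *\<^sub>R c n) sums f s"
      using assms unfolding real_analytic_def by blast
    define F where "F = (\<lambda>w. \<Sum>n. c n * w ^ n)"
    have sums: "(\<lambda>n. c n * (w - 0) ^ n) sums F w" if w: "w \<in> ball 0 r" for w
    proof -
      obtain x where x: "norm w < x" "x < r" using w dense[of "norm w" r] by auto
      have xp: "0 < x" using x norm_ge_zero le_less_trans by blast
      have "summable (\<lambda>n. ((t + x) - t) ^ n *\<^sub>R c n)" using r(2)[of "t + x"] x xp by (auto intro: sums_summable)
      hence "summable (\<lambda>n. c n * (of_real x) ^ n)" by (simp add: scaleR_conv_of_real mult.commute)
      hence "summable (\<lambda>n. c n * w ^ n)" by (rule powser_inside) (use x xp in auto)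
      thus ?thesis by (simp add: F_def summable_sums)
    qed
    have "F holomorphic_on ball 0 r" by (rule power_series_holomorphic[OF sums])
    moreover have "f s = F (of_real (s - t))" if "\<bar>s - t\<bar> < r" for s
    proof -
      have "of_real (s - t) \<in> ball (0::complex) r" using that by (simp only: mem_ball_0 norm_of_real)
      from sums[OF this] have "(\<lambda>n. (s - t) ^ n *\<^sub>R c n) sums F (of_real (s - t))"
        by (simp add: scaleR_conv_of_real mult.commute)
      thus ?thesis using r(2)[OF that] sums_unique2 by blast
    qed
    ultimately show ?thesis using r(1) by blast
  qed
  have vd: "(f has_vector_derivative deriv F (of_real (s - t))) (at s)"
    if F: "r > 0" "F holomorphic_on ball 0 r" "\<And>s. \<bar>s - t\<bar> < r \<Longrightarrow> f s = F (of_real (s - t))" and s: "\<bar>s - t\<bar> < r" for F r s t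
  proof -
    have "(F has_field_derivative deriv F (of_real (s - t))) (at (of_real (s - t)))"
      by (rule holomorphic_derivI[OF F(2) open_ball]) (use s in \<open>simp only: mem_ball_0 norm_of_real\<close>)
    moreover have "((\<lambda>s. of_real (s - t) :: complex) has_vector_derivative 1) (at s)"
      by (auto intro!: derivative_eq_intros simp: has_vector_derivative_def scaleR_conv_of_real)
    ultimately have "((F \<circ> (\<lambda>s. of_real (s - t))) has_vector_derivative 1 * deriv F (of_real (s - t))) (at s)"
      by (intro field_vector_diff_chain_at)
    hence "((\<lambda>s. F (of_real (s - t))) has_vector_derivative deriv F (of_real (s - t))) (at s)" by (simp add: o_def)
    thus ?thesis
    proof (rule has_vector_derivative_transform_within_open[OF _ open_ball[of t r]])
      show "s \<in> ball t r" using s by (simp add: dist_real_def abs_minus_commute)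
      fix y assume "y \<in> ball t r"
      thus "F (of_real (y - t)) = f y" using F(3)[of y] by (simp only: mem_ball dist_real_def abs_minus_commute)
    qed
  qed
  show "(f has_vector_derivative vector_derivative f (at t)) (at t)"
  proof -
    obtain F r where F: "r > 0" "F holomorphic_on ball 0 r" "\<And>s. \<bar>s - t\<bar> < r \<Longrightarrow> f s = F (of_real (s - t))"
      using loc[of t] by blast
    show ?thesis using vd[OF F, of t] F(1) by (auto simp: vector_derivative_at)
  qed
  have "isCont (\<lambda>t. vector_derivative f (at t)) t" for t
  proof -
    obtain F r where F: "r > 0" "F holomorphic_on ball 0 r" "\<And>s. \<bar>s - t\<bar> < r \<Longrightarrow> f s = F (of_real (s - t))"
      using loc[of t] by blast
    have "deriv F holomorphic_on ball 0 r" by (rule holomorphic_deriv[OF F(2) open_ball])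
    hence "isCont (deriv F) (of_real (t - t))"
      using F(1) holomorphic_on_imp_continuous_on[of "deriv F" "ball 0 r"] by (simp add: continuous_on_eq_continuous_at)
    moreover have "isCont (\<lambda>s. of_real (s - t) :: complex) t" by (intro continuous_intros)
    ultimately have "isCont (\<lambda>s. deriv F (of_real (s - t))) t" by (rule isCont_o2[rotated])
    moreover have "\<forall>\<^sub>F s in nhds t. vector_derivative f (at s) = deriv F (of_real (s - t))"
    proof -
      have "\<forall>\<^sub>F x in nhds t. x \<in> ball t r" by (rule eventually_nhds_in_open) (use F(1) in auto)
      thus ?thesis
      proof (rule eventually_mono)
        fix s assume "s \<in> ball t r"
        hence "\<bar>s - t\<bar> < r" by (auto simp: dist_real_def)
        from vd[OF F this] show "vector_derivative f (at s) = deriv F (of_real (s - t))" by (rule vector_derivative_at)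
      qed
    qed
    ultimately show ?thesis by (subst isCont_cong)
  qed
  thus "continuous_on UNIV (\<lambda>t. vector_derivative f (at t))" by (simp add: continuous_at_imp_continuous_on)
qed

lemma real_analytic_continuous:
  fixes f :: "real \<Rightarrow> complex"
  assumes "real_analytic f" shows "continuous_on UNIV f"
  using real_analytic_C1(1)[OF assms] has_vector_derivative_continuous
  by (metis continuous_at_imp_continuous_on)

lemma real_analytic_of_real: "real_analytic f \<Longrightarrow> real_analytic (\<lambda>t. complex_of_real (f t))"
  unfolding real_analytic_def
proof (intro allI)
  fix t
  assume "\<forall>t. \<exists>a. \<exists>r>0. \<forall>s. \<bar>s - t\<bar> < r \<longrightarrow> (\<lambda>n. (s - t) ^ n *\<^sub>R a n) sums f s"
  then obtain a r where r: "r > 0" "\<And>s. \<bar>s - t\<bar> < r \<Longrightarrow> (\<lambda>n. (s - t) ^ n *\<^sub>R a n) sums f s" by blast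
  have "(\<lambda>n. (s - t) ^ n *\<^sub>R complex_of_real (a n)) sums complex_of_real (f s)" if "\<bar>s - t\<bar> < r" for s
    using sums_of_real[OF r(2)[OF that], where 'a = complex] by (simp add: scaleR_conv_of_real)
  thus "\<exists>a. \<exists>r>0. \<forall>s. \<bar>s - t\<bar> < r \<longrightarrow> (\<lambda>n. (s - t) ^ n *\<^sub>R a n) sums complex_of_real (f s)"
    using r(1) by (intro exI[of _ "\<lambda>n. complex_of_real (a n)"] exI[of _ r]) auto
qed

locale analytic_curve =
  fixes g :: "real \<Rightarrow> complex"
  assumes curve: "analytic_jordan_curve g"
begin

lemma continuous_g: "continuous_on S g"
  using curve real_analytic_continuous unfolding analytic_jordan_curve_def
  by (blast intro: continuous_on_subset)

lemma measurable_g [measurable]: "g \<in> borel_measurable borel"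
  by (rule borel_measurable_continuous_onI[OF continuous_g])

lemma periodic_g: "g (t + of_int n) = g t"
proof (induction n rule: int_induct[of _ 0])
  case (step1 i)
  have "g ((t + of_int i) + 1) = g (t + of_int i)" using curve by (simp add: analytic_jordan_curve_def)
  thus ?case using step1 by (simp add: add.assoc)
next
  case (step2 i)
  have "g ((t + of_int (i - 1)) + 1) = g (t + of_int (i - 1))" using curve unfolding analytic_jordan_curve_def by blast
  thus ?case using step2 by (simp add: algebra_simps)
qed simp

lemma range_g: "range g = g ` {0..<1}" "range g = g ` {0..1}"
proof -
  have "g t \<in> g ` {0..<1}" for t
  proof
    show "g t = g (frac t)" using periodic_g[of t "- \<lfloor>t\<rfloor>"] by (simp add: frac_def)
    show "frac t \<in> {0..<1}" using frac_ge_0[of t] frac_lt_1[of t] by simp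
  qed
  thus 1: "range g = g ` {0..<1}" by auto
  thus "range g = g ` {0..1}" by (metis image_mono subset_antisym top_greatest atLeastLessThan_subseteq_atLeastAtMost_iff order_refl)
qed

lemma path_g: "simple_path g" "pathfinish g = pathstart g" "path_image g = range g"
proof -
  have g01: "g 1 = g 0" using periodic_g[of 0 1] by simp
  show "pathfinish g = pathstart g" using g01 by (simp add: pathfinish_def pathstart_def)
  show "path_image g = range g" using range_g by (simp add: path_image_def)
  have inj: "inj_on g {0..<1}" using curve by (simp add: analytic_jordan_curve_def)
  have "x = y \<or> x = 0 \<and> y = 1 \<or> x = 1 \<and> y = 0" if "x \<in> {0..1}" "y \<in> {0..1}" "g x = g y" for x y
  proof -
    define f where "f = (\<lambda>x::real. if x = 1 then 0 else x)"
    have "g (f x) = g (f y)" "f x \<in> {0..<1}" "f y \<in> {0..<1}" using that g01 by (auto simp: f_def)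
    hence "f x = f y" by (rule inj_onD[OF inj])
    thus ?thesis by (auto simp: f_def split: if_splits)
  qed
  thus "simple_path g" unfolding simple_path_def loop_free_def path_def using continuous_g by blast
qed

lemma compact_range_g: "compact (range g)"
  unfolding range_g(2) by (intro compact_continuous_image continuous_g) auto

definition speed :: "real \<Rightarrow> real" where "speed t = norm (vector_derivative g (at t))"

lemma speed: "continuous_on S speed" "speed t > 0"
proof -
  have "continuous_on UNIV (\<lambda>t. vector_derivative g (at t))"
    using curve real_analytic_C1(2) unfolding analytic_jordan_curve_def by blast
  thus "continuous_on S speed" unfolding speed_def
    by (intro continuous_on_norm) (rule continuous_on_subset, auto)
  show "speed t > 0" using curve by (simp add: speed_def analytic_jordan_curve_def)
qed

lemma speed_bounds: obtains l L where "0 < l" "\<And>t. t \<in> {0..1} \<Longrightarrow> l \<le> speed t" "\<And>t. t \<in> {0..1} \<Longrightarrow> speed t \<le> L"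
proof -
  obtain t0 where t0: "t0 \<in> {0..1}" "\<And>t. t \<in> {0..1} \<Longrightarrow> speed t0 \<le> speed t"
    using continuous_attains_inf[of "{0..1::real}" speed] speed(1) by auto
  obtain t1 where t1: "t1 \<in> {0..1}" "\<And>t. t \<in> {0..1} \<Longrightarrow> speed t \<le> speed t1"
    using continuous_attains_sup[of "{0..1::real}" speed] speed(1) by auto
  show ?thesis using that[of "speed t0" "speed t1"] t0 t1 speed(2) by blast
qed

lemma lipschitz_g:
  assumes L: "\<And>t. t \<in> {0..1} \<Longrightarrow> speed t \<le> L" and st: "s \<in> {0..1}" "t \<in> {0..1}"
  shows "norm (g s - g t) \<le> L * \<bar>s - t\<bar>"
proof -
  have "norm (g s - g t) \<le> L * norm (s - t)"
  proof (rule differentiable_bound[of "{0..1::real}" g "\<lambda>x h. h *\<^sub>R vector_derivative g (at x)"])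
    fix x :: real assume x: "x \<in> {0..1}"
    have "(g has_vector_derivative vector_derivative g (at x)) (at x)"
      using curve real_analytic_C1(1) unfolding analytic_jordan_curve_def by blast
    thus "(g has_derivative (\<lambda>h. h *\<^sub>R vector_derivative g (at x))) (at x within {0..1})"
      unfolding has_vector_derivative_def by (rule has_derivative_at_withinI)
    have "L \<ge> 0" using L[OF x] speed(2)[of x] by linarith
    show "onorm (\<lambda>h. h *\<^sub>R vector_derivative g (at x)) \<le> L"
      by (rule onorm_le) (use L[OF x] in \<open>auto simp: speed_def mult.commute[of L] intro!: mult_left_mono\<close>)
  qed (use st in auto)
  thus ?thesis by simp
qed

end

locale analytic_curve_density = analytic_curve +
  fixes \<rho> :: "complex \<Rightarrow> real"
  assumes density: "positive_analytic_density g \<rho>"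
begin

lemma continuous_\<rho>_g: "continuous_on S (\<lambda>t. \<rho> (g t))"
proof -
  have "continuous_on UNIV (\<lambda>t. complex_of_real (\<rho> (g t)))"
    using density real_analytic_continuous[OF real_analytic_of_real] by (simp add: positive_analytic_density_def)
  hence "continuous_on UNIV (\<lambda>t. Re (complex_of_real (\<rho> (g t))))" by (rule continuous_on_Re)
  thus ?thesis by (auto intro: continuous_on_subset)
qed

lemma \<rho>_pos: "\<rho> (g t) > 0"
  using density by (simp add: positive_analytic_density_def)

text \<open>Preimages of closed sets are continuous images of compact sets.\<close>

lemma continuous_\<rho>: "continuous_on (range g) \<rho>"
  unfolding continuous_on_closed_invariant
proof (intro allI impI)
  fix B :: "real set" assume B: "closed B"
  have "compact ({0..1} \<inter> (\<lambda>t. \<rho> (g t)) -` B)"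
    by (intro compact_Int_closed closed_vimage B) (auto intro: continuous_\<rho>_g)
  hence "compact (g ` ({0..1} \<inter> (\<lambda>t. \<rho> (g t)) -` B))" by (intro compact_continuous_image continuous_g)
  moreover have "g ` ({0..1} \<inter> (\<lambda>t. \<rho> (g t)) -` B) = \<rho> -` B \<inter> range g" unfolding range_g(2) by auto
  ultimately show "\<exists>A. closed A \<and> A \<inter> range g = \<rho> -` B \<inter> range g"
    by (intro exI[of _ "\<rho> -` B \<inter> range g"]) (auto dest: compact_imp_closed)
qed

text \<open>Cutting off outside the curve makes the density Borel measurable.\<close>

definition weight :: "complex \<Rightarrow> real" where "weight z = indicator (range g) z * \<rho> z"

lemma measurable_weight [measurable]: "weight \<in> borel_measurable borel"
proof -
  have "(\<lambda>z. indicator (range g) z *\<^sub>R \<rho> z) \<in> borel_measurable borel"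
    by (rule borel_measurable_continuous_on_indicator[OF _ continuous_\<rho>])
       (simp add: compact_imp_closed[OF compact_range_g])
  thus ?thesis by (simp add: weight_def[abs_def])
qed

definition boundary_measure :: "complex measure" where
  "boundary_measure = density (arclength g) (\<lambda>z. ennreal (weight z))"

lemma sets_arclength [simp, measurable_cong]: "sets (arclength g) = sets borel"
  by (simp add: arclength_def)

lemma sets_boundary [simp]: "sets boundary_measure = sets borel"
  by (simp add: boundary_measure_def)

lemma nn_integral_boundary:
  assumes [measurable]: "f \<in> borel_measurable borel"
  shows "(\<integral>\<^sup>+z. f z \<partial>boundary_measure) = (\<integral>\<^sup>+t. ennreal (speed t * \<rho> (g t)) * indicator {0..<1} t * f (g t) \<partial>lborel)"
proof -
  have [measurable]: "speed \<in> borel_measurable borel" by (rule borel_measurable_continuous_onI[OF speed(1)])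
  have "(\<integral>\<^sup>+z. f z \<partial>boundary_measure) = (\<integral>\<^sup>+z. ennreal (weight z) * f z \<partial>arclength g)"
    unfolding boundary_measure_def by (rule nn_integral_density) measurable
  also have "\<dots> = (\<integral>\<^sup>+t. ennreal (weight (g t)) * f (g t) \<partial>density lborel (\<lambda>t. ennreal (speed t) * indicator {0..<1} t))"
    unfolding arclength_def speed_def[symmetric] by (rule nn_integral_distr) measurable
  also have "\<dots> = (\<integral>\<^sup>+t. (ennreal (speed t) * indicator {0..<1} t) * (ennreal (weight (g t)) * f (g t)) \<partial>lborel)"
    by (rule nn_integral_density) measurable
  also have "\<dots> = (\<integral>\<^sup>+t. ennreal (speed t * \<rho> (g t)) * indicator {0..<1} t * f (g t) \<partial>lborel)"
    using speed(2) \<rho>_pos by (intro nn_integral_cong) (auto simp: weight_def ennreal_mult less_imp_le mult_ac)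
  finally show ?thesis .
qed

text \<open>The parametrization is Lipschitz, so a parameter interval of length proportional to
  \<open>r\<close> is mapped into the ball of radius \<open>r\<close>, and the speed and the
  density are bounded below.\<close>

lemma boundary_measure_facts:
  shows "finite_measure boundary_measure" "AE z in boundary_measure. z \<in> range g"
    and "\<exists>c>0. \<forall>z\<in>range g. \<forall>r. 0 < r \<longrightarrow> r \<le> 1 \<longrightarrow> c * r \<le> measure boundary_measure (ball z r)"
proof -
  obtain l L where L: "0 < l" "\<And>t. t \<in> {0..1} \<Longrightarrow> l \<le> speed t" "\<And>t. t \<in> {0..1} \<Longrightarrow> speed t \<le> L"
    using speed_bounds by blast
  have Lpos: "L > 0" using L(1) L(2)[of 0] L(3)[of 0] by simp
  have ne: "{0..1::real} \<noteq> {}" by simp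
  obtain t0 where "\<forall>t\<in>{0..1}. \<rho> (g t0) \<le> \<rho> (g t)"
    using continuous_attains_inf[OF compact_Icc ne continuous_\<rho>_g] by blast
  hence t0: "\<And>t. t \<in> {0..1} \<Longrightarrow> \<rho> (g t0) \<le> \<rho> (g t)" by blast
  obtain t1 where "\<forall>t\<in>{0..1}. \<rho> (g t) \<le> \<rho> (g t1)"
    using continuous_attains_sup[OF compact_Icc ne continuous_\<rho>_g] by blast
  hence t1: "\<And>t. t \<in> {0..1} \<Longrightarrow> \<rho> (g t) \<le> \<rho> (g t1)" by blast
  have ub: "speed t * \<rho> (g t) \<le> L * \<rho> (g t1)" if "t \<in> {0..1}" for t
    using L(3)[OF that] t1[OF that] Lpos \<rho>_pos[of t] speed(2)[of t] by (intro mult_mono) (auto intro: less_imp_le)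
  have lb: "l * \<rho> (g t0) \<le> speed t * \<rho> (g t)" if "t \<in> {0..1}" for t
    using L(2)[OF that] t0[OF that] L(1) \<rho>_pos[of t0] speed(2)[of t] by (intro mult_mono) (auto intro: less_imp_le)
  have "emeasure boundary_measure (space boundary_measure) = (\<integral>\<^sup>+z. 1 \<partial>boundary_measure)" by simp
  also have "\<dots> = (\<integral>\<^sup>+t. ennreal (speed t * \<rho> (g t)) * indicator {0..<1} t \<partial>lborel)"
    by (subst nn_integral_boundary) auto
  also have "\<dots> \<le> (\<integral>\<^sup>+t. ennreal (L * \<rho> (g t1)) * indicator {0..1::real} t \<partial>lborel)"
    by (rule nn_integral_mono) (use ub in \<open>auto split: split_indicator intro!: ennreal_leI\<close>)
  also have "\<dots> < \<infinity>" by (simp add: nn_integral_cmult_indicator ennreal_mult_less_top)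
  finally show fin: "finite_measure boundary_measure" by (intro finite_measureI) auto
  interpret finite_measure boundary_measure by (rule fin)
  have rb: "range g \<in> sets borel" using compact_range_g by (simp add: compact_imp_closed)
  have "(\<integral>\<^sup>+z. indicator (- range g) z \<partial>boundary_measure) = 0"
    using rb by (subst nn_integral_boundary) auto
  hence "emeasure boundary_measure (- range g) = 0" using rb by (subst (asm) nn_integral_indicator) auto
  hence "AE z in boundary_measure. z \<notin> - range g" using rb by (intro AE_not_in null_setsI) auto
  thus "AE z in boundary_measure. z \<in> range g" by simp
  define c where "c = l * \<rho> (g t0) * min (1 / L) (1 / 2)"
  have c: "c > 0" using L(1) \<rho>_pos Lpos by (simp add: c_def)
  show "\<exists>c>0. \<forall>z\<in>range g. \<forall>r. 0 < r \<longrightarrow> r \<le> 1 \<longrightarrow> c * r \<le> measure boundary_measure (ball z r)"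
  proof (intro exI[of _ c] conjI c ballI allI impI)
    fix z r assume z: "z \<in> range g" and r: "0 < r" "r \<le> (1::real)"
    then obtain s where s: "s \<in> {0..<1}" "z = g s" using range_g(1) by auto
    define h where "h = r * min (1 / L) (1 / 2)"
    have h: "h > 0" "h \<le> 1 / 2" "h * L \<le> r"
    proof -
      show "h > 0" using r Lpos by (simp add: h_def)
      have "h \<le> 1 * (1 / 2)" unfolding h_def using r Lpos by (intro mult_mono) auto
      thus "h \<le> 1 / 2" by simp
      have "h \<le> r * (1 / L)" unfolding h_def using r by (intro mult_left_mono) auto
      thus "h * L \<le> r" using Lpos by (simp add: field_simps)
    qed
    \<comment> \<open>The half-open parameter interval contains an interval of length \<open>h\<close> on one side of \<open>s\<close>.\<close>
    obtain u where u: "{u<..<u + h} \<subseteq> {0..<1}" "\<And>t. t \<in> {u<..<u + h} \<Longrightarrow> \<bar>t - s\<bar> < h"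
    proof (cases "s < 1 / 2")
      case True
      show ?thesis
      proof (rule that[of s])
        show "{s<..<s + h} \<subseteq> {0..<1}"
        proof
          fix t assume "t \<in> {s<..<s + h}"
          thus "t \<in> {0..<1}" using s(1) h(2) True by (simp only: greaterThanLessThan_iff atLeastLessThan_iff, intro conjI; linarith)
        qed
      qed auto
    next
      case False
      show ?thesis
      proof (rule that[of "s - h"])
        show "{s - h<..<s - h + h} \<subseteq> {0..<1}"
        proof
          fix t assume "t \<in> {s - h<..<s - h + h}"
          thus "t \<in> {0..<1}" using s(1) h(2) False by (simp only: greaterThanLessThan_iff atLeastLessThan_iff, intro conjI; linarith)
        qed
      qed auto
    qed
    have inb: "g t \<in> ball z r" if "t \<in> {u<..<u + h}" for t
    proof -
      have "norm (g s - g t) \<le> L * \<bar>s - t\<bar>"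
        by (rule lipschitz_g[OF L(3)]) (use s u(1) that in auto)
      also have "\<dots> < L * h" using u(2)[OF that] Lpos by (simp add: abs_minus_commute)
      also have "\<dots> \<le> r" using h by (simp add: mult.commute)
      finally show ?thesis using s by (simp add: dist_norm)
    qed
    have "ennreal (c * r) = ennreal (l * \<rho> (g t0)) * emeasure lborel {u<..<u + h}"
      using h L(1) \<rho>_pos[of t0] by (simp add: c_def h_def ennreal_mult[symmetric] mult_ac)
    also have "\<dots> = (\<integral>\<^sup>+t. ennreal (l * \<rho> (g t0)) * indicator {u<..<u + h} t \<partial>lborel)"
      by (rule nn_integral_cmult_indicator[symmetric]) simp
    also have "\<dots> \<le> (\<integral>\<^sup>+t. ennreal (speed t * \<rho> (g t)) * indicator {0..<1} t * indicator (ball z r) (g t) \<partial>lborel)"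
    proof (rule nn_integral_mono)
      fix t
      show "ennreal (l * \<rho> (g t0)) * indicator {u<..<u + h} t \<le>
          ennreal (speed t * \<rho> (g t)) * indicator {0..<1} t * indicator (ball z r) (g t)"
      proof (cases "t \<in> {u<..<u + h}")
        case True
        hence t01: "t \<in> {0..<1}" using u(1) by blast
        show ?thesis using True t01 inb[OF True] lb[of t] by (simp add: ennreal_leI)
      qed simp
    qed
    also have "\<dots> = emeasure boundary_measure (ball z r)"
      by (subst nn_integral_boundary[symmetric]) (auto intro: nn_integral_indicator intro!: borel_measurable_indicator)
    also have "\<dots> = ennreal (measure boundary_measure (ball z r))" by (simp add: emeasure_eq_measure)
    finally show "c * r \<le> measure boundary_measure (ball z r)" by (simp add: ennreal_le_iff)
  qed
qed

lemma boundary_inner_eq: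
  "boundary_inner g \<rho> p q = (\<integral>z. poly p z * cnj (poly q z) \<partial>boundary_measure)"
proof -
  have [measurable]: "(\<lambda>z. poly p z * cnj (poly q z)) \<in> borel_measurable borel"
    by (intro borel_measurable_continuous_onI continuous_intros)
  have "weight z \<ge> 0" for z using density by (auto simp: weight_def positive_analytic_density_def less_imp_le split: split_indicator)
  hence "(\<integral>z. poly p z * cnj (poly q z) \<partial>boundary_measure) = (\<integral>z. weight z *\<^sub>R (poly p z * cnj (poly q z)) \<partial>arclength g)"
    unfolding boundary_measure_def by (intro integral_density) auto
  also have "\<dots> = boundary_inner g \<rho> p q"
    unfolding boundary_inner_def set_lebesgue_integral_def weight_def
    by (intro Bochner_Integration.integral_cong refl) (auto simp: scaleR_conv_of_real mult_ac)
  finally show ?thesis ..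
qed

end

lemma area_inner_eq:
  assumes "open \<Omega>"
  shows "area_inner \<Omega> p q = (\<integral>z. poly p z * cnj (poly q z) \<partial>density lborel (\<lambda>z. ennreal (indicator \<Omega> z)))"
proof -
  have "(\<lambda>z. poly p z * cnj (poly q z)) \<in> borel_measurable borel"
    by (intro borel_measurable_continuous_onI continuous_intros)
  thus ?thesis unfolding area_inner_def set_lebesgue_integral_def using assms
    by (subst integral_density) auto
qed

section \<open>The Bernstein-Markov property\<close>

text \<open>A union of finitely many paths in \<open>\<Omega>\<close> from \<open>a\<close> to the
  points of a finite net of the closure.\<close>

lemma compact_connected_net:
  fixes \<Omega> :: "complex set"
  assumes \<Omega>: "open \<Omega>" "connected \<Omega>" "bounded \<Omega>" and ab: "a \<in> \<Omega>" "b \<in> \<Omega>" and s: "s > 0"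
  obtains L where "compact L" "connected L" "L \<subseteq> \<Omega>" "a \<in> L" "b \<in> L" "\<And>z. z \<in> closure \<Omega> \<Longrightarrow> \<exists>e\<in>L. norm (z - e) \<le> s"
proof -
  have cc: "compact (closure \<Omega>)" using \<Omega>(3) by simp
  have "closure \<Omega> \<subseteq> (\<Union>e\<in>\<Omega>. ball e s)"
  proof
    fix z assume "z \<in> closure \<Omega>"
    then obtain e where "e \<in> \<Omega>" "dist e z < s" using s closure_approachable by blast
    thus "z \<in> (\<Union>e\<in>\<Omega>. ball e s)" by auto
  qed
  then obtain F where F: "F \<subseteq> \<Omega>" "finite F" "closure \<Omega> \<subseteq> (\<Union>e\<in>F. ball e s)"
    using compactE_image[OF cc, of \<Omega> "\<lambda>e. ball e s"] by auto
  have "path_connected \<Omega>" using \<Omega> connected_open_path_connected by blast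
  hence "\<exists>c. path c \<and> path_image c \<subseteq> \<Omega> \<and> pathstart c = a \<and> pathfinish c = e" if "e \<in> \<Omega>" for e
    using that ab(1) unfolding path_connected_def by blast
  then obtain c where c: "\<And>e. e \<in> \<Omega> \<Longrightarrow> path (c e) \<and> path_image (c e) \<subseteq> \<Omega> \<and> pathstart (c e) = a \<and> pathfinish (c e) = e"
    by metis
  define G where "G = insert b F"
  have G: "G \<subseteq> \<Omega>" "finite G" using F ab by (auto simp: G_def)
  define L where "L = (\<Union>e\<in>G. path_image (c e))"
  have ends: "a \<in> path_image (c e)" "e \<in> path_image (c e)" if "e \<in> \<Omega>" for e
    using c[OF that] pathstart_in_path_image[of "c e"] pathfinish_in_path_image[of "c e"] by auto
  show ?thesis
  proof (rule that[of L])
    show "compact L" unfolding L_def using G c by (intro compact_UN compact_path_image) auto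
    show "connected L" unfolding L_def
    proof (rule connected_Union)
      show "\<And>S. S \<in> (\<lambda>e. path_image (c e)) ` G \<Longrightarrow> connected S" using G c by (auto intro!: connected_path_image)
      have "a \<in> (\<Inter>e\<in>G. path_image (c e))" using G ends by auto
      thus "(\<Inter>e\<in>G. path_image (c e)) \<noteq> {}" by blast
    qed
    show "L \<subseteq> \<Omega>" unfolding L_def using G c by blast
    show "a \<in> L" "b \<in> L" unfolding L_def using ends[of b] ab by (auto simp: G_def)
    fix z assume "z \<in> closure \<Omega>"
    then obtain e where "e \<in> F" "dist e z < s" using F(3) by auto
    thus "\<exists>e\<in>L. norm (z - e) \<le> s" unfolding L_def using ends[of e] F(1)
      by (intro bexI[of _ e]) (auto simp: G_def dist_norm norm_minus_commute)
  qed
qed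

lemma far_point:
  fixes L :: "complex set"
  assumes "a \<in> L" "b \<in> L" shows "\<exists>y\<in>L. norm (a - b) / 2 \<le> norm (y - e)"
proof -
  have "norm (a - b) \<le> norm (a - e) + norm (b - e)" using norm_triangle_ineq4[of "a - e" "b - e"] by simp
  hence "norm (a - b) / 2 \<le> norm (a - e) \<or> norm (a - b) / 2 \<le> norm (b - e)" by linarith
  thus ?thesis using assms by blast
qed

lemma (in orthonormal_setting) integrable_norm_sq: "integrable m (\<lambda>z. (norm (poly p z))\<^sup>2)"
  by (intro integrable_continuous_m continuous_intros)

text \<open>For area measure the maximum over a compact connected part of the domain is controlled first;
  the part is chosen so close to the boundary that passing to the closure costs only
  \<open>exp (\<epsilon> N)\<close>.\<close>

lemma (in orthonormal_setting) bernstein_markov_area: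
  assumes \<Omega>: "open \<Omega>" "connected \<Omega>" "bounded \<Omega>" "\<Omega> \<noteq> {}" and K: "K = closure \<Omega>"
    and m: "m = density lborel (\<lambda>z. ennreal (indicator \<Omega> z))"
  shows bernstein_markov
  unfolding bernstein_markov_def
proof (intro allI impI)
  fix \<epsilon> :: real assume "\<epsilon> > 0"
  hence e2: "\<epsilon> / 2 > 0" by simp
  obtain p0 where p0: "p0 \<in> \<Omega>" using \<Omega>(4) by blast
  then obtain \<delta>0 where "\<delta>0 > 0" "ball p0 \<delta>0 \<subseteq> \<Omega>" using \<Omega>(1) openE by blast
  hence q0: "p0 + of_real (\<delta>0 / 2) \<in> \<Omega>" "p0 + of_real (\<delta>0 / 2) \<noteq> p0" by (auto simp: subset_iff dist_norm)
  define q0 where "q0 = p0 + of_real (\<delta>0 / 2)"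
  define d where "d = norm (p0 - q0) / 2"
  have d: "d > 0" using q0 by (simp add: d_def q0_def)
  define s where "s = d * (cosh (\<epsilon> / 2) - 1) / 2"
  have "cosh (\<epsilon> / 2) > 1" using cosh_real_strict_mono[of 0 "\<epsilon> / 2"] e2 by simp
  hence s: "s > 0" using d by (simp add: s_def)
  have arc: "arcosh (1 + 2 * s / d) = \<epsilon> / 2" unfolding s_def using d e2 by (simp add: arcosh_cosh_real)
  obtain L where L: "compact L" "connected L" "L \<subseteq> \<Omega>" "p0 \<in> L" "q0 \<in> L"
    "\<And>z. z \<in> closure \<Omega> \<Longrightarrow> \<exists>e\<in>L. norm (z - e) \<le> s"
    by (rule compact_connected_net[OF \<Omega>(1-3) p0 q0(1)[folded q0_def] s]) blast
  obtain \<delta> where \<delta>0: "\<delta> > 0" "(\<Union>x\<in>L. ball x \<delta>) \<subseteq> \<Omega>"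
    by (rule compact_subset_open_imp_ball_epsilon_subset[OF L(1) \<Omega>(1) L(3)])
  hence \<delta>: "\<delta> > 0" "\<And>z. z \<in> L \<Longrightarrow> ball z \<delta> \<subseteq> \<Omega>" by auto
  define v where "v = unit_ball_vol 2"
  have v: "v > 0" unfolding v_def by (rule unit_ball_vol_pos) simp
  have ball: "v * \<rho>\<^sup>2 \<le> measure m (ball z \<rho>)" if "z \<in> L" "0 < \<rho>" "\<rho> \<le> \<delta>" for z \<rho>
  proof -
    have sub: "ball z \<rho> \<subseteq> \<Omega>" using \<delta>(2)[OF that(1)] that(3) by (meson subset_ball subset_trans)
    have "emeasure m (ball z \<rho>) = (\<integral>\<^sup>+x. ennreal (indicator \<Omega> x) * indicator (ball z \<rho>) x \<partial>lborel)"
      unfolding m using \<Omega>(1) by (subst emeasure_density) auto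
    also have "\<dots> = (\<integral>\<^sup>+x. indicator (ball z \<rho>) x \<partial>lborel)"
      using sub by (intro nn_integral_cong) (auto split: split_indicator)
    also have "\<dots> = ennreal (v * \<rho>\<^sup>2)" using that(2) by (simp add: emeasure_ball v_def)
    finally show ?thesis using v by (simp add: measure_def)
  qed
  obtain C where C: "C > 0" "\<And>N p z. degree p \<le> N \<Longrightarrow> z \<in> L \<Longrightarrow>
      norm (poly p z) \<le> C * exp (\<epsilon> / 2 * real N) * sqrt (\<integral>z. (norm (poly p z))\<^sup>2 \<partial>m)"
    using bernstein_markov_connected[OF L(1,2,4,5) _ finite_m sets_m integrable_norm_sq v \<delta>(1) ball e2] q0
    by (auto simp: q0_def)
  show "\<exists>C>0. \<forall>N p z. degree p \<le> N \<longrightarrow> z \<in> K \<longrightarrow> norm (poly p z) \<le> C * exp (\<epsilon> * real N) * sqrt (L2 p)"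
  proof (intro exI[of _ C] conjI C(1) allI impI)
    fix N and p :: "complex poly" and z assume p: "degree p \<le> N" and "z \<in> K"
    then obtain e where e: "e \<in> L" "norm (z - e) \<le> s" using L(6) K by blast
    obtain y where y: "y \<in> L" "d \<le> norm (y - e)" using far_point[OF L(4,5), of e] by (auto simp: d_def)
    have "norm (poly p z) \<le> (C * exp (\<epsilon> / 2 * real N) * sqrt (L2 p)) * exp (real N * arcosh (1 + 2 * s / d))"
      by (rule bernstein_walsh_connected[OF L(2) e(1) y(1) d y(2) p _ e(2)])
         (use C(2)[OF p] in \<open>simp add: L2_def\<close>)
    also have "\<dots> = C * (exp (\<epsilon> / 2 * real N) * exp (real N * (\<epsilon> / 2))) * sqrt (L2 p)" unfolding arc by (simp add: mult_ac)
    also have "exp (\<epsilon> / 2 * real N) * exp (real N * (\<epsilon> / 2)) = exp (\<epsilon> * real N)"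
      by (simp add: exp_add[symmetric] field_simps)
    finally show "norm (poly p z) \<le> C * exp (\<epsilon> * real N) * sqrt (L2 p)" .
  qed
qed

text \<open>The curve is connected and its balls of radius \<open>r\<close> have mass at least of
  order \<open>r\<close>, so its own maximum is controlled; the maximum principle extends the
  bound to \<open>K\<close>.\<close>

lemma (in orthonormal_setting) bernstein_markov_boundary:
  assumes K: "frontier K \<subseteq> range g" and g: "analytic_curve_density g \<rho>"
    and m: "m = analytic_curve_density.boundary_measure g \<rho>"
  shows bernstein_markov
  unfolding bernstein_markov_def
proof (intro allI impI)
  interpret G: analytic_curve_density g \<rho> by (rule g)
  fix \<epsilon> :: real assume eps: "\<epsilon> > 0"
  obtain c where c: "c > 0" "\<And>z r. z \<in> range g \<Longrightarrow> 0 < r \<Longrightarrow> r \<le> 1 \<Longrightarrow> c * r \<le> measure m (ball z r)"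
    using G.boundary_measure_facts(3) unfolding m by blast
  have ball: "c * r\<^sup>2 \<le> measure m (ball z r)" if "z \<in> range g" "0 < r" "r \<le> 1" for z r
  proof -
    have "r\<^sup>2 \<le> r" using that by (simp add: power2_eq_square mult_left_le)
    hence "c * r\<^sup>2 \<le> c * r" using c(1) by (intro mult_left_mono) auto
    thus ?thesis using c(2)[OF that] by simp
  qed
  have "inj_on g {0..<1}" using G.curve by (simp add: analytic_jordan_curve_def)
  hence ne: "g 0 \<noteq> g (1/2)" by (auto dest: inj_onD[of _ _ 0 "1/2"])
  have conn: "connected (range g)" by (intro connected_continuous_image G.continuous_g) auto
  obtain C where C: "C > 0" "\<And>N p z. degree p \<le> N \<Longrightarrow> z \<in> range g \<Longrightarrow>
      norm (poly p z) \<le> C * exp (\<epsilon> * real N) * sqrt (\<integral>z. (norm (poly p z))\<^sup>2 \<partial>m)"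
    using bernstein_markov_connected[OF G.compact_range_g conn _ _ ne finite_m sets_m integrable_norm_sq c(1) zero_less_one ball eps]
    by auto
  show "\<exists>C>0. \<forall>N p z. degree p \<le> N \<longrightarrow> z \<in> K \<longrightarrow> norm (poly p z) \<le> C * exp (\<epsilon> * real N) * sqrt (L2 p)"
  proof (intro exI[of _ C] conjI C(1) allI impI)
    fix N and p :: "complex poly" and z assume p: "degree p \<le> N" and z: "z \<in> K"
    show "norm (poly p z) \<le> C * exp (\<epsilon> * real N) * sqrt (L2 p)"
    proof (rule maximum_modulus_frontier[of "poly p" K])
      fix w assume "w \<in> frontier K"
      hence "w \<in> range g" using K by blast
      from C(2)[OF p this] show "norm (poly p w) \<le> C * exp (\<epsilon> * real N) * sqrt (L2 p)" by (simp add: L2_def)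
    qed (use z compact_imp_bounded[OF compact_K] in \<open>auto intro!: holomorphic_intros continuous_intros\<close>)
  qed
qed

section \<open>Equidistribution of the zeros\<close>

text \<open>The fourth powers divided by \<open>N^4\<close> have expectations of order \<open>1 /
  N^3\<close>. Their sum over \<open>N\<close> has finite expectation, hence converges almost
  surely, and its terms tend to zero.\<close>

lemma AE_normalized_log_mean_limit:
  fixes P :: "nat \<Rightarrow> nat \<Rightarrow> complex poly" and \<gamma> :: "nat \<Rightarrow> complex poly measure"
  assumes P: "\<And>N j. N \<ge> 1 \<Longrightarrow> j \<le> N \<Longrightarrow> P N j \<in> polys N"
    and span: "\<And>N f. N \<ge> 1 \<Longrightarrow> f \<in> polys N \<Longrightarrow> \<exists>a. f = random_poly N (P N) a"
    and \<gamma>: "\<And>N. N \<ge> 1 \<Longrightarrow> \<gamma> N = distr (PiM {..N} (\<lambda>_. std_complex_gaussian)) (borel_polys N) (random_poly N (P N))"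
    and prob: "\<And>N. N \<ge> 1 \<Longrightarrow> prob_space (\<gamma> N)"
  shows "AE f in PiM {1..} \<gamma>. (\<lambda>N. normalized_log_mean N (P N) z r (f N) / real N) \<longlonglongrightarrow> 0"
proof -
  obtain C where C: "C \<ge> 0" "\<And>N P z r. (\<And>j. j \<le> N \<Longrightarrow> P j \<in> polys N) \<Longrightarrow>
     (\<And>f. f \<in> polys N \<Longrightarrow> \<exists>a. f = random_poly N P a) \<Longrightarrow>
    (\<integral>\<^sup>+p. ennreal ((normalized_log_mean N P z r p) ^ 4)
       \<partial>distr (PiM {..N} (\<lambda>_. std_complex_gaussian)) (borel_polys N) (random_poly N P)) \<le> ennreal (C * (real N + 1))"
    by (rule normalized_log_mean_moment) blast
  define Y where "Y = (\<lambda>n f. (normalized_log_mean (Suc n) (P (Suc n)) z r (f (Suc n)) / real (Suc n)) ^ 4)"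
  have sets_\<gamma>: "sets (\<gamma> (Suc n)) = sets (borel_polys (Suc n))" for n by (simp add: \<gamma>)
  have comp: "(\<lambda>f. f (Suc n)) \<in> PiM {1..} \<gamma> \<rightarrow>\<^sub>M \<gamma> (Suc n)" for n
    by (rule measurable_component_singleton) simp
  have nm: "normalized_log_mean (Suc n) (P (Suc n)) z r \<in> borel_measurable (\<gamma> (Suc n))" for n
    unfolding measurable_cong_sets[OF sets_\<gamma> refl] by (rule measurable_normalized_log_mean)
  have Ym [measurable]: "Y n \<in> borel_measurable (PiM {1..} \<gamma>)" for n
    unfolding Y_def using measurable_compose[OF comp nm, of n] by measurable
  have bound: "(\<integral>\<^sup>+f. ennreal (Y n f) \<partial>PiM {1..} \<gamma>) \<le> ennreal (2 * C * (1 / (real (Suc n)) ^ 3))" for n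
  proof -
    have "(\<integral>\<^sup>+f. ennreal (Y n f) \<partial>PiM {1..} \<gamma>) =
        (\<integral>\<^sup>+p. ennreal ((normalized_log_mean (Suc n) (P (Suc n)) z r p / real (Suc n)) ^ 4)
          \<partial>distr (PiM {1..} \<gamma>) (\<gamma> (Suc n)) (\<lambda>f. f (Suc n)))"
      unfolding Y_def using measurable_compose[OF nm[of n], of "\<lambda>x. ennreal ((x / real (Suc n)) ^ 4)" borel]
      by (intro nn_integral_distr[symmetric] comp) simp_all
    also have "distr (PiM {1..} \<gamma>) (\<gamma> (Suc n)) (\<lambda>f. f (Suc n)) = \<gamma> (Suc n)"
      by (rule distr_PiM_component) (use prob in auto)
    also have "(\<integral>\<^sup>+p. ennreal ((normalized_log_mean (Suc n) (P (Suc n)) z r p / real (Suc n)) ^ 4) \<partial>\<gamma> (Suc n)) =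
        (\<integral>\<^sup>+p. ennreal (1 / real (Suc n) ^ 4) * ennreal ((normalized_log_mean (Suc n) (P (Suc n)) z r p) ^ 4) \<partial>\<gamma> (Suc n))"
      by (intro nn_integral_cong) (simp only: ennreal_mult[symmetric] zero_le_divide_1_iff zero_le_even_power
        even_numeral of_nat_0_le_iff zero_le_power power_divide times_divide_eq_left mult_1_left)
    also have "\<dots> = ennreal (1 / real (Suc n) ^ 4) * (\<integral>\<^sup>+p. ennreal ((normalized_log_mean (Suc n) (P (Suc n)) z r p) ^ 4) \<partial>\<gamma> (Suc n))"
      using measurable_compose[OF nm[of n], of "\<lambda>x. ennreal (x ^ 4)" borel]
      by (intro nn_integral_cmult) simp_all
    also have "\<dots> \<le> ennreal (1 / real (Suc n) ^ 4) * ennreal (C * (real (Suc n) + 1))"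
    proof (rule mult_left_mono)
      show "(\<integral>\<^sup>+p. ennreal ((normalized_log_mean (Suc n) (P (Suc n)) z r p) ^ 4) \<partial>\<gamma> (Suc n)) \<le> ennreal (C * (real (Suc n) + 1))"
        unfolding \<gamma>[of "Suc n", simplified] by (rule C(2)) (use P span in auto)
    qed simp
    also have "\<dots> = ennreal (1 / real (Suc n) ^ 4 * (C * (real (Suc n) + 1)))"
      using C(1) by (intro ennreal_mult[symmetric]) auto
    also have "\<dots> \<le> ennreal (2 * C * (1 / (real (Suc n)) ^ 3))"
    proof (rule ennreal_leI)
      have "C * (real (Suc n) + 1) \<le> C * (2 * real (Suc n))" by (rule mult_left_mono[OF _ C(1)]) simp
      hence "1 / real (Suc n) ^ 4 * (C * (real (Suc n) + 1)) \<le> 1 / real (Suc n) ^ 4 * (C * (2 * real (Suc n)))"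
        by (rule mult_left_mono) simp
      also have "\<dots> = 2 * C * (1 / (real (Suc n)) ^ 3)"
        by (simp add: power4_eq_xxxx power3_eq_cube mult_ac del: of_nat_Suc)
      finally show "1 / real (Suc n) ^ 4 * (C * (real (Suc n) + 1)) \<le> 2 * C * (1 / (real (Suc n)) ^ 3)" .
    qed
    finally show ?thesis .
  qed
  have "summable (\<lambda>n. 1 / (real (Suc n)) ^ 3)"
  proof -
    have "summable (\<lambda>n. inverse ((real n) ^ 3))" by (rule inverse_power_summable) simp
    hence "summable (\<lambda>n. inverse ((real (Suc n)) ^ 3))" by (subst summable_Suc_iff)
    thus ?thesis by (simp add: inverse_eq_divide)
  qed
  hence sm: "summable (\<lambda>n. 2 * C * (1 / (real (Suc n)) ^ 3))" by (rule summable_mult)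
  have "(\<integral>\<^sup>+f. (\<Sum>n. ennreal (Y n f)) \<partial>PiM {1..} \<gamma>) = (\<Sum>n. \<integral>\<^sup>+f. ennreal (Y n f) \<partial>PiM {1..} \<gamma>)"
    by (rule nn_integral_suminf) measurable
  also have "\<dots> \<le> (\<Sum>n. ennreal (2 * C * (1 / (real (Suc n)) ^ 3)))" by (intro suminf_le bound) auto
  also have "\<dots> < \<infinity>" using C(1) sm by (subst suminf_ennreal2) auto
  finally have fin: "(\<integral>\<^sup>+f. (\<Sum>n. ennreal (Y n f)) \<partial>PiM {1..} \<gamma>) < \<infinity>" .
  have "AE f in PiM {1..} \<gamma>. (\<Sum>n. ennreal (Y n f)) \<noteq> \<infinity>"
    by (rule nn_integral_PInf_AE) (measurable, use fin in simp)
  thus ?thesis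
  proof eventually_elim
    case (elim f)
    have "summable (\<lambda>n. Y n f)" by (rule summable_suminf_not_top) (use elim in \<open>auto simp: Y_def\<close>)
    hence lim: "(\<lambda>n. Y n f) \<longlonglongrightarrow> 0" by (rule summable_LIMSEQ_zero)
    show ?case
    proof (rule LIMSEQ_imp_Suc, rule tendstoI)
      fix \<epsilon> :: real assume e: "\<epsilon> > 0"
      have "\<forall>\<^sub>F n in sequentially. Y n f < \<epsilon> ^ 4" using lim e by (intro order_tendstoD(2)) auto
      thus "\<forall>\<^sub>F n in sequentially. dist (normalized_log_mean (Suc n) (P (Suc n)) z r (f (Suc n)) / real (Suc n)) 0 < \<epsilon>"
      proof eventually_elim
        case (elim n)
        hence "\<bar>normalized_log_mean (Suc n) (P (Suc n)) z r (f (Suc n)) / real (Suc n)\<bar> ^ 4 < \<epsilon> ^ 4"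
          by (subst power_even_abs) (simp_all add: Y_def del: of_nat_Suc)
        hence "\<bar>normalized_log_mean (Suc n) (P (Suc n)) z r (f (Suc n)) / real (Suc n)\<bar> < \<epsilon>"
          by (rule power_less_imp_less_base) (use e in simp)
        thus ?case by (simp add: dist_real_def del: of_nat_Suc)
      qed
    qed
  qed
qed

text \<open>Jensen's formula splits a sum of tents into a random part, which tends to zero, and
  the circle means of the Christoffel function, which converge to those of the Green function; the
  tent integrals of \<open>\<nu>\<close> are these same means because of its potential. Countably
  many tents share one null set.\<close>

theorem (in orthonormal_setting) AE_tents:
  fixes P :: "nat \<Rightarrow> nat \<Rightarrow> complex poly" and \<gamma> :: "nat \<Rightarrow> complex poly measure"
  assumes bm: "bernstein_markov"
    and on: "\<And>N. N \<ge> 1 \<Longrightarrow> orthonormal_basis N ip (P N)"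
    and \<gamma>: "\<And>N. N \<ge> 1 \<Longrightarrow> \<gamma> N = distr (PiM {..N} (\<lambda>_. std_complex_gaussian)) (borel_polys N) (random_poly N (P N))"
    and \<nu>: "prob_space \<nu>" "sets \<nu> = sets borel" "AE w in \<nu>. w \<in> K"
    and pot: "\<And>z s. s > 0 \<Longrightarrow> (\<integral>w. ln (max s (norm (z - w))) \<partial>\<nu>) = circle_mean (\<lambda>z. log_capacity + green z) z s"
    and E: "countable E"
  shows "AE f in PiM {1..} \<gamma>. (\<forall>N\<ge>1. degree (f N) = N \<and> rsquarefree (f N)) \<and>
    (\<forall>x\<in>E. \<forall>k. (\<lambda>N. (\<Sum>y | poly (f N) y = 0. tent (1 / real (Suc k)) (x - y)) / real N)
      \<longlonglongrightarrow> (\<integral>w. tent (1 / real (Suc k)) (x - w) \<partial>\<nu>))"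
proof -
  have P: "P N j \<in> polys N" if "N \<ge> 1" "j \<le> N" for N j
    using on[OF that(1)] that(2) by (simp add: orthonormal_basis_def)
  have ons: "ip (P N j) (P N k) = (if j = k then 1 else 0)" if "N \<ge> 1" "j \<le> N" "k \<le> N" for N j k
    using on[OF that(1)] that(2,3) by (simp add: orthonormal_basis_def)
  have span: "\<exists>a. f = random_poly N (P N) a" if "N \<ge> 1" "f \<in> polys N" for N f
    using on[OF that(1)] that(2) by (simp add: orthonormal_basis_def random_poly_def)
  interpret \<nu>: prob_space \<nu> by fact
  interpret U: prob_space unif01 by (rule prob_space_unif01)
  have prob: "prob_space (\<gamma> N)" if "N \<ge> 1" for N
  proof -
    interpret G: prob_space "PiM {..N} (\<lambda>_. std_complex_gaussian)"
      by (rule prob_space_PiM) (rule prob_space_std_complex_gaussian)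
    show ?thesis unfolding \<gamma>[OF that]
      by (rule G.prob_space_distr) (rule measurable_random_poly, rule P[OF that])
  qed
  have roots: "AE f in PiM {1..} \<gamma>. degree (f N) = N \<and> rsquarefree (f N)" if N: "N \<ge> 1" for N
  proof (rule AE_PiM_component)
    show "AE p in \<gamma> N. degree p = N \<and> rsquarefree p"
      unfolding \<gamma>[OF N] by (rule AE_simple_roots[OF N]) (use P[OF N] span[OF N] in auto)
  qed (use prob N in auto)
  have tent_int: "(\<integral>w. tent s (z - w) \<partial>\<nu>) = circle_mean green z (2 * s) - circle_mean green z s" if s: "s > 0" for s z
  proof -
    have int: "integrable \<nu> (\<lambda>w. ln (max s (norm (z - w))))" if "s > 0" for s
    proof -
      have c: "continuous_on UNIV (\<lambda>w. ln (max s (norm (z - w))))" using that by (intro continuous_intros) auto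
      obtain B where "\<forall>w\<in>K. norm (ln (max s (norm (z - w)))) \<le> B"
        using compact_imp_bounded[OF compact_continuous_image[OF continuous_on_subset[OF c] compact_K]]
        unfolding bounded_iff by auto
      thus ?thesis using \<nu>(3) borel_measurable_continuous_onI[OF c]
        by (intro \<nu>.integrable_const_bound[of _ B]) (auto elim!: eventually_mono simp: measurable_cong_sets[OF \<nu>(2) refl])
    qed
    have cm: "circle_mean (\<lambda>z. log_capacity + green z) z r = log_capacity + circle_mean green z r" for r
      using integrable_circle[OF continuous_green, of z r] U.prob_space by (simp add: circle_mean_def)
    have "(\<integral>w. tent s (z - w) \<partial>\<nu>) = (\<integral>w. ln (max (2 * s) (norm (z - w))) \<partial>\<nu>) - (\<integral>w. ln (max s (norm (z - w))) \<partial>\<nu>)"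
      unfolding tent_def using s int[of "2 * s"] int[OF s] by (intro Bochner_Integration.integral_diff) auto
    also have "\<dots> = circle_mean (\<lambda>z. log_capacity + green z) z (2 * s) - circle_mean (\<lambda>z. log_capacity + green z) z s"
      using pot[of "2 * s" z] pot[OF s, of z] s by simp
    finally show ?thesis by (simp add: cm)
  qed
  have one: "AE f in PiM {1..} \<gamma>. (\<lambda>N. (\<Sum>y | poly (f N) y = 0. tent s (z - y)) / real N) \<longlonglongrightarrow> (\<integral>w. tent s (z - w) \<partial>\<nu>)"
    if s: "s > 0" for s z
  proof -
    have all: "AE f in PiM {1..} \<gamma>. \<forall>N\<in>{1..}. degree (f N) = N \<and> rsquarefree (f N)"
      using roots by (subst AE_ball_countable) auto
    have L: "AE f in PiM {1..} \<gamma>. (\<lambda>N. normalized_log_mean N (P N) z r (f N) / real N) \<longlonglongrightarrow> 0" for r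
      by (rule AE_normalized_log_mean_limit) (fact P span \<gamma> prob)+
    show ?thesis
      using L[of "2 * s"] L[of s] all
    proof eventually_elim
      case (elim f)
      let ?n = "\<lambda>r N. normalized_log_mean N (P N) z r (f N) / real N"
      let ?c = "\<lambda>r N. circle_mean (\<lambda>x. ln (christoffel N (P N) x) / 2) z r / real N"
      have "(\<lambda>N. (?n (2 * s) N - ?n s N) + (?c (2 * s) N - ?c s N)) \<longlonglongrightarrow> (0 - 0) + (circle_mean green z (2 * s) - circle_mean green z s)"
        by (intro tendsto_add tendsto_diff elim circle_mean_christoffel_limit[OF bm P ons span])
      moreover have "\<forall>\<^sub>F N in sequentially. (?n (2 * s) N - ?n s N) + (?c (2 * s) N - ?c s N) =
          (\<Sum>y | poly (f N) y = 0. tent s (z - y)) / real N"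
        using eventually_ge_at_top[of 1]
      proof eventually_elim
        case N: (elim N)
        have "rsquarefree (f N)" using elim(3) N by auto
        from sum_tent_roots[OF this s continuous_christoffel[of UNIV N "P N"] christoffel_pos[OF span[OF N]], of z]
        show ?case by (simp add: normalized_log_mean_def add_divide_distrib diff_divide_distrib)
      qed
      ultimately show ?case unfolding tent_int[OF s] by (simp add: tendsto_cong)
    qed
  qed
  have "AE f in PiM {1..} \<gamma>. \<forall>N\<in>{1..}. degree (f N) = N \<and> rsquarefree (f N)"
    using roots by (subst AE_ball_countable) auto
  moreover have "AE f in PiM {1..} \<gamma>. \<forall>x\<in>E. \<forall>k. (\<lambda>N. (\<Sum>y | poly (f N) y = 0. tent (1 / real (Suc k)) (x - y)) / real N)
      \<longlonglongrightarrow> (\<integral>w. tent (1 / real (Suc k)) (x - w) \<partial>\<nu>)"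
    using one by (subst AE_ball_countable[OF E]) (auto simp: AE_all_countable simp del: of_nat_Suc)
  ultimately show ?thesis by eventually_elim auto
qed

text \<open>Translates continuity on the one-point compactification into continuity on the plane
  and a limit at infinity.\<close>

lemma riemann_sphere_limits:
  fixes \<phi> :: "complex option \<Rightarrow> 'a::metric_space"
  assumes "continuous_map riemann_sphere euclidean \<phi>"
  shows "continuous_on UNIV (\<lambda>z. \<phi> (Some z))" "((\<lambda>z. \<phi> (Some z)) \<longlongrightarrow> \<phi> None) at_infinity"
proof -
  have op: "openin riemann_sphere {x \<in> topspace riemann_sphere. \<phi> x \<in> V}" if "open V" for V
    using openin_continuous_map_preimage[OF assms, of V] that by simp
  have top: "topspace riemann_sphere = UNIV"
    unfolding riemann_sphere_def by (auto simp: topspace_Alexandroff_compactification image_iff)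
  have "continuous_map euclidean riemann_sphere (Some :: complex \<Rightarrow> complex option)"
    unfolding riemann_sphere_def by (rule continuous_map_Some)
  hence "continuous_map euclidean euclidean (\<phi> \<circ> Some)" using assms by (rule continuous_map_compose)
  thus "continuous_on UNIV (\<lambda>z. \<phi> (Some z))" by (simp add: o_def)
  show "((\<lambda>z. \<phi> (Some z)) \<longlongrightarrow> \<phi> None) at_infinity"
  proof (rule tendstoI)
    fix e :: real assume e: "e > 0"
    have "openin riemann_sphere {x. \<phi> x \<in> ball (\<phi> None) e}" using op[of "ball (\<phi> None) e"] top by simp
    moreover have "None \<in> {x. \<phi> x \<in> ball (\<phi> None) e}" using e by simp
    ultimately obtain C :: "complex set" where C: "compact C" "{x. \<phi> x \<in> ball (\<phi> None) e} = insert None (Some ` (- C))"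
      unfolding riemann_sphere_def openin_Alexandroff_compactification by (auto simp: Compl_eq_Diff_UNIV)
    obtain B where B: "\<And>x. x \<in> C \<Longrightarrow> norm x \<le> B" using compact_imp_bounded[OF C(1)] bounded_iff by blast
    have "dist (\<phi> (Some z)) (\<phi> None) < e" if "norm z \<ge> B + 1" for z
    proof -
      have "z \<in> - C" using B[of z] that by auto
      hence "Some z \<in> {x. \<phi> x \<in> ball (\<phi> None) e}" unfolding C(2) by blast
      thus ?thesis by (simp add: dist_commute)
    qed
    thus "\<forall>\<^sub>F z in at_infinity. dist (\<phi> (Some z)) (\<phi> None) < e" unfolding eventually_at_infinity by blast
  qed
qed

text \<open>The limit measure with potential \<open>log_capacity + green\<close> is both the
  equilibrium measure and the limit of the zeros. A function \<open>\<phi>\<close> on the sphere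
  is replaced by \<open>\<phi> - \<phi>(\<infinity>)\<close>, which vanishes at infinity; the
  constant contributes \<open>\<phi>(\<infinity>)\<close> to both sides since there are
  \<open>N\<close> zeros.\<close>

theorem (in orthonormal_setting) zeros_equidistributed:
  fixes P :: "nat \<Rightarrow> nat \<Rightarrow> complex poly" and \<gamma> :: "nat \<Rightarrow> complex poly measure" and g :: "real \<Rightarrow> complex"
  assumes bm: "bernstein_markov"
    and on: "\<And>N. N \<ge> 1 \<Longrightarrow> orthonormal_basis N ip (P N)"
    and \<gamma>: "\<And>N. N \<ge> 1 \<Longrightarrow> \<gamma> N = distr (PiM {..N} (\<lambda>_. std_complex_gaussian)) (borel_polys N) (random_poly N (P N))"
    and g: "continuous_on UNIV g" "range g = g ` {0..1}" "frontier K \<subseteq> range g" "range g \<subseteq> K"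
  shows "AE f in PiM {1..} \<gamma>.
           \<forall>\<phi> :: complex option \<Rightarrow> complex. continuous_map riemann_sphere euclidean \<phi> \<longrightarrow>
             (\<lambda>N. (1 / of_nat N) * (\<Sum>z | poly (f N) z = 0. \<phi> (Some z)))
               \<longlonglongrightarrow> (LINT z:range g|equilibrium_measure K. \<phi> (Some z))"
proof -
  have gb: "range g \<in> sets borel"
    using compact_continuous_image[OF continuous_on_subset[OF g(1)] compact_Icc[of 0 1]] g(2) by (simp add: compact_imp_closed)
  obtain \<nu> where \<nu>: "prob_space \<nu>" "sets \<nu> = sets borel" "emeasure \<nu> (range g) = 1"
    and pot: "\<And>z s. s > 0 \<Longrightarrow> (\<integral>w. ln (max s (norm (z - w))) \<partial>\<nu>) = circle_mean (\<lambda>z. log_capacity + green z) z s"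
    using limit_measure_exists[OF g(1-3)] by blast
  have eq: "equilibrium_measure K = \<nu>" by (rule equilibrium_measure_exterior[OF g(4) gb \<nu> pot])
  interpret \<nu>: prob_space \<nu> by (rule \<nu>(1))
  have ae: "AE w in \<nu>. w \<in> range g" using \<nu>.AE_in_set_eq_1[of "range g"] \<nu> gb by (simp add: \<nu>.emeasure_eq_measure)
  have aeK: "AE w in \<nu>. w \<in> K" using ae g(4) by (auto elim!: eventually_mono)
  obtain E :: "complex set" where E: "countable E" "\<And>X. open X \<Longrightarrow> X \<noteq> {} \<Longrightarrow> \<exists>d\<in>E. d \<in> X"
    using countable_dense_setE by blast
  have "AE f in PiM {1..} \<gamma>. (\<forall>N\<ge>1. degree (f N) = N \<and> rsquarefree (f N)) \<and>
    (\<forall>x\<in>E. \<forall>k. (\<lambda>N. (\<Sum>y | poly (f N) y = 0. tent (1 / real (Suc k)) (x - y)) / real N)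
      \<longlonglongrightarrow> (\<integral>w. tent (1 / real (Suc k)) (x - w) \<partial>\<nu>))"
    by (rule AE_tents) (fact bm on \<gamma> \<nu> aeK pot E)+
  thus ?thesis
  proof eventually_elim
    case (elim f)
    show ?case
    proof (intro allI impI)
      fix \<phi> :: "complex option \<Rightarrow> complex" assume \<phi>: "continuous_map riemann_sphere euclidean \<phi>"
      note lim = riemann_sphere_limits[OF \<phi>]
      let ?Z = "\<lambda>N. {z. poly (f N) z = 0}"
      have deg: "degree (f N) = N" "rsquarefree (f N)" if "N \<ge> 1" for N using elim that by auto
      have fin: "finite (?Z N)" if "N \<ge> 1" for N
        using deg[OF that] by (intro poly_roots_finite) (auto simp: rsquarefree_def)
      have card: "card (?Z N) = N" if "N \<ge> 1" for N
      proof -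
        have "degree (f N) = degree (smult (lead_coeff (f N)) (\<Prod>x | poly (f N) x = 0. [:- x, 1:]))"
          using complex_poly_decompose_rsquarefree[OF deg(2)[OF that]] by simp
        also have "\<dots> = degree (\<Prod>x | poly (f N) x = 0. [:- x, 1:])"
          using deg(2)[OF that] by (simp add: rsquarefree_def)
        also have "\<dots> = (\<Sum>x | poly (f N) x = 0. degree [:- x, 1:])" by (rule degree_prod_eq_sum_degree) auto
        also have "\<dots> = card (?Z N)" by simp
        finally show ?thesis using deg(1)[OF that] by simp
      qed
      have W: "(\<lambda>N. (\<Sum>x\<in>?Z N. \<psi> x) / real N) \<longlonglongrightarrow> (\<integral>w. \<psi> w \<partial>\<nu>)" "integrable \<nu> \<psi>"
        if "continuous_on UNIV \<psi>" "(\<psi> \<longlongrightarrow> 0) at_infinity" for \<psi> :: "complex \<Rightarrow> real"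
        using weak_convergence_from_tents[of ?Z \<nu> E \<psi>, OF fin card \<nu>(1,2) E(2) _ that] elim by auto
      define \<psi> where "\<psi> = (\<lambda>z. \<phi> (Some z) - \<phi> None)"
      have c\<psi>: "continuous_on UNIV \<psi>" unfolding \<psi>_def by (intro continuous_intros lim)
      have l\<psi>: "(\<psi> \<longlongrightarrow> 0) at_infinity" unfolding \<psi>_def using tendsto_diff[OF lim(2) tendsto_const[of "\<phi> None"]] by simp
      have re: "(\<lambda>N. (\<Sum>x\<in>?Z N. Re (\<psi> x)) / real N) \<longlonglongrightarrow> (\<integral>w. Re (\<psi> w) \<partial>\<nu>)" "integrable \<nu> (\<lambda>w. Re (\<psi> w))"
        using W[of "\<lambda>w. Re (\<psi> w)"] continuous_on_Re[OF c\<psi>] tendsto_Re[OF l\<psi>] by auto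
      have im: "(\<lambda>N. (\<Sum>x\<in>?Z N. Im (\<psi> x)) / real N) \<longlonglongrightarrow> (\<integral>w. Im (\<psi> w) \<partial>\<nu>)" "integrable \<nu> (\<lambda>w. Im (\<psi> w))"
        using W[of "\<lambda>w. Im (\<psi> w)"] continuous_on_Im[OF c\<psi>] tendsto_Im[OF l\<psi>] by auto
      have "integrable \<nu> (\<lambda>w. complex_of_real (Re (\<psi> w)) + \<i> * complex_of_real (Im (\<psi> w)))"
        by (intro Bochner_Integration.integrable_add integrable_mult_right integrable_of_real re im)
      hence int: "integrable \<nu> \<psi>" by (simp only: complex_eq[symmetric])
      have "(\<lambda>N. (\<Sum>x\<in>?Z N. \<psi> x) / of_nat N) \<longlonglongrightarrow> (\<integral>w. \<psi> w \<partial>\<nu>)"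
        unfolding tendsto_complex_iff using re(1) im(1) int
        by (simp add: Re_divide_of_nat Im_divide_of_nat)
      hence "(\<lambda>N. (\<Sum>x\<in>?Z N. \<psi> x) / of_nat N + \<phi> None) \<longlonglongrightarrow> (\<integral>w. \<psi> w \<partial>\<nu>) + \<phi> None"
        by (intro tendsto_add tendsto_const)
      moreover have "\<forall>\<^sub>F N in sequentially. (\<Sum>x\<in>?Z N. \<psi> x) / of_nat N + \<phi> None =
          (1 / of_nat N) * (\<Sum>z | poly (f N) z = 0. \<phi> (Some z))"
        using eventually_ge_at_top[of 1]
      proof eventually_elim
        case N: (elim N)
        have "(\<Sum>x\<in>?Z N. \<psi> x) = (\<Sum>z | poly (f N) z = 0. \<phi> (Some z)) - of_nat N * \<phi> None"
          by (simp add: \<psi>_def sum_subtractf card[OF N])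
        thus ?case using N by (simp add: field_simps)
      qed
      moreover have "(\<integral>w. \<psi> w \<partial>\<nu>) + \<phi> None = (LINT z:range g|equilibrium_measure K. \<phi> (Some z))"
      proof -
        have "(LINT z:range g|equilibrium_measure K. \<phi> (Some z)) = (\<integral>w. \<psi> w + \<phi> None \<partial>\<nu>)"
          unfolding eq set_lebesgue_integral_def
        proof (rule integral_cong_AE)
          have "(\<lambda>z. \<phi> (Some z)) \<in> borel_measurable borel" by (rule borel_measurable_continuous_onI[OF lim(1)])
          thus "(\<lambda>z. indicator (range g) z *\<^sub>R \<phi> (Some z)) \<in> borel_measurable \<nu>"
            unfolding measurable_cong_sets[OF \<nu>(2) refl] using gb by measurable
          show "(\<lambda>w. \<psi> w + \<phi> None) \<in> borel_measurable \<nu>" using int by auto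
          show "AE z in \<nu>. indicator (range g) z *\<^sub>R \<phi> (Some z) = \<psi> z + \<phi> None"
            using ae by eventually_elim (simp add: \<psi>_def)
        qed
        thus ?thesis using int \<nu>.prob_space by simp
      qed
      ultimately show "(\<lambda>N. (1 / of_nat N) * (\<Sum>z | poly (f N) z = 0. \<phi> (Some z)))
               \<longlonglongrightarrow> (LINT z:range g|equilibrium_measure K. \<phi> (Some z))"
        by (simp add: tendsto_cong)
    qed
  qed
qed

lemma induced_gaussian_basis:
  assumes "\<forall>N\<ge>1. induced_gaussian N ip (\<gamma> N)"
  shows "\<exists>P. \<forall>N\<ge>1. orthonormal_basis N ip (P N) \<and>
    \<gamma> N = distr (PiM {..N} (\<lambda>_. std_complex_gaussian)) (borel_polys N) (random_poly N (P N))"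
proof -
  have "\<forall>N. \<exists>P. N \<ge> 1 \<longrightarrow> orthonormal_basis N ip P \<and>
      \<gamma> N = distr (PiM {..N} (\<lambda>_. std_complex_gaussian)) (borel_polys N) (random_poly N P)"
    using assms unfolding induced_gaussian_def random_poly_def[abs_def] by blast
  thus ?thesis by (rule choice)
qed

theorem theorem3:
  fixes \<Omega> :: "complex set" and g :: "real \<Rightarrow> complex"
    and \<gamma> :: "nat \<Rightarrow> complex poly measure"
  assumes "\<Omega> \<noteq> {}" and "open \<Omega>" and "connected \<Omega>" and "bounded \<Omega>" and "simply_connected \<Omega>"
    and "analytic_jordan_curve g" and "frontier \<Omega> = range g"
    and "(\<exists>\<rho>. positive_analytic_density g \<rho> \<and>
              (\<forall>N\<ge>1. induced_gaussian N (boundary_inner g \<rho>) (\<gamma> N))) \<or>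
         (\<forall>N\<ge>1. induced_gaussian N (area_inner \<Omega>) (\<gamma> N))"
  shows "AE f in PiM {1..} \<gamma>.
           \<forall>\<phi> :: complex option \<Rightarrow> complex. continuous_map riemann_sphere euclidean \<phi> \<longrightarrow>
             (\<lambda>N. (1 / of_nat N) * (\<Sum>z | poly (f N) z = 0. \<phi> (Some z)))
               \<longlonglongrightarrow> (LINT z:frontier \<Omega>|equilibrium_measure (closure \<Omega>). \<phi> (Some z))"
proof -
  interpret curve: analytic_curve g by unfold_locales (rule assms(6))
  let ?K = "closure \<Omega>"
  have fr: "frontier ?K \<subseteq> range g" using assms(7) interior_mono[OF closure_subset[of \<Omega>]] by (auto simp: frontier_def)
  have sub: "range g \<subseteq> ?K" using assms(7) by (auto simp: frontier_def)
  have "frontier \<Omega> = path_image g" using assms(7) curve.path_g(3) by simp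
  note jordan = jordan_domain_exterior[OF assms(2,3,4,1) curve.path_g(1,2) this]
  obtain a where a: "a \<in> \<Omega>" using assms(1) by blast
  obtain H h where ex: "exterior_map ?K a H h"
    using exterior_map_exists[OF assms(2,3,4) a jordan] by blast
  show ?thesis
    using assms(8)
  proof (elim disjE exE conjE)
    fix \<rho> assume \<rho>: "positive_analytic_density g \<rho>" and ind: "\<forall>N\<ge>1. induced_gaussian N (boundary_inner g \<rho>) (\<gamma> N)"
    interpret B: analytic_curve_density g \<rho> by unfold_locales (rule \<rho>)
    have os: "orthonormal_setting ?K a H h B.boundary_measure"
      unfolding orthonormal_setting_def orthonormal_setting_axioms_def
      using ex B.boundary_measure_facts(1,2) sub by (auto elim!: eventually_mono)
    interpret S: orthonormal_setting ?K a H h "insert 0 ((\<lambda>z. 1 / (z - a)) ` (- ?K))" B.boundary_measure by (rule os)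
    have ip: "boundary_inner g \<rho> = S.ip" by (intro ext) (simp add: B.boundary_inner_eq S.ip_def)
    have bm: "S.bernstein_markov" by (rule S.bernstein_markov_boundary[OF fr B.analytic_curve_density_axioms refl])
    obtain P where P: "\<forall>N\<ge>1. orthonormal_basis N S.ip (P N) \<and>
        \<gamma> N = distr (PiM {..N} (\<lambda>_. std_complex_gaussian)) (borel_polys N) (random_poly N (P N))"
      using induced_gaussian_basis[OF ind[unfolded ip]] ..
    show ?thesis unfolding assms(7)
      by (rule S.zeros_equidistributed[OF bm _ _ curve.continuous_g curve.range_g(2) fr sub]) (use P in auto)
  next
    assume ind: "\<forall>N\<ge>1. induced_gaussian N (area_inner \<Omega>) (\<gamma> N)"
    define m :: "complex measure" where "m = density lborel (\<lambda>z. ennreal (indicator \<Omega> z))"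
    have fm: "finite_measure m"
    proof (rule finite_measureI)
      have "emeasure m (space m) = (\<integral>\<^sup>+z. ennreal (indicator \<Omega> z) \<partial>lborel)"
        unfolding m_def using assms(2) by (subst emeasure_density) auto
      also have "\<dots> = emeasure lborel \<Omega>" using assms(2) by (simp add: ennreal_indicator)
      finally show "emeasure m (space m) \<noteq> \<infinity>" using emeasure_bounded_finite[OF assms(4)] by simp
    qed
    have aeK: "AE z in m. z \<in> ?K"
      unfolding m_def using assms(2) closure_subset[of \<Omega>] by (subst AE_density) (simp_all add: borel_measurable_indicator measurable_compose[OF borel_measurable_indicator] del: ennreal_indicator, auto simp: indicator_def)
    have os: "orthonormal_setting ?K a H h m"
      unfolding orthonormal_setting_def orthonormal_setting_axioms_def using ex fm aeK by (simp add: m_def)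
    interpret S: orthonormal_setting ?K a H h "insert 0 ((\<lambda>z. 1 / (z - a)) ` (- ?K))" m by (rule os)
    have ip: "area_inner \<Omega> = S.ip" by (intro ext) (simp add: area_inner_eq[OF assms(2)] S.ip_def flip: m_def)
    have bm: "S.bernstein_markov" by (rule S.bernstein_markov_area[OF assms(2,3,4,1) refl m_def])
    obtain P where P: "\<forall>N\<ge>1. orthonormal_basis N S.ip (P N) \<and>
        \<gamma> N = distr (PiM {..N} (\<lambda>_. std_complex_gaussian)) (borel_polys N) (random_poly N (P N))"
      using induced_gaussian_basis[OF ind[unfolded ip]] ..
    show ?thesis unfolding assms(7)
      by (rule S.zeros_equidistributed[OF bm _ _ curve.continuous_g curve.range_g(2) fr sub]) (use P in auto)
  qed
qed

end
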